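(* Let $F$ be a field. For every pair of tetrahedra $(L;M)=(l_0,l_1,l_2,l_3;m_0,m_1,m_2,m_3)$ in generic position in $\mathbb P^3(F)$ one has $$\delta_3\bigl(a_3(L;M)\bigr)=(a_2\wedge a_1)\bigl(\nu(L;M)\bigr)\quad\text{in } B_2(F)\otimes F^*,$$ i.e. the square formed by $\nu:\tilde A_3^0\to A_2^0\otimes A_1^0\oplus A_1^0\otimes A_2^0$, $\ a_2\wedge a_1: A_2^0\otimes A_1^0\oplus A_1^0\otimes A_2^0\to B_2(F)\otimes F^*$, $\ a_3:\tilde A_3^0\to B_3(F)$ and $\delta_3:B_3(F)\to B_2(F)\otimes F^*$ is commutative.
   Context: All abelian groups are taken modulo torsion, i.e. tensored with $\mathbb Q$. $\mathrm{Alt}$ denotes the unnormalized alternating sum $\sum_\sigma \mathrm{sgn}(\sigma)\,\sigma$ over permutations of the indicated variables. Determinants and projections. For vectors $l_1,\dots,l_n$ in an $n$-dimensional space with a fixed volume form, $\Delta(l_1,\dots,l_n)$ is their determinant; for points one uses lifts to vectors. $(a_1,\dots,a_k|b_1,\dots,b_p)$ is the configuration of the projections of the points $b_i$ with center the span of the points $a_j$; a function written with such an argument is evaluated on the projected configuration. A configuration is a tuple of points up to projective equivalence. Cross-ratio on $\mathbb P^1$: $r(l_1,l_2,l_3,l_4)=\frac{\Delta(l_1,l_3)\Delta(l_2,l_4)}{\Delta(l_1,l_4)\Delta(l_2,l_3)}$. $B_2(F)$ is the quotient of the free group on symbols $\{x\}$, $x\in F^*\setminus\{1\}$, by $\sum_{i=1}^5(-1)^i\{r(x_1,\dots,\hat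 x_i,\dots,x_5)\}$ for distinct $x_i\in\mathbb P^1(F)$; $\{x\}_2$ is the class of $\{x\}$, and $\{1\}_2:=0$. Generalized cross-ratio of six generic points of $\mathbb P^2$: $$r_3(x_1,\dots,x_6)=\tfrac1{15}\mathrm{Alt}_6\Bigl\{\tfrac{\Delta(x_1,x_2,x_4)\Delta(x_2,x_3,x_5)\Delta(x_3,x_1,x_6)}{\Delta(x_1,x_2,x_5)\Delta(x_2,x_3,x_6)\Delta(x_3,x_1,x_4)}\Bigr\}\in\mathbb Q[F^*].$$ $B_3(F)=\mathbb Q[F^*]/R_3(F)$, where $R_3(F)$ is generated by $\{x\}-\{x^{-1}\}$, by $\sum_{i=1}^7(-1)^ir_3(x_1,\dots,\hat x_i,\dots,x_7)$ for $7$ points in generic position in $\mathbb P^2(F)$, and by $$K(x,y)=-\{\tfrac{x(1-y)^2}{y(1-x)^2}\}-\{xy\}-\{\tfrac xy\}-2\{1\}+2\bigl(\{\tfrac{-x(1-y)}{1-x}\}+\{\tfrac{x(1-y)}{y(1-x)}\}+\{\tfrac{-y(1-x)}{1-y}\}+\{\tfrac{1-x}{1-y}\}+\{y\}+\{x\}\bigr).$$ $\{x\}_3$ is the class of $\{x\}$; $r_3$ is also regarded as having values in $B_3(F)$. The homomorphism $\delta_3:B_3(F)\to B_2(F)\otimes F^*$ is $\{x\}_3\mapsto\{x\}_2\otimes x$ (well defined). $A_n(F)$ is generated by configurations $(l_0,\dots,l_n;m_0,\dots,m_n)$ of $2(n+1)$ points of $\mathbb P^n(F)$ which are the vertices of an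 admissible pair of simplices (no common faces of the same dimension), modulo: (1) $(L;M)=0$ if $l_0,\dots,l_n$ or $m_0,\dots,m_n$ lie in a hyperplane; (2) $(\sigma L;M)=(L;\sigma M)=(-1)^{|\sigma|}(L;M)$; (3) $\sum_{i=0}^{n+1}(-1)^i(l_0,\dots,\hat l_i,\dots,l_{n+1};m_0,\dots,m_n)=0$ if all terms are admissible, and similarly in $M$; ($\hat 3$) for points in $\mathbb P^{n+1}$, $\sum_{i=0}^{n+1}(-1)^i(l_i|l_0,\dots,\hat l_i,\dots,l_{n+1};m_0,\dots,m_n)=0$ if all terms are admissible, and similarly in $M$; (4) projective invariance. $A_n^0\subset A_n$ is the subgroup generated by pairs in generic position (all $2n+2$ points in generic position), and $\tilde A_3^0$ is the free group on the generators of $A_3^0$ (pairs of tetrahedra in generic position). $a_1:A_1(F)\to F^*$, $(l_0,l_1;m_0,m_1)\mapsto r(l_0,l_1,m_0,m_1)$ (an isomorphism). $a_2:A_2\to B_2(F)$, $$a_2(l_0,l_1,l_2;m_0,m_1,m_2)=\sum_{i,j=0}^2(-1)^{i+j}\{r(l_i|l_0,..,\hat l_i,..,l_2,m_0,..,\hat m_j,..,m_2)\}_2.$$ $(a_2\wedge a_1)(x_2\otimes x_1+y_1\otimes y_2)=a_2(x_2)\otimes a_1(x_1)-a_2(y_2)\otimes a_1(y_1)$. $\nu=\nu_{2,1}+\nu_{1,2}$ with, writing $\{i,a,b\}=\{j,c,d\}=\{1,2,3\}$, $$\nu_{2,1}(L;M)=\sum_{i,j=1}^3(-1)^{i+j}(l_i|l_0,..,\hat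 l_i,..,l_3;m_0,..,\hat m_j,..,m_3)\otimes(m_c,m_d|l_0,l_i;m_0,m_j),$$ $$\nu_{1,2}(L;M)=\sum_{i,j=1}^3(-1)^{i+j}(l_a,l_b|l_0,l_i;m_0,m_j)\otimes(m_j|l_0,..,\hat l_i,..,l_3;m_0,..,\hat m_j,..,m_3).$$ For six distinct points on a line, $$\mu_3(x_1,x_2,x_3;y_1,y_2,y_3)=\tfrac14\mathrm{Alt}_{(x_1,x_2,x_3)(y_1,y_2,y_3)}\bigl(\{r(x_1,y_2,x_2,y_1)\}_3-\{r(x_1,y_1,x_2,y_2)\}_3\bigr)\in B_3(F).$$ Finally $a_3=\frac16a_3'-\frac13a_3''$, where $$a_3'(L;M)=\sum_{i,j=0}^3(-1)^{i+j}r_3(l_i|l_0,..,\hat l_i,..,l_3,m_0,..,\hat m_j,..,m_3),$$ $$a_3''(L;M)=\sum_{i,j=0}^3(-1)^{i+j}\mu_3(l_i,m_j|l_0,..,\hat l_i,..,l_3;m_0,..,\hat m_j,..,m_3).$$ *)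

theory Defs
  imports
    "Jordan_Normal_Form.VS_Connect"
    "HOL-Combinatorics.Permutations"
    "HOL-Library.Poly_Mapping"
    "HOL-Library.Product_Plus"
begin

section \<open>Rational vector spaces\<close>

text \<open>Abelian groups are considered modulo torsion, i.e. tensored with the rational numbers.
  So every group below is a rational vector space, and homomorphisms are linear over the
  rational numbers.\<close>

class rat_vector = ab_group_add +
  fixes scaleQ :: "rat \<Rightarrow> 'a \<Rightarrow> 'a"  (infixr \<open>*\<^sub>Q\<close> 75)
  assumes scaleQ_add_right: "c *\<^sub>Q (x + y) = c *\<^sub>Q x + c *\<^sub>Q y"
    and scaleQ_add_left: "(c + d) *\<^sub>Q x = c *\<^sub>Q x + d *\<^sub>Q x"
    and scaleQ_scaleQ: "c *\<^sub>Q d *\<^sub>Q x = (c * d) *\<^sub>Q x"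
    and scaleQ_one: "1 *\<^sub>Q x = x"

global_interpretation Q: vector_space "scaleQ :: rat \<Rightarrow> 'a \<Rightarrow> 'a::rat_vector"
  defines Qspan = Q.span
  by unfold_locales (simp_all add: scaleQ_add_right scaleQ_add_left scaleQ_scaleQ scaleQ_one)

abbreviation Qlinear :: "('a::rat_vector \<Rightarrow> 'b::rat_vector) \<Rightarrow> bool"
  where "Qlinear f \<equiv> Vector_Spaces.linear scaleQ scaleQ f"

instantiation rat :: rat_vector
begin
definition scaleQ_rat :: "rat \<Rightarrow> rat \<Rightarrow> rat"
  where "scaleQ_rat = (*)"
instance
  by standard (simp_all add: scaleQ_rat_def algebra_simps)
end

instantiation prod :: (rat_vector, rat_vector) rat_vector
begin
definition scaleQ_prod :: "rat \<Rightarrow> 'a \<times> 'b \<Rightarrow> 'a \<times> 'b"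
  where "scaleQ_prod c p = (c *\<^sub>Q fst p, c *\<^sub>Q snd p)"
instance
  by standard (simp_all add: scaleQ_prod_def plus_prod_def scaleQ_add_right scaleQ_add_left
      scaleQ_scaleQ scaleQ_one)
end

instantiation poly_mapping :: (type, rat_vector) rat_vector
begin
lift_definition scaleQ_poly_mapping :: "rat \<Rightarrow> ('a \<Rightarrow>\<^sub>0 'b) \<Rightarrow> 'a \<Rightarrow>\<^sub>0 'b"
  is "\<lambda>c p g. c *\<^sub>Q p g"
  by (auto elim!: finite_subset[rotated])
instance
  by standard (transfer; simp add: fun_eq_iff scaleQ_add_right scaleQ_add_left
      scaleQ_scaleQ scaleQ_one)+
end

type_synonym 'g free = "'g \<Rightarrow>\<^sub>0 rat"

abbreviation gen :: "'g \<Rightarrow> 'g free"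
  where "gen g \<equiv> Poly_Mapping.single g 1"

text \<open>Presentations: the free space on the generators in \<open>G\<close> modulo the subspace spanned by \<open>R\<close>.
  As \<open>G\<close> need not be a whole type, the relation is a partial equivalence with domain the
  elements supported on \<open>G\<close>.\<close>

definition pres_rel :: "'g set \<Rightarrow> 'g free set \<Rightarrow> 'g free \<Rightarrow> 'g free \<Rightarrow> bool"
  where "pres_rel G R p q \<longleftrightarrow>
    Poly_Mapping.keys p \<subseteq> G \<and> Poly_Mapping.keys q \<subseteq> G \<and> p - q \<in> Qspan R"

lemma keys_scaleQ: "Poly_Mapping.keys (c *\<^sub>Q p) \<subseteq> Poly_Mapping.keys (p :: 'g free)"
  by transfer (auto simp: scaleQ_rat_def)

lemma pres_rel_zero: "pres_rel G R 0 0"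
  by (simp add: pres_rel_def Q.span_zero)

lemma pres_rel_part_equivp: "part_equivp (pres_rel G R)"
proof (rule part_equivpI)
  show "\<exists>x. pres_rel G R x x"
    using pres_rel_zero by blast
  show "symp (pres_rel G R)"
  proof (rule sympI)
    fix p q assume "pres_rel G R p q"
    then show "pres_rel G R q p"
      using Q.span_neg[of "p - q" R] by (simp add: pres_rel_def)
  qed
  show "transp (pres_rel G R)"
  proof (rule transpI)
    fix p q r assume "pres_rel G R p q" "pres_rel G R q r"
    then show "pres_rel G R p r"
      using Q.span_add[of "p - q" R "q - r"] by (simp add: pres_rel_def)
  qed
qed

lemma pres_rel_add:
  assumes "pres_rel G R p q" "pres_rel G R p' q'"
  shows "pres_rel G R (p + p') (q + q')"
  using assms Q.span_add[of "p - q" R "p' - q'"] keys_add[of p p'] keys_add[of q q']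
  unfolding pres_rel_def by (auto simp: algebra_simps)

lemma pres_rel_uminus:
  assumes "pres_rel G R p q"
  shows "pres_rel G R (- p) (- q)"
  using assms Q.span_neg[of "p - q" R] by (simp add: pres_rel_def)

lemma pres_rel_diff:
  assumes "pres_rel G R p q" "pres_rel G R p' q'"
  shows "pres_rel G R (p - p') (q - q')"
  using pres_rel_add[OF assms(1) pres_rel_uminus[OF assms(2)]] by simp

lemma pres_rel_scaleQ:
  assumes "pres_rel G R p q"
  shows "pres_rel G R (c *\<^sub>Q p) (c *\<^sub>Q q)"
  using assms Q.span_scale[of "p - q" R c] keys_scaleQ[of c p] keys_scaleQ[of c q]
  unfolding pres_rel_def by (auto simp: Q.scale_right_diff_distrib)

lemma pres_relI: "pres_rel G R p p \<Longrightarrow> p = q \<Longrightarrow> pres_rel G R p q"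
  by simp

section \<open>Tensor products\<close>

definition bilinear_rels :: "('u::rat_vector \<times> 'v::rat_vector) free set"
  where "bilinear_rels =
    {gen (u + u', v) - gen (u, v) - gen (u', v) | u u' v. True} \<union>
    {gen (u, v + v') - gen (u, v) - gen (u, v') | u v v'. True} \<union>
    {gen (c *\<^sub>Q u, v) - c *\<^sub>Q gen (u, v) | c u v. True} \<union>
    {gen (u, c *\<^sub>Q v) - c *\<^sub>Q gen (u, v) | c u v. True}"

quotient_type (overloaded) ('u, 'v) tensor =
  "('u::rat_vector \<times> 'v::rat_vector) free" / partial: "pres_rel UNIV bilinear_rels"
  by (rule pres_rel_part_equivp)

instantiation tensor :: (rat_vector, rat_vector) rat_vector
begin
lift_definition zero_tensor :: "('a, 'b) tensor" is 0
  by (rule pres_rel_zero)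
lift_definition plus_tensor :: "('a, 'b) tensor \<Rightarrow> ('a, 'b) tensor \<Rightarrow> ('a, 'b) tensor" is "(+)"
  by (rule pres_rel_add)
lift_definition uminus_tensor :: "('a, 'b) tensor \<Rightarrow> ('a, 'b) tensor" is uminus
  by (rule pres_rel_uminus)
lift_definition minus_tensor :: "('a, 'b) tensor \<Rightarrow> ('a, 'b) tensor \<Rightarrow> ('a, 'b) tensor" is "(-)"
  by (rule pres_rel_diff)
lift_definition scaleQ_tensor :: "rat \<Rightarrow> ('a, 'b) tensor \<Rightarrow> ('a, 'b) tensor" is scaleQ
  by (rule pres_rel_scaleQ)
instance
  by standard (transfer, (rule pres_relI, (intro pres_rel_add pres_rel_uminus pres_rel_diff
        pres_rel_scaleQ pres_rel_zero; assumption), simp add: algebra_simps scaleQ_add_right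
        scaleQ_add_left scaleQ_scaleQ scaleQ_one))+
end

definition tensor_of :: "'u::rat_vector \<Rightarrow> 'v::rat_vector \<Rightarrow> ('u, 'v) tensor"  (infix \<open>\<otimes>\<^sub>Q\<close> 72)
  where "u \<otimes>\<^sub>Q v = abs_tensor (gen (u, v))"

section \<open>Configurations of points in projective space\<close>

text \<open>A point of \<open>\<P>\<^sup>n(F)\<close> is given by a lift to a nonzero vector of \<open>F\<^sup>n\<^sup>+\<^sup>1\<close>, a tuple of points by
  the list of the lifts. Independence of the lifts is part of \<open>same_config\<close> below.\<close>

type_synonym 'a points = "'a vec list"

definition points :: "nat \<Rightarrow> 'a::field points \<Rightarrow> bool"
  where "points n xs \<longleftrightarrow> (\<forall>x\<in>set xs. x \<in> carrier_vec (Suc n) \<and> x \<noteq> 0\<^sub>v (Suc n))"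

definition same_config :: "nat \<Rightarrow> 'a::field points \<Rightarrow> 'a points \<Rightarrow> bool"
  where "same_config n xs ys \<longleftrightarrow> length xs = length ys \<and>
    (\<exists>g\<in>carrier_mat (Suc n) (Suc n). invertible_mat g \<and>
      (\<forall>k<length xs. \<exists>c. c \<noteq> 0 \<and> ys ! k = c \<cdot>\<^sub>v (g *\<^sub>v (xs ! k))))"

definition distinct_points :: "'a::field points \<Rightarrow> bool"
  where "distinct_points xs \<longleftrightarrow>
    (\<forall>i<length xs. \<forall>j<length xs. i \<noteq> j \<longrightarrow> \<not> (\<exists>c. c \<noteq> 0 \<and> xs ! j = c \<cdot>\<^sub>v (xs ! i)))"

definition in_hyperplane :: "nat \<Rightarrow> 'a::field points \<Rightarrow> bool"
  where "in_hyperplane n xs \<longleftrightarrow>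
    (\<exists>h\<in>carrier_vec (Suc n). h \<noteq> 0\<^sub>v (Suc n) \<and> (\<forall>x\<in>set xs. h \<bullet> x = 0))"

definition generic :: "nat \<Rightarrow> 'a::field points \<Rightarrow> bool"
  where "generic n xs \<longleftrightarrow> points n xs \<and>
    (\<forall>I\<subseteq>{..<length xs}. card I = Suc n \<longrightarrow> \<not> in_hyperplane n (nths xs I))"

definition vec_span :: "nat \<Rightarrow> 'a::field vec list \<Rightarrow> 'a vec set"
  where "vec_span d xs = LinearCombinations.module.span class_ring (module_vec TYPE('a) d) (set xs)"

definition \<Delta> :: "'a::field vec list \<Rightarrow> 'a"
  where "\<Delta> ls = det (mat_of_cols (length ls) ls)"

definition omit :: "nat \<Rightarrow> 'b list \<Rightarrow> 'b list"
  where "omit i xs = take i xs @ drop (Suc i) xs"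

text \<open>\<open>project as bs\<close> is the configuration \<open>(a\<^sub>1, \<dots>, a\<^sub>k | b\<^sub>1, \<dots>, b\<^sub>p)\<close>: for independent \<open>as\<close> in
  \<open>F\<^sup>d\<close>, a matrix whose kernel is the span of \<open>as\<close> identifies the quotient by this span with
  \<open>F\<^sup>d\<^sup>-\<^sup>k\<close>. Two such matrices differ by an invertible matrix, so that the configuration does not
  depend on the choice.\<close>

definition projection_mat :: "nat \<Rightarrow> 'a::field vec list \<Rightarrow> 'a mat"
  where "projection_mat d as = (SOME P. P \<in> carrier_mat (d - length as) d \<and>
    (\<forall>v\<in>carrier_vec d. P *\<^sub>v v = 0\<^sub>v (d - length as) \<longleftrightarrow> v \<in> vec_span d as))"

definition project :: "'a::field points \<Rightarrow> 'a points \<Rightarrow> 'a points"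
  where "project as bs = map (\<lambda>b. projection_mat (dim_vec (hd as)) as *\<^sub>v b) bs"

definition cross_ratio :: "'a::field points \<Rightarrow> 'a"
  where "cross_ratio l =
    \<Delta> [l!0, l!2] * \<Delta> [l!1, l!3] / (\<Delta> [l!0, l!3] * \<Delta> [l!1, l!2])"

definition Alt :: "nat \<Rightarrow> ('b list \<Rightarrow> 'v::rat_vector) \<Rightarrow> 'b list \<Rightarrow> 'v"
  where "Alt n f xs = (\<Sum>\<sigma> | \<sigma> permutes {..<n}. of_int (sign \<sigma>) *\<^sub>Q f (permute_list \<sigma> xs))"

section \<open>The group \<open>F\<^sup>*\<close> modulo torsion\<close>

definition mult_rels :: "'a::field free set"
  where "mult_rels = {gen (x * y) - gen x - gen y | x y. x \<noteq> 0 \<and> y \<noteq> 0}"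

quotient_type (overloaded) 'a multQ = "'a::field free" / partial: "pres_rel (- {0}) mult_rels"
  by (rule pres_rel_part_equivp)

instantiation multQ :: (field) rat_vector
begin
lift_definition zero_multQ :: "'a multQ" is 0
  by (rule pres_rel_zero)
lift_definition plus_multQ :: "'a multQ \<Rightarrow> 'a multQ \<Rightarrow> 'a multQ" is "(+)"
  by (rule pres_rel_add)
lift_definition uminus_multQ :: "'a multQ \<Rightarrow> 'a multQ" is uminus
  by (rule pres_rel_uminus)
lift_definition minus_multQ :: "'a multQ \<Rightarrow> 'a multQ \<Rightarrow> 'a multQ" is "(-)"
  by (rule pres_rel_diff)
lift_definition scaleQ_multQ :: "rat \<Rightarrow> 'a multQ \<Rightarrow> 'a multQ" is scaleQ
  by (rule pres_rel_scaleQ)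
instance
  by standard (transfer, (rule pres_relI, (intro pres_rel_add pres_rel_uminus pres_rel_diff
        pres_rel_scaleQ pres_rel_zero; assumption), simp add: algebra_simps scaleQ_add_right
        scaleQ_add_left scaleQ_scaleQ scaleQ_one))+
end

definition mult_class :: "'a::field \<Rightarrow> 'a multQ"
  where "mult_class x = abs_multQ (gen x)"

section \<open>The groups \<open>B\<^sub>2(F)\<close> and \<open>B\<^sub>3(F)\<close>\<close>

definition R2 :: "'a::field free set"
  where "R2 = {(\<Sum>i<5. (-1) ^ Suc i *\<^sub>Q gen (cross_ratio (omit i xs))) | xs.
    length xs = 5 \<and> points 1 xs \<and> distinct_points xs}"

quotient_type (overloaded) 'a B2 = "'a::field free" / partial: "pres_rel (- {0, 1}) R2"
  by (rule pres_rel_part_equivp)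

instantiation B2 :: (field) rat_vector
begin
lift_definition zero_B2 :: "'a B2" is 0
  by (rule pres_rel_zero)
lift_definition plus_B2 :: "'a B2 \<Rightarrow> 'a B2 \<Rightarrow> 'a B2" is "(+)"
  by (rule pres_rel_add)
lift_definition uminus_B2 :: "'a B2 \<Rightarrow> 'a B2" is uminus
  by (rule pres_rel_uminus)
lift_definition minus_B2 :: "'a B2 \<Rightarrow> 'a B2 \<Rightarrow> 'a B2" is "(-)"
  by (rule pres_rel_diff)
lift_definition scaleQ_B2 :: "rat \<Rightarrow> 'a B2 \<Rightarrow> 'a B2" is scaleQ
  by (rule pres_rel_scaleQ)
instance
  by standard (transfer, (rule pres_relI, (intro pres_rel_add pres_rel_uminus pres_rel_diff
        pres_rel_scaleQ pres_rel_zero; assumption), simp add: algebra_simps scaleQ_add_right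
        scaleQ_add_left scaleQ_scaleQ scaleQ_one))+
end

text \<open>Besides \<open>{1}\<^sub>2 = 0\<close> we use the customary conventions \<open>{0}\<^sub>2 = {\<infinity>}\<^sub>2 = 0\<close>; they only matter
  for admissible pairs of triangles which are not in generic position. A cross-ratio with value
  \<open>\<infinity>\<close> is \<open>0\<close> here, because \<open>x / 0 = 0\<close>.\<close>

definition sym2 :: "'a::field \<Rightarrow> 'a B2"  (\<open>{_}\<^sub>2\<close>)
  where "{x}\<^sub>2 = (if x = 0 \<or> x = 1 then 0 else abs_B2 (gen x))"

definition r3_free :: "'a::field points \<Rightarrow> 'a free"
  where "r3_free xs = (1/15) *\<^sub>Q Alt 6 (\<lambda>x. gen
    (\<Delta> [x!0, x!1, x!3] * \<Delta> [x!1, x!2, x!4] * \<Delta> [x!2, x!0, x!5] /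
     (\<Delta> [x!0, x!1, x!4] * \<Delta> [x!1, x!2, x!5] * \<Delta> [x!2, x!0, x!3]))) xs"

definition K :: "'a::field \<Rightarrow> 'a \<Rightarrow> 'a free"
  where "K x y =
    - gen (x * (1 - y)\<^sup>2 / (y * (1 - x)\<^sup>2)) - gen (x * y) - gen (x / y) - 2 *\<^sub>Q gen 1
    + 2 *\<^sub>Q (gen (- x * (1 - y) / (1 - x)) + gen (x * (1 - y) / (y * (1 - x)))
      + gen (- y * (1 - x) / (1 - y)) + gen ((1 - x) / (1 - y)) + gen y + gen x)"

definition R3 :: "'a::field free set"
  where "R3 =
    {gen x - gen (inverse x) | x. x \<noteq> 0} \<union>
    {(\<Sum>i<7. (-1) ^ Suc i *\<^sub>Q r3_free (omit i xs)) | xs. length xs = 7 \<and> generic 2 xs} \<union>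
    {K x y | x y. x \<notin> {0, 1} \<and> y \<notin> {0, 1}}"

quotient_type (overloaded) 'a B3 = "'a::field free" / partial: "pres_rel (- {0}) R3"
  by (rule pres_rel_part_equivp)

instantiation B3 :: (field) rat_vector
begin
lift_definition zero_B3 :: "'a B3" is 0
  by (rule pres_rel_zero)
lift_definition plus_B3 :: "'a B3 \<Rightarrow> 'a B3 \<Rightarrow> 'a B3" is "(+)"
  by (rule pres_rel_add)
lift_definition uminus_B3 :: "'a B3 \<Rightarrow> 'a B3" is uminus
  by (rule pres_rel_uminus)
lift_definition minus_B3 :: "'a B3 \<Rightarrow> 'a B3 \<Rightarrow> 'a B3" is "(-)"
  by (rule pres_rel_diff)
lift_definition scaleQ_B3 :: "rat \<Rightarrow> 'a B3 \<Rightarrow> 'a B3" is scaleQ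
  by (rule pres_rel_scaleQ)
instance
  by standard (transfer, (rule pres_relI, (intro pres_rel_add pres_rel_uminus pres_rel_diff
        pres_rel_scaleQ pres_rel_zero; assumption), simp add: algebra_simps scaleQ_add_right
        scaleQ_add_left scaleQ_scaleQ scaleQ_one))+
end

definition sym3 :: "'a::field \<Rightarrow> 'a B3"  (\<open>{_}\<^sub>3\<close>)
  where "{x}\<^sub>3 = abs_B3 (gen x)"

definition r3 :: "'a::field points \<Rightarrow> 'a B3"
  where "r3 xs = abs_B3 (r3_free xs)"

definition \<mu>3 :: "'a::field points \<Rightarrow> 'a points \<Rightarrow> 'a B3"
  where "\<mu>3 xs ys = (1/4) *\<^sub>Q Alt 3 (\<lambda>x. Alt 3 (\<lambda>y.
    {cross_ratio [x!0, y!1, x!1, y!0]}\<^sub>3 - {cross_ratio [x!0, y!0, x!1, y!1]}\<^sub>3) ys) xs"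

definition \<delta>3 :: "'a::field B3 \<Rightarrow> ('a B2, 'a multQ) tensor"
  where "\<delta>3 = (THE f. Qlinear f \<and> (\<forall>x. x \<noteq> 0 \<longrightarrow> f {x}\<^sub>3 = {x}\<^sub>2 \<otimes>\<^sub>Q mult_class x))"

section \<open>The groups \<open>A\<^sub>n(F)\<close>\<close>

text \<open>The faces of a simplex are the spans of the nonempty proper subsets of its vertices. Two faces
  which coincide have the same dimension, so it need not be mentioned.\<close>

definition admissible :: "nat \<Rightarrow> 'a::field points \<times> 'a points \<Rightarrow> bool"
  where "admissible n = (\<lambda>(L, M).
    length L = Suc n \<and> length M = Suc n \<and> points n L \<and> points n M \<and>
    (\<forall>I J. I \<noteq> {} \<longrightarrow> I \<subset> {..n} \<longrightarrow> J \<noteq> {} \<longrightarrow> J \<subset> {..n} \<longrightarrow>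
      vec_span (Suc n) (nths L I) \<noteq> vec_span (Suc n) (nths M J)))"

definition A_rels :: "nat \<Rightarrow> ('a::field points \<times> 'a points) free set"
  where "A_rels n =
    {gen (L, M) | L M. admissible n (L, M) \<and> (in_hyperplane n L \<or> in_hyperplane n M)} \<union>
    {gen (permute_list \<sigma> L, M) - of_int (sign \<sigma>) *\<^sub>Q gen (L, M) | \<sigma> L M.
      admissible n (L, M) \<and> \<sigma> permutes {..n}} \<union>
    {gen (L, permute_list \<sigma> M) - of_int (sign \<sigma>) *\<^sub>Q gen (L, M) | \<sigma> L M.
      admissible n (L, M) \<and> \<sigma> permutes {..n}} \<union>
    {(\<Sum>i\<le>Suc n. (-1) ^ i *\<^sub>Q gen (omit i L, M)) | L M.
      length L = n + 2 \<and> (\<forall>i\<le>Suc n. admissible n (omit i L, M))} \<union>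
    {(\<Sum>i\<le>Suc n. (-1) ^ i *\<^sub>Q gen (L, omit i M)) | L M.
      length M = n + 2 \<and> (\<forall>i\<le>Suc n. admissible n (L, omit i M))} \<union>
    {(\<Sum>i\<le>Suc n. (-1) ^ i *\<^sub>Q gen (project [L!i] (omit i L), project [L!i] M)) | L M.
      length L = n + 2 \<and> length M = n + 1 \<and> points (Suc n) L \<and> points (Suc n) M \<and>
      (\<forall>i\<le>Suc n. admissible n (project [L!i] (omit i L), project [L!i] M))} \<union>
    {(\<Sum>i\<le>Suc n. (-1) ^ i *\<^sub>Q gen (project [M!i] L, project [M!i] (omit i M))) | L M.
      length L = n + 1 \<and> length M = n + 2 \<and> points (Suc n) L \<and> points (Suc n) M \<and>
      (\<forall>i\<le>Suc n. admissible n (project [M!i] L, project [M!i] (omit i M)))} \<union>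
    {gen (L, M) - gen (L', M') | L M L' M'.
      admissible n (L, M) \<and> length L' = Suc n \<and> same_config n (L @ M) (L' @ M')}"

quotient_type (overloaded) 'a A1 = "('a::field points \<times> 'a points) free"
  / partial: "pres_rel (Collect (admissible 1)) (A_rels 1)"
  by (rule pres_rel_part_equivp)

instantiation A1 :: (field) rat_vector
begin
lift_definition zero_A1 :: "'a A1" is 0
  by (rule pres_rel_zero)
lift_definition plus_A1 :: "'a A1 \<Rightarrow> 'a A1 \<Rightarrow> 'a A1" is "(+)"
  by (rule pres_rel_add)
lift_definition uminus_A1 :: "'a A1 \<Rightarrow> 'a A1" is uminus
  by (rule pres_rel_uminus)
lift_definition minus_A1 :: "'a A1 \<Rightarrow> 'a A1 \<Rightarrow> 'a A1" is "(-)"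
  by (rule pres_rel_diff)
lift_definition scaleQ_A1 :: "rat \<Rightarrow> 'a A1 \<Rightarrow> 'a A1" is scaleQ
  by (rule pres_rel_scaleQ)
instance
  by standard (transfer, (rule pres_relI, (intro pres_rel_add pres_rel_uminus pres_rel_diff
        pres_rel_scaleQ pres_rel_zero; assumption), simp add: algebra_simps scaleQ_add_right
        scaleQ_add_left scaleQ_scaleQ scaleQ_one))+
end

quotient_type (overloaded) 'a A2 = "('a::field points \<times> 'a points) free"
  / partial: "pres_rel (Collect (admissible 2)) (A_rels 2)"
  by (rule pres_rel_part_equivp)

instantiation A2 :: (field) rat_vector
begin
lift_definition zero_A2 :: "'a A2" is 0
  by (rule pres_rel_zero)
lift_definition plus_A2 :: "'a A2 \<Rightarrow> 'a A2 \<Rightarrow> 'a A2" is "(+)"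
  by (rule pres_rel_add)
lift_definition uminus_A2 :: "'a A2 \<Rightarrow> 'a A2" is uminus
  by (rule pres_rel_uminus)
lift_definition minus_A2 :: "'a A2 \<Rightarrow> 'a A2 \<Rightarrow> 'a A2" is "(-)"
  by (rule pres_rel_diff)
lift_definition scaleQ_A2 :: "rat \<Rightarrow> 'a A2 \<Rightarrow> 'a A2" is scaleQ
  by (rule pres_rel_scaleQ)
instance
  by standard (transfer, (rule pres_relI, (intro pres_rel_add pres_rel_uminus pres_rel_diff
        pres_rel_scaleQ pres_rel_zero; assumption), simp add: algebra_simps scaleQ_add_right
        scaleQ_add_left scaleQ_scaleQ scaleQ_one))+
end

definition A1_class :: "'a::field points \<Rightarrow> 'a points \<Rightarrow> 'a A1"
  where "A1_class L M = abs_A1 (gen (L, M))"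

definition A2_class :: "'a::field points \<Rightarrow> 'a points \<Rightarrow> 'a A2"
  where "A2_class L M = abs_A2 (gen (L, M))"

definition generic_pair :: "nat \<Rightarrow> 'a::field points \<Rightarrow> 'a points \<Rightarrow> bool"
  where "generic_pair n L M \<longleftrightarrow> length L = Suc n \<and> length M = Suc n \<and> generic n (L @ M)"

definition a1 :: "'a::field A1 \<Rightarrow> 'a multQ"
  where "a1 = (THE f. Qlinear f \<and>
    (\<forall>L M. admissible 1 (L, M) \<longrightarrow> f (A1_class L M) = mult_class (cross_ratio (L @ M))))"

definition a2 :: "'a::field A2 \<Rightarrow> 'a B2"
  where "a2 = (THE f. Qlinear f \<and>
    (\<forall>L M. admissible 2 (L, M) \<longrightarrow> f (A2_class L M) =
      (\<Sum>i\<le>2. \<Sum>j\<le>2. (-1) ^ (i + j) *\<^sub>Q {cross_ratio (project [L!i] (omit i L @ omit j M))}\<^sub>2)))"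

text \<open>The \<open>A\<^sub>n\<^sup>0\<close>, spanned by the pairs in generic position, are subspaces of \<open>A\<^sub>n\<close>, so
  \<open>A\<^sub>2\<^sup>0 \<otimes> A\<^sub>1\<^sup>0 \<oplus> A\<^sub>1\<^sup>0 \<otimes> A\<^sub>2\<^sup>0\<close> is a subspace of the following domain. For pairs of tetrahedra in generic position \<open>\<nu>\<close> takes values in it.\<close>

type_synonym 'a A21_A12 =
  "('a A2, 'a A1) tensor \<times> ('a A1, 'a A2) tensor"

definition a2_wedge_a1 :: "'a::field A21_A12 \<Rightarrow> ('a B2, 'a multQ) tensor"
  where "a2_wedge_a1 = (THE f. Qlinear f \<and>
    (\<forall>x2 x1 y1 y2. f (x2 \<otimes>\<^sub>Q x1, y1 \<otimes>\<^sub>Q y2) = a2 x2 \<otimes>\<^sub>Q a1 x1 - a2 y2 \<otimes>\<^sub>Q a1 y1))"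

section \<open>The maps \<open>\<nu>\<close> and \<open>a\<^sub>3\<close>\<close>

definition others :: "nat \<Rightarrow> 'b list \<Rightarrow> 'b list"
  where "others i xs = map ((!) xs) (filter (\<lambda>k. k \<noteq> i) [1, 2, 3])"

definition \<nu>21 :: "'a::field points \<Rightarrow> 'a points \<Rightarrow> ('a A2, 'a A1) tensor"
  where "\<nu>21 L M = (\<Sum>i=1..3. \<Sum>j=1..3. (-1) ^ (i + j) *\<^sub>Q
    (A2_class (project [L!i] (omit i L)) (project [L!i] (omit j M)) \<otimes>\<^sub>Q
     A1_class (project (others j M) [L!0, L!i]) (project (others j M) [M!0, M!j])))"

definition \<nu>12 :: "'a::field points \<Rightarrow> 'a points \<Rightarrow> ('a A1, 'a A2) tensor"
  where "\<nu>12 L M = (\<Sum>i=1..3. \<Sum>j=1..3. (-1) ^ (i + j) *\<^sub>Q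
    (A1_class (project (others i L) [L!0, L!i]) (project (others i L) [M!0, M!j]) \<otimes>\<^sub>Q
     A2_class (project [M!j] (omit i L)) (project [M!j] (omit j M))))"

definition \<nu> :: "'a::field points \<Rightarrow> 'a points \<Rightarrow> 'a A21_A12"
  where "\<nu> L M = (\<nu>21 L M, \<nu>12 L M)"

definition a3' :: "'a::field points \<Rightarrow> 'a points \<Rightarrow> 'a B3"
  where "a3' L M = (\<Sum>i\<le>3. \<Sum>j\<le>3. (-1) ^ (i + j) *\<^sub>Q r3 (project [L!i] (omit i L @ omit j M)))"

definition a3'' :: "'a::field points \<Rightarrow> 'a points \<Rightarrow> 'a B3"
  where "a3'' L M = (\<Sum>i\<le>3. \<Sum>j\<le>3. (-1) ^ (i + j) *\<^sub>Q
    \<mu>3 (project [L!i, M!j] (omit i L)) (project [L!i, M!j] (omit j M)))"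

definition a3 :: "'a::field points \<Rightarrow> 'a points \<Rightarrow> 'a B3"
  where "a3 L M = (1/6) *\<^sub>Q a3' L M - (1/3) *\<^sub>Q a3'' L M"

end

theory Submission
  imports Defs
begin

text \<open>
  If \<open>F\<close> is finite, then \<open>F\<^sup>*\<close> is torsion and both sides vanish; so let \<open>F\<close> be infinite. Then the
  five-term relation yields \<open>{1/x}\<^sub>2 = {1 - x}\<^sub>2 = - {x}\<^sub>2\<close>, cross-ratios are alternating in their four
  arguments, and the five-term relation persists for coinciding points. Gale duality gives a second
  relation, for five points of the plane projected from each of them in turn. It makes \<open>\<delta>\<^sub>3\<close> and
  \<open>a\<^sub>2\<close> well defined.

  Write \<open>(pq|abcd)\<close> for the class in \<open>B\<^sub>2\<close> of the cross-ratio of \<open>a, b, c, d\<close> projected from the line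
  \<open>pq\<close>, and let \<open>E\<^sub>1, E\<^sub>2, E\<^sub>3, Z\<close> be the sums of \<open>(l\<^sub>0m\<^sub>0|l\<^sub>1l\<^sub>2m\<^sub>1m\<^sub>2) \<otimes> \<Delta>(l\<^sub>0m\<^sub>0l\<^sub>1l\<^sub>2)\<close>,
  \<open>(l\<^sub>0m\<^sub>0|l\<^sub>1l\<^sub>2m\<^sub>1m\<^sub>2) \<otimes> \<Delta>(l\<^sub>0m\<^sub>0l\<^sub>1m\<^sub>1)\<close>, \<open>(l\<^sub>0m\<^sub>0|l\<^sub>1l\<^sub>2m\<^sub>1m\<^sub>2) \<otimes> \<Delta>(l\<^sub>0m\<^sub>0m\<^sub>1m\<^sub>2)\<close> and
  \<open>(l\<^sub>0l\<^sub>1|l\<^sub>2l\<^sub>3m\<^sub>0m\<^sub>1) \<otimes> \<Delta>(l\<^sub>0m\<^sub>0m\<^sub>1m\<^sub>2)\<close>, alternated over the vertices of both tetrahedra.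
  Then \<open>\<delta>\<^sub>3 a\<^sub>3' = - (E\<^sub>1 + 4 E\<^sub>2 + E\<^sub>3)/2\<close> and \<open>\<delta>\<^sub>3 a\<^sub>3'' = (E\<^sub>1 + E\<^sub>3)/2 - E\<^sub>2\<close>, hence
  \<open>\<delta>\<^sub>3 a\<^sub>3 = - (E\<^sub>1 + E\<^sub>3)/4\<close>. By the relations of \<open>A\<^sub>2\<close>, the sum over \<open>i, j \<ge> 1\<close> defining \<open>\<nu>\<close> regroups into a
  sum over all \<open>i\<close> and \<open>j\<close>, which gives \<open>(a\<^sub>2 \<and> a\<^sub>1) \<nu> = (Z - E\<^sub>1)/4\<close>. Finally \<open>E\<^sub>3 = - Z\<close>: for the
  sum \<open>U\<close> of \<open>(l\<^sub>0l\<^sub>1|l\<^sub>2m\<^sub>0m\<^sub>1m\<^sub>2) \<otimes> \<Delta>(l\<^sub>0m\<^sub>0m\<^sub>1m\<^sub>2)\<close>, the dual relation gives \<open>2 U + 3 E\<^sub>3 = 0\<close> and the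
  five-term relation gives \<open>- 2 U + 3 Z = 0\<close>.
\<close>

section \<open>Linear maps out of presented spaces\<close>

text \<open>\<open>a1\<close>, \<open>a2\<close>, \<open>\<delta>3\<close> and
  \<open>a2_wedge_a1\<close> are given by \<open>THE\<close>, so nothing can be computed with them
  before a linear map with the prescribed values is known to exist. For \<open>a2\<close> these
  values have to respect the relations between all admissible pairs, degenerate ones included, and
  this takes far more work than for generic pairs. What makes it possible is that a bracket with two
  coinciding points is 0: its cross-ratio is 0, 1 or a quotient by zero, and
  \<open>{0}\<^sub>2 = {1}\<^sub>2 = 0\<close>, \<open>x / 0 = 0\<close>. Projection matrices are
  only known up to a linear change of coordinates. Hence every expression is first brought into a
  form invariant under scaling, then rewritten with determinants of the original vectors, and only
  then split into classes of single determinants. Such a class depends on the chosen lifts, but the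
  lifts are fixed throughout. Signs of determinants are torsion, so the classes are symmetric in the
  points; all antisymmetry comes from the brackets.\<close>

lemma QlinearI:
  assumes "\<And>x y. f (x + y) = f x + f y" "\<And>c x. f (c *\<^sub>Q x) = c *\<^sub>Q f x"
  shows "Qlinear f"
  using assms by (simp add: Vector_Spaces.linear_iff Q.vector_space_axioms)

lemma
  assumes "Qlinear f"
  shows Qlinear_add: "f (x + y) = f x + f y"
    and Qlinear_scale: "f (c *\<^sub>Q x) = c *\<^sub>Q f x"
    and Qlinear_zero: "f 0 = 0"
    and Qlinear_neg: "f (- x) = - f x"
    and Qlinear_diff: "f (x - y) = f x - f y"
    and Qlinear_sum: "f (\<Sum>i\<in>A. g i) = (\<Sum>i\<in>A. f (g i))"
proof -
  interpret f: Vector_Spaces.linear scaleQ scaleQ f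
    by (fact assms)
  show "f (x + y) = f x + f y" "f (c *\<^sub>Q x) = c *\<^sub>Q f x" "f 0 = 0" "f (- x) = - f x"
    "f (x - y) = f x - f y" "f (\<Sum>i\<in>A. g i) = (\<Sum>i\<in>A. f (g i))"
    by (simp_all add: f.add f.scale f.zero f.neg f.diff f.sum)
qed

lemma Qlinear_span_zero:
  assumes "Qlinear f" "\<And>r. r \<in> R \<Longrightarrow> f r = 0" "p \<in> Qspan R"
  shows "f p = 0"
  using assms(3)
proof (induction rule: Q.span_induct_alt)
  case base
  then show ?case by (simp add: Qlinear_zero[OF assms(1)])
next
  case (step c x y)
  then show ?case by (simp add: Qlinear_add[OF assms(1)] Qlinear_scale[OF assms(1)] assms(2))
qed

text \<open>Total on the free space, with no condition on the support: a relation can be evaluated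
  before it is known where its generators lie.\<close>

definition lin_ext :: "('g \<Rightarrow> 'v::rat_vector) \<Rightarrow> 'g free \<Rightarrow> 'v"
  where "lin_ext h p = (\<Sum>k\<in>Poly_Mapping.keys p. Poly_Mapping.lookup p k *\<^sub>Q h k)"

lemma lookup_scaleQ: "Poly_Mapping.lookup (c *\<^sub>Q p) k = c * Poly_Mapping.lookup (p :: 'g free) k"
  by transfer (simp add: scaleQ_rat_def)

lemma lin_ext_superset:
  assumes "finite A" "Poly_Mapping.keys p \<subseteq> A"
  shows "lin_ext h p = (\<Sum>k\<in>A. Poly_Mapping.lookup p k *\<^sub>Q h k)"
  unfolding lin_ext_def
  by (rule sum.mono_neutral_left) (use assms in \<open>auto simp: in_keys_iff\<close>)

lemma lin_ext_Qlinear: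
  fixes h :: "'g \<Rightarrow> 'v::rat_vector"
  shows "Qlinear (lin_ext h)"
proof (rule QlinearI)
  fix p q :: "'g free"
  show "lin_ext h (p + q) = lin_ext h p + lin_ext h q"
    by (simp add: lin_ext_superset[of "Poly_Mapping.keys p \<union> Poly_Mapping.keys q"] keys_add
        lookup_add scaleQ_add_left sum.distrib)
next
  fix c and p :: "'g free"
  show "lin_ext h (c *\<^sub>Q p) = c *\<^sub>Q lin_ext h p"
    by (simp add: lin_ext_superset[of "Poly_Mapping.keys p"] keys_scaleQ
        lookup_scaleQ scaleQ_scaleQ Q.scale_sum_right)
qed

lemmas lin_ext_simps = Qlinear_add[OF lin_ext_Qlinear] Qlinear_scale[OF lin_ext_Qlinear]
  Qlinear_zero[OF lin_ext_Qlinear] Qlinear_neg[OF lin_ext_Qlinear] Qlinear_diff[OF lin_ext_Qlinear]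
  Qlinear_sum[OF lin_ext_Qlinear]

lemma lin_ext_gen [simp]: "lin_ext h (gen g) = h g"
  by (simp add: lin_ext_def scaleQ_one)

lemma keys_gen_sum:
  assumes "A \<subseteq> G"
  shows "Poly_Mapping.keys (\<Sum>k\<in>A. c k *\<^sub>Q gen (k :: 'g)) \<subseteq> G"
proof (rule order_trans[OF keys_sum])
  show "(\<Union>k\<in>A. Poly_Mapping.keys (c k *\<^sub>Q gen k)) \<subseteq> G"
    using assms keys_scaleQ by fastforce
qed

lemma free_eq_sum_gen:
  "p = (\<Sum>k\<in>Poly_Mapping.keys p. Poly_Mapping.lookup p k *\<^sub>Q gen k)"
proof (rule poly_mapping_eqI)
  fix j
  show "Poly_Mapping.lookup p j =
      Poly_Mapping.lookup (\<Sum>k\<in>Poly_Mapping.keys p. Poly_Mapping.lookup p k *\<^sub>Q gen k) j"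
    by (simp add: lookup_sum lookup_scaleQ lookup_single when_def in_keys_iff
        if_distrib[of "(*) _"] cong: if_cong)
qed

text \<open>Common interface of the six quotient types, so that the universal property is proved
  only once. The laws are restricted to elements supported on \<open>G\<close>, since the
  abstraction function is unspecified elsewhere.\<close>

locale presentation =
  fixes G :: "'g set" and R :: "'g free set" and ab :: "'g free \<Rightarrow> 'v::rat_vector"
  assumes ab_add: "Poly_Mapping.keys p \<subseteq> G \<Longrightarrow> Poly_Mapping.keys q \<subseteq> G \<Longrightarrow> ab (p + q) = ab p + ab q"
    and ab_scale: "Poly_Mapping.keys p \<subseteq> G \<Longrightarrow> ab (c *\<^sub>Q p) = c *\<^sub>Q ab p"
    and ab_surj: "\<exists>p. Poly_Mapping.keys p \<subseteq> G \<and> x = ab p"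
    and ab_eq_iff: "Poly_Mapping.keys p \<subseteq> G \<Longrightarrow> Poly_Mapping.keys q \<subseteq> G \<Longrightarrow>
      ab p = ab q \<longleftrightarrow> p - q \<in> Qspan R"
begin

lemma ab_zero: "ab 0 = 0"
  using ab_scale[of 0 0] by simp

lemma ab_gen_sum:
  assumes "finite A" "A \<subseteq> G"
  shows "ab (\<Sum>k\<in>A. c k *\<^sub>Q gen k) = (\<Sum>k\<in>A. c k *\<^sub>Q ab (gen k))"
  using assms
proof (induction A)
  case empty
  then show ?case by (simp add: ab_zero)
next
  case (insert k A)
  have "Poly_Mapping.keys (c k *\<^sub>Q gen k) \<subseteq> G"
    using insert.prems keys_scaleQ[of "c k" "gen k"] by auto
  then show ?case
    using insert by (simp add: ab_add keys_gen_sum ab_scale)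
qed

lemma ab_eq_lin_ext:
  assumes "Poly_Mapping.keys p \<subseteq> G"
  shows "ab p = lin_ext (\<lambda>g. ab (gen g)) p"
  using ab_gen_sum[OF finite_keys assms, of "Poly_Mapping.lookup p"]
  by (simp add: lin_ext_def flip: free_eq_sum_gen)

lemma ab_in_span:
  assumes "Poly_Mapping.keys p \<subseteq> G" "p \<in> Qspan R"
  shows "ab p = 0"
  using assms ab_eq_iff[of p 0] by (simp add: ab_zero)

lemma linear_ab:
  assumes "Qlinear f" "\<And>g. g \<in> G \<Longrightarrow> f (ab (gen g)) = h g" "Poly_Mapping.keys p \<subseteq> G"
  shows "f (ab p) = lin_ext h p"
  using assms(2,3)
  by (subst ab_eq_lin_ext) (auto simp: lin_ext_def Qlinear_sum[OF assms(1)] Qlinear_scale[OF assms(1)] intro!: sum.cong)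

lemma linear_eqI:
  assumes "Qlinear f" "Qlinear f'" "\<And>g. g \<in> G \<Longrightarrow> f (ab (gen g)) = f' (ab (gen g))"
  shows "f = f'"
proof
  fix x
  obtain p where p: "Poly_Mapping.keys p \<subseteq> G" "x = ab p" using ab_surj by blast
  show "f x = f' x"
    unfolding p(2) by (simp add: linear_ab[OF assms(1) assms(3) p(1)] linear_ab[OF assms(2) refl p(1)])
qed

text \<open>Each class is evaluated at a chosen representative supported on \<open>G\<close>. Two
  representatives differ by an element of the span of \<open>R\<close>, on which
  \<open>lin_ext h\<close> vanishes, so the choice does not matter.\<close>

lemma lift_exists:
  assumes "\<And>r. r \<in> R \<Longrightarrow> lin_ext h r = 0"
  shows "\<exists>f. Qlinear f \<and> (\<forall>g\<in>G. f (ab (gen g)) = h g)"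
proof -
  define rp where "rp x = (SOME p. Poly_Mapping.keys p \<subseteq> G \<and> x = ab p)" for x
  have rp: "Poly_Mapping.keys (rp x) \<subseteq> G" "ab (rp x) = x" for x
    unfolding rp_def using someI_ex[OF ab_surj[of x]] by auto
  have eq: "lin_ext h (rp (ab p)) = lin_ext h p" if "Poly_Mapping.keys p \<subseteq> G" for p
  proof -
    have "rp (ab p) - p \<in> Qspan R"
      using ab_eq_iff[of "rp (ab p)" p] that rp by simp
    then have "lin_ext h (rp (ab p) - p) = 0"
      using Qlinear_span_zero[OF lin_ext_Qlinear, of R h] assms by blast
    then show ?thesis by (simp add: lin_ext_simps)
  qed
  have "Qlinear (\<lambda>x. lin_ext h (rp x))"
  proof (rule QlinearI)
    fix x y
    have "Poly_Mapping.keys (rp x + rp y) \<subseteq> G" by (rule order_trans[OF keys_add]) (simp add: rp(1))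
    then show "lin_ext h (rp (x + y)) = lin_ext h (rp x) + lin_ext h (rp y)"
      using eq[of "rp x + rp y"] by (simp add: ab_add rp lin_ext_simps)
  next
    fix c x
    have "Poly_Mapping.keys (c *\<^sub>Q rp x) \<subseteq> G" by (rule order_trans[OF keys_scaleQ rp(1)])
    then show "lin_ext h (rp (c *\<^sub>Q x)) = c *\<^sub>Q lin_ext h (rp x)"
      using eq[of "c *\<^sub>Q rp x"] by (simp add: ab_scale rp lin_ext_simps)
  qed
  moreover have "lin_ext h (rp (ab (gen g))) = h g" if "g \<in> G" for g
    using eq[of "gen g"] that by simp
  ultimately show ?thesis by blast
qed

text \<open>The form with \<open>THE\<close> matches the definitions of \<open>\<delta>3\<close>,
  \<open>a1\<close> and \<open>a2\<close>; uniqueness holds because the generators span.\<close>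

lemma the_lift:
  assumes "\<And>r. r \<in> R \<Longrightarrow> lin_ext h r = 0"
  defines "f \<equiv> (THE f. Qlinear f \<and> (\<forall>g\<in>G. f (ab (gen g)) = h g))"
  shows "Qlinear f" "\<And>g. g \<in> G \<Longrightarrow> f (ab (gen g)) = h g"
proof -
  have "\<exists>!f. Qlinear f \<and> (\<forall>g\<in>G. f (ab (gen g)) = h g)"
    using lift_exists[OF assms(1)] by (auto intro!: linear_eqI)
  from theI'[OF this] show "Qlinear f" "\<And>g. g \<in> G \<Longrightarrow> f (ab (gen g)) = h g"
    unfolding f_def by blast+
qed

end

lemma presentationI:
  fixes ab :: "'g free \<Rightarrow> 'v::rat_vector"
  assumes "Quotient (pres_rel G R) ab rep cr"
    and "\<And>p q. pres_rel G R p p \<Longrightarrow> pres_rel G R q q \<Longrightarrow> ab p + ab q = ab (p + q)"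
    and "\<And>c p. pres_rel G R p p \<Longrightarrow> c *\<^sub>Q ab p = ab (c *\<^sub>Q p)"
  shows "presentation G R ab"
proof -
  have refl: "pres_rel G R p p" if "Poly_Mapping.keys p \<subseteq> G" for p
    using that by (simp add: pres_rel_def Q.span_zero)
  show ?thesis
  proof
    fix p q :: "'g free" assume p: "Poly_Mapping.keys p \<subseteq> G" and q: "Poly_Mapping.keys q \<subseteq> G"
    show "ab (p + q) = ab p + ab q" using assms(2)[OF refl refl] p q by simp
    have "pres_rel G R p q \<longleftrightarrow> ab p = ab q"
      using Quotient_rel[OF assms(1), of p q] refl p q by blast
    then show "ab p = ab q \<longleftrightarrow> p - q \<in> Qspan R"
      using p q by (simp add: pres_rel_def)
  next
    fix c and p :: "'g free" assume p: "Poly_Mapping.keys p \<subseteq> G"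
    show "ab (c *\<^sub>Q p) = c *\<^sub>Q ab p" using assms(3)[OF refl] p by simp
  next
    fix x
    have "pres_rel G R (rep x) (rep x)" "ab (rep x) = x"
      using Quotient_rep_reflp[OF assms(1)] Quotient_abs_rep[OF assms(1)] by auto
    then show "\<exists>p. Poly_Mapping.keys p \<subseteq> G \<and> x = ab p"
      unfolding pres_rel_def by metis
  qed
qed

interpretation tensor: presentation UNIV bilinear_rels
  "abs_tensor :: ('u::rat_vector \<times> 'v::rat_vector) free \<Rightarrow> _"
  by (rule presentationI[OF Quotient_tensor plus_tensor.abs_eq scaleQ_tensor.abs_eq])

interpretation multQ: presentation "- {0}" mult_rels "abs_multQ :: 'a::field free \<Rightarrow> _"
  by (rule presentationI[OF Quotient_multQ plus_multQ.abs_eq scaleQ_multQ.abs_eq])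

interpretation B2: presentation "- {0, 1}" R2 "abs_B2 :: 'a::field free \<Rightarrow> _"
  by (rule presentationI[OF Quotient_B2 plus_B2.abs_eq scaleQ_B2.abs_eq])

interpretation B3: presentation "- {0}" R3 "abs_B3 :: 'a::field free \<Rightarrow> _"
  by (rule presentationI[OF Quotient_B3 plus_B3.abs_eq scaleQ_B3.abs_eq])

interpretation A1: presentation "Collect (admissible 1)" "A_rels 1"
  "abs_A1 :: ('a::field points \<times> 'a points) free \<Rightarrow> _"
  by (rule presentationI[OF Quotient_A1 plus_A1.abs_eq scaleQ_A1.abs_eq])

interpretation A2: presentation "Collect (admissible 2)" "A_rels 2"
  "abs_A2 :: ('a::field points \<times> 'a points) free \<Rightarrow> _"
  by (rule presentationI[OF Quotient_A2 plus_A2.abs_eq scaleQ_A2.abs_eq])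

section \<open>Tensor products\<close>

lemma
  fixes u u' :: "'u::rat_vector" and v v' :: "'v::rat_vector"
  shows tensor_add_left: "(u + u') \<otimes>\<^sub>Q v = u \<otimes>\<^sub>Q v + u' \<otimes>\<^sub>Q v"
    and tensor_add_right: "u \<otimes>\<^sub>Q (v + v') = u \<otimes>\<^sub>Q v + u \<otimes>\<^sub>Q v'"
    and tensor_scale_left: "(c *\<^sub>Q u) \<otimes>\<^sub>Q v = c *\<^sub>Q (u \<otimes>\<^sub>Q v)"
    and tensor_scale_right: "u \<otimes>\<^sub>Q (c *\<^sub>Q v) = c *\<^sub>Q (u \<otimes>\<^sub>Q v)"
proof -
  have *: "abs_tensor (p :: ('u \<times> 'v) free) = abs_tensor q" if "p - q \<in> bilinear_rels" for p q
    using tensor.ab_eq_iff[of p q] Q.span_base[OF that] by simp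
  have "gen (u + u', v) - (gen (u, v) + gen (u', v)) \<in> bilinear_rels"
    by (simp add: bilinear_rels_def diff_diff_eq[symmetric]) blast
  from *[OF this] show "(u + u') \<otimes>\<^sub>Q v = u \<otimes>\<^sub>Q v + u' \<otimes>\<^sub>Q v"
    by (simp add: tensor_of_def tensor.ab_add)
  have "gen (u, v + v') - (gen (u, v) + gen (u, v')) \<in> bilinear_rels"
    by (simp add: bilinear_rels_def diff_diff_eq[symmetric]) blast
  from *[OF this] show "u \<otimes>\<^sub>Q (v + v') = u \<otimes>\<^sub>Q v + u \<otimes>\<^sub>Q v'"
    by (simp add: tensor_of_def tensor.ab_add)
  have "gen (c *\<^sub>Q u, v) - c *\<^sub>Q gen (u, v) \<in> bilinear_rels"
    by (simp add: bilinear_rels_def) blast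
  from *[OF this] show "(c *\<^sub>Q u) \<otimes>\<^sub>Q v = c *\<^sub>Q (u \<otimes>\<^sub>Q v)"
    by (simp add: tensor_of_def tensor.ab_scale)
  have "gen (u, c *\<^sub>Q v) - c *\<^sub>Q gen (u, v) \<in> bilinear_rels"
    by (simp add: bilinear_rels_def) blast
  from *[OF this] show "u \<otimes>\<^sub>Q (c *\<^sub>Q v) = c *\<^sub>Q (u \<otimes>\<^sub>Q v)"
    by (simp add: tensor_of_def tensor.ab_scale)
qed

lemma Qlinear_tensor_left: "Qlinear (\<lambda>u. u \<otimes>\<^sub>Q v)"
  by (rule QlinearI) (simp_all add: tensor_add_left tensor_scale_left)

lemma Qlinear_tensor_right: "Qlinear (\<lambda>v. u \<otimes>\<^sub>Q v)"
  by (rule QlinearI) (simp_all add: tensor_add_right tensor_scale_right)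

lemmas tensor_left_simps = Qlinear_zero[OF Qlinear_tensor_left] Qlinear_neg[OF Qlinear_tensor_left]
  Qlinear_diff[OF Qlinear_tensor_left] Qlinear_sum[OF Qlinear_tensor_left]
lemmas tensor_right_simps = Qlinear_zero[OF Qlinear_tensor_right] Qlinear_neg[OF Qlinear_tensor_right]
  Qlinear_diff[OF Qlinear_tensor_right] Qlinear_sum[OF Qlinear_tensor_right]
lemmas tensor_simps = tensor_add_left tensor_add_right tensor_scale_left tensor_scale_right
  tensor_left_simps tensor_right_simps

lemma tensor_lift_exists:
  fixes h :: "'u::rat_vector \<Rightarrow> 'v::rat_vector \<Rightarrow> 'w::rat_vector"
  assumes "\<And>v. Qlinear (\<lambda>u. h u v)" "\<And>u. Qlinear (h u)"
  shows "\<exists>f. Qlinear f \<and> (\<forall>u v. f (u \<otimes>\<^sub>Q v) = h u v)"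
proof -
  have "lin_ext (case_prod h) r = 0" if "r \<in> bilinear_rels" for r
    using that assms by (auto simp: bilinear_rels_def lin_ext_simps Qlinear_add Qlinear_scale
        Qlinear_add[OF assms(1)] Qlinear_scale[OF assms(1)])
  from tensor.lift_exists[of "case_prod h", OF this] show ?thesis
    by (auto simp: tensor_of_def)
qed

lemma tensor_linear_eqI:
  assumes "Qlinear f" "Qlinear g" "\<And>u v. f (u \<otimes>\<^sub>Q v) = g (u \<otimes>\<^sub>Q v)"
  shows "f = g"
  using assms by (intro tensor.linear_eqI) (auto simp: tensor_of_def)

lemma tensor_eq_zero:
  assumes "\<And>v. v = (0::'v)"
  shows "(t :: ('u::rat_vector, 'v::rat_vector) tensor) = 0"
proof -
  have "u \<otimes>\<^sub>Q v = 0" for u :: 'u and v :: 'v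
    using assms[of v] by (simp add: tensor_simps)
  then have "(\<lambda>t :: ('u, 'v) tensor. t) = (\<lambda>t. 0)"
    by (intro tensor_linear_eqI) (auto intro!: QlinearI simp: Q.scale_zero_right)
  then show ?thesis by meson
qed

lemma Qlinear_compose: "Qlinear f \<Longrightarrow> Qlinear g \<Longrightarrow> Qlinear (\<lambda>x. f (g x))"
  by (rule QlinearI) (simp_all add: Qlinear_add Qlinear_scale)

text \<open>Pairs of pure tensors are enough: with a zero tensor in one component, \<open>eq\<close>
  tests each summand of the direct sum alone.\<close>

lemma tensor_pair_linear_eqI:
  assumes F: "Qlinear F" and F': "Qlinear F'"
    and eq: "\<And>x y x' y'. F (x \<otimes>\<^sub>Q y, x' \<otimes>\<^sub>Q y') = F' (x \<otimes>\<^sub>Q y, x' \<otimes>\<^sub>Q y')"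
  shows "F = F'"
proof -
  have fst: "Qlinear (\<lambda>s. (s, 0))" and snd: "Qlinear (\<lambda>s. (0, s))"
    by (rule QlinearI; simp add: scaleQ_prod_def Q.scale_zero_right)+
  have "(\<lambda>s. F (s, 0)) = (\<lambda>s. F' (s, 0))"
    by (rule tensor_linear_eqI[OF Qlinear_compose[OF F fst] Qlinear_compose[OF F' fst]])
      (use eq[of _ _ 0 0] in \<open>simp add: tensor_simps\<close>)
  moreover have "(\<lambda>s. F (0, s)) = (\<lambda>s. F' (0, s))"
    by (rule tensor_linear_eqI[OF Qlinear_compose[OF F snd] Qlinear_compose[OF F' snd]])
      (use eq[of 0 0] in \<open>simp add: tensor_simps\<close>)
  moreover have "F p = F (fst p, 0) + F (0, snd p)" "F' p = F' (fst p, 0) + F' (0, snd p)" for p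
    by (simp_all flip: Qlinear_add[OF F] Qlinear_add[OF F'])
  ultimately show ?thesis by (metis ext)
qed

lemma a2_wedge_a1_props:
  assumes a2: "Qlinear (a2 :: 'a::field A2 \<Rightarrow> _)" and a1: "Qlinear (a1 :: 'a A1 \<Rightarrow> _)"
  shows "Qlinear (a2_wedge_a1 :: 'a A21_A12 \<Rightarrow> _)"
    and "a2_wedge_a1 (x2 \<otimes>\<^sub>Q x1, y1 \<otimes>\<^sub>Q y2) =
      a2 (x2 :: 'a A2) \<otimes>\<^sub>Q a1 x1 - a2 y2 \<otimes>\<^sub>Q a1 y1"
proof -
  let ?P = "\<lambda>f :: 'a A21_A12 \<Rightarrow> ('a B2, 'a multQ) tensor. Qlinear f \<and> (\<forall>x2 x1 y1 y2. f (x2 \<otimes>\<^sub>Q x1, y1 \<otimes>\<^sub>Q y2) =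
    a2 (x2 :: 'a A2) \<otimes>\<^sub>Q a1 x1 - a2 y2 \<otimes>\<^sub>Q a1 y1)"
  note lin = Qlinear_compose[OF Qlinear_tensor_left a2] Qlinear_compose[OF Qlinear_tensor_right a1]
    Qlinear_compose[OF Qlinear_tensor_left a2] Qlinear_compose[OF Qlinear_tensor_right a1]
  obtain f where f: "Qlinear f" "\<And>u v. f (u \<otimes>\<^sub>Q v) = a2 (u :: 'a A2) \<otimes>\<^sub>Q a1 (v :: 'a A1)"
    using tensor_lift_exists[of "\<lambda>u v. a2 (u :: 'a A2) \<otimes>\<^sub>Q a1 (v :: 'a A1)", OF lin(1) lin(2)] by blast
  obtain g where g: "Qlinear g" "\<And>u v. g (u \<otimes>\<^sub>Q v) = a2 (v :: 'a A2) \<otimes>\<^sub>Q a1 (u :: 'a A1)"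
    using tensor_lift_exists[of "\<lambda>u v. a2 (v :: 'a A2) \<otimes>\<^sub>Q a1 (u :: 'a A1)", OF lin(4) lin(3)] by blast
  have "Qlinear (\<lambda>p. f (fst p) - g (snd p))"
    by (rule QlinearI) (simp_all add: Qlinear_add[OF f(1)] Qlinear_add[OF g(1)]
        Qlinear_scale[OF f(1)] Qlinear_scale[OF g(1)] scaleQ_prod_def Q.scale_right_diff_distrib)
  then have ex: "?P (\<lambda>p. f (fst p) - g (snd p))"
    by (simp add: f g)
  have uniq: "F = F'" if "?P F" "?P F'" for F F'
  proof (rule tensor_pair_linear_eqI)
    show "Qlinear F" "Qlinear F'" using that by blast+
    show "F (x \<otimes>\<^sub>Q y, x' \<otimes>\<^sub>Q y') = F' (x \<otimes>\<^sub>Q y, x' \<otimes>\<^sub>Q y')" for x y x' y'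
      using that by simp
  qed
  have "\<exists>!F. ?P F"
    by (rule ex1I[of ?P, OF ex]) (rule uniq[OF _ ex])
  from theI'[OF this] show "Qlinear (a2_wedge_a1 :: 'a A21_A12 \<Rightarrow> _)"
    and "a2_wedge_a1 (x2 \<otimes>\<^sub>Q x1, y1 \<otimes>\<^sub>Q y2) =
      a2 (x2 :: 'a A2) \<otimes>\<^sub>Q a1 x1 - a2 y2 \<otimes>\<^sub>Q a1 y1"
    unfolding a2_wedge_a1_def[symmetric] by simp_all
qed

section \<open>The multiplicative group\<close>

lemma mult_class_mult:
  assumes "x \<noteq> 0" "y \<noteq> 0"
  shows "mult_class (x * y) = mult_class x + mult_class y"
proof -
  have "gen (x * y) - (gen x + gen y) \<in> mult_rels"
    using assms by (auto simp: mult_rels_def diff_diff_eq[symmetric])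
  moreover have "Poly_Mapping.keys (gen x + gen y) \<subseteq> - {0}"
    using assms keys_add[of "gen x" "gen y"] by auto
  ultimately show ?thesis
    using assms multQ.ab_eq_iff[of "gen (x * y)" "gen x + gen y"]
    by (simp add: mult_class_def multQ.ab_add Q.span_base)
qed

lemma mult_class_one [simp]: "mult_class 1 = 0"
  using mult_class_mult[of 1 1] by simp

lemma twice_eq_zero_iff: "x + x = 0 \<longleftrightarrow> (x :: 'v::rat_vector) = 0"
proof
  assume *: "x + x = 0"
  have "x = (1/2 + 1/2 :: rat) *\<^sub>Q x" by simp
  also have "\<dots> = (1/2 :: rat) *\<^sub>Q (x + x)"
    unfolding scaleQ_add_left scaleQ_add_right ..
  finally show "x = 0" by (simp add: *)
qed simp

lemma mult_class_neg_one [simp]: "mult_class (- 1) = 0"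
  using mult_class_mult[of "-1" "-1"] by (simp add: twice_eq_zero_iff)

lemma mult_class_neg [simp]: "mult_class (- x) = mult_class x"
  using mult_class_mult[of "-1" x] by (cases "x = 0") auto

lemma mult_class_inverse:
  assumes "x \<noteq> 0"
  shows "mult_class (inverse x) = - mult_class x"
  using mult_class_mult[of x "inverse x"] assms by (simp add: eq_neg_iff_add_eq_0 add.commute)

lemma mult_class_divide:
  assumes "x \<noteq> 0" "y \<noteq> 0"
  shows "mult_class (x / y) = mult_class x - mult_class y"
  using assms by (simp add: divide_inverse mult_class_mult mult_class_inverse)

lemma mult_class_power:
  assumes "x \<noteq> 0"
  shows "mult_class (x ^ n) = of_nat n *\<^sub>Q mult_class x"
  by (induction n) (use assms in \<open>simp_all add: mult_class_mult scaleQ_add_left scaleQ_one\<close>)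

lemma multQ_trivial_of_finite:
  assumes "finite (UNIV :: 'a::field set)"
  shows "(x :: 'a multQ) = 0"
proof -
  have "mult_class a = 0" if "a \<noteq> 0" for a :: 'a
  proof -
    \<comment> \<open>Pigeonhole: two exponents give the same power of \<open>a\<close>, and in a
      rational vector space the resulting torsion relation kills its class.\<close>
    have "\<not> inj (\<lambda>n. a ^ n)"
      using range_inj_infinite[of "\<lambda>n. a ^ n"] finite_subset[OF subset_UNIV assms] by blast
    then obtain m n where mn: "a ^ m = a ^ n" "m \<noteq> n"
      unfolding inj_def by blast
    have "of_nat m *\<^sub>Q mult_class a = of_nat n *\<^sub>Q mult_class a"
      using mn mult_class_power[OF that] by metis
    then show ?thesis using mn(2) by auto
  qed
  then have "(\<lambda>t :: 'a multQ. t) = (\<lambda>t. 0)"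
    by (intro multQ.linear_eqI) (auto intro!: QlinearI simp: mult_class_def Q.scale_zero_right)
  then show ?thesis by meson
qed

section \<open>Alternating sums\<close>

lemma Alt_scale: "Alt n (\<lambda>x. c *\<^sub>Q f x) xs = c *\<^sub>Q Alt n f xs"
  by (simp add: Alt_def Q.scale_sum_right mult.commute)

lemma Alt_add: "Alt n (\<lambda>x. f x + g x) xs = Alt n f xs + Alt n g xs"
  by (simp add: Alt_def scaleQ_add_right sum.distrib)

lemma Alt_minus: "Alt n (\<lambda>x. - f x) xs = - Alt n f xs"
  by (simp add: Alt_def sum_negf)

lemma Alt_diff: "Alt n (\<lambda>x. f x - g x) xs = Alt n f xs - Alt n g xs"
  by (simp add: Alt_def Q.scale_right_diff_distrib sum_subtractf)

lemma Alt_zero: "Alt n (\<lambda>x. 0) xs = 0"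
  by (simp add: Alt_def)

lemma Alt_sum: "Alt n (\<lambda>x. \<Sum>i\<in>A. f i x) xs = (\<Sum>i\<in>A. Alt n (f i) xs)"
  unfolding Alt_def by (simp add: Q.scale_sum_right sum.swap[of _ A])

lemma Alt_Qlinear: "Qlinear F \<Longrightarrow> F (Alt n f xs) = Alt n (\<lambda>x. F (f x)) xs"
  by (simp add: Alt_def Qlinear_sum Qlinear_scale)

lemma Alt_cong:
  assumes "length xs = n" "\<And>x. length x = n \<Longrightarrow> mset x = mset xs \<Longrightarrow> f x = g x"
  shows "Alt n f xs = Alt n g xs"
  unfolding Alt_def
  by (intro sum.cong refl arg_cong2[where f = scaleQ] assms(2)) (use assms(1) in auto)

lemma Alt_commute: "Alt n (\<lambda>x. Alt m (f x) ys) xs = Alt m (\<lambda>y. Alt n (\<lambda>x. f x y) xs) ys"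
  unfolding Alt_def
  by (simp add: Q.scale_sum_right mult.commute sum.swap[of _ "{\<sigma>. \<sigma> permutes {..<m}}"])

text \<open>Reindexing of the sum by \<open>\<sigma> \<circ> \<tau>\<close>; in
  \<open>permute_list\<close> the right factor of a composition acts last.\<close>

lemma Alt_permute:
  assumes "length xs = n" "\<tau> permutes {..<n}"
  shows "Alt n (\<lambda>x. f (permute_list \<tau> x)) xs = of_int (sign \<tau>) *\<^sub>Q Alt n f xs"
proof -
  have "Alt n f xs = (\<Sum>\<sigma> | \<sigma> permutes {..<n}.
      of_int (sign (\<sigma> \<circ> \<tau>)) *\<^sub>Q f (permute_list (\<sigma> \<circ> \<tau>) xs))"
    unfolding Alt_def by (rule sum_permutations_compose_right[OF assms(2)])
  also have "\<dots> = (\<Sum>\<sigma> | \<sigma> permutes {..<n}.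
      of_int (sign \<tau>) *\<^sub>Q of_int (sign \<sigma>) *\<^sub>Q f (permute_list \<tau> (permute_list \<sigma> xs)))"
  proof (rule sum.cong[OF refl])
    fix \<sigma> assume \<sigma>: "\<sigma> \<in> {\<sigma>. \<sigma> permutes {..<n}}"
    have "sign (\<sigma> \<circ> \<tau>) = sign \<sigma> * sign \<tau>"
      using \<sigma> assms(2) by (intro sign_compose) (auto intro: permutation_permutes[THEN iffD2])
    then show "of_int (sign (\<sigma> \<circ> \<tau>)) *\<^sub>Q f (permute_list (\<sigma> \<circ> \<tau>) xs) =
        of_int (sign \<tau>) *\<^sub>Q of_int (sign \<sigma>) *\<^sub>Q f (permute_list \<tau> (permute_list \<sigma> xs))"
      using assms by (simp add: permute_list_compose scaleQ_scaleQ mult.commute)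
  qed
  also have "\<dots> = of_int (sign \<tau>) *\<^sub>Q Alt n (\<lambda>x. f (permute_list \<tau> x)) xs"
    by (simp add: Alt_def Q.scale_sum_right)
  finally have "of_int (sign \<tau>) *\<^sub>Q Alt n f xs =
      (of_int (sign \<tau>) * of_int (sign \<tau>)) *\<^sub>Q Alt n (\<lambda>x. f (permute_list \<tau> x)) xs"
    by (simp add: scaleQ_scaleQ)
  then show ?thesis
    by (simp flip: of_int_mult add: sign_def split: if_splits)
qed

lemma Alt_swap:
  assumes "length xs = n" "i < n" "j < n" "i \<noteq> j"
    and "\<And>x. length x = n \<Longrightarrow> mset x = mset xs \<Longrightarrow> g x = f (permute_list (transpose i j) x)"
  shows "Alt n g xs = - Alt n f xs"
proof -
  have "Alt n g xs = Alt n (\<lambda>x. f (permute_list (transpose i j) x)) xs"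
    using assms by (intro Alt_cong) auto
  also have "\<dots> = of_int (sign (transpose i j)) *\<^sub>Q Alt n f xs"
    using assms by (intro Alt_permute) (auto intro: permutes_swap_id)
  finally show ?thesis using assms(4) by (simp add: sign_swap_id)
qed

text \<open>The cycle that sends 0 to \<open>i\<close> and moves 1, ..., \<open>i\<close> down by
  one; on lists it brings entry \<open>i\<close> to the front. These cycles represent the cosets of
  the stabilizer of 0, which consists of the \<open>shift_perm \<tau>\<close>.\<close>

primrec front_cycle :: "nat \<Rightarrow> nat \<Rightarrow> nat"
  where "front_cycle 0 = id"
  | "front_cycle (Suc i) = transpose i (Suc i) \<circ> front_cycle i"

lemma front_cycle_permutes: "i \<le> n \<Longrightarrow> front_cycle i permutes {..n}"
proof (induction i)
  case (Suc i)
  then have "front_cycle i permutes {..n}" "transpose i (Suc i) permutes {..n}"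
    by (auto intro: permutes_swap_id)
  then show ?case
    unfolding front_cycle.simps by (rule permutes_compose)
qed (simp add: permutes_id)

lemma sign_front_cycle: "sign (front_cycle i) = (-1) ^ i"
proof (induction i)
  case (Suc i)
  have "permutation (front_cycle i)"
    using front_cycle_permutes[of i i] by (auto intro: permutation_permutes[THEN iffD2])
  then show ?case
    using Suc unfolding front_cycle.simps
    by (subst sign_compose) (simp_all add: permutation_swap_id sign_swap_id)
qed (simp add: sign_id)

lemma front_cycle_apply:
  "front_cycle i 0 = i" "front_cycle i (Suc k) = (if k < i then k else Suc k)"
  by (induction i) (auto simp: transpose_def)

definition shift_perm :: "(nat \<Rightarrow> nat) \<Rightarrow> nat \<Rightarrow> nat"
  where "shift_perm \<tau> k = (case k of 0 \<Rightarrow> 0 | Suc k \<Rightarrow> Suc (\<tau> k))"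

lemma shift_perm_apply [simp]: "shift_perm \<tau> 0 = 0" "shift_perm \<tau> (Suc k) = Suc (\<tau> k)"
  by (simp_all add: shift_perm_def)

lemma
  assumes "\<tau> permutes {..<n}"
  shows shift_perm_permutes: "shift_perm \<tau> permutes {..<Suc n}"
    and sign_shift_perm: "sign (shift_perm \<tau>) = sign \<tau>"
proof -
  have "shift_perm \<tau> permutes {..<Suc n} \<and> sign (shift_perm \<tau>) = sign \<tau>"
    using assms finite_lessThan[of n]
  proof (induction \<tau> rule: permutes_induct)
    case id
    have "shift_perm id = id"
      by (auto simp: fun_eq_iff shift_perm_def split: nat.splits)
    then show ?case by (simp only: permutes_id sign_id simp_thms)
  next
    case (swap a b p)
    have eq: "shift_perm (transpose a b \<circ> p) = transpose (Suc a) (Suc b) \<circ> shift_perm p"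
      by (auto simp: fun_eq_iff shift_perm_def transpose_def split: nat.splits)
    have "permutation p" "permutation (shift_perm p)"
      using swap by (auto intro: permutation_permutes[THEN iffD2])
    then have "sign (transpose (Suc a) (Suc b) \<circ> shift_perm p) = sign (transpose a b \<circ> p)"
      using swap by (simp only: sign_compose permutation_swap_id sign_swap_id) simp
    moreover have "transpose (Suc a) (Suc b) \<circ> shift_perm p permutes {..<Suc n}"
      using swap by (intro permutes_compose permutes_swap_id) auto
    ultimately show ?case unfolding eq by blast
  qed
  then show "shift_perm \<tau> permutes {..<Suc n}" "sign (shift_perm \<tau>) = sign \<tau>" by auto
qed

text \<open>Coset decomposition of the symmetric group. Surjectivity follows from injectivity by
  counting, as \<open>Suc n * fact n = fact (Suc n)\<close>.\<close>

lemma bij_betw_permutes_Suc: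
  "bij_betw (\<lambda>(i, \<tau>). front_cycle i \<circ> shift_perm \<tau>)
    ({..<Suc n} \<times> {\<tau>. \<tau> permutes {..<n}}) {\<sigma>. \<sigma> permutes {..<Suc n}}"
proof -
  let ?f = "\<lambda>(i, \<tau>). front_cycle i \<circ> shift_perm \<tau>"
  let ?A = "{..<Suc n} \<times> {\<tau>. \<tau> permutes {..<n}}"
  have inj: "inj_on ?f ?A"
  proof (rule inj_onI, clarify)
    fix i \<tau> j \<tau>' assume *: "front_cycle i \<circ> shift_perm \<tau> = front_cycle j \<circ> shift_perm \<tau>'"
    from fun_cong[OF *, of 0] have ij: "i = j" by (simp add: front_cycle_apply)
    have "inj (front_cycle i)"
      using front_cycle_permutes[of i i] by (auto intro: permutes_inj)
    then have "shift_perm \<tau> = shift_perm \<tau>'"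
      using * ij by (simp add: fun_eq_iff inj_eq)
    then have "Suc (\<tau> k) = Suc (\<tau>' k)" for k by (metis shift_perm_apply(2))
    then show "i = j \<and> \<tau> = \<tau>'" using ij by auto
  qed
  have sub: "?f ` ?A \<subseteq> {\<sigma>. \<sigma> permutes {..<Suc n}}"
    using front_cycle_permutes[of _ n] shift_perm_permutes[of _ n]
    unfolding lessThan_Suc_atMost[symmetric] by (auto intro!: permutes_compose)
  have "card (?f ` ?A) = Suc n * fact n"
    by (simp add: card_image[OF inj] card_cartesian_product card_permutations)
  also have "\<dots> = card {\<sigma>. \<sigma> permutes {..<Suc n}}"
    by (subst card_permutations[OF refl]) auto
  finally have "?f ` ?A = {\<sigma>. \<sigma> permutes {..<Suc n}}"
    by (intro card_subset_eq sub finite_permutations) auto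
  with inj show ?thesis by (simp add: bij_betw_def)
qed

lemma length_omit: "i < length xs \<Longrightarrow> length (omit i xs) = length xs - 1"
  by (simp add: omit_def)

lemma nth_omit:
  "i < length xs \<Longrightarrow> k < length xs - 1 \<Longrightarrow> omit i xs ! k = xs ! (if k < i then k else Suc k)"
  by (auto simp: omit_def nth_append min_def)

text \<open>Expansion along the entry that comes first, the analogue of Laplace expansion. Read
  backwards, it turns the sums over \<open>omit i\<close> in the definitions into full
  alternations.\<close>

lemma Alt_Suc:
  assumes "length xs = Suc n"
  shows "Alt (Suc n) f xs = (\<Sum>i<Suc n. (-1) ^ i *\<^sub>Q Alt n (\<lambda>ys. f (xs ! i # ys)) (omit i xs))"
proof -
  have "Alt (Suc n) f xs = (\<Sum>(i, \<tau>)\<in>{..<Suc n} \<times> {\<tau>. \<tau> permutes {..<n}}.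
      of_int (sign (front_cycle i \<circ> shift_perm \<tau>)) *\<^sub>Q
      f (permute_list (front_cycle i \<circ> shift_perm \<tau>) xs))"
    unfolding Alt_def by (subst sum.reindex_bij_betw[OF bij_betw_permutes_Suc, symmetric])
      (simp add: case_prod_unfold)
  also have "\<dots> = (\<Sum>(i, \<tau>)\<in>{..<Suc n} \<times> {\<tau>. \<tau> permutes {..<n}}.
      (-1) ^ i *\<^sub>Q of_int (sign \<tau>) *\<^sub>Q f (xs ! i # permute_list \<tau> (omit i xs)))"
  proof (intro sum.cong refl, clarify)
    fix i \<tau> assume i: "i < Suc n" and \<tau>: "\<tau> permutes {..<n}"
    have "permutation (front_cycle i)" "permutation (shift_perm \<tau>)"
      using front_cycle_permutes[of i i] shift_perm_permutes[OF \<tau>]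
      by (auto intro: permutation_permutes[THEN iffD2])
    then have sgn: "sign (front_cycle i \<circ> shift_perm \<tau>) = (-1) ^ i * sign \<tau>"
      by (simp add: sign_compose sign_front_cycle sign_shift_perm[OF \<tau>])
    have "permute_list (front_cycle i \<circ> shift_perm \<tau>) xs = xs ! i # permute_list \<tau> (omit i xs)"
    proof (rule nth_equalityI)
      show "length (permute_list (front_cycle i \<circ> shift_perm \<tau>) xs) =
          length (xs ! i # permute_list \<tau> (omit i xs))"
        using assms i by (simp add: length_omit)
      fix k assume "k < length (permute_list (front_cycle i \<circ> shift_perm \<tau>) xs)"
      then have k: "k < Suc n" using assms by simp
      show "permute_list (front_cycle i \<circ> shift_perm \<tau>) xs ! k =
          (xs ! i # permute_list \<tau> (omit i xs)) ! k"
      proof (cases k)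
        case 0
        then show ?thesis using assms
          by (simp add: permute_list_def front_cycle_apply del: upt_Suc)
      next
        case (Suc m)
        moreover have "\<tau> m < n" using permutes_in_image[OF \<tau>, of m] Suc k by simp
        ultimately show ?thesis using assms i k
          by (simp add: permute_list_def length_omit front_cycle_apply nth_omit del: upt_Suc)
      qed
    qed
    then show "of_int (sign (front_cycle i \<circ> shift_perm \<tau>)) *\<^sub>Q
        f (permute_list (front_cycle i \<circ> shift_perm \<tau>) xs) =
        (-1) ^ i *\<^sub>Q of_int (sign \<tau>) *\<^sub>Q f (xs ! i # permute_list \<tau> (omit i xs))"
      by (simp add: sgn scaleQ_scaleQ)
  qed
  also have "\<dots> = (\<Sum>i<Suc n. (-1) ^ i *\<^sub>Q Alt n (\<lambda>ys. f (xs ! i # ys)) (omit i xs))"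
    by (simp add: Alt_def Q.scale_sum_right sum.cartesian_product del: sum.lessThan_Suc)
  finally show ?thesis .
qed

lemma Alt_0: "Alt 0 f xs = f xs"
  by (simp add: Alt_def sign_id scaleQ_one)

text \<open>Signed sum of \<open>f\<close> over all shuffles of the two lists. Taking
  \<open>b\<close> first moves it past the \<open>Suc (length u)\<close> entries of
  \<open>a # u\<close>, hence the sign.\<close>

fun shuffle_sum :: "('b list \<Rightarrow> 'v::rat_vector) \<Rightarrow> 'b list \<Rightarrow> 'b list \<Rightarrow> 'v"
  where "shuffle_sum f [] v = f v"
  | "shuffle_sum f u [] = f u"
  | "shuffle_sum f (a # u) (b # v) = shuffle_sum (\<lambda>z. f (a # z)) u (b # v) +
      (-1) ^ Suc (length u) *\<^sub>Q shuffle_sum (\<lambda>z. f (b # z)) (a # u) v"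

lemma omit_append:
  "i < length xs \<Longrightarrow> omit i (xs @ ys) = omit i xs @ ys"
  "omit (length xs + i) (xs @ ys) = xs @ omit i ys"
  by (simp_all add: omit_def)

text \<open>Shuffles represent the cosets of the product of the two smaller symmetric groups. The
  induction expands both sides along the first entry, which comes from \<open>xs\<close> or from
  \<open>ys\<close>. It is needed to split an alternation over six points into one over three
  vertices of each tetrahedron.\<close>

lemma Alt_append:
  fixes f :: "'b list \<Rightarrow> 'v::rat_vector"
  assumes "length xs = p" "length ys = q"
  shows "Alt (p + q) f (xs @ ys) = Alt p (\<lambda>u. Alt q (shuffle_sum f u) ys) xs"
  using assms
proof (induction "p + q" arbitrary: p q xs ys f)
  case 0
  then show ?case by (simp add: Alt_0)
next
  case (Suc m)
  show ?case
  proof (cases "p = 0 \<or> q = 0")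
    case True
    then show ?thesis
    proof
      assume "p = 0"
      moreover have "shuffle_sum f [] = f" by auto
      ultimately show ?thesis using Suc.prems by (simp add: Alt_0)
    next
      assume q: "q = 0"
      have "shuffle_sum f u [] = f u" for u by (cases u) auto
      then show ?thesis using q Suc.prems by (simp add: Alt_0)
    qed
  next
    case False
    then obtain p' q' where p': "p = Suc p'" and q': "q = Suc q'"
      by (meson not0_implies_Suc)
    have m: "m = p' + q" "m = p + q'" using Suc.hyps(2) p' q' by auto
    have 1: "(\<Sum>i<p. (-1) ^ i *\<^sub>Q Alt m (\<lambda>z. f ((xs @ ys) ! i # z)) (omit i (xs @ ys))) =
      Alt p (\<lambda>u. Alt q (\<lambda>v. shuffle_sum (\<lambda>z. f (hd u # z)) (tl u) v) ys) xs"
    proof -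
      have "Alt m (\<lambda>z. f ((xs @ ys) ! i # z)) (omit i (xs @ ys)) =
          Alt p' (\<lambda>u. Alt q (shuffle_sum (\<lambda>z. f (xs ! i # z)) u) ys) (omit i xs)" if "i < p" for i
        using Suc.hyps(1)[OF m(1), of "omit i xs" ys "\<lambda>z. f (xs ! i # z)"] that Suc.prems p' m(1)
        by (simp add: length_omit omit_append nth_append)
      then show ?thesis
        using Suc.prems(1) unfolding p' by (subst Alt_Suc) auto
    qed
    \<comment> \<open>Entry \<open>i\<close> of \<open>ys\<close> has position \<open>p + i\<close>
      in the joined list; the extra \<open>(-1) ^ p\<close> is the sign with which
      \<open>shuffle_sum\<close> takes the head of its second list.\<close>
    have 2: "(\<Sum>i<q. (-1) ^ (p + i) *\<^sub>Q
        Alt m (\<lambda>z. f ((xs @ ys) ! (p + i) # z)) (omit (p + i) (xs @ ys))) =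
      (-1) ^ p *\<^sub>Q Alt q (\<lambda>v. Alt p (\<lambda>u. shuffle_sum (\<lambda>z. f (hd v # z)) u (tl v)) xs) ys"
    proof -
      have "Alt m (\<lambda>z. f ((xs @ ys) ! (p + i) # z)) (omit (p + i) (xs @ ys)) =
          Alt q' (\<lambda>v. Alt p (\<lambda>u. shuffle_sum (\<lambda>z. f (ys ! i # z)) u v) xs) (omit i ys)"
        if "i < q" for i
      proof -
        have "omit (p + i) (xs @ ys) = xs @ omit i ys" "(xs @ ys) ! (p + i) = ys ! i"
          using Suc.prems(1) by (auto simp: omit_append(2))
        then show ?thesis
          using Suc.hyps(1)[OF m(2), of xs "omit i ys" "\<lambda>z. f (ys ! i # z)"] that Suc.prems q' m(2)
          by (simp add: length_omit Alt_commute[of p])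
      qed
      then show ?thesis
        using Suc.prems(2) unfolding q'
        by (subst Alt_Suc) (auto simp: power_add Q.scale_sum_right scaleQ_scaleQ simp del: sum.lessThan_Suc)
    qed
    have "Alt (p + q) f (xs @ ys) =
        (\<Sum>i<p + q. (-1) ^ i *\<^sub>Q Alt m (\<lambda>z. f ((xs @ ys) ! i # z)) (omit i (xs @ ys)))"
      using Suc.prems Suc.hyps(2) by (subst Suc.hyps(2)[symmetric], subst Alt_Suc) auto
    also have "\<dots> = (\<Sum>i<p. (-1) ^ i *\<^sub>Q Alt m (\<lambda>z. f ((xs @ ys) ! i # z)) (omit i (xs @ ys))) +
        (\<Sum>i<q. (-1) ^ (p + i) *\<^sub>Q
          Alt m (\<lambda>z. f ((xs @ ys) ! (p + i) # z)) (omit (p + i) (xs @ ys)))"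
      by (induction q) (simp_all add: add.assoc)
    also have "\<dots> = Alt p (\<lambda>u. Alt q (\<lambda>v. shuffle_sum (\<lambda>z. f (hd u # z)) (tl u) v +
        (-1) ^ p *\<^sub>Q shuffle_sum (\<lambda>z. f (hd v # z)) u (tl v)) ys) xs"
      unfolding 1 2 Alt_add Alt_scale Alt_commute[of q] ..
    also have "\<dots> = Alt p (\<lambda>u. Alt q (shuffle_sum f u) ys) xs"
    proof (intro Alt_cong Suc.prems)
      fix u v :: "'b list" assume "length u = p" "length v = q"
      then obtain a u' b v' where "u = a # u'" "v = b # v'" "length u' = p'"
        using p' q' by (metis length_Suc_conv)
      then show "shuffle_sum (\<lambda>z. f (hd u # z)) (tl u) v +
          (-1) ^ p *\<^sub>Q shuffle_sum (\<lambda>z. f (hd v # z)) u (tl v) = shuffle_sum f u v"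
        by (simp add: p')
    qed
    finally show ?thesis .
  qed
qed

section \<open>Determinants\<close>

lemma det_mat_Suc:
  "det (mat (Suc n) (Suc n) f :: 'a::comm_ring_1 mat) = (\<Sum>i<Suc n. (-1) ^ i * f (i, 0) *
    det (mat n n (\<lambda>(i', j'). f (if i' < i then i' else Suc i', Suc j'))))"
proof -
  have "det (mat (Suc n) (Suc n) f) =
      (\<Sum>i<Suc n. mat (Suc n) (Suc n) f $$ (i, 0) * cofactor (mat (Suc n) (Suc n) f) i 0)"
    by (rule laplace_expansion_column) auto
  also have "\<dots> = (\<Sum>i<Suc n. (-1) ^ i * f (i, 0) *
    det (mat n n (\<lambda>(i', j'). f (if i' < i then i' else Suc i', Suc j'))))"
  proof (rule sum.cong[OF refl])
    fix i assume "i \<in> {..<Suc n}"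
    then have "mat_delete (mat (Suc n) (Suc n) f) i 0 =
        mat n n (\<lambda>(i', j'). f (if i' < i then i' else Suc i', Suc j'))"
      by (intro eq_matI) (auto simp: mat_delete_def)
    then show "mat (Suc n) (Suc n) f $$ (i, 0) * cofactor (mat (Suc n) (Suc n) f) i 0 =
        (-1) ^ i * f (i, 0) * det (mat n n (\<lambda>(i', j'). f (if i' < i then i' else Suc i', Suc j')))"
      using \<open>i \<in> {..<Suc n}\<close> by (simp add: cofactor_def mult.commute)
  qed
  finally show ?thesis .
qed

lemma det_mat_0: "det (mat 0 0 f) = 1"
  by (rule det_dim_zero) auto

lemma \<Delta>_2: "\<Delta> [a, b] = a $ 0 * b $ 1 - a $ 1 * b $ 0"
  by (simp add: \<Delta>_def mat_of_cols_def det_mat_Suc det_mat_0 numeral_eq_Suc algebra_simps)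

lemma \<Delta>_3: "\<Delta> [a, b, c] =
    a $ 0 * (b $ 1 * c $ 2 - b $ 2 * c $ 1) - a $ 1 * (b $ 0 * c $ 2 - b $ 2 * c $ 0) +
    a $ 2 * (b $ 0 * c $ 1 - b $ 1 * c $ 0)"
  by (simp add: \<Delta>_def mat_of_cols_def det_mat_Suc det_mat_0 numeral_eq_Suc algebra_simps)

lemma \<Delta>_4: "\<Delta> [a, b, c, d] =
    a $ 0 * (b $ 1 * (c $ 2 * d $ 3 - c $ 3 * d $ 2) - b $ 2 * (c $ 1 * d $ 3 - c $ 3 * d $ 1) +
      b $ 3 * (c $ 1 * d $ 2 - c $ 2 * d $ 1)) -
    a $ 1 * (b $ 0 * (c $ 2 * d $ 3 - c $ 3 * d $ 2) - b $ 2 * (c $ 0 * d $ 3 - c $ 3 * d $ 0) +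
      b $ 3 * (c $ 0 * d $ 2 - c $ 2 * d $ 0)) +
    a $ 2 * (b $ 0 * (c $ 1 * d $ 3 - c $ 3 * d $ 1) - b $ 1 * (c $ 0 * d $ 3 - c $ 3 * d $ 0) +
      b $ 3 * (c $ 0 * d $ 1 - c $ 1 * d $ 0)) -
    a $ 3 * (b $ 0 * (c $ 1 * d $ 2 - c $ 2 * d $ 1) - b $ 1 * (c $ 0 * d $ 2 - c $ 2 * d $ 0) +
      b $ 2 * (c $ 0 * d $ 1 - c $ 1 * d $ 0))"
  by (simp add: \<Delta>_def mat_of_cols_def det_mat_Suc det_mat_0 numeral_eq_Suc algebra_simps)

lemma \<Delta>_map_mult:
  assumes "g \<in> carrier_mat n n" "set xs \<subseteq> carrier_vec n" "length xs = n"
  shows "\<Delta> (map ((*\<^sub>v) g) xs) = det (g :: 'a::field mat) * \<Delta> xs"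
proof -
  have "mat_of_cols n (map ((*\<^sub>v) g) xs) = g * mat_of_cols n xs"
    by (rule eq_matI) (use assms in \<open>auto simp: mat_of_cols_index subset_iff\<close>)
  moreover have "mat_of_cols n xs \<in> carrier_mat n n"
    using mat_of_cols_carrier(1)[of n xs] assms(3) by simp
  ultimately show ?thesis
    using det_mult[OF assms(1), of "mat_of_cols n xs"] assms(3) unfolding \<Delta>_def length_map by metis
qed

section \<open>Projections\<close>

lemma vec_span_iff:
  assumes "set cs \<subseteq> carrier_vec d"
  shows "v \<in> vec_span d cs \<longleftrightarrow>
    (\<exists>x\<in>carrier_vec (length cs). v = mat_of_cols d cs *\<^sub>v (x :: 'a::field vec))"
proof -
  interpret V: vec_space "TYPE('a)" d .
  have "vec_span d cs = V.span_list cs"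
    using V.span_list_as_span[OF assms] by (simp add: vec_span_def)
  also have "\<dots> = {mat_of_cols d cs *\<^sub>v vec (length cs) c | c. True}"
  proof -
    have "\<forall>w\<in>set cs. dim_vec w = d" using assms by auto
    from V.lincomb_list_as_mat_mult[OF this] show ?thesis by (simp add: V.span_list_def)
  qed
  also have "\<dots> = {mat_of_cols d cs *\<^sub>v x | x. x \<in> carrier_vec (length cs)}"
  proof (safe, goal_cases)
    case (1 x c)
    then show ?case by (auto intro!: exI[of _ "vec (length cs) c"])
  next
    case (2 x y)
    then have "vec (length cs) (($) y) = y" by auto
    then show ?case by (intro exI[of _ "($) y"]) simp
  qed
  finally show ?thesis by auto
qed

lemma mat_of_cols_append_mult:
  assumes "x \<in> carrier_vec (length cs)" "y \<in> carrier_vec (length us)"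
  shows "mat_of_cols d (cs @ us) *\<^sub>v (x @\<^sub>v y) =
    mat_of_cols d cs *\<^sub>v x + mat_of_cols d us *\<^sub>v (y :: 'a::field vec)"
proof (rule eq_vecI)
  fix i assume "i < dim_vec (mat_of_cols d cs *\<^sub>v x + mat_of_cols d us *\<^sub>v y)"
  then have i: "i < d" by simp
  have r: "row (mat_of_cols d (cs @ us)) i = row (mat_of_cols d cs) i @\<^sub>v row (mat_of_cols d us) i"
    by (rule eq_vecI) (use i in \<open>auto simp: mat_of_cols_index nth_append append_vec_def Let_def\<close>)
  have "row (mat_of_cols d cs) i \<in> carrier_vec (length cs)"
    "row (mat_of_cols d us) i \<in> carrier_vec (length us)"
    using row_carrier[of "mat_of_cols d _" i] by simp_all
  from scalar_prod_append[OF this assms]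
  show "(mat_of_cols d (cs @ us) *\<^sub>v (x @\<^sub>v y)) $ i =
      (mat_of_cols d cs *\<^sub>v x + mat_of_cols d us *\<^sub>v y) $ i"
    using i by (simp add: r)
qed (use assms in auto)

text \<open>\<open>us\<close> completes \<open>cs\<close> to a basis. Coordinates in this basis give
  an explicit projection, whereas of the chosen \<open>projection_mat\<close> only the kernel is
  known.\<close>

locale projection =
  fixes cs us :: "'a::field vec list" and d k :: nat and B B' :: "'a mat"
  assumes cs: "set cs \<subseteq> carrier_vec d" and us: "set us \<subseteq> carrier_vec d"
    and len: "length cs + length us = d" and k: "k = length us"
    and \<Delta>: "\<Delta> (cs @ us) \<noteq> 0"
begin

abbreviation "C \<equiv> mat_of_cols d cs"
abbreviation "U \<equiv> mat_of_cols d us"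

lemma decompose:
  assumes "v \<in> carrier_vec d"
  shows "\<exists>x\<in>carrier_vec (length cs). \<exists>y\<in>carrier_vec k. v = C *\<^sub>v x + U *\<^sub>v y"
proof -
  let ?M = "mat_of_cols d (cs @ us)"
  have M: "?M \<in> carrier_mat d d" using len by (auto intro!: carrier_matI)
  from det_non_zero_imp_unit[OF M, of "()"] \<Delta> len
  obtain N where N: "N \<in> carrier_mat d d" "?M * N = 1\<^sub>m d"
    by (auto simp: \<Delta>_def Units_def ring_mat_def)
  let ?w = "N *\<^sub>v v"
  have w: "?w \<in> carrier_vec d" using N assms by auto
  have "?w = vec_first ?w (length cs) @\<^sub>v vec_last ?w k"
    using vec_first_last_append[of ?w "length cs" k] w len k by simp
  moreover have "?M *\<^sub>v ?w = v"
    using N M assms by (simp flip: assoc_mult_mat_vec)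
  ultimately have "v = C *\<^sub>v vec_first ?w (length cs) + U *\<^sub>v vec_last ?w k"
    using mat_of_cols_append_mult[of "vec_first ?w (length cs)" cs "vec_last ?w k" us d] k by simp
  then show ?thesis by (intro bexI) auto
qed

lemma independent:
  assumes "x \<in> carrier_vec (length cs)" "y \<in> carrier_vec k" "C *\<^sub>v x + U *\<^sub>v y = 0\<^sub>v d"
  shows "x = 0\<^sub>v (length cs)" "y = 0\<^sub>v k"
proof -
  let ?M = "mat_of_cols d (cs @ us)"
  have M: "?M \<in> carrier_mat d d" using len by (auto intro!: carrier_matI)
  have "?M *\<^sub>v (x @\<^sub>v y) = 0\<^sub>v d"
    using assms k by (simp add: mat_of_cols_append_mult)
  moreover have "x @\<^sub>v y \<in> carrier_vec d" using assms len k by auto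
  ultimately have "x @\<^sub>v y = 0\<^sub>v d"
    using det_0_iff_vec_prod_zero[OF M] \<Delta> len by (auto simp: \<Delta>_def)
  then have *: "(x @\<^sub>v y) $ i = 0" if "i < d" for i using that by simp
  have "x $ i = 0" if "i < length cs" for i
    using *[of i] that assms(1,2) len k by (simp add: append_vec_def Let_def)
  then show "x = 0\<^sub>v (length cs)"
    using assms(1) by (intro eq_vecI) auto
  have "y $ i = 0" if "i < k" for i
    using *[of "length cs + i"] that assms(1,2) len k by (simp add: append_vec_def Let_def)
  then show "y = 0\<^sub>v k"
    using assms(2) by (intro eq_vecI) auto
qed

lemma projection_mat_exists:
  "\<exists>P. P \<in> carrier_mat (d - length cs) d \<and>
    (\<forall>v\<in>carrier_vec d. P *\<^sub>v v = 0\<^sub>v (d - length cs) \<longleftrightarrow> v \<in> vec_span d cs)"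
proof -
  let ?M = "mat_of_cols d (cs @ us)"
  have M: "?M \<in> carrier_mat d d" using len by (auto intro!: carrier_matI)
  from det_non_zero_imp_unit[OF M, of "()"] \<Delta> len
  obtain N where N: "N \<in> carrier_mat d d" "N * ?M = 1\<^sub>m d"
    by (auto simp: \<Delta>_def Units_def ring_mat_def)
  \<comment> \<open>The lower \<open>k\<close> rows of the inverse basis matrix; they read off the
    coordinates along \<open>us\<close>.\<close>
  let ?P = "mat k d (\<lambda>(i, j). N $$ (i + length cs, j))"
  have P: "?P *\<^sub>v (C *\<^sub>v x + U *\<^sub>v y) = y"
    if x: "x \<in> carrier_vec (length cs)" and y: "y \<in> carrier_vec k" for x y
  proof -
    have "N *\<^sub>v (C *\<^sub>v x + U *\<^sub>v y) = N *\<^sub>v (?M *\<^sub>v (x @\<^sub>v y))"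
      using x y k by (simp add: mat_of_cols_append_mult)
    also have "\<dots> = x @\<^sub>v y"
      using x y k len N M by (subst assoc_mult_mat_vec[symmetric, of _ d d _ d]) auto
    finally have *: "N *\<^sub>v (C *\<^sub>v x + U *\<^sub>v y) = x @\<^sub>v y" .
    show ?thesis
    proof (rule eq_vecI)
      fix i assume "i < dim_vec y"
      then have i: "i < k" "i + length cs < d" using y len k by auto
      have "row ?P i = row N (i + length cs)"
        by (rule eq_vecI) (use i N in auto)
      then have "(?P *\<^sub>v (C *\<^sub>v x + U *\<^sub>v y)) $ i = (N *\<^sub>v (C *\<^sub>v x + U *\<^sub>v y)) $ (i + length cs)"
        using i N by simp
      also have "\<dots> = y $ i"
        unfolding * using i x y by (simp add: append_vec_def Let_def)
      finally show "(?P *\<^sub>v (C *\<^sub>v x + U *\<^sub>v y)) $ i = y $ i" .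
    qed (use y in auto)
  qed
  have "?P *\<^sub>v v = 0\<^sub>v k \<longleftrightarrow> v \<in> vec_span d cs" if v: "v \<in> carrier_vec d" for v
  proof -
    obtain x y where xy: "x \<in> carrier_vec (length cs)" "y \<in> carrier_vec k" "v = C *\<^sub>v x + U *\<^sub>v y"
      using decompose[OF v] by blast
    have "?P *\<^sub>v v = y" using P[OF xy(1,2)] xy(3) by simp
    moreover have "U *\<^sub>v 0\<^sub>v k = 0\<^sub>v d" using k by auto
    moreover have "y = 0\<^sub>v k" if x': "x' \<in> carrier_vec (length cs)" "v = C *\<^sub>v x'" for x'
    proof -
      have "C *\<^sub>v x' = C *\<^sub>v x' + U *\<^sub>v 0\<^sub>v k"
        using \<open>U *\<^sub>v 0\<^sub>v k = 0\<^sub>v d\<close> x' v by auto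
      with P[OF x'(1) zero_carrier_vec] x'(2) have "?P *\<^sub>v v = 0\<^sub>v k" by simp
      with \<open>?P *\<^sub>v v = y\<close> show ?thesis by simp
    qed
    moreover have "C *\<^sub>v x \<in> carrier_vec d" using xy by (auto intro!: carrier_vecI)
    ultimately show ?thesis
      using vec_span_iff[OF cs, of v] xy by auto
  qed
  moreover have "d - length cs = k" using len k by simp
  ultimately show ?thesis by (intro exI[of _ ?P]) auto
qed

lemma projection_mat_props:
  shows "projection_mat d cs \<in> carrier_mat k d"
    and "v \<in> carrier_vec d \<Longrightarrow> projection_mat d cs *\<^sub>v v = 0\<^sub>v k \<longleftrightarrow> v \<in> vec_span d cs"
proof -
  have *: "d - length cs = k" using len k by simp
  have "projection_mat d cs \<in> carrier_mat (d - length cs) d \<and> (\<forall>v\<in>carrier_vec d.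
      projection_mat d cs *\<^sub>v v = 0\<^sub>v (d - length cs) \<longleftrightarrow> v \<in> vec_span d cs)"
    unfolding projection_mat_def by (rule someI_ex[OF projection_mat_exists])
  then show "projection_mat d cs \<in> carrier_mat k d"
    and "v \<in> carrier_vec d \<Longrightarrow> projection_mat d cs *\<^sub>v v = 0\<^sub>v k \<longleftrightarrow> v \<in> vec_span d cs"
    unfolding * by blast+
qed

text \<open>The factor \<open>c\<close> depends on the choice of the matrix but not on
  \<open>bs\<close>. It therefore cancels in cross-ratios and triple ratios, and projected
  determinants may be replaced by determinants that contain the center.\<close>

lemma \<Delta>_projection:
  "\<exists>c. c \<noteq> 0 \<and> (\<forall>bs. set bs \<subseteq> carrier_vec d \<longrightarrow> length bs = k \<longrightarrow>
    \<Delta> (map ((*\<^sub>v) (projection_mat d cs)) bs) = c * \<Delta> (cs @ bs))"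
proof -
  let ?P = "projection_mat d cs" and ?M = "\<lambda>bs. mat_of_cols d (cs @ bs)"
  note P = projection_mat_props
  have UC: "U \<in> carrier_mat d k" "C \<in> carrier_mat d (length cs)"
    using k by (auto intro!: carrier_matI)
  have Mc: "?M bs \<in> carrier_mat d d" if "length bs = k" for bs
    using that len k by (auto intro!: carrier_matI)
  define Y where "Y = ?P * U"
  have Y: "Y \<in> carrier_mat k k" using P(1) UC by (auto simp: Y_def)
  have PC: "?P *\<^sub>v (C *\<^sub>v x) = 0\<^sub>v k" if "x \<in> carrier_vec (length cs)" for x
    using that P(2)[of "C *\<^sub>v x"] vec_span_iff[OF cs] UC by auto
  \<comment> \<open>A kernel vector \<open>w\<close> would put \<open>U *\<^sub>v w\<close> into the
    kernel of the projection, which is the span of \<open>cs\<close>, against independence.\<close>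
  have "det Y \<noteq> 0"
  proof
    assume "det Y = 0"
    then obtain w where w: "w \<in> carrier_vec k" "w \<noteq> 0\<^sub>v k" "Y *\<^sub>v w = 0\<^sub>v k"
      using det_0_iff_vec_prod_zero[OF Y] by blast
    have Uw: "U *\<^sub>v w \<in> carrier_vec d" using UC w by auto
    have "?P *\<^sub>v (U *\<^sub>v w) = 0\<^sub>v k"
      using w P(1) UC by (simp add: Y_def)
    then obtain x where x: "x \<in> carrier_vec (length cs)" "U *\<^sub>v w = C *\<^sub>v x"
      using P(2)[OF Uw] vec_span_iff[OF cs] by blast
    have "C *\<^sub>v x + U *\<^sub>v (- w) = 0\<^sub>v d"
    proof -
      have "U *\<^sub>v (- w) = - (U *\<^sub>v w)"
        using UC w by (intro eq_vecI) auto
      then show ?thesis using x Uw by auto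
    qed
    from independent(2)[OF x(1) _ this] w have "- w = 0\<^sub>v k" by auto
    then have "w = 0\<^sub>v k" using w(1) by (metis uminus_uminus_vec uminus_zero_vec)
    with w(2) show False by simp
  qed
  have dU: "det (?M us) \<noteq> 0" using \<Delta> len by (simp add: \<Delta>_def)
  have "\<Delta> (map ((*\<^sub>v) ?P) bs) = (det Y / det (?M us)) * \<Delta> (cs @ bs)"
    if bs: "set bs \<subseteq> carrier_vec d" "length bs = k" for bs
  proof -
    have "\<forall>j<k. \<exists>x y. x \<in> carrier_vec (length cs) \<and> y \<in> carrier_vec k \<and> bs ! j = C *\<^sub>v x + U *\<^sub>v y"
      using decompose bs by (metis nth_mem subset_iff)
    then obtain x y where xy: "\<And>j. j < k \<Longrightarrow> x j \<in> carrier_vec (length cs)"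
      "\<And>j. j < k \<Longrightarrow> y j \<in> carrier_vec k" "\<And>j. j < k \<Longrightarrow> bs ! j = C *\<^sub>v x j + U *\<^sub>v y j"
      by metis
    define X where "X = mat (length cs) k (\<lambda>(i, j). x j $ i)"
    define Z where "Z = mat k k (\<lambda>(i, j). y j $ i)"
    \<comment> \<open>The columns of \<open>X\<close> and \<open>Z\<close> are the coordinates of
      \<open>bs\<close> along \<open>cs\<close> and \<open>us\<close>. Multiplication by
      \<open>?E\<close> replaces \<open>us\<close> by \<open>bs\<close> in the basis matrix, so both
      determinants in question are multiples of \<open>det Z\<close>.\<close>
    let ?E = "four_block_mat (1\<^sub>m (length cs)) X (0\<^sub>m k (length cs)) Z"
    have XZ: "X \<in> carrier_mat (length cs) k" "Z \<in> carrier_mat k k" by (auto simp: X_def Z_def)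
    have E: "?E \<in> carrier_mat d d" using XZ len k by auto
    have colE: "col ?E j = unit_vec (length cs) j @\<^sub>v 0\<^sub>v k" if "j < length cs" for j
      by (rule eq_vecI) (use that len k in
        \<open>auto simp: append_vec_def Let_def X_def Z_def col_def\<close>)
    have colE': "col ?E (length cs + j) = x j @\<^sub>v y j" if "j < k" for j
      by (rule eq_vecI) (use that len k xy(1)[OF that] xy(2)[OF that] in
        \<open>auto simp: append_vec_def Let_def X_def Z_def col_def\<close>)
    have "?M bs = ?M us * ?E"
    proof (rule mat_col_eqI)
      fix j assume "j < dim_col (?M us * ?E)"
      then have j: "j < d" using E by auto
      show "col (?M bs) j = col (?M us * ?E) j"
      proof (cases "j < length cs")
        case True
        have "col (?M us * ?E) j = ?M us *\<^sub>v (unit_vec (length cs) j @\<^sub>v 0\<^sub>v k)"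
          using col_mult2[OF Mc[OF k[symmetric]] E j] by (simp only: colE[OF True])
        also have "\<dots> = C *\<^sub>v unit_vec (length cs) j + U *\<^sub>v 0\<^sub>v k"
          using k by (simp add: mat_of_cols_append_mult)
        also have "\<dots> = cs ! j"
        proof -
          have "C *\<^sub>v unit_vec (length cs) j = col C j"
            using True by (intro eq_vecI) auto
          moreover have "U *\<^sub>v 0\<^sub>v k = 0\<^sub>v d" using UC by auto
          moreover have "cs ! j \<in> carrier_vec d" using True cs by (meson nth_mem subset_iff)
          ultimately show ?thesis using True by simp
        qed
        also have "\<dots> = col (?M bs) j"
          using True cs bs by (subst col_mat_of_cols) (auto simp: nth_append)
        finally show ?thesis ..
      next
        case False
        then obtain i where i: "j = length cs + i" "i < k" using j len k by (metis add_diff_inverse_nat nat_add_left_cancel_less)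
        have "col (?M us * ?E) j = ?M us *\<^sub>v (x i @\<^sub>v y i)"
          using col_mult2[OF Mc[OF k[symmetric]] E j] by (simp only: i(1) colE'[OF i(2)])
        also have "\<dots> = bs ! i"
          using k xy i by (simp add: mat_of_cols_append_mult)
        also have "\<dots> = col (?M bs) j"
          using i bs by (subst col_mat_of_cols) (auto simp: nth_append)
        finally show ?thesis ..
      qed
    qed (use E Mc[of us] Mc[OF bs(2)] k XZ bs(2) in auto)
    then have "det (?M bs) = det (?M us) * det ?E"
      using det_mult[OF Mc[of us] E] k by simp
    also have "det ?E = det Z"
      by (subst det_four_block_mat_lower_left_zero) (use XZ in auto)
    finally have 1: "\<Delta> (cs @ bs) = det (?M us) * det Z"
      using bs len k by (simp add: \<Delta>_def)
    have "mat_of_cols k (map ((*\<^sub>v) ?P) bs) = Y * Z"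
    proof (rule mat_col_eqI)
      fix j assume "j < dim_col (Y * Z)"
      then have j: "j < k" using XZ by auto
      have "col Z j = y j" by (rule eq_vecI) (use j xy(2)[OF j] in \<open>auto simp: Z_def\<close>)
      then have "col (Y * Z) j = Y *\<^sub>v y j" using j XZ Y col_mult2[of Y k k Z k j] by simp
      also have "\<dots> = ?P *\<^sub>v (U *\<^sub>v y j)"
        using P(1) UC xy j by (simp add: Y_def)
      also have "\<dots> = ?P *\<^sub>v (C *\<^sub>v x j + U *\<^sub>v y j)"
      proof -
        have c: "C *\<^sub>v x j \<in> carrier_vec d" "U *\<^sub>v y j \<in> carrier_vec d"
          using mult_mat_vec_carrier[OF UC(2) xy(1)[OF j]] mult_mat_vec_carrier[OF UC(1) xy(2)[OF j]] .
        moreover have "?P *\<^sub>v (U *\<^sub>v y j) \<in> carrier_vec k" using P(1) c by auto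
        ultimately show ?thesis
          using P(1) PC[OF xy(1)[OF j]] by (simp add: mult_add_distrib_mat_vec)
      qed
      also have "\<dots> = col (mat_of_cols k (map ((*\<^sub>v) ?P) bs)) j"
        using j bs P(1) xy(3)[OF j] by (subst col_mat_of_cols) (auto intro!: carrier_vecI)
      finally show "col (mat_of_cols k (map ((*\<^sub>v) ?P) bs)) j = col (Y * Z) j" ..
    qed (use Y XZ bs in auto)
    then have "\<Delta> (map ((*\<^sub>v) ?P) bs) = det Y * det Z"
      using det_mult[OF Y XZ(2)] bs by (simp add: \<Delta>_def)
    then show ?thesis using 1 dU by simp
  qed
  then show ?thesis using \<open>det Y \<noteq> 0\<close> dU by (intro exI[of _ "det Y / det (?M us)"]) auto
qed

end

section \<open>Relations in $B_2$\<close>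

lemma sym2_0 [simp]: "{0}\<^sub>2 = 0" and sym2_1 [simp]: "{1}\<^sub>2 = 0"
  by (simp_all add: sym2_def)

lemma \<Delta>_2_swap: "\<Delta> [b, a] = - \<Delta> [a, b]"
  by (simp add: \<Delta>_2)

lemma \<Delta>_2_pluecker:
  "\<Delta> [a, b] * \<Delta> [c, d] - \<Delta> [a, c] * \<Delta> [b, d] + \<Delta> [a, d] * \<Delta> [b, c] = 0"
  by (simp add: \<Delta>_2 algebra_simps)

lemma \<Delta>_2_eq_0:
  assumes "u \<in> carrier_vec 2" "v \<in> carrier_vec 2" "u \<noteq> 0\<^sub>v 2" "v \<noteq> 0\<^sub>v 2" "\<Delta> [u, v :: 'a::field vec] = 0"
  shows "\<exists>c. c \<noteq> 0 \<and> v = c \<cdot>\<^sub>v u"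
proof -
  have eqI: "x = y" if "x \<in> carrier_vec 2" "y \<in> carrier_vec 2" "x $ 0 = y $ 0" "x $ 1 = y $ 1"
    for x y :: "'a vec"
    by (rule eq_vecI) (use that in \<open>auto simp: less_2_cases_iff\<close>)
  obtain i where i: "i < 2" "u $ i \<noteq> 0"
    using assms(1,3) eqI[of u "0\<^sub>v 2"] by (metis index_zero_vec(1) one_less_numeral_iff pos2 semiring_norm(76) zero_carrier_vec)
  let ?c = "v $ i / u $ i"
  have v: "v = ?c \<cdot>\<^sub>v u"
  proof (rule eqI)
    show "v $ 0 = (?c \<cdot>\<^sub>v u) $ 0" "v $ 1 = (?c \<cdot>\<^sub>v u) $ 1"
      using i assms(1,5) by (auto simp: less_2_cases_iff \<Delta>_2 field_simps)
  qed (use assms in auto)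
  moreover have "?c \<noteq> 0"
  proof
    assume "?c = 0"
    then have "v = 0\<^sub>v 2" using v assms(1) by auto
    then show False using assms(4) by simp
  qed
  ultimately show ?thesis by blast
qed

text \<open>Class of the cross-ratio of the four points projected from the span of
  \<open>cs\<close>, read off determinants of the unprojected vectors, so that no projection has to
  be chosen. A vanishing denominator gives \<open>{0}\<^sub>2 = 0\<close>.\<close>

definition br :: "'a::field vec list \<Rightarrow> 'a vec \<Rightarrow> 'a vec \<Rightarrow> 'a vec \<Rightarrow> 'a vec \<Rightarrow> 'a B2"
  where "br cs a b c d = {\<Delta> (cs @ [a, c]) * \<Delta> (cs @ [b, d]) / (\<Delta> (cs @ [a, d]) * \<Delta> (cs @ [b, c]))}\<^sub>2"

lemma B2_eq_lin_ext:
  assumes "Poly_Mapping.keys p \<subseteq> - {0, 1}"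
  shows "abs_B2 p = lin_ext sym2 p"
  using B2.ab_eq_lin_ext[OF assms] assms unfolding lin_ext_def
  by (auto simp: sym2_def intro!: sum.cong)

lemma five_term_distinct:
  fixes xs :: "'a::field points"
  assumes "length xs = 5" "set xs \<subseteq> carrier_vec 2"
    and "\<And>i j. i < 5 \<Longrightarrow> j < 5 \<Longrightarrow> i \<noteq> j \<Longrightarrow> \<Delta> [xs ! i, xs ! j] \<noteq> 0"
  shows "(\<Sum>i<5. (-1) ^ Suc i *\<^sub>Q {cross_ratio (omit i xs)}\<^sub>2) = 0"
proof -
  let ?r = "\<Sum>i<5. (-1) ^ Suc i *\<^sub>Q gen (cross_ratio (omit i xs))"
  have carr: "xs ! i \<in> carrier_vec 2" if "i < 5" for i
    using assms(1,2) that by (metis nth_mem subset_iff)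
  have "xs ! i \<noteq> 0\<^sub>v 2" if "i < 5" for i
  proof -
    define j :: nat where "j = (if i = 0 then 1 else 0)"
    have "\<Delta> [xs ! i, xs ! j] \<noteq> 0" using assms(3)[OF that, of j] by (auto simp: j_def)
    then show ?thesis by (auto simp: \<Delta>_2)
  qed
  then have "points 1 xs"
    using assms(1,2) unfolding points_def by (auto simp: numeral_2_eq_2 in_set_conv_nth)
  moreover have "distinct_points xs"
    unfolding distinct_points_def
  proof (intro allI impI notI)
    fix i j assume ij: "i < length xs" "j < length xs" "i \<noteq> j" and "\<exists>c. c \<noteq> 0 \<and> xs ! j = c \<cdot>\<^sub>v xs ! i"
    then obtain c where "xs ! j = c \<cdot>\<^sub>v xs ! i" by blast
    then have "\<Delta> [xs ! i, xs ! j] = 0" using carr[of i] ij assms(1) by (simp add: \<Delta>_2)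
    then show False using assms(3)[of i j] ij assms(1) by simp
  qed
  ultimately have "?r \<in> R2" using assms(1) unfolding R2_def by blast
  moreover have keys: "Poly_Mapping.keys ?r \<subseteq> - {0, 1}"
  proof -
    \<comment> \<open>The values must avoid 0 and 1, because \<open>B2.ab_in_span\<close> applies
      only to elements supported on the generators. The value 1 is excluded by the Pluecker
      relation.\<close>
    have cr: "cross_ratio [a, b, c, d] \<notin> {0, 1}"
      if "\<Delta> [a, b] \<noteq> 0" "\<Delta> [a, c] \<noteq> 0" "\<Delta> [a, d] \<noteq> 0" "\<Delta> [b, c] \<noteq> 0" "\<Delta> [b, d] \<noteq> 0" "\<Delta> [c, d] \<noteq> 0"
      for a b c d :: "'a vec"
      using that \<Delta>_2_pluecker[of a b c d] by (auto simp: cross_ratio_def divide_eq_1_iff)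
    obtain a b c d e where xs: "xs = [a, b, c, d, e]"
      using assms(1) by (auto simp: numeral_eq_Suc length_Suc_conv)
    have "\<Delta> [a, b] \<noteq> 0" "\<Delta> [a, c] \<noteq> 0" "\<Delta> [a, d] \<noteq> 0" "\<Delta> [a, e] \<noteq> 0" "\<Delta> [b, c] \<noteq> 0"
      "\<Delta> [b, d] \<noteq> 0" "\<Delta> [b, e] \<noteq> 0" "\<Delta> [c, d] \<noteq> 0" "\<Delta> [c, e] \<noteq> 0" "\<Delta> [d, e] \<noteq> 0"
      using assms(3)[of 0 1] assms(3)[of 0 2] assms(3)[of 0 3] assms(3)[of 0 4] assms(3)[of 1 2]
        assms(3)[of 1 3] assms(3)[of 1 4] assms(3)[of 2 3] assms(3)[of 2 4] assms(3)[of 3 4]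
      by (simp_all add: xs numeral_eq_Suc)
    then have "cross_ratio (omit i xs) \<notin> {0, 1}" if "i < 5" for i
    proof -
      have "i = 0 \<or> i = 1 \<or> i = 2 \<or> i = 3 \<or> i = 4" using that by arith
      then show ?thesis
        using cr \<open>\<Delta> [a, b] \<noteq> 0\<close> \<open>\<Delta> [a, c] \<noteq> 0\<close> \<open>\<Delta> [a, d] \<noteq> 0\<close> \<open>\<Delta> [a, e] \<noteq> 0\<close> \<open>\<Delta> [b, c] \<noteq> 0\<close>
          \<open>\<Delta> [b, d] \<noteq> 0\<close> \<open>\<Delta> [b, e] \<noteq> 0\<close> \<open>\<Delta> [c, d] \<noteq> 0\<close> \<open>\<Delta> [c, e] \<noteq> 0\<close> \<open>\<Delta> [d, e] \<noteq> 0\<close>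
        by (elim disjE) (simp_all add: xs omit_def)
    qed
    then show ?thesis
      using keys_scaleQ
      by (intro order_trans[OF keys_sum] UN_least order_trans[OF keys_scaleQ]) auto
  qed
  ultimately have "abs_B2 ?r = 0" by (intro B2.ab_in_span Q.span_base)
  then show ?thesis using B2_eq_lin_ext[OF keys] by (simp add: lin_ext_simps)
qed

definition five_term :: "'a::field vec list \<Rightarrow> 'a vec \<Rightarrow> 'a vec \<Rightarrow> 'a vec \<Rightarrow> 'a vec \<Rightarrow> 'a vec \<Rightarrow> 'a B2"
  where "five_term cs a b c d e =
    br cs b c d e - br cs a c d e + br cs a b d e - br cs a b c e + br cs a b c d"

lemma five_term_distinct':
  fixes a b c d e :: "'a::field vec"
  assumes "set [a, b, c, d, e] \<subseteq> carrier_vec 2"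
    and "\<Delta> [a, b] \<noteq> 0" "\<Delta> [a, c] \<noteq> 0" "\<Delta> [a, d] \<noteq> 0" "\<Delta> [a, e] \<noteq> 0" "\<Delta> [b, c] \<noteq> 0"
      "\<Delta> [b, d] \<noteq> 0" "\<Delta> [b, e] \<noteq> 0" "\<Delta> [c, d] \<noteq> 0" "\<Delta> [c, e] \<noteq> 0" "\<Delta> [d, e] \<noteq> 0"
  shows "five_term [] a b c d e = 0"
proof -
  have "\<Delta> [[a, b, c, d, e] ! i, [a, b, c, d, e] ! j] \<noteq> 0" if "i < 5" "j < 5" "i \<noteq> j" for i j
  proof -
    have "i = 0 \<or> i = 1 \<or> i = 2 \<or> i = 3 \<or> i = 4" "j = 0 \<or> j = 1 \<or> j = 2 \<or> j = 3 \<or> j = 4"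
      using that by arith+
    then show ?thesis
      using that(3) assms(2-)
      by (elim disjE) (simp_all add: \<Delta>_2_swap[of b a] \<Delta>_2_swap[of c a] \<Delta>_2_swap[of d a] \<Delta>_2_swap[of e a]
        \<Delta>_2_swap[of c b] \<Delta>_2_swap[of d b] \<Delta>_2_swap[of e b] \<Delta>_2_swap[of d c] \<Delta>_2_swap[of e c]
        \<Delta>_2_swap[of e d])
  qed
  from five_term_distinct[OF _ assms(1) this]
  have "(\<Sum>i<5. (-1) ^ Suc i *\<^sub>Q {cross_ratio (omit i [a, b, c, d, e])}\<^sub>2) = 0"
    by simp
  then have "- five_term [] a b c d e = 0"
    by (simp add: five_term_def br_def lessThan_nat_numeral lessThan_Suc omit_def cross_ratio_def
        numeral_eq_Suc algebra_simps)
  then show ?thesis by simp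
qed

locale infinite_field =
  fixes F :: "'a::field itself"
  assumes infinite_field: "infinite (UNIV :: 'a set)"
begin

lemma sym2_five_term:
  assumes "x \<noteq> y" "x \<noteq> 0" "x \<noteq> 1" "y \<noteq> 0" "y \<noteq> (1::'a)"
  shows "{x * (1 - y) / (y * (1 - x))}\<^sub>2 - {(1 - y) / (1 - x)}\<^sub>2 + {y / x}\<^sub>2 - {y}\<^sub>2 + {x}\<^sub>2 = 0"
proof -
  \<comment> \<open>\<open>?p s t\<close> is the point s/t of the line: the five points are
    infinity, 0, 1, \<open>x\<close>, \<open>y\<close>.\<close>
  let ?p = "\<lambda>s t. vec 2 (\<lambda>i. if i = 0 then s else t) :: 'a vec"
  have "five_term [] (?p 1 0) (?p 0 1) (?p 1 1) (?p x 1) (?p y 1) = 0"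
    by (rule five_term_distinct') (use assms in \<open>auto simp: \<Delta>_2\<close>)
  moreover have "br [] (?p 0 1) (?p 1 1) (?p x 1) (?p y 1) = {x * (1 - y) / (y * (1 - x))}\<^sub>2"
    "br [] (?p 1 0) (?p 1 1) (?p x 1) (?p y 1) = {(1 - y) / (1 - x)}\<^sub>2"
    "br [] (?p 1 0) (?p 0 1) (?p x 1) (?p y 1) = {y / x}\<^sub>2"
    "br [] (?p 1 0) (?p 0 1) (?p 1 1) (?p y 1) = {y}\<^sub>2"
    "br [] (?p 1 0) (?p 0 1) (?p 1 1) (?p x 1) = {x}\<^sub>2"
    by (simp_all add: br_def \<Delta>_2)
  ultimately show ?thesis
    by (simp only: five_term_def)
qed

text \<open>Add the five-term relations for (x, y) and for (1/x, 1/y): their first two terms are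
  exchanged and cancel, which leaves g(y/x) = g(y) - g(x) for
  \<open>g t = {t}\<^sub>2 + {inverse t}\<^sub>2\<close>. Since g is invariant under inversion,
  exchanging x and y gives 2 g(y/x) = 0.\<close>

lemma sym2_inverse: "{inverse x}\<^sub>2 = - {x :: 'a}\<^sub>2"
proof -
  define g where "g t = {t}\<^sub>2 + {inverse t}\<^sub>2" for t :: 'a
  have g: "g (y / x) = g y - g x" if "x \<noteq> y" "x \<noteq> 0" "x \<noteq> 1" "y \<noteq> 0" "y \<noteq> 1" for x y :: 'a
  proof -
    have e: "inverse x * (1 - inverse y) / (inverse y * (1 - inverse x)) = (1 - y) / (1 - x)"
      "(1 - inverse y) / (1 - inverse x) = x * (1 - y) / (y * (1 - x))"
      "inverse y / inverse x = inverse (y / x)"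
      using that by (simp_all add: field_simps)
    have "inverse x \<noteq> inverse y" "inverse x \<noteq> 0" "inverse x \<noteq> 1" "inverse y \<noteq> 0" "inverse y \<noteq> 1"
      using that by auto
    note * = sym2_five_term[OF this, unfolded e]
    have "g (y / x) - (g y - g x) =
        ({x * (1 - y) / (y * (1 - x))}\<^sub>2 - {(1 - y) / (1 - x)}\<^sub>2 + {y / x}\<^sub>2 - {y}\<^sub>2 + {x}\<^sub>2) +
        ({(1 - y) / (1 - x)}\<^sub>2 - {x * (1 - y) / (y * (1 - x))}\<^sub>2 + {inverse (y / x)}\<^sub>2 -
          {inverse y}\<^sub>2 + {inverse x}\<^sub>2)"
      unfolding g_def by (simp only: diff_conv_add_uminus minus_add_distrib minus_minus ac_simps) simp
    then show ?thesis by (simp only: * sym2_five_term[OF that]) simp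
  qed
  have "{inverse t}\<^sub>2 = - {t}\<^sub>2" if t: "t \<noteq> 0" "t \<noteq> 1" for t :: 'a
  proof -
    \<comment> \<open>Any \<open>t\<close> is a ratio y/x with \<open>y = t * x\<close>; infinitude
      of the field leaves an \<open>x\<close> for which neither \<open>x\<close> nor
      \<open>y\<close> is 0 or 1.\<close>
    obtain x where x: "x \<notin> {0, 1, inverse t}"
      using ex_new_if_finite[OF infinite_field, of "{0, 1, inverse t}"] by auto
    let ?y = "t * x"
    have y: "x \<noteq> ?y" "x \<noteq> 0" "x \<noteq> 1" "?y \<noteq> 0" "?y \<noteq> 1"
      using x t inverse_unique[of t x] by auto
    have "g (x / ?y) = g (?y / x)"
      using y by (simp add: g_def add.commute inverse_eq_divide)
    moreover have "g (x / ?y) = g x - g ?y" using g[of ?y x] y by metis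
    ultimately have "g (?y / x) + g (?y / x) = (g ?y - g x) + (g x - g ?y)"
      unfolding g[OF y] by (simp only:)
    then have "g (?y / x) + g (?y / x) = 0" by simp
    then have "g t = 0" using y by (simp add: twice_eq_zero_iff)
    then show ?thesis by (simp add: g_def eq_neg_iff_add_eq_0 add.commute)
  qed
  then show ?thesis by (cases "x = 0 \<or> x = 1") auto
qed

text \<open>Adding the five-term relations for (x, y) and (1 - x, 1 - y) shows that
  \<open>h t = {t}\<^sub>2 + {1 - t}\<^sub>2\<close> is constant. The six values of the cross-ratio
  form three inverse pairs, so h(x) + h(1/x) + h(1/(1 - x)) = 0, that is, three times the constant
  is 0.\<close>

lemma sym2_one_minus: "{1 - x}\<^sub>2 = - {x :: 'a}\<^sub>2"
proof -
  define h where "h t = {t}\<^sub>2 + {1 - t}\<^sub>2" for t :: 'a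
  have h: "h x = h y" if "x \<noteq> 0" "x \<noteq> 1" "y \<noteq> 0" "y \<noteq> 1" for x y :: 'a
  proof (cases "x = y")
    case False
    have e: "(1 - x) * (1 - (1 - y)) / ((1 - y) * (1 - (1 - x))) = inverse (x * (1 - y) / (y * (1 - x)))"
      "(1 - (1 - y)) / (1 - (1 - x)) = y / x"
      by (simp_all add: mult.commute)
    have "1 - x \<noteq> 1 - y" "1 - x \<noteq> 0" "1 - x \<noteq> 1" "1 - y \<noteq> 0" "1 - y \<noteq> 1"
      using that False by auto
    note * = sym2_five_term[OF this, unfolded e sym2_inverse]
    have "h x - h y =
        ({x * (1 - y) / (y * (1 - x))}\<^sub>2 - {(1 - y) / (1 - x)}\<^sub>2 + {y / x}\<^sub>2 - {y}\<^sub>2 + {x}\<^sub>2) +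
        (- {x * (1 - y) / (y * (1 - x))}\<^sub>2 - {y / x}\<^sub>2 + {(1 - y) / (1 - x)}\<^sub>2 -
          {1 - y}\<^sub>2 + {1 - x}\<^sub>2)"
      unfolding h_def by (simp only: diff_conv_add_uminus minus_add_distrib minus_minus ac_simps) simp
    then show ?thesis by (simp only: * sym2_five_term[OF False that]) simp
  qed simp
  have "{1 - x}\<^sub>2 = - {x}\<^sub>2" if x: "x \<noteq> 0" "x \<noteq> 1" for x :: 'a
  proof -
    have 1: "h (inverse x) = h x" "h (inverse (1 - x)) = h x"
      using x by (auto intro!: h)
    have "1 - inverse (1 - x) = inverse (1 - inverse x)"
      using x by (simp add: field_simps)
    then have "h x + h (inverse x) + h (inverse (1 - x)) = 0"
      unfolding h_def by (simp add: sym2_inverse)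
    then have "(3::rat) *\<^sub>Q h x = 0"
      unfolding 1 by (simp add: scaleQ_add_left[of 1 2, simplified] scaleQ_add_left[of 1 1, simplified] add.assoc)
    then have "h x = 0" by simp
    then show ?thesis by (simp add: h_def eq_neg_iff_add_eq_0 add.commute)
  qed
  then show ?thesis by (cases "x = 0 \<or> x = 1") auto
qed

text \<open>The hypothesis is a Pluecker relation and makes the two arguments add up to 1. If
  \<open>t * u = 0\<close>, both arguments are 0 by the convention for division.\<close>

lemma sym2_cross_ratio_antisym:
  assumes "p * s - q * r + t * u = (0::'a)"
  shows "{p * s / (- t * u)}\<^sub>2 = - {q * r / (t * u)}\<^sub>2"
proof (cases "t * u = 0")
  case False
  have "p * s = q * r - t * u" using assms by (simp add: algebra_simps)
  then have "p * s / (- t * u) = 1 - q * r / (t * u)"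
    using False by (simp add: field_simps)
  then show ?thesis by (simp only: sym2_one_minus)
qed auto

lemma br_2_swap:
  fixes a b c d :: "'a vec"
  shows br_2_swap12: "br [] b a c d = - br [] a b c d"
    and br_2_swap23: "br [] a c b d = - br [] a b c d"
    and br_2_swap34: "br [] a b d c = - br [] a b c d"
proof -
  show "br [] b a c d = - br [] a b c d" "br [] a b d c = - br [] a b c d"
    by (simp_all add: br_def mult.commute flip: sym2_inverse)
  show "br [] a c b d = - br [] a b c d"
    using sym2_cross_ratio_antisym[OF \<Delta>_2_pluecker[of a b c d]]
    by (simp add: br_def \<Delta>_2_swap[of c b])
qed

lemma five_term_2_swap:
  fixes a b c d e :: "'a vec"
  shows "five_term [] b a c d e = - five_term [] a b c d e"
    "five_term [] a c b d e = - five_term [] a b c d e"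
    "five_term [] a b d c e = - five_term [] a b c d e"
    "five_term [] a b c e d = - five_term [] a b c d e"
  unfolding five_term_def
  by (simp_all add: br_2_swap12[of b a] br_2_swap12[of c b] br_2_swap23[of _ c b] br_2_swap12[of d c]
      br_2_swap23[of _ d c] br_2_swap34[of _ _ d c] br_2_swap34[of _ _ e d] br_2_swap23[of _ e d])

text \<open>The three brackets that contain both coinciding points vanish, their arguments being 0
  or 1, and the remaining two cancel.\<close>

lemma five_term_2_parallel:
  fixes a b c d e :: "'a vec"
  assumes "a \<in> carrier_vec 2" "b = k \<cdot>\<^sub>v a" "k \<noteq> 0"
  shows "five_term [] a b c d e = 0"
proof -
  have b: "b $ 0 = k * a $ 0" "b $ 1 = k * a $ 1" using assms by auto
  have 0: "br [] a b x y = 0" for x y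
  proof -
    let ?q = "\<Delta> [a, x] * \<Delta> [b, y] / (\<Delta> [a, y] * \<Delta> [b, x])"
    have bx: "\<Delta> [b, z] = k * \<Delta> [a, z]" for z unfolding \<Delta>_2 b by (simp add: algebra_simps)
    have "?q = 0 \<or> ?q = 1" using assms(3) by (auto simp: bx)
    then show ?thesis by (auto simp: br_def)
  qed
  have "br [] b c d e = br [] a c d e"
  proof -
    have "\<Delta> [b, z] = k * \<Delta> [a, z]" for z unfolding \<Delta>_2 b by (simp add: algebra_simps)
    then show ?thesis using assms(3) by (simp add: br_def mult.assoc)
  qed
  then show ?thesis by (simp add: five_term_def 0)
qed

text \<open>Antisymmetry moves a coinciding pair to the first two places.\<close>

lemma five_term_2:
  fixes a b c d e :: "'a vec"
  assumes "set [a, b, c, d, e] \<subseteq> carrier_vec 2 - {0\<^sub>v 2}"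
  shows "five_term [] a b c d e = 0"
proof -
  note sw = five_term_2_swap
  have par: "five_term [] x y u v w = 0"
    if "\<Delta> [x, y] = 0" "x \<in> {a, b, c, d, e}" "y \<in> {a, b, c, d, e}" for x y u v w
  proof -
    have "x \<in> carrier_vec 2 - {0\<^sub>v 2}" "y \<in> carrier_vec 2 - {0\<^sub>v 2}" using that assms by auto
    then show ?thesis using \<Delta>_2_eq_0[of x y] that(1) five_term_2_parallel[of x y] by auto
  qed
  consider "\<Delta> [a, b] = 0" | "\<Delta> [a, c] = 0" | "\<Delta> [a, d] = 0" | "\<Delta> [a, e] = 0" | "\<Delta> [b, c] = 0"
    | "\<Delta> [b, d] = 0" | "\<Delta> [b, e] = 0" | "\<Delta> [c, d] = 0" | "\<Delta> [c, e] = 0" | "\<Delta> [d, e] = 0"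
    | "five_term [] a b c d e = 0"
    using five_term_distinct'[of a b c d e] assms by auto
  then show ?thesis
  proof cases
    case 1
    then show ?thesis using par[of a b c d e] by simp
  next
    case 2
    then show ?thesis using par[of a c b d e] sw(2)[of a c b d e] by simp
  next
    case 3
    then show ?thesis using par[of a d b c e] sw(2)[of a d b c e] sw(3)[of a b d c e] by simp
  next
    case 4
    then show ?thesis using par[of a e b c d] sw(2)[of a e b c d] sw(3)[of a b e c d]
        sw(4)[of a b c e d] by simp
  next
    case 5
    then show ?thesis using par[of b c a d e] sw(2)[of b c a d e] sw(1)[of b a c d e] by simp
  next
    case 6
    then show ?thesis using par[of b d a c e] sw(2)[of b d a c e] sw(1)[of b a d c e]
        sw(3)[of a b d c e] by simp
  next
    case 7
    then show ?thesis using par[of b e a c d] sw(2)[of b e a c d] sw(1)[of b a e c d]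
        sw(3)[of a b e c d] sw(4)[of a b c e d] by simp
  next
    case 8
    then show ?thesis using par[of c d a b e] sw(2)[of c d a b e] sw(1)[of c a d b e]
        sw(3)[of a c d b e] sw(2)[of a c b d e] by simp
  next
    case 9
    then show ?thesis using par[of c e a b d] sw(2)[of c e a b d] sw(1)[of c a e b d]
        sw(3)[of a c e b d] sw(2)[of a c b e d] sw(4)[of a b c e d] by simp
  next
    case 10
    then show ?thesis using par[of d e a b c] sw(2)[of d e a b c] sw(1)[of d a e b c]
        sw(3)[of a d e b c] sw(2)[of a d b e c] sw(4)[of a b d e c] sw(3)[of a b d c e] by simp
  qed simp
qed

end

section \<open>Brackets and five-term relations seen from a center\<close>

declare add_2_eq_Suc [simp del] add_2_eq_Suc' [simp del]

lemma \<Delta>_3_swap: "\<Delta> [b, a, c] = - \<Delta> [a, b, c]" "\<Delta> [a, c, b] = - \<Delta> [a, b, c]"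
  by (simp_all add: \<Delta>_3 algebra_simps)

lemma \<Delta>_4_swap: "\<Delta> [b, a, c, d] = - \<Delta> [a, b, c, d]" "\<Delta> [a, c, b, d] = - \<Delta> [a, b, c, d]"
  "\<Delta> [a, b, d, c] = - \<Delta> [a, b, c, d]"
  by (simp_all add: \<Delta>_4 algebra_simps)

lemma br_center_swap: "br [q, p] a b c d = br [p, q] a b c d"
  by (simp add: br_def \<Delta>_4_swap(1)[of q p])

lemma project_scaling:
  fixes cs :: "'a::field vec list"
  assumes "set cs \<subseteq> carrier_vec d" "set us \<subseteq> carrier_vec d" "length cs + length us = d"
    and "\<Delta> (cs @ us) \<noteq> 0"
  obtains c where "c \<noteq> 0" "projection_mat d cs \<in> carrier_mat (length us) d"
    "\<And>bs. set bs \<subseteq> carrier_vec d \<Longrightarrow> length bs = length us \<Longrightarrow>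
      \<Delta> (map ((*\<^sub>v) (projection_mat d cs)) bs) = c * \<Delta> (cs @ bs)"
proof -
  interpret projection cs us d "length us"
    by unfold_locales (use assms in auto)
  show thesis using \<Delta>_projection projection_mat_props(1) that by blast
qed

text \<open>Transfers identities between brackets with center \<open>cs\<close> to the projective
  line; the points \<open>p\<close>, \<open>q\<close> witness that \<open>cs\<close> is
  independent.\<close>

lemma br_projection:
  fixes cs :: "'a::field vec list"
  assumes "set cs \<subseteq> carrier_vec (length cs + 2)"
    and "p \<in> carrier_vec (length cs + 2)" "q \<in> carrier_vec (length cs + 2)" "\<Delta> (cs @ [p, q]) \<noteq> 0"
  obtains P k where "P \<in> carrier_mat 2 (length cs + 2)" "k \<noteq> 0"
    "\<And>a b. a \<in> carrier_vec (length cs + 2) \<Longrightarrow> b \<in> carrier_vec (length cs + 2) \<Longrightarrow>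
      \<Delta> [P *\<^sub>v a, P *\<^sub>v b] = k * \<Delta> (cs @ [a, b])"
    "\<And>a b c d. set [a, b, c, d] \<subseteq> carrier_vec (length cs + 2) \<Longrightarrow>
      br cs a b c d = br [] (P *\<^sub>v a) (P *\<^sub>v b) (P *\<^sub>v c) (P *\<^sub>v d)"
proof -
  let ?P = "projection_mat (length cs + 2) cs"
  obtain k where k: "k \<noteq> 0" "?P \<in> carrier_mat 2 (length cs + 2)"
    "\<And>bs. set bs \<subseteq> carrier_vec (length cs + 2) \<Longrightarrow> length bs = 2 \<Longrightarrow>
      \<Delta> (map ((*\<^sub>v) ?P) bs) = k * \<Delta> (cs @ bs)"
    by (rule project_scaling[of cs "length cs + 2" "[p, q]"])
      (use assms in \<open>auto simp: numeral_2_eq_2\<close>)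
  have \<Delta>: "\<Delta> [?P *\<^sub>v a, ?P *\<^sub>v b] = k * \<Delta> (cs @ [a, b])"
    if "a \<in> carrier_vec (length cs + 2)" "b \<in> carrier_vec (length cs + 2)" for a b
    using k(3)[of "[a, b]"] that by simp
  have "br cs a b c d = br [] (?P *\<^sub>v a) (?P *\<^sub>v b) (?P *\<^sub>v c) (?P *\<^sub>v d)"
    if "set [a, b, c, d] \<subseteq> carrier_vec (length cs + 2)" for a b c d
    using that k(1) by (simp add: br_def \<Delta> mult.assoc mult.left_commute)
  with k(1,2) \<Delta> show thesis using that by blast
qed

lemma br_degenerate:
  assumes "set [a, b, c, d] \<subseteq> carrier_vec n"
    and "\<And>p q. p \<in> carrier_vec n \<Longrightarrow> q \<in> carrier_vec n \<Longrightarrow> \<Delta> (cs @ [p, q]) = 0"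
  shows "br cs a b c d = 0"
  using assms by (simp add: br_def)

text \<open>If some determinant containing \<open>cs\<close> is nonzero, this is the relation on the
  line, up to the factor \<open>k * k\<close>; otherwise every term is 0.\<close>

lemma \<Delta>_pluecker:
  fixes cs :: "'a::field vec list"
  assumes "set cs \<subseteq> carrier_vec (length cs + 2)" "set [a, b, c, d] \<subseteq> carrier_vec (length cs + 2)"
  shows "\<Delta> (cs @ [a, b]) * \<Delta> (cs @ [c, d]) - \<Delta> (cs @ [a, c]) * \<Delta> (cs @ [b, d]) +
    \<Delta> (cs @ [a, d]) * \<Delta> (cs @ [b, c]) = 0"
proof (cases "\<exists>p\<in>carrier_vec (length cs + 2). \<exists>q\<in>carrier_vec (length cs + 2). \<Delta> (cs @ [p, q]) \<noteq> 0")
  case True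
  then obtain p q where pq: "p \<in> carrier_vec (length cs + 2)" "q \<in> carrier_vec (length cs + 2)"
    "\<Delta> (cs @ [p, q]) \<noteq> 0" by blast
  obtain P k where k: "k \<noteq> 0"
    "\<And>a b. a \<in> carrier_vec (length cs + 2) \<Longrightarrow> b \<in> carrier_vec (length cs + 2) \<Longrightarrow>
      \<Delta> [P *\<^sub>v a, P *\<^sub>v b] = k * \<Delta> (cs @ [a, b])"
    using br_projection[OF assms(1) pq] by metis
  have "k * k * (\<Delta> (cs @ [a, b]) * \<Delta> (cs @ [c, d]) - \<Delta> (cs @ [a, c]) * \<Delta> (cs @ [b, d]) +
      \<Delta> (cs @ [a, d]) * \<Delta> (cs @ [b, c])) =
    (k * \<Delta> (cs @ [a, b])) * (k * \<Delta> (cs @ [c, d])) - (k * \<Delta> (cs @ [a, c])) * (k * \<Delta> (cs @ [b, d])) +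
      (k * \<Delta> (cs @ [a, d])) * (k * \<Delta> (cs @ [b, c]))"
    by (simp add: algebra_simps)
  also have "\<dots> = 0"
    using \<Delta>_2_pluecker[of "P *\<^sub>v a" "P *\<^sub>v b" "P *\<^sub>v c" "P *\<^sub>v d"] assms(2)
    by (simp add: k(2))
  finally show ?thesis using k(1) unfolding mult_eq_0_iff by blast
next
  case False
  then show ?thesis using assms by auto
qed

text \<open>A vector outside the span of the independent vectors \<open>cs\<close> is characterized by a nonvanishing
  determinant, so that no independence hypotheses on \<open>cs\<close> are needed below.\<close>

definition off_center :: "'a::field vec list \<Rightarrow> 'a vec \<Rightarrow> bool"
  where "off_center cs v \<longleftrightarrow> v \<in> carrier_vec (length cs + 2) \<and>
    (\<exists>u\<in>carrier_vec (length cs + 2). \<Delta> (cs @ [v, u]) \<noteq> 0)"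

context infinite_field
begin

lemma br_swap:
  fixes cs :: "'a vec list"
  assumes "set cs \<subseteq> carrier_vec (length cs + 2)" "set [a, b, c, d] \<subseteq> carrier_vec (length cs + 2)"
  shows br_swap12: "br cs b a c d = - br cs a b c d"
    and br_swap23: "br cs a c b d = - br cs a b c d"
    and br_swap34: "br cs a b d c = - br cs a b c d"
proof -
  have "br cs b a c d = - br cs a b c d \<and> br cs a c b d = - br cs a b c d \<and>
    br cs a b d c = - br cs a b c d"
  proof (cases "\<exists>p\<in>carrier_vec (length cs + 2). \<exists>q\<in>carrier_vec (length cs + 2). \<Delta> (cs @ [p, q]) \<noteq> 0")
    case True
    then obtain p q where pq: "p \<in> carrier_vec (length cs + 2)" "q \<in> carrier_vec (length cs + 2)"
      "\<Delta> (cs @ [p, q]) \<noteq> 0" by blast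
    obtain P where P: "\<And>a b c d. set [a, b, c, d] \<subseteq> carrier_vec (length cs + 2) \<Longrightarrow>
        br cs a b c d = br [] (P *\<^sub>v a) (P *\<^sub>v b) (P *\<^sub>v c) (P *\<^sub>v d)"
      using br_projection[OF assms(1) pq] by metis
    show ?thesis
      using assms(2) br_2_swap12[of "P *\<^sub>v b" "P *\<^sub>v a"] br_2_swap23[of "P *\<^sub>v a" "P *\<^sub>v c" "P *\<^sub>v b"]
        br_2_swap34[of "P *\<^sub>v a" "P *\<^sub>v b" "P *\<^sub>v d" "P *\<^sub>v c"] by (simp add: P)
  next
    case False
    then have "\<And>p q. p \<in> carrier_vec (length cs + 2) \<Longrightarrow> q \<in> carrier_vec (length cs + 2) \<Longrightarrow>
      \<Delta> (cs @ [p, q]) = 0" by blast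
    then have "br cs u v x y = 0" if "set [u, v, x, y] \<subseteq> carrier_vec (length cs + 2)" for u v x y
      using br_degenerate[OF that] by blast
    then show ?thesis using assms(2) by simp
  qed
  then show "br cs b a c d = - br cs a b c d" "br cs a c b d = - br cs a b c d"
    "br cs a b d c = - br cs a b c d" by auto
qed

text \<open>\<open>off_center\<close> ensures that the projected vectors are nonzero, which is all
  that the relation on the line demands.\<close>

lemma five_term_zero:
  fixes cs :: "'a vec list"
  assumes cs: "set cs \<subseteq> carrier_vec (length cs + 2)"
    and v: "off_center cs a" "off_center cs b" "off_center cs c" "off_center cs d" "off_center cs e"
  shows "five_term cs a b c d e = 0"
proof -
  obtain q where q: "q \<in> carrier_vec (length cs + 2)" "\<Delta> (cs @ [a, q]) \<noteq> 0"
    and a: "a \<in> carrier_vec (length cs + 2)"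
    using v(1) by (auto simp: off_center_def)
  obtain P k where P: "P \<in> carrier_mat 2 (length cs + 2)" "k \<noteq> 0"
    "\<And>a b. a \<in> carrier_vec (length cs + 2) \<Longrightarrow> b \<in> carrier_vec (length cs + 2) \<Longrightarrow>
      \<Delta> [P *\<^sub>v a, P *\<^sub>v b] = k * \<Delta> (cs @ [a, b])"
    "\<And>a b c d. set [a, b, c, d] \<subseteq> carrier_vec (length cs + 2) \<Longrightarrow>
      br cs a b c d = br [] (P *\<^sub>v a) (P *\<^sub>v b) (P *\<^sub>v c) (P *\<^sub>v d)"
    by (rule br_projection[OF cs a q]) blast
  have nz: "P *\<^sub>v x \<in> carrier_vec 2 - {0\<^sub>v 2}" if x: "off_center cs x" for x
  proof -
    obtain u where u: "x \<in> carrier_vec (length cs + 2)" "u \<in> carrier_vec (length cs + 2)"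
      "\<Delta> (cs @ [x, u]) \<noteq> 0" using x unfolding off_center_def by blast
    have "\<Delta> [P *\<^sub>v x, P *\<^sub>v u] \<noteq> 0" using u P(2,3) by simp
    then have "P *\<^sub>v x \<noteq> 0\<^sub>v 2" by (auto simp: \<Delta>_2)
    then show ?thesis using P(1) u by auto
  qed
  have "five_term [] (P *\<^sub>v a) (P *\<^sub>v b) (P *\<^sub>v c) (P *\<^sub>v d) (P *\<^sub>v e) = 0"
    by (rule five_term_2) (use nz v in auto)
  then show ?thesis
    using v unfolding five_term_def off_center_def by (subst (asm) (1 2 3 4 5) P(4)[symmetric]) auto
qed

definition dual_five_term :: "'a vec list \<Rightarrow> 'a vec \<Rightarrow> 'a vec \<Rightarrow> 'a vec \<Rightarrow> 'a vec \<Rightarrow> 'a vec \<Rightarrow> 'a B2"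
  where "dual_five_term cs a b c d e = br (cs @ [a]) b c d e - br (cs @ [b]) a c d e +
    br (cs @ [c]) a b d e - br (cs @ [d]) a b c e + br (cs @ [e]) a b c d"

text \<open>The Gale dual of five points of the plane consists of five points of the line; the cross-ratio
  of four of the latter is that of the corresponding points of the plane projected from the fifth.\<close>

lemma dual_five_term_3:
  fixes a b c d e :: "'a vec"
  assumes "\<Delta> [a, b, c] \<noteq> 0"
    and "\<Delta> [b, c, d] \<noteq> 0 \<or> \<Delta> [b, c, e] \<noteq> 0"
    and "\<Delta> [a, c, d] \<noteq> 0 \<or> \<Delta> [a, c, e] \<noteq> 0"
    and "\<Delta> [a, b, d] \<noteq> 0 \<or> \<Delta> [a, b, e] \<noteq> 0"
  shows "dual_five_term [] a b c d e = 0"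
proof -
  define p where "p s t = vec 2 (\<lambda>i. if i = 0 then s else t)" for s t :: 'a
  have p: "p s t $ 0 = s" "p s t $ 1 = t" "p s t \<in> carrier_vec 2" for s t
    by (simp_all add: p_def)
  have p0: "p s t = 0\<^sub>v 2 \<longleftrightarrow> s = 0 \<and> t = 0" for s t
  proof
    assume "p s t = 0\<^sub>v 2"
    then have "p s t $ 0 = 0" "p s t $ 1 = 0" by simp_all
    then show "s = 0 \<and> t = 0" by (simp only: p)
  qed (auto simp: p_def)
  let ?t = "\<Delta> [a, b, c]"
  \<comment> \<open>The first coordinates are the coefficients of the linear relation between
    \<open>a\<close>, \<open>b\<close>, \<open>c\<close>, \<open>d\<close> given by Cramer's rule,
    the second ones those of the relation between \<open>a\<close>, \<open>b\<close>,
    \<open>c\<close>, \<open>e\<close>. The last three hypotheses say that \<open>y1\<close>,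
    \<open>y2\<close>, \<open>y3\<close> are nonzero.\<close>
  define y1 where "y1 = p (\<Delta> [b, c, d]) (\<Delta> [b, c, e])"
  define y2 where "y2 = p (- \<Delta> [a, c, d]) (- \<Delta> [a, c, e])"
  define y3 where "y3 = p (\<Delta> [a, b, d]) (\<Delta> [a, b, e])"
  define y4 where "y4 = p (- ?t) 0"
  define y5 where "y5 = p 0 (- ?t)"
  note ys = y1_def y2_def y3_def y4_def y5_def
  have y: "\<Delta> [y1, y2] = ?t * \<Delta> [c, d, e]" "\<Delta> [y1, y3] = - ?t * \<Delta> [b, d, e]"
    "\<Delta> [y2, y3] = ?t * \<Delta> [a, d, e]"
    unfolding ys \<Delta>_2 p by (simp_all add: \<Delta>_3 algebra_simps)
  have y': "\<Delta> [y1, y4] = ?t * \<Delta> [b, c, e]" "\<Delta> [y1, y5] = - ?t * \<Delta> [b, c, d]"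
    "\<Delta> [y2, y4] = - ?t * \<Delta> [a, c, e]" "\<Delta> [y2, y5] = ?t * \<Delta> [a, c, d]"
    "\<Delta> [y3, y4] = ?t * \<Delta> [a, b, e]" "\<Delta> [y3, y5] = - ?t * \<Delta> [a, b, d]"
    "\<Delta> [y4, y5] = ?t * ?t"
    unfolding ys \<Delta>_2 p by simp_all
  have sw: "\<Delta> [b, a, c] = - ?t" "\<Delta> [b, a, d] = - \<Delta> [a, b, d]" "\<Delta> [b, a, e] = - \<Delta> [a, b, e]"
    "\<Delta> [c, a, d] = - \<Delta> [a, c, d]" "\<Delta> [c, a, e] = - \<Delta> [a, c, e]" "\<Delta> [c, b, d] = - \<Delta> [b, c, d]"
    "\<Delta> [c, b, e] = - \<Delta> [b, c, e]" "\<Delta> [d, a, c] = \<Delta> [a, c, d]" "\<Delta> [d, a, e] = - \<Delta> [a, d, e]"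
    "\<Delta> [d, b, c] = \<Delta> [b, c, d]" "\<Delta> [d, b, e] = - \<Delta> [b, d, e]" "\<Delta> [e, a, c] = \<Delta> [a, c, e]"
    "\<Delta> [e, a, d] = \<Delta> [a, d, e]" "\<Delta> [e, b, c] = \<Delta> [b, c, e]" "\<Delta> [e, b, d] = \<Delta> [b, d, e]"
    by (simp_all add: \<Delta>_3 algebra_simps)
  have "five_term [] y1 y2 y3 y4 y5 = 0"
    by (rule five_term_2) (use assms in \<open>auto simp: ys p p0\<close>)
  moreover have "br [] y2 y3 y4 y5 = br [a] b c d e" "br [] y1 y3 y4 y5 = br [b] a c d e"
    "br [] y1 y2 y4 y5 = br [c] a b d e" "br [] y1 y2 y3 y5 = br [d] a b c e"
    "br [] y1 y2 y3 y4 = br [e] a b c d"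
    using assms(1) unfolding br_def append_Nil append_Cons y y' sw
    by (simp_all add: mult.commute mult.left_commute mult.assoc)
  ultimately show ?thesis
    by (simp add: five_term_def dual_five_term_def)
qed

end

section \<open>The generalized cross-ratio\<close>

lemma eq_neg_self_zero:
  assumes "x = - (x :: 'v::rat_vector)"
  shows "x = 0"
proof -
  have "x + x = - x + x" by (rule arg_cong[OF assms])
  then show ?thesis by (simp add: twice_eq_zero_iff)
qed

lemma Alt_cong_perm:
  assumes "\<And>\<sigma>. \<sigma> permutes {..<n} \<Longrightarrow> f (permute_list \<sigma> xs) = g (permute_list \<sigma> xs)"
  shows "Alt n f xs = Alt n g xs"
  unfolding Alt_def by (intro sum.cong refl arg_cong2[where f = scaleQ] assms) simp

lemma permute_list_transpose_6:
  "permute_list (transpose 0 (Suc 0)) [a, b, c, d, e, f] = [b, a, c, d, e, f]"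
  "permute_list (transpose (Suc 0) 2) [a, b, c, d, e, f] = [a, c, b, d, e, f]"
  "permute_list (transpose 2 3) [a, b, c, d, e, f] = [a, b, d, c, e, f]"
  "permute_list (transpose 4 5) [a, b, c, d, e, f] = [a, b, c, d, f, e]"
  "permute_list (transpose 3 5) [a, b, c, d, e, f] = [a, b, c, f, e, d]"
  "permute_list (transpose 2 5) [a, b, c, d, e, f] = [a, b, f, d, e, c]"
  "permute_list (transpose 0 3) [a, b, c, d, e, f] = [d, b, c, a, e, f]"
  "permute_list (transpose 0 2) [a, b, c, d, e, f] = [c, b, a, d, e, f]"
  "permute_list (transpose 3 4) [a, b, c, d, e, f] = [a, b, c, e, d, f]"
  by (simp_all add: permute_list_def upt_rec transpose_def)

text \<open>Six points of a plane, either given directly (\<open>cs = []\<close>) or as points of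
  3-space seen from one center. The first case serves the relations of \<open>B3\<close>, the second
  the summands of \<open>a3'\<close>.\<close>

locale triple_ratio = infinite_field F for F :: "'a::field itself" +
  fixes cs :: "'a vec list"
  assumes len_cs: "length cs \<le> 1" and cs_carrier: "set cs \<subseteq> carrier_vec (length cs + 3)"
begin

abbreviation "pts \<equiv> carrier_vec (length cs + 3) :: 'a vec set"

definition D :: "'a vec \<Rightarrow> 'a vec \<Rightarrow> 'a vec \<Rightarrow> 'a"
  where "D a b c = \<Delta> (cs @ [a, b, c])"

abbreviation m :: "'a vec \<Rightarrow> 'a vec \<Rightarrow> 'a vec \<Rightarrow> 'a multQ"
  where "m a b c \<equiv> mult_class (D a b c)"

abbreviation S :: "'a vec \<Rightarrow> 'a vec \<Rightarrow> 'a vec \<Rightarrow> 'a vec \<Rightarrow> 'a vec \<Rightarrow> 'a B2"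
  where "S c \<equiv> br (cs @ [c])"

text \<open>The triple ratio, that is, the term alternated in \<open>r3_free\<close>.\<close>

definition T :: "'a vec \<Rightarrow> 'a vec \<Rightarrow> 'a vec \<Rightarrow> 'a vec \<Rightarrow> 'a vec \<Rightarrow> 'a vec \<Rightarrow> 'a"
  where "T a b c d e f = D a b d * D b c e * D c a f / (D a b e * D b c f * D c a d)"

lemma cs_cases: obtains "cs = []" | l where "cs = [l]" "l \<in> carrier_vec 4"
  using len_cs cs_carrier by (cases cs) auto

lemma D_swap: "D b a c = - D a b c" "D a c b = - D a b c"
proof -
  have "D b a c = - D a b c \<and> D a c b = - D a b c"
  proof (cases rule: cs_cases)
    case 1
    then show ?thesis
      unfolding D_def using \<Delta>_3_swap(1)[of b a c] \<Delta>_3_swap(2)[of a c b] by simp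
  next
    case (2 l)
    then show ?thesis
      unfolding D_def using \<Delta>_4_swap(2)[of l b a c] \<Delta>_4_swap(3)[of l a c b] by simp
  qed
  then show "D b a c = - D a b c" "D a c b = - D a b c" by auto
qed

lemma D_perm: "D a b c = - D b a c" "D a b c = - D a c b" "D a b c = D b c a" "D a b c = D c a b"
  "D a b c = - D c b a"
proof -
  show "D a b c = - D b a c" "D a b c = - D a c b" by (rule D_swap)+
  show *: "D a b c = D b c a" for a b c
    using D_swap(1)[of a b c] D_swap(2)[of b a c] by (simp only: minus_minus)
  show "D a b c = D c a b" by (rule *[symmetric])
  show "D a b c = - D c b a"
    using *[of a b c] D_swap(1)[of b c a] by (simp only:)
qed

lemma m_swap: "m b a c = m a b c" "m a c b = m a b c"
  by (simp_all only: D_swap(1)[of b a] D_swap(2)[of a c] mult_class_neg)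

lemma D_lincomb:
  assumes "u \<in> pts" "v \<in> pts"
  shows "D a b (r \<cdot>\<^sub>v u - s \<cdot>\<^sub>v v) = r * D a b u - s * D a b v"
proof (cases rule: cs_cases)
  case 1
  then show ?thesis using assms unfolding D_def by (simp add: \<Delta>_3 algebra_simps)
next
  case (2 l)
  then show ?thesis using assms unfolding D_def by (simp add: \<Delta>_4 algebra_simps)
qed

lemma D_repeat: "D p b b = 0"
proof (cases rule: cs_cases)
  case 1
  then show ?thesis unfolding D_def by (simp add: \<Delta>_3 algebra_simps)
next
  case (2 l)
  then show ?thesis unfolding D_def by (simp add: \<Delta>_4 algebra_simps)
qed

lemma cs_snoc_carrier: "p \<in> pts \<Longrightarrow> set (cs @ [p]) \<subseteq> carrier_vec (length (cs @ [p]) + 2)"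
  using cs_carrier by (auto simp: numeral_eq_Suc)

lemma length_snoc: "carrier_vec (length (cs @ [p]) + 2) = pts"
  by (simp add: numeral_eq_Suc)

lemma D_pluecker:
  assumes "set [p, a, b, c, d] \<subseteq> pts"
  shows "D p a b * D p c d - D p a c * D p b d + D p a d * D p b c = 0"
  using \<Delta>_pluecker[OF cs_snoc_carrier, of p a b c d] assms unfolding length_snoc by (simp add: D_def)

lemma S_swap:
  assumes "set [p, a, b, c, d] \<subseteq> pts"
  shows "S p b a c d = - S p a b c d" "S p a c b d = - S p a b c d" "S p a b d c = - S p a b c d"
  using br_swap[OF cs_snoc_carrier, of p a b c d] assms unfolding length_snoc by auto

lemma S_eq: "S p a b c d = {D p a c * D p b d / (D p a d * D p b c)}\<^sub>2"
  by (simp add: br_def D_def)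

lemma five_term_S:
  assumes "p \<in> pts" "\<And>v. v \<in> {a, b, c, d, e} \<Longrightarrow> v \<in> pts \<and> (\<exists>u\<in>pts. D p v u \<noteq> 0)"
  shows "five_term (cs @ [p]) a b c d e = 0"
  by (rule five_term_zero[OF cs_snoc_carrier[OF assms(1)]])
    (use assms(2) in \<open>auto simp: off_center_def length_snoc[simplified] D_def\<close>)

definition generic6 :: "'a vec list \<Rightarrow> bool"
  where "generic6 x \<longleftrightarrow> length x = 6 \<and> set x \<subseteq> pts \<and> (\<forall>i<6. \<forall>j<6. \<forall>k<6.
    i \<noteq> j \<longrightarrow> i \<noteq> k \<longrightarrow> j \<noteq> k \<longrightarrow> D (x ! i) (x ! j) (x ! k) \<noteq> 0)"

lemma generic6_permute:
  assumes "generic6 x" "\<sigma> permutes {..<6}"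
  shows "generic6 (permute_list \<sigma> x)"
proof -
  have "\<sigma> i < 6 \<longleftrightarrow> i < 6" for i using permutes_in_image[OF assms(2), of i] by simp
  moreover have "\<sigma> i = \<sigma> j \<longleftrightarrow> i = j" for i j using permutes_inj[OF assms(2)] by (auto dest: injD)
  ultimately show ?thesis
    using assms unfolding generic6_def by (auto simp: permute_list_nth)
qed

lemma generic6D:
  assumes "generic6 [a, b, c, d, e, f]"
  shows "set [a, b, c, d, e, f] \<subseteq> pts"
    and "D a b c \<noteq> 0" "D a b d \<noteq> 0" "D a b e \<noteq> 0" "D a b f \<noteq> 0" "D a c d \<noteq> 0" "D a c e \<noteq> 0"
      "D a c f \<noteq> 0" "D a d e \<noteq> 0" "D a d f \<noteq> 0" "D a e f \<noteq> 0" "D b c d \<noteq> 0" "D b c e \<noteq> 0"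
      "D b c f \<noteq> 0" "D b d e \<noteq> 0" "D b d f \<noteq> 0" "D b e f \<noteq> 0" "D c d e \<noteq> 0" "D c d f \<noteq> 0"
      "D c e f \<noteq> 0" "D d e f \<noteq> 0"
proof -
  have *: "D ([a, b, c, d, e, f] ! i) ([a, b, c, d, e, f] ! j) ([a, b, c, d, e, f] ! k) \<noteq> 0"
    if "i < j" "j < k" "k < 6" for i j k
  proof -
    have H: "\<forall>i<6. \<forall>j<6. \<forall>k<6. i \<noteq> j \<longrightarrow> i \<noteq> k \<longrightarrow> j \<noteq> k \<longrightarrow>
      D ([a, b, c, d, e, f] ! i) ([a, b, c, d, e, f] ! j) ([a, b, c, d, e, f] ! k) \<noteq> 0"
      using assms unfolding generic6_def by blast
    show ?thesis by (rule H[rule_format]) (use that in linarith)+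
  qed
  show "set [a, b, c, d, e, f] \<subseteq> pts" using assms unfolding generic6_def by blast
  show "D a b c \<noteq> 0" "D a b d \<noteq> 0" "D a b e \<noteq> 0" "D a b f \<noteq> 0" "D a c d \<noteq> 0" "D a c e \<noteq> 0"
      "D a c f \<noteq> 0" "D a d e \<noteq> 0" "D a d f \<noteq> 0" "D a e f \<noteq> 0" "D b c d \<noteq> 0" "D b c e \<noteq> 0"
      "D b c f \<noteq> 0" "D b d e \<noteq> 0" "D b d f \<noteq> 0" "D b e f \<noteq> 0" "D c d e \<noteq> 0" "D c d f \<noteq> 0"
      "D c e f \<noteq> 0" "D d e f \<noteq> 0"
    using *[of 0 1 2] *[of 0 1 3] *[of 0 1 4] *[of 0 1 5] *[of 0 2 3] *[of 0 2 4] *[of 0 2 5]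
      *[of 0 3 4] *[of 0 3 5] *[of 0 4 5] *[of 1 2 3] *[of 1 2 4] *[of 1 2 5] *[of 1 3 4] *[of 1 3 5]
      *[of 1 4 5] *[of 2 3 4] *[of 2 3 5] *[of 2 4 5] *[of 3 4 5]
    by simp_all
qed

lemma generic6_obtain:
  assumes "generic6 xs" "\<sigma> permutes {..<6}"
  obtains a b c d e f where "permute_list \<sigma> xs = [a, b, c, d, e, f]" "generic6 [a, b, c, d, e, f]"
proof -
  have *: "\<exists>a b c d e f. x = [a, b, c, d, e, f]" if "length x = 6" for x :: "'a vec list"
    using that by (auto simp: numeral_eq_Suc length_Suc_conv)
  have "length (permute_list \<sigma> xs) = 6"
    using generic6_permute[OF assms] unfolding generic6_def by (rule conjunct1)
  from *[OF this] obtain a b c d e f where "permute_list \<sigma> xs = [a, b, c, d, e, f]"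
    by (elim exE)
  with generic6_permute[OF assms] show thesis by (intro that) auto
qed

lemma Alt6_cong:
  assumes "generic6 xs"
    and "\<And>a b c d e f. generic6 [a, b, c, d, e, f] \<Longrightarrow> g [a, b, c, d, e, f] = h [a, b, c, d, e, f]"
  shows "Alt 6 g xs = Alt 6 h xs"
  by (rule Alt_cong_perm) (metis assms generic6_obtain)

lemma Alt6_swap:
  assumes "generic6 xs" "i < 6" "j < 6" "i \<noteq> j"
    and "\<And>a b c d e f. generic6 [a, b, c, d, e, f] \<Longrightarrow>
      g [a, b, c, d, e, f] = h (permute_list (transpose i j) [a, b, c, d, e, f])"
  shows "Alt 6 g xs = - Alt 6 h xs"
proof -
  have "Alt 6 g xs = Alt 6 (\<lambda>x. h (permute_list (transpose i j) x)) xs"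
    by (rule Alt6_cong[OF assms(1)]) (rule assms(5))
  also have "\<dots> = - Alt 6 h xs"
    using assms(1-4) by (intro Alt_swap) (auto simp: generic6_def)
  finally show ?thesis .
qed

text \<open>The triple ratio is the cross-ratio at \<open>a\<close> of the lines to \<open>b\<close>, \<open>c\<close>, \<open>d\<close> and to the
  intersection point \<open>z\<close> of the lines \<open>be\<close> and \<open>cf\<close>. The expansion is the five-term relation at \<open>a\<close>
  for \<open>b\<close>, \<open>c\<close>, \<open>d\<close>, \<open>f\<close>, \<open>z\<close>; its first summand is symmetric in \<open>a\<close> and \<open>d\<close>.\<close>

definition R :: "'a vec \<Rightarrow> 'a vec \<Rightarrow> 'a vec \<Rightarrow> 'a vec \<Rightarrow> 'a vec \<Rightarrow> 'a vec \<Rightarrow> 'a B2"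
  where "R a b c d e f = {(D c f b * D a d e - D c f e * D a d b) / (D b c e * D a d f)}\<^sub>2"

lemma R_symmetric: "R d b c a e f = R a b c d e f"
proof -
  have num: "D c f b * D d a e - D c f e * D d a b = - (D c f b * D a d e - D c f e * D a d b)"
    and den: "D b c e * D d a f = - (D b c e * D a d f)"
    by (simp_all add: D_perm(1)[of d a])
  show ?thesis
    unfolding R_def num den by (simp only: divide_minus_left divide_minus_right minus_minus)
qed

lemma triple_ratio_expand:
  assumes "generic6 [a, b, c, d, e, f]"
  shows "{T a b c d e f}\<^sub>2 = R a b c d e f + {T a b f d e c}\<^sub>2 + S b a c f e + S a b c d f"
proof -
  note nz = generic6D(2-)[OF assms]
  have carr: "a \<in> pts" "b \<in> pts" "c \<in> pts" "d \<in> pts" "e \<in> pts" "f \<in> pts"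
    using generic6D(1)[OF assms] by auto
  \<comment> \<open>A combination of \<open>e\<close> and \<open>b\<close> with D c f z = 0, hence
    the intersection point of the lines be and cf.\<close>
  define z where "z = D c f b \<cdot>\<^sub>v e - D c f e \<cdot>\<^sub>v b"
  have z: "z \<in> pts" using carr by (auto simp: z_def)
  have Dz: "D p q z = D c f b * D p q e - D c f e * D p q b" for p q
    unfolding z_def by (rule D_lincomb) (use carr in auto)
  note sorted = D_perm(4)[of c f b] D_perm(2)[of c f e] D_perm(1)[of c a] D_perm(3)[of c a b]
    D_perm(1)[of c b] D_perm(3)[of f a b] D_perm(5)[of f e c] D_perm(3)[of f a] D_perm(3)[of f b]
    D_perm(2)[of a f] D_perm(2)[of a c b] D_perm(2)[of b f] D_perm(1)[of b a]
  have abz: "D a b z = D b c f * D a b e"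
    by (simp add: Dz D_repeat D_perm(4)[of c f b])
  have acz: "D a c z = D b c e * D a c f"
    using D_pluecker[of c a b e f] carr by (simp add: Dz sorted algebra_simps)
  have afz: "D a f z = - (D b e f * D a c f)"
    using D_pluecker[of f a b e c] carr by (simp add: Dz sorted algebra_simps)
  have "five_term (cs @ [a]) b c d f z = 0"
  proof (rule five_term_S)
    have 1: "\<exists>u\<in>pts. D a b u \<noteq> 0" using carr nz by blast
    have 2: "\<exists>u\<in>pts. D a c u \<noteq> 0" using carr nz by blast
    have 3: "\<exists>u\<in>pts. D a d u \<noteq> 0" using carr nz by blast
    have 4: "\<exists>u\<in>pts. D a f u \<noteq> 0" using carr nz(10) D_perm(2)[of a f e] by force
    have 5: "\<exists>u\<in>pts. D a z u \<noteq> 0" using carr nz abz D_perm(2)[of a z b] by force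
    show "v \<in> pts \<and> (\<exists>u\<in>pts. D a v u \<noteq> 0)" if "v \<in> {b, c, d, f, z}" for v
      using that 1 2 3 4 5 carr z by auto
  qed fact
  then have "S a c d f z - S a b d f z + S a b c f z - S a b c d z + S a b c d f = 0"
    by (simp add: five_term_def)
  moreover have "S a b c d z = {T a b c d e f}\<^sub>2"
    unfolding S_eq abz acz T_def
    by (simp add: sorted mult_ac)
  moreover have "S a b d f z = - {T a b f d e c}\<^sub>2"
  proof -
    have "S a b d f z = - S a b f d z" using S_swap(2)[of a b f d z] carr z by simp
    also have "S a b f d z = {T a b f d e c}\<^sub>2"
      unfolding S_eq abz afz T_def
      by (simp add: sorted mult_ac)
    finally show ?thesis .
  qed
  moreover have "S a b c f z = S b a c f e"
    unfolding S_eq abz acz using nz by (simp add: sorted mult_ac)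
  moreover have "S a c d f z = R a b c d e f"
    unfolding S_eq acz R_def Dz[symmetric] using nz by (simp add: mult_ac)
  ultimately show ?thesis by (simp add: algebra_simps)
qed

text \<open>Exchanging two of the first three points together with the corresponding two of the last
  three swaps numerator and denominator.\<close>

lemma T_double_swap:
  assumes "generic6 [a, b, c, d, e, f]"
  shows "T b a c e d f = inverse (T a b c d e f)" "T c b a f e d = inverse (T a b c d e f)"
    "T a c b d f e = inverse (T a b c d e f)"
proof -
  show "T b a c e d f = inverse (T a b c d e f)" "T c b a f e d = inverse (T a b c d e f)"
    "T a c b d f e = inverse (T a b c d e f)"
    by (simp_all add: T_def D_perm(1)[of b a] D_perm(1)[of c b] D_perm(1)[of c a] inverse_divide mult_ac)
qed

lemma Alt6_double_swap:
  assumes "generic6 xs" "i < 6" "j < 6" "i \<noteq> j" "k < 6" "l < 6" "k \<noteq> l"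
    and "\<And>a b c d e f. generic6 [a, b, c, d, e, f] \<Longrightarrow> g [a, b, c, d, e, f] =
      - h (permute_list (transpose k l) (permute_list (transpose i j) [a, b, c, d, e, f]))"
  shows "Alt 6 g xs = - Alt 6 h xs"
proof -
  have "Alt 6 g xs = - Alt 6 (\<lambda>x. - h (permute_list (transpose k l) x)) xs"
    by (rule Alt6_swap[OF assms(1-4)]) (use assms(8) in auto)
  also have "Alt 6 (\<lambda>x. - h (permute_list (transpose k l) x)) xs = - Alt 6 (\<lambda>x. - h x) xs"
    by (rule Alt6_swap[OF assms(1,5-7)]) auto
  finally show ?thesis by (simp add: Alt_minus)
qed

text \<open>The double transpositions invert \<open>T\<close> and hence negate its class, so all six
  determinants of \<open>T\<close> contribute the same, and the left side is 6 X, where X is the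
  alternation \<open>E ?f\<close> with the single determinant m(a, b, d). Into X the expansion of
  \<open>T\<close> is inserted: the term \<open>R\<close> is symmetric in a and d, as is the
  determinant, and drops out; the second triple ratio gives - X; the two brackets give Q - P. Hence
  2 X = Q - P. The five-term relation at a, tensored with m(a, b, c), gives 2 Q = - 3 P. So 4 X = -
  5 P and 6 X = - (15/2) P. With the factor 1/15 of \<open>r3_free\<close> this becomes - (1/2)
  P.\<close>

lemma delta_triple_ratio:
  assumes "generic6 xs"
  shows "Alt 6 (\<lambda>x. {T (x!0) (x!1) (x!2) (x!3) (x!4) (x!5)}\<^sub>2 \<otimes>\<^sub>Q
      mult_class (T (x!0) (x!1) (x!2) (x!3) (x!4) (x!5))) xs =
    - (15/2) *\<^sub>Q Alt 6 (\<lambda>x. S (x!0) (x!1) (x!2) (x!3) (x!4) \<otimes>\<^sub>Q m (x!0) (x!1) (x!2)) xs"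
proof -
  define t where "t x = {T (x!0) (x!1) (x!2) (x!3) (x!4) (x!5)}\<^sub>2" for x
  define E where "E g = Alt 6 g xs" for g :: "'a vec list \<Rightarrow> ('a B2, 'a multQ) tensor"
  note perm = permute_list_transpose_6
  let ?f = "\<lambda>x. t x \<otimes>\<^sub>Q m (x!0) (x!1) (x!3)"
  let ?h = "\<lambda>x. t x \<otimes>\<^sub>Q m (x!0) (x!1) (x!4)"
  have h: "E ?h = - E ?f"
    unfolding E_def by (rule Alt6_double_swap[OF assms, of 0 1 3 4])
      (simp_all add: perm t_def T_double_swap sym2_inverse tensor_simps m_swap(1))
  have h2: "E (\<lambda>x. t x \<otimes>\<^sub>Q m (x!1) (x!2) (x!5)) = - E ?f"
    unfolding E_def by (rule Alt6_double_swap[OF assms, of 0 2 3 5])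
      (simp_all add: perm t_def T_double_swap sym2_inverse tensor_simps m_swap(1))
  have h3: "E (\<lambda>x. t x \<otimes>\<^sub>Q m (x!2) (x!0) (x!3)) = - E ?f"
    unfolding E_def by (rule Alt6_double_swap[OF assms, of 1 2 4 5])
      (simp_all add: perm t_def T_double_swap sym2_inverse tensor_simps m_swap(1))
  have f2: "E (\<lambda>x. t x \<otimes>\<^sub>Q m (x!1) (x!2) (x!4)) = - E ?h"
    unfolding E_def by (rule Alt6_double_swap[OF assms, of 0 2 3 5])
      (simp_all add: perm t_def T_double_swap sym2_inverse tensor_simps m_swap(1))
  have f3: "E (\<lambda>x. t x \<otimes>\<^sub>Q m (x!2) (x!0) (x!5)) = - E ?h"
    unfolding E_def by (rule Alt6_double_swap[OF assms, of 1 2 4 5])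
      (simp_all add: perm t_def T_double_swap sym2_inverse tensor_simps m_swap(1))
  have "E (\<lambda>x. t x \<otimes>\<^sub>Q mult_class (T (x!0) (x!1) (x!2) (x!3) (x!4) (x!5))) =
      E (\<lambda>x. ?f x + t x \<otimes>\<^sub>Q m (x!1) (x!2) (x!4) + t x \<otimes>\<^sub>Q m (x!2) (x!0) (x!5) -
        ?h x - t x \<otimes>\<^sub>Q m (x!1) (x!2) (x!5) - t x \<otimes>\<^sub>Q m (x!2) (x!0) (x!3))"
    unfolding E_def
  proof (rule Alt6_cong[OF assms], goal_cases)
    case G: (1 a b c d e f)
    have e: "mult_class (T a b c d e f) = m a b d + m b c e + m c a f - (m a b e + m b c f + m c a d)"
      using generic6D(2-)[OF G] unfolding T_def
      by (simp add: mult_class_divide mult_class_mult D_perm(1)[of c a])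
    show ?case by (simp add: e tensor_simps algebra_simps)
  qed
  also have "\<dots> = 6 *\<^sub>Q E ?f"
    using h h2 h3 f2 f3 unfolding E_def Alt_add Alt_diff
    by (simp add: scaleQ_add_left[of 1 5, simplified] scaleQ_add_left[of 1 4, simplified]
        scaleQ_add_left[of 1 3, simplified] scaleQ_add_left[of 1 2, simplified] scaleQ_add_left[of 1 1, simplified])
  finally have 1: "E (\<lambda>x. t x \<otimes>\<^sub>Q mult_class (T (x!0) (x!1) (x!2) (x!3) (x!4) (x!5))) = 6 *\<^sub>Q E ?f" .

  let ?P = "E (\<lambda>x. S (x!0) (x!1) (x!2) (x!3) (x!4) \<otimes>\<^sub>Q m (x!0) (x!1) (x!2))"
  let ?Q = "E (\<lambda>x. S (x!0) (x!2) (x!3) (x!4) (x!5) \<otimes>\<^sub>Q m (x!0) (x!1) (x!2))"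
  have carr: "set [a, b, c, d, e, f] \<subseteq> pts" if "generic6 [a, b, c, d, e, f]" for a b c d e f
    using generic6D(1)[OF that] .
  have q1: "E (\<lambda>x. S (x!0) (x!1) (x!3) (x!4) (x!5) \<otimes>\<^sub>Q m (x!0) (x!1) (x!2)) = - ?Q"
    unfolding E_def by (rule Alt6_swap[OF assms, of 1 2]) (simp_all add: perm m_swap(2))
  have p1: "E (\<lambda>x. S (x!0) (x!1) (x!2) (x!3) (x!5) \<otimes>\<^sub>Q m (x!0) (x!1) (x!2)) = - ?P"
    unfolding E_def by (rule Alt6_swap[OF assms, of 4 5]) (simp_all add: perm)
  have p2: "E (\<lambda>x. S (x!0) (x!1) (x!2) (x!4) (x!5) \<otimes>\<^sub>Q m (x!0) (x!1) (x!2)) = ?P"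
  proof -
    have "E (\<lambda>x. S (x!0) (x!1) (x!2) (x!4) (x!5) \<otimes>\<^sub>Q m (x!0) (x!1) (x!2)) =
        - E (\<lambda>x. - S (x!0) (x!1) (x!2) (x!3) (x!4) \<otimes>\<^sub>Q m (x!0) (x!1) (x!2))"
      unfolding E_def
    proof (rule Alt6_swap[OF assms, of 3 5], goal_cases)
      case (4 a b c d e f)
      then show ?case unfolding perm using S_swap(3)[of a b c f e] carr[OF 4] by simp
    qed auto
    then show ?thesis by (simp add: E_def tensor_simps Alt_minus)
  qed
  have "E (\<lambda>x. S (x!0) (x!2) (x!3) (x!4) (x!5) \<otimes>\<^sub>Q m (x!0) (x!1) (x!2) -
        S (x!0) (x!1) (x!3) (x!4) (x!5) \<otimes>\<^sub>Q m (x!0) (x!1) (x!2) +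
        S (x!0) (x!1) (x!2) (x!4) (x!5) \<otimes>\<^sub>Q m (x!0) (x!1) (x!2) -
        S (x!0) (x!1) (x!2) (x!3) (x!5) \<otimes>\<^sub>Q m (x!0) (x!1) (x!2) +
        S (x!0) (x!1) (x!2) (x!3) (x!4) \<otimes>\<^sub>Q m (x!0) (x!1) (x!2)) = E (\<lambda>x. 0)"
    unfolding E_def
  proof (rule Alt6_cong[OF assms], goal_cases)
    case G: (1 a b c d e f)
    have "five_term (cs @ [a]) b c d e f = 0"
    proof (rule five_term_S)
      have "D a f b \<noteq> 0" "D a e b \<noteq> 0" "D a d b \<noteq> 0" "D a c b \<noteq> 0"
        using generic6D(2-)[OF G] by (simp_all add: D_perm(2)[of a _ b])
      then show "v \<in> pts \<and> (\<exists>u\<in>pts. D a v u \<noteq> 0)" if "v \<in> {b, c, d, e, f}" for v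
        using that carr[OF G] generic6D(2)[OF G] by auto
    qed (use carr[OF G] in auto)
    from arg_cong[OF this, of "\<lambda>u. u \<otimes>\<^sub>Q m a b c"]
    show ?case by (simp add: five_term_def tensor_simps)
  qed
  then have "?Q - (- ?Q) + ?P - (- ?P) + ?P = 0"
    using q1 p1 p2 unfolding E_def Alt_add Alt_diff Alt_zero by simp
  then have Q: "2 *\<^sub>Q ?Q = - 3 *\<^sub>Q ?P"
    by (simp add: scaleQ_add_left[of 1 2, simplified] scaleQ_add_left[of 1 1, simplified]
        eq_neg_iff_add_eq_0 algebra_simps)

  have r1: "E (\<lambda>x. R (x!0) (x!1) (x!2) (x!3) (x!4) (x!5) \<otimes>\<^sub>Q m (x!0) (x!1) (x!3)) =
      - E (\<lambda>x. R (x!0) (x!1) (x!2) (x!3) (x!4) (x!5) \<otimes>\<^sub>Q m (x!0) (x!1) (x!3))"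
    unfolding E_def
    by (rule Alt6_swap[OF assms, of 0 3]) (simp_all add: perm R_symmetric m_swap)
  have r2: "E (\<lambda>x. {T (x!0) (x!1) (x!5) (x!3) (x!4) (x!2)}\<^sub>2 \<otimes>\<^sub>Q m (x!0) (x!1) (x!3)) = - E ?f"
    unfolding E_def by (rule Alt6_swap[OF assms, of 2 5]) (simp_all add: perm t_def)
  have r3: "E (\<lambda>x. S (x!1) (x!0) (x!2) (x!5) (x!4) \<otimes>\<^sub>Q m (x!0) (x!1) (x!3)) = ?Q"
  proof -
    have "E (\<lambda>x. S (x!1) (x!0) (x!2) (x!5) (x!4) \<otimes>\<^sub>Q m (x!0) (x!1) (x!3)) =
        - E (\<lambda>x. S (x!0) (x!1) (x!2) (x!5) (x!4) \<otimes>\<^sub>Q m (x!0) (x!1) (x!3))"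
      unfolding E_def by (rule Alt6_swap[OF assms, of 0 1]) (simp_all add: perm m_swap(1))
    also have "E (\<lambda>x. S (x!0) (x!1) (x!2) (x!5) (x!4) \<otimes>\<^sub>Q m (x!0) (x!1) (x!3)) =
        - E (\<lambda>x. S (x!0) (x!1) (x!3) (x!5) (x!4) \<otimes>\<^sub>Q m (x!0) (x!1) (x!2))"
      unfolding E_def by (rule Alt6_swap[OF assms, of 2 3]) (simp_all add: perm)
    also have "E (\<lambda>x. S (x!0) (x!1) (x!3) (x!5) (x!4) \<otimes>\<^sub>Q m (x!0) (x!1) (x!2)) =
        E (\<lambda>x. - S (x!0) (x!1) (x!3) (x!4) (x!5) \<otimes>\<^sub>Q m (x!0) (x!1) (x!2))"
      unfolding E_def
    proof (rule Alt6_cong[OF assms], goal_cases)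
      case (1 a b c d e f)
      then show ?case using S_swap(3)[of a b d e f] carr[OF 1] by simp
    qed
    finally show ?thesis using q1 by (simp add: E_def tensor_simps Alt_minus)
  qed
  have r4: "E (\<lambda>x. S (x!0) (x!1) (x!2) (x!3) (x!5) \<otimes>\<^sub>Q m (x!0) (x!1) (x!3)) = - ?P"
  proof -
    have "E (\<lambda>x. S (x!0) (x!1) (x!2) (x!3) (x!5) \<otimes>\<^sub>Q m (x!0) (x!1) (x!3)) =
        - E (\<lambda>x. S (x!0) (x!1) (x!3) (x!2) (x!5) \<otimes>\<^sub>Q m (x!0) (x!1) (x!2))"
      unfolding E_def by (rule Alt6_swap[OF assms, of 2 3]) (simp_all add: perm)
    also have "E (\<lambda>x. S (x!0) (x!1) (x!3) (x!2) (x!5) \<otimes>\<^sub>Q m (x!0) (x!1) (x!2)) =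
        E (\<lambda>x. - S (x!0) (x!1) (x!2) (x!3) (x!5) \<otimes>\<^sub>Q m (x!0) (x!1) (x!2))"
      unfolding E_def
    proof (rule Alt6_cong[OF assms], goal_cases)
      case (1 a b c d e f)
      then show ?case using S_swap(2)[of a b c d f] carr[OF 1] by simp
    qed
    finally show ?thesis using p1 by (simp add: E_def tensor_simps Alt_minus)
  qed
  have E_add: "E (\<lambda>x. g x + h x) = E g + E h" for g h by (simp add: E_def Alt_add)
  let ?r = "E (\<lambda>x. R (x!0) (x!1) (x!2) (x!3) (x!4) (x!5) \<otimes>\<^sub>Q m (x!0) (x!1) (x!3))"
  have "?r = 0"
    by (rule eq_neg_self_zero[OF r1])
  have "E ?f = E (\<lambda>x. R (x!0) (x!1) (x!2) (x!3) (x!4) (x!5) \<otimes>\<^sub>Q m (x!0) (x!1) (x!3) +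
      {T (x!0) (x!1) (x!5) (x!3) (x!4) (x!2)}\<^sub>2 \<otimes>\<^sub>Q m (x!0) (x!1) (x!3) +
      S (x!1) (x!0) (x!2) (x!5) (x!4) \<otimes>\<^sub>Q m (x!0) (x!1) (x!3) +
      S (x!0) (x!1) (x!2) (x!3) (x!5) \<otimes>\<^sub>Q m (x!0) (x!1) (x!3))"
    unfolding E_def by (rule Alt6_cong[OF assms]) (simp add: t_def triple_ratio_expand tensor_simps)
  then have eq: "E ?f = ?r + (- E ?f) + ?Q + (- ?P)"
    unfolding E_add r2 r3 r4 .
  have "E ?f + E ?f = (?r + (- E ?f) + ?Q + (- ?P)) + E ?f"
    by (rule arg_cong[OF eq])
  also have "\<dots> = ?Q - ?P"
    by (simp only: \<open>?r = 0\<close>) simp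
  finally have "E ?f + E ?f = ?Q - ?P" .
  then have "4 *\<^sub>Q E ?f = 2 *\<^sub>Q (?Q - ?P)"
    using scaleQ_add_left[of 2 2 "E ?f"] by (simp flip: scaleQ_add_right)
  also have "\<dots> = - 5 *\<^sub>Q ?P"
    unfolding Q Q.scale_right_diff_distrib using Q.scale_left_diff_distrib[of "- 3" 2 ?P] by simp
  finally have "(3/2) *\<^sub>Q 4 *\<^sub>Q E ?f = (3/2) *\<^sub>Q (- 5) *\<^sub>Q ?P" by simp
  then show ?thesis using 1 by (simp add: E_def t_def)
qed

end

section \<open>The map $\delta_3$\<close>

text \<open>A kernel vector of the transposed matrix is the equation of a hyperplane through the
  chosen points.\<close>

lemma generic_\<Delta>_nonzero:
  fixes xs :: "'a::field points"
  assumes "generic n xs" "distinct is" "length is = Suc n" "set is \<subseteq> {..<length xs}"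
  shows "\<Delta> (map ((!) xs) is) \<noteq> 0"
proof
  let ?A = "mat_of_cols (Suc n) (map ((!) xs) is)"
  assume "\<Delta> (map ((!) xs) is) = 0"
  then have "det ?A = 0" using assms(3) by (simp add: \<Delta>_def)
  have A: "?A \<in> carrier_mat (Suc n) (Suc n)"
    using mat_of_cols_carrier(1)[of "Suc n" "map ((!) xs) is"] assms(3) by simp
  have AT: "?A\<^sup>T \<in> carrier_mat (Suc n) (Suc n)" using A by simp
  have "det ?A\<^sup>T = 0" using det_transpose[OF A] \<open>det ?A = 0\<close> by simp
  then obtain h where h: "h \<in> carrier_vec (Suc n)" "h \<noteq> 0\<^sub>v (Suc n)" "?A\<^sup>T *\<^sub>v h = 0\<^sub>v (Suc n)"
    using det_0_iff_vec_prod_zero[OF AT] by blast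
  have carr: "xs ! i \<in> carrier_vec (Suc n)" if "i < length xs" for i
    using assms(1) that unfolding generic_def points_def by auto
  have "h \<bullet> xs ! i = 0" if i: "i \<in> set is" for i
  proof -
    obtain k where k: "k < Suc n" "is ! k = i" using i assms(3) by (metis in_set_conv_nth)
    have "i < length xs" using i assms(4) by auto
    have "(?A\<^sup>T *\<^sub>v h) $ k = col ?A k \<bullet> h"
      using k(1) assms(3) by simp
    also have "col ?A k = xs ! i"
      using k assms(3) carr[OF \<open>i < length xs\<close>] by (subst col_mat_of_cols) auto
    finally have "xs ! i \<bullet> h = 0" using h(3) k(1) by simp
    then show ?thesis using comm_scalar_prod[OF h(1) carr[OF \<open>i < length xs\<close>]] by simp
  qed
  then have "in_hyperplane n (nths xs (set is))"
    unfolding in_hyperplane_def using h(1,2) by (auto simp: set_nths)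
  moreover have "card (set is) = Suc n" using assms(2,3) by (simp add: distinct_card)
  ultimately show False using assms(1,4) unfolding generic_def by blast
qed

section \<open>The relations of \<open>B3\<close> under \<delta>3\<close>

lemma scaleQ_2: "2 *\<^sub>Q v = v + v"
  using scaleQ_add_left[of 1 1 v] by simp

definition delta_gen :: "'a::field \<Rightarrow> ('a B2, 'a multQ) tensor"
  where "delta_gen x = {x}\<^sub>2 \<otimes>\<^sub>Q mult_class x"

context infinite_field
begin

lemma sym2_divide_swap: "{x / y}\<^sub>2 = - {y / (x::'a)}\<^sub>2"
  using sym2_inverse[of "y / x"] by (simp add: inverse_divide)

lemma K_relations:
  fixes x y :: 'a
  assumes "x \<noteq> 0" "x \<noteq> 1" "y \<noteq> 0" "y \<noteq> 1"
  defines "u1 \<equiv> {- x * (1 - y) / (1 - x)}\<^sub>2" and "u2 \<equiv> {x * (1 - y) / (y * (1 - x))}\<^sub>2"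
    and "u3 \<equiv> {- y * (1 - x) / (1 - y)}\<^sub>2" and "u4 \<equiv> {(1 - x) / (1 - y)}\<^sub>2"
  shows "{x * y}\<^sub>2 = {x}\<^sub>2 + {y}\<^sub>2 + u1 + u3"
    and "{x / y}\<^sub>2 = {x}\<^sub>2 - {y}\<^sub>2 + u2 + u4"
    and "{x * (1 - y)\<^sup>2 / (y * (1 - x)\<^sup>2)}\<^sub>2 = u1 + u2 - u3 - u4"
proof -
  have nz: "1 - x \<noteq> 0" "1 - y \<noteq> 0" using assms by auto
  show xy: "{x * y}\<^sub>2 = {x}\<^sub>2 + {y}\<^sub>2 + u1 + u3"
  proof (cases "x * y = 1")
    case True
    then have y: "y = inverse x" using inverse_unique by metis
    have "- x * (1 - y) / (1 - x) = 1" "- y * (1 - x) / (1 - y) = 1"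
      using assms True nz by (simp_all add: divide_eq_1_iff algebra_simps)
    then show ?thesis using True by (simp add: u1_def u3_def y sym2_inverse)
  next
    case False
    have "x \<noteq> inverse y" "inverse y \<noteq> 0" "inverse y \<noteq> 1" using False assms by auto
    note V = sym2_five_term[OF this(1) assms(1,2) this(2,3)]
    have e: "x * (1 - inverse y) / (inverse y * (1 - x)) = - x * (1 - y) / (1 - x)"
      "(1 - inverse y) / (1 - x) = inverse (- y * (1 - x) / (1 - y))"
      "inverse y / x = inverse (x * y)"
      using assms nz by (simp_all add: divide_simps) (simp_all add: algebra_simps)
    show ?thesis using V unfolding e sym2_inverse u1_def u3_def by (simp add: algebra_simps)
  qed
  show "{x / y}\<^sub>2 = {x}\<^sub>2 - {y}\<^sub>2 + u2 + u4"
  proof (cases "x = y")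
    case True
    then show ?thesis using assms nz by (simp add: u2_def u4_def)
  next
    case False
    note V = sym2_five_term[OF False assms(1-4)]
    show ?thesis using V sym2_divide_swap[of y x] sym2_divide_swap[of "1 - y" "1 - x"]
      unfolding u2_def u4_def by (simp add: algebra_simps)
  qed
  show "{x * (1 - y)\<^sup>2 / (y * (1 - x)\<^sup>2)}\<^sub>2 = u1 + u2 - u3 - u4"
  proof (cases "x = y \<or> x * y = 1")
    case True
    then show ?thesis
    proof
      assume "x = y"
      then show ?thesis using assms nz by (simp add: u1_def u2_def u3_def u4_def)
    next
      assume xy: "x * y = 1"
      have "- x * (1 - y) / (1 - x) = 1" "- y * (1 - x) / (1 - y) = 1"
        using assms xy nz by (simp_all add: divide_eq_1_iff algebra_simps)
      moreover have "x * (1 - y) / (y * (1 - x)) = (1 - x) / (1 - y)"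
      proof -
        have "x * (1 - y) = x - 1" "y * (1 - x) = y - 1" using xy by (simp_all add: algebra_simps)
        then show ?thesis using nz by (simp add: divide_simps) (simp add: algebra_simps)
      qed
      moreover have "x * (1 - y)\<^sup>2 / (y * (1 - x)\<^sup>2) = 1"
      proof -
        have e: "x * (1 - y)\<^sup>2 = x - 2 + y" "y * (1 - x)\<^sup>2 = y - 2 + x"
          using xy by (simp_all add: power2_eq_square algebra_simps flip: mult.assoc)
        have "x * (1 - y)\<^sup>2 = y * (1 - x)\<^sup>2" unfolding e by simp
        moreover have "y * (1 - x)\<^sup>2 \<noteq> 0" using assms nz by simp
        ultimately show ?thesis by simp
      qed
      ultimately show ?thesis by (simp add: u1_def u2_def u3_def u4_def)
    qed
  next
    case False
    let ?p = "- y * (1 - x) / (1 - y)" and ?q = "- x * (1 - y) / (1 - x)"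
    have pq: "1 - ?p = (1 - x * y) / (1 - y)" "1 - ?q = (1 - x * y) / (1 - x)"
      using nz by (simp_all add: field_simps)
    have A: "?q / ?p = x * (1 - y)\<^sup>2 / (y * (1 - x)\<^sup>2)"
      by (simp add: power2_eq_square mult_ac)
    have "1 - x * y \<noteq> 0" using False by auto
    then have 1: "?p \<noteq> 1" "?q \<noteq> 1" using pq nz by (metis diff_self divide_eq_0_iff)+
    have 0: "?p \<noteq> 0" "?q \<noteq> 0" using assms nz by auto
    have "?p \<noteq> ?q"
    proof
      assume "?p = ?q"
      then have "y * (1 - x) * (1 - x) = x * (1 - y) * (1 - y)" using nz by (simp add: divide_simps)
      then have "(x - y) * (1 - x * y) = 0" by (simp add: algebra_simps)
      then show False using False by auto
    qed
    note V = sym2_five_term[OF this 0(1) 1(1) 0(2) 1(2)]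
    have e: "?p * (1 - ?q) / (?q * (1 - ?p)) = inverse (x * (1 - y) / (y * (1 - x)))"
      "(1 - ?q) / (1 - ?p) = inverse ((1 - x) / (1 - y))"
      unfolding pq using nz assms \<open>1 - x * y \<noteq> 0\<close> by (simp_all add: divide_simps)
    show ?thesis using V unfolding e A sym2_inverse u1_def u2_def u3_def u4_def
      by (simp add: algebra_simps)
  qed
qed

text \<open>By \<open>K_relations\<close> only the classes of x, y and of four further arguments are
  left, and every second factor is a combination of x, y, 1 - x, 1 - y; the coefficients then cancel
  formally. The symbol of 1 contributes nothing.\<close>

lemma delta_K:
  assumes "x \<notin> {0, 1}" "y \<notin> {0, 1::'a}"
  shows "lin_ext delta_gen (K x y) = 0"
proof -
  have nz: "x \<noteq> 0" "y \<noteq> 0" "x \<noteq> 1" "y \<noteq> 1" "1 - x \<noteq> 0" "1 - y \<noteq> 0" using assms by auto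
  note r = K_relations[OF nz(1,3,2,4)]
  have mc: "mult_class (x * y) = mult_class x + mult_class y"
    "mult_class (x / y) = mult_class x - mult_class y"
    "mult_class (x * (1 - y)\<^sup>2 / (y * (1 - x)\<^sup>2)) =
      mult_class x - mult_class y + mult_class (1 - y) + mult_class (1 - y) - mult_class (1 - x) - mult_class (1 - x)"
    "mult_class (- x * (1 - y) / (1 - x)) = mult_class x + mult_class (1 - y) - mult_class (1 - x)"
    "mult_class (x * (1 - y) / (y * (1 - x))) =
      mult_class x + mult_class (1 - y) - mult_class y - mult_class (1 - x)"
    "mult_class (- y * (1 - x) / (1 - y)) = mult_class y + mult_class (1 - x) - mult_class (1 - y)"
    "mult_class ((1 - x) / (1 - y)) = mult_class (1 - x) - mult_class (1 - y)"
    using nz by (simp_all add: mult_class_divide mult_class_mult power2_eq_square del: minus_mult_left)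
  show ?thesis
    unfolding K_def lin_ext_simps lin_ext_gen delta_gen_def mc r scaleQ_2
    by (simp add: tensor_simps algebra_simps)
qed

lemma delta_r3_free:
  assumes "length xs = 6" "set xs \<subseteq> carrier_vec 3"
    and "\<And>i j k. i < 6 \<Longrightarrow> j < 6 \<Longrightarrow> k < 6 \<Longrightarrow> distinct [i, j, k] \<Longrightarrow> \<Delta> [xs ! i, xs ! j, xs ! k] \<noteq> (0::'a)"
  shows "lin_ext delta_gen (r3_free xs) = - (1/2) *\<^sub>Q
    Alt 6 (\<lambda>x. br [x!0] (x!1) (x!2) (x!3) (x!4) \<otimes>\<^sub>Q mult_class (\<Delta> [x!0, x!1, x!2])) xs"
    and "Poly_Mapping.keys (r3_free xs) \<subseteq> - {0}"
proof -
  interpret triple_ratio F "[]" by unfold_locales auto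
  have g: "generic6 xs" using assms by (auto simp: generic6_def D_def)
  show "lin_ext delta_gen (r3_free xs) = - (1/2) *\<^sub>Q
    Alt 6 (\<lambda>x. br [x!0] (x!1) (x!2) (x!3) (x!4) \<otimes>\<^sub>Q mult_class (\<Delta> [x!0, x!1, x!2])) xs"
    using delta_triple_ratio[OF g]
    by (simp add: r3_free_def lin_ext_simps Alt_Qlinear[OF lin_ext_Qlinear] delta_gen_def T_def D_def
        scaleQ_scaleQ)
  show "Poly_Mapping.keys (r3_free xs) \<subseteq> - {0}"
    unfolding r3_free_def Alt_def
  proof (intro order_trans[OF keys_scaleQ] order_trans[OF keys_sum] UN_least)
    fix \<sigma> assume "\<sigma> \<in> {\<sigma>. \<sigma> permutes {..<6::nat}}"
    then obtain a b c d e f where x: "permute_list \<sigma> xs = [a, b, c, d, e, f]" "generic6 [a, b, c, d, e, f]"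
      using generic6_obtain[OF g] by blast
    show "Poly_Mapping.keys (gen (\<Delta> [permute_list \<sigma> xs!0, permute_list \<sigma> xs!1, permute_list \<sigma> xs!3] *
        \<Delta> [permute_list \<sigma> xs!1, permute_list \<sigma> xs!2, permute_list \<sigma> xs!4] *
        \<Delta> [permute_list \<sigma> xs!2, permute_list \<sigma> xs!0, permute_list \<sigma> xs!5] /
        (\<Delta> [permute_list \<sigma> xs!0, permute_list \<sigma> xs!1, permute_list \<sigma> xs!4] *
        \<Delta> [permute_list \<sigma> xs!1, permute_list \<sigma> xs!2, permute_list \<sigma> xs!5] *
        \<Delta> [permute_list \<sigma> xs!2, permute_list \<sigma> xs!0, permute_list \<sigma> xs!3]))) \<subseteq> - {0}"
      using generic6D(2-)[OF x(2)] unfolding x(1) by (simp add: D_def \<Delta>_3_swap(1)[of c a])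
  qed
qed

text \<open>The sum over the omitted point is an alternation over all seven points of a function
  that involves only entries 1 to 5. Exchanging entries 0 and 6 leaves it fixed, so the alternation
  is its own negative.\<close>

lemma delta_seven_term:
  assumes "length xs = 7" "generic 2 (xs :: 'a points)"
  shows "lin_ext delta_gen (\<Sum>i<7. (-1) ^ Suc i *\<^sub>Q r3_free (omit i xs)) = 0"
proof -
  let ?f = "\<lambda>x. br [x!0] (x!1) (x!2) (x!3) (x!4) \<otimes>\<^sub>Q mult_class (\<Delta> [x!0, x!1, x!2])"
  have r3: "lin_ext delta_gen (r3_free (omit l xs)) = - (1/2) *\<^sub>Q Alt 6 ?f (omit l xs)" if l: "l < 7" for l
  proof (rule delta_r3_free(1))
    show "length (omit l xs) = 6" using assms l by (simp add: length_omit)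
    have "set (omit l xs) \<subseteq> set xs" unfolding omit_def using set_take_subset set_drop_subset by fastforce
    then show "set (omit l xs) \<subseteq> carrier_vec 3"
      using assms unfolding generic_def points_def by auto
    fix i j k :: nat assume ijk: "i < 6" "j < 6" "k < 6" "distinct [i, j, k]"
    define s where "s i = (if i < l then i else Suc i)" for i :: nat
    have "\<Delta> (map ((!) xs) [s i, s j, s k]) \<noteq> 0"
      using ijk assms l by (intro generic_\<Delta>_nonzero[OF assms(2)]) (auto simp: s_def)
    moreover have "omit l xs ! i = xs ! s i" if "i < 6" for i
      using that assms l by (simp add: nth_omit s_def)
    ultimately show "\<Delta> [omit l xs ! i, omit l xs ! j, omit l xs ! k] \<noteq> 0"
      using ijk by simp
  qed
  have "Alt 7 (\<lambda>x. ?f (tl x)) xs = - Alt 7 (\<lambda>x. ?f (tl x)) xs"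
  proof (rule Alt_swap[of xs 7 0 6])
    fix x :: "'a vec list" assume "length x = 7"
    then show "?f (tl x) = ?f (tl (permute_list (transpose 0 6) x))"
      by (simp add: nth_tl permute_list_nth[OF permutes_swap_id] transpose_def)
  qed (use assms in auto)
  then have A: "Alt 7 (\<lambda>x. ?f (tl x)) xs = 0" by (rule eq_neg_self_zero)
  have "lin_ext delta_gen (\<Sum>i<7. (-1) ^ Suc i *\<^sub>Q r3_free (omit i xs)) =
      (\<Sum>i<7. (-1) ^ Suc i *\<^sub>Q - (1/2) *\<^sub>Q Alt 6 ?f (omit i xs))"
    unfolding lin_ext_simps by (intro sum.cong) (simp_all add: r3)
  also have "\<dots> = (1/2) *\<^sub>Q (\<Sum>i<Suc 6. (-1) ^ i *\<^sub>Q Alt 6 (\<lambda>y. ?f (tl (xs ! i # y))) (omit i xs))"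
    unfolding Q.scale_sum_right by (intro sum.cong) (simp_all add: scaleQ_scaleQ)
  also have "\<dots> = (1/2) *\<^sub>Q Alt (Suc 6) (\<lambda>x. ?f (tl x)) xs"
    using assms(1) by (subst Alt_Suc[where n = 6]) (auto simp del: sum.lessThan_Suc)
  also have "\<dots> = 0" using A by simp
  finally show ?thesis .
qed

lemma delta_relations:
  assumes "r \<in> R3"
  shows "lin_ext delta_gen (r :: 'a free) = 0"
proof -
  have "lin_ext delta_gen (gen x - gen (inverse x)) = 0" if "x \<noteq> 0" for x :: 'a
    using that by (simp add: lin_ext_simps delta_gen_def sym2_inverse mult_class_inverse tensor_simps)
  then show ?thesis
    using assms delta_seven_term delta_K unfolding R3_def by blast
qed

lemma delta3_props:
  shows delta3_Qlinear: "Qlinear (\<delta>3 :: 'a B3 \<Rightarrow> _)"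
    and delta3_sym3: "x \<noteq> 0 \<Longrightarrow> \<delta>3 {x :: 'a}\<^sub>3 = {x}\<^sub>2 \<otimes>\<^sub>Q mult_class x"
    and delta3_abs: "Poly_Mapping.keys p \<subseteq> - {0} \<Longrightarrow> \<delta>3 (abs_B3 (p :: 'a free)) = lin_ext delta_gen p"
proof -
  have eq: "(\<delta>3 :: 'a B3 \<Rightarrow> _) = (THE f. Qlinear f \<and> (\<forall>g\<in>- {0}. f (abs_B3 (gen g)) = delta_gen g))"
    unfolding \<delta>3_def sym3_def delta_gen_def by (rule arg_cong[where f = The]) auto
  note l = B3.the_lift[OF delta_relations, folded eq]
  show 1: "Qlinear (\<delta>3 :: 'a B3 \<Rightarrow> _)" by (rule l(1))
  show "\<delta>3 {x :: 'a}\<^sub>3 = {x}\<^sub>2 \<otimes>\<^sub>Q mult_class x" if "x \<noteq> 0"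
    using l(2)[of x] that by (simp add: sym3_def delta_gen_def)
  show "\<delta>3 (abs_B3 p) = lin_ext delta_gen p" if "Poly_Mapping.keys p \<subseteq> - {0}" for p :: "'a free"
    by (rule B3.linear_ab[OF 1 l(2) that])
qed

end

section \<open>The map $a_2$ on pairs of triangles\<close>

lemma \<Delta>_3_lincomb:
  assumes "u \<in> carrier_vec 3" "v \<in> carrier_vec (3::nat)"
  shows "\<Delta> [r \<cdot>\<^sub>v u + s \<cdot>\<^sub>v v, y, z] = r * \<Delta> [u, y, z] + s * \<Delta> [v, y, z :: 'a::field vec]"
    and "\<Delta> [x, r \<cdot>\<^sub>v u + s \<cdot>\<^sub>v v, z] = r * \<Delta> [x, u, z] + s * \<Delta> [x, v, z]"
    and "\<Delta> [x, y, r \<cdot>\<^sub>v u + s \<cdot>\<^sub>v v] = r * \<Delta> [x, y, u] + s * \<Delta> [x, y, v]"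
  using assms by (simp_all add: \<Delta>_3 algebra_simps)

lemma \<Delta>_3_scale:
  assumes "u \<in> carrier_vec (3::nat)"
  shows "\<Delta> [r \<cdot>\<^sub>v u, y, z] = r * \<Delta> [u, y, z :: 'a::field vec]"
    and "\<Delta> [x, r \<cdot>\<^sub>v u, z] = r * \<Delta> [x, u, z]"
    and "\<Delta> [x, y, r \<cdot>\<^sub>v u] = r * \<Delta> [x, y, u]"
  using assms by (simp_all add: \<Delta>_3 algebra_simps)

lemma \<Delta>_3_repeat: "\<Delta> [x, x, y] = 0" "\<Delta> [x, y, x] = 0" "\<Delta> [y, x, x] = 0"
  by (simp_all add: \<Delta>_3 algebra_simps)

lemma cramer_3:
  assumes "x \<in> carrier_vec 3" "u \<in> carrier_vec 3" "v \<in> carrier_vec 3"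
    and "\<Delta> [x, u, v] = 0" "\<Delta> [u, v, w] \<noteq> 0"
  shows "\<exists>r s. x = r \<cdot>\<^sub>v u + s \<cdot>\<^sub>v (v :: 'a::field vec)"
proof -
  have "\<Delta> [u, v, w] * x $ i = \<Delta> [x, v, w] * u $ i + \<Delta> [u, x, w] * v $ i + \<Delta> [x, u, v] * w $ i"
    if "i < 3" for i
  proof -
    have "i = 0 \<or> i = 1 \<or> i = 2" using that by arith
    then show ?thesis by (elim disjE) (simp_all add: \<Delta>_3 algebra_simps)
  qed
  then have "x $ i = \<Delta> [x, v, w] / \<Delta> [u, v, w] * u $ i + \<Delta> [u, x, w] / \<Delta> [u, v, w] * v $ i"
    if "i < 3" for i
    using assms(4,5) that by (simp add: field_simps)
  then have "x = (\<Delta> [x, v, w] / \<Delta> [u, v, w]) \<cdot>\<^sub>v u + (\<Delta> [u, x, w] / \<Delta> [u, v, w]) \<cdot>\<^sub>v v"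
    using assms(1-3) by (intro eq_vecI) auto
  then show ?thesis by blast
qed

text \<open>Linear dependence, stated by determinants so that it can be pulled back along a
  projection.\<close>

definition par :: "'a::field vec \<Rightarrow> 'a vec \<Rightarrow> bool"
  where "par u v \<longleftrightarrow> (\<forall>w\<in>carrier_vec 3. \<Delta> [u, v, w] = 0)"

lemma par_sym: "par u v \<longleftrightarrow> par v u"
  by (simp add: par_def \<Delta>_3_swap(1)[of u v])

lemma completion_3:
  assumes "l \<in> carrier_vec 3" "l \<noteq> 0\<^sub>v 3"
  shows "\<exists>p\<in>carrier_vec 3. \<exists>q\<in>carrier_vec 3. \<Delta> [l, p, q :: 'a::field vec] \<noteq> 0"
proof -
  have "l $ 0 \<noteq> 0 \<or> l $ 1 \<noteq> 0 \<or> l $ 2 \<noteq> 0"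
  proof (rule ccontr)
    assume "\<not> ?thesis"
    then have "l $ i = 0" if "i < 3" for i
      using that by (cases "i = 0 \<or> i = 1 \<or> i = 2") auto
    then have "l = 0\<^sub>v 3" using assms(1) by (intro eq_vecI) auto
    then show False using assms(2) by simp
  qed
  moreover have "\<Delta> [l, unit_vec 3 1, unit_vec 3 2] = l $ 0" "\<Delta> [l, unit_vec 3 2, unit_vec 3 0] = l $ 1"
    "\<Delta> [l, unit_vec 3 0, unit_vec 3 1] = l $ 2"
    by (simp_all add: \<Delta>_3)
  ultimately show ?thesis by (metis unit_vec_carrier)
qed

lemma par_scale:
  assumes "u \<in> carrier_vec 3" "v \<in> carrier_vec 3" "u \<noteq> 0\<^sub>v 3" "v \<noteq> 0\<^sub>v 3" "par u (v :: 'a::field vec)"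
  shows "\<exists>c. c \<noteq> 0 \<and> v = c \<cdot>\<^sub>v u"
proof -
  obtain p q where pq: "p \<in> carrier_vec 3" "q \<in> carrier_vec 3" "\<Delta> [u, p, q] \<noteq> 0"
    using completion_3[OF assms(1,3)] by blast
  have "\<Delta> [v, u, p] = 0" "\<Delta> [v, u, q] = 0"
    using assms(5) pq by (simp_all add: par_def \<Delta>_3_swap(1)[of u v])
  moreover obtain r s where v: "v = r \<cdot>\<^sub>v u + s \<cdot>\<^sub>v p"
    using cramer_3[OF assms(2,1) pq(1) \<open>\<Delta> [v, u, p] = 0\<close> pq(3)] by blast
  ultimately have "s * \<Delta> [p, u, q] = 0"
    using assms(1) pq by (simp add: \<Delta>_3_lincomb \<Delta>_3_repeat)
  then have "s = 0" using pq(3) by (simp add: \<Delta>_3_swap(1)[of u p])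
  then have "v = r \<cdot>\<^sub>v u" using v assms(1) pq(1) by auto
  moreover have "r \<noteq> 0"
  proof
    assume "r = 0"
    then have "v = 0\<^sub>v 3" using \<open>v = r \<cdot>\<^sub>v u\<close> assms(1) by auto
    then show False using assms(4) by simp
  qed
  ultimately show ?thesis by blast
qed

context infinite_field
begin

text \<open>If \<open>a\<close>, \<open>b\<close> or \<open>c\<close>, \<open>d\<close> coincide,
  the Pluecker relation makes the cross-ratio 1 or its denominator 0; the other coincidences
  annihilate its numerator or denominator.\<close>

lemma br_eq_0:
  fixes cs :: "'a vec list"
  assumes "set cs \<subseteq> carrier_vec (length cs + 2)" "set [a, b, c, d] \<subseteq> carrier_vec (length cs + 2)"
    and "\<Delta> (cs @ [a, b]) = 0 \<or> \<Delta> (cs @ [a, c]) = 0 \<or> \<Delta> (cs @ [a, d]) = 0 \<or>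
      \<Delta> (cs @ [b, c]) = 0 \<or> \<Delta> (cs @ [b, d]) = 0 \<or> \<Delta> (cs @ [c, d]) = 0"
  shows "br cs a b c d = 0"
proof (cases "\<Delta> (cs @ [a, b]) * \<Delta> (cs @ [c, d]) = 0")
  case True
  then have "\<Delta> (cs @ [a, c]) * \<Delta> (cs @ [b, d]) = \<Delta> (cs @ [a, d]) * \<Delta> (cs @ [b, c])"
  proof -
    have "\<Delta> (cs @ [a, c]) * \<Delta> (cs @ [b, d]) =
        \<Delta> (cs @ [a, b]) * \<Delta> (cs @ [c, d]) + \<Delta> (cs @ [a, d]) * \<Delta> (cs @ [b, c])"
      using \<Delta>_pluecker[OF assms(1,2)] by (simp add: algebra_simps)
    then show ?thesis unfolding True by simp
  qed
  then show ?thesis unfolding br_def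
    by (cases "\<Delta> (cs @ [a, d]) * \<Delta> (cs @ [b, c]) = 0") auto
next
  case False
  then show ?thesis using assms(3) by (auto simp: br_def)
qed

definition tri :: "'a vec \<Rightarrow> 'a vec \<Rightarrow> 'a vec \<Rightarrow> 'a vec \<Rightarrow> 'a vec \<Rightarrow> 'a vec \<Rightarrow> 'a B2"
  where "tri l0 l1 l2 m0 m1 m2 =
    br [l0] l1 l2 m1 m2 - br [l0] l1 l2 m0 m2 + br [l0] l1 l2 m0 m1
    - (br [l1] l0 l2 m1 m2 - br [l1] l0 l2 m0 m2 + br [l1] l0 l2 m0 m1)
    + (br [l2] l0 l1 m1 m2 - br [l2] l0 l1 m0 m2 + br [l2] l0 l1 m0 m1)"

text \<open>A cochain on the edges of the first triangle. On admissible pairs \<open>tri\<close> is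
  its coboundary, so the additivity relation in the first triangle telescopes.\<close>

definition edge :: "'a vec \<Rightarrow> 'a vec \<Rightarrow> 'a vec \<Rightarrow> 'a vec \<Rightarrow> 'a vec \<Rightarrow> 'a B2"
  where "edge k a m0 m1 m2 = br [k] a m0 m1 m2 - br [a] k m0 m1 m2"

lemma br_1:
  fixes a b c d x :: "'a vec"
  assumes "set [x, a, b, c, d] \<subseteq> carrier_vec 3"
  shows br_1_zero: "\<Delta> [x, a, b] = 0 \<or> \<Delta> [x, a, c] = 0 \<or> \<Delta> [x, a, d] = 0 \<or> \<Delta> [x, b, c] = 0 \<or>
      \<Delta> [x, b, d] = 0 \<or> \<Delta> [x, c, d] = 0 \<Longrightarrow> br [x] a b c d = 0"
    and br_1_swap: "br [x] b a c d = - br [x] a b c d" "br [x] a c b d = - br [x] a b c d"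
      "br [x] a b d c = - br [x] a b c d"
  using br_eq_0[of "[x]" a b c d] br_swap[of "[x]" a b c d] assms by simp_all

lemma br_1_scale:
  fixes a b c d x :: "'a vec"
  assumes "r \<noteq> 0"
  shows "x \<in> carrier_vec 3 \<Longrightarrow> br [r \<cdot>\<^sub>v x] a b c d = br [x] a b c d"
    and "a \<in> carrier_vec 3 \<Longrightarrow> br [x] (r \<cdot>\<^sub>v a) b c d = br [x] a b c d"
    and "b \<in> carrier_vec 3 \<Longrightarrow> br [x] a (r \<cdot>\<^sub>v b) c d = br [x] a b c d"
  using assms by (simp_all add: br_def \<Delta>_3_scale mult_ac)

lemma off_center_1: "off_center [x] v \<longleftrightarrow> v \<in> carrier_vec 3 \<and> \<not> par x v"
  by (auto simp: off_center_def par_def)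

text \<open>The two sides differ by an alternating sum of the five-term relations seen from
  \<open>l0\<close>, \<open>l1\<close>, \<open>l2\<close>. These require all points to be off the
  center, so coinciding vertices are treated first; there, brackets vanish or cancel in
  pairs.\<close>

lemma tri_eq_edges:
  fixes l0 l1 l2 m0 m1 m2 :: "'a vec"
  assumes L: "set [l0, l1, l2] \<subseteq> carrier_vec 3 - {0\<^sub>v 3}" and M: "set [m0, m1, m2] \<subseteq> carrier_vec 3"
    and LM: "\<And>l m. l \<in> {l0, l1, l2} \<Longrightarrow> m \<in> {m0, m1, m2} \<Longrightarrow> \<not> par l m"
  shows "tri l0 l1 l2 m0 m1 m2 = edge l0 l1 m0 m1 m2 + edge l1 l2 m0 m1 m2 - edge l0 l2 m0 m1 m2"
    and "par l0 l1 \<or> par l0 l2 \<or> par l1 l2 \<Longrightarrow> tri l0 l1 l2 m0 m1 m2 = 0"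
proof -
  let ?thesis = "tri l0 l1 l2 m0 m1 m2 = edge l0 l1 m0 m1 m2 + edge l1 l2 m0 m1 m2 - edge l0 l2 m0 m1 m2"
  have carr: "l0 \<in> carrier_vec 3" "l1 \<in> carrier_vec 3" "l2 \<in> carrier_vec 3" "m0 \<in> carrier_vec 3"
    "m1 \<in> carrier_vec 3" "m2 \<in> carrier_vec 3" using L M by auto
  have z: "br [x] x b c d = 0" "br [x] b x c d = 0" "br [x] b b c d = 0"
    if "set [x, b, c, d] \<subseteq> carrier_vec 3" for x b c d :: "'a vec"
    using that by (simp_all add: br_1_zero \<Delta>_3_repeat)
  have par: "tri l0 l1 l2 m0 m1 m2 = 0 \<and> ?thesis" if p: "par l0 l1 \<or> par l0 l2 \<or> par l1 l2"
    using p
  proof (elim disjE)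
    assume "par l0 l1"
    then obtain c where "c \<noteq> 0" "l1 = c \<cdot>\<^sub>v l0" using par_scale[of l0 l1] L by auto
    then show ?thesis using carr by (simp add: tri_def edge_def br_1_scale z)
  next
    assume "par l0 l2"
    then obtain c where "c \<noteq> 0" "l2 = c \<cdot>\<^sub>v l0" using par_scale[of l0 l2] L by auto
    then show ?thesis using carr by (simp add: tri_def edge_def br_1_scale z)
  next
    assume "par l1 l2"
    then obtain c where "c \<noteq> 0" "l2 = c \<cdot>\<^sub>v l1" using par_scale[of l1 l2] L by auto
    then show ?thesis using carr by (simp add: tri_def edge_def br_1_scale z)
  qed
  then show "par l0 l1 \<or> par l0 l2 \<or> par l1 l2 \<Longrightarrow> tri l0 l1 l2 m0 m1 m2 = 0" by blast
  show ?thesis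
  proof (cases "par l0 l1 \<or> par l0 l2 \<or> par l1 l2")
    case True
    then show ?thesis using par by blast
  next
    case False
    have F: "five_term [x] a b m0 m1 m2 = 0"
      if "x \<in> {l0, l1, l2}" "a \<in> {l0, l1, l2}" "b \<in> {l0, l1, l2}" "\<not> par x a" "\<not> par x b" for x a b
      by (rule five_term_zero) (use that LM carr in \<open>auto simp: off_center_1\<close>)
    have "five_term [l0] l1 l2 m0 m1 m2 = 0" "five_term [l1] l0 l2 m0 m1 m2 = 0"
      "five_term [l2] l0 l1 m0 m1 m2 = 0"
      using False par_sym by (auto intro!: F)
    moreover have "tri l0 l1 l2 m0 m1 m2 - (edge l0 l1 m0 m1 m2 + edge l1 l2 m0 m1 m2 - edge l0 l2 m0 m1 m2) =
      five_term [l0] l1 l2 m0 m1 m2 - five_term [l1] l0 l2 m0 m1 m2 + five_term [l2] l0 l1 m0 m1 m2"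
      by (simp add: tri_def edge_def five_term_def)
    ultimately show ?thesis by simp
  qed
qed

lemma edge_swap: "edge a k m0 m1 m2 = - edge k a m0 m1 m2"
  by (simp add: edge_def)

text \<open>Here all \<open>m\<^sub>i\<close> lie on a line; \<open>br [k] a m\<^sub>0 m\<^sub>1 m\<^sub>2\<close> is then symmetric in \<open>k\<close> and \<open>a\<close>, except when
  one of the centers lies on the line as well.\<close>

lemma edge_collinear:
  fixes k a m0 m1 m2 :: "'a vec"
  assumes "set [k, a, m0, m1] \<subseteq> carrier_vec 3" and m2: "m2 = r \<cdot>\<^sub>v m0 + s \<cdot>\<^sub>v m1"
  shows "\<Delta> [k, m0, m1] = 0 \<Longrightarrow> \<Delta> [a, m0, m1] = 0 \<Longrightarrow> edge k a m0 m1 m2 = 0"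
    and "\<Delta> [k, m0, m1] \<noteq> 0 \<Longrightarrow> \<Delta> [a, m0, m1] \<noteq> 0 \<Longrightarrow> edge k a m0 m1 m2 = 0"
    and "\<Delta> [k, m0, m1] \<noteq> 0 \<Longrightarrow> \<Delta> [k', m0, m1] \<noteq> 0 \<Longrightarrow> a = t \<cdot>\<^sub>v m0 + u \<cdot>\<^sub>v m1 \<Longrightarrow>
      k' \<in> carrier_vec 3 \<Longrightarrow> edge k a m0 m1 m2 = edge k' a m0 m1 m2"
proof -
  have carr: "k \<in> carrier_vec 3" "a \<in> carrier_vec 3" "m0 \<in> carrier_vec 3" "m1 \<in> carrier_vec 3"
    using assms by auto
  have m02: "\<Delta> [x, m0, m2] = s * \<Delta> [x, m0, m1]" for x
    using carr by (simp add: m2 \<Delta>_3_lincomb \<Delta>_3_repeat)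
  have off: "br [x] b m0 m1 m2 = {s * \<Delta> [x, b, m1] / \<Delta> [x, b, m2]}\<^sub>2" if "\<Delta> [x, m0, m1] \<noteq> 0" for x b
    using that by (simp add: br_def m02 mult.commute)
  have on: "br [x] b m0 m1 m2 = 0" if "\<Delta> [x, m0, m1] = 0" for x b
    using that by (simp add: br_def)
  show "edge k a m0 m1 m2 = 0" if "\<Delta> [k, m0, m1] = 0" "\<Delta> [a, m0, m1] = 0"
    using that by (simp add: edge_def on)
  show "edge k a m0 m1 m2 = 0" if "\<Delta> [k, m0, m1] \<noteq> 0" "\<Delta> [a, m0, m1] \<noteq> 0"
    using that by (simp add: edge_def off \<Delta>_3_swap(1)[of a k])
  show "edge k a m0 m1 m2 = edge k' a m0 m1 m2"
    if "\<Delta> [k, m0, m1] \<noteq> 0" "\<Delta> [k', m0, m1] \<noteq> 0" and a: "a = t \<cdot>\<^sub>v m0 + u \<cdot>\<^sub>v m1" and "k' \<in> carrier_vec 3"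
  proof -
    have "\<Delta> [a, m0, m1] = 0" using carr by (simp add: a \<Delta>_3_lincomb \<Delta>_3_repeat)
    moreover have "\<Delta> [x, a, m1] = t * \<Delta> [x, m0, m1]" for x
      using carr by (simp add: a \<Delta>_3_lincomb \<Delta>_3_repeat)
    moreover have "\<Delta> [x, a, m2] = (t * s - u * r) * \<Delta> [x, m0, m1]" for x
      using carr by (simp add: a m2 \<Delta>_3_lincomb \<Delta>_3_repeat \<Delta>_3_swap(2)[of x m1 m0] algebra_simps)
    ultimately show ?thesis using that(1,2) by (simp add: edge_def on off)
  qed
qed

text \<open>An edge with both or with no vertex on the line of the \<open>m\<close>'s contributes 0.
  By \<open>E\<close> at most one vertex lies on this line, and the two edges at that vertex
  contribute equal values, which cancel in the coboundary. \<open>E\<close> is what admissibility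
  says: no edge of the first triangle lies on the line of an edge of the second.\<close>

lemma tri_M_collinear:
  fixes l0 l1 l2 m0 m1 m2 :: "'a vec"
  assumes L: "set [l0, l1, l2] \<subseteq> carrier_vec 3 - {0\<^sub>v 3}" and M: "set [m0, m1, m2] \<subseteq> carrier_vec 3"
    and LM: "\<And>l m. l \<in> {l0, l1, l2} \<Longrightarrow> m \<in> {m0, m1, m2} \<Longrightarrow> \<not> par l m"
    and E: "\<And>k a. (k, a) \<in> {(l0, l1), (l0, l2), (l1, l2)} \<Longrightarrow> \<not> par k a \<Longrightarrow> \<not> par m0 m1 \<Longrightarrow>
      \<not> (\<Delta> [k, m0, m1] = 0 \<and> \<Delta> [a, m0, m1] = 0)"
    and D: "\<Delta> [m0, m1, m2] = 0"
  shows "tri l0 l1 l2 m0 m1 m2 = 0"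
proof (cases "par m0 m1 \<or> par l0 l1 \<or> par l0 l2 \<or> par l1 l2")
  case True
  then show ?thesis
  proof
    assume p: "par m0 m1"
    have "\<Delta> [x, m0, m1] = 0" if "x \<in> carrier_vec 3" for x
    proof -
      have "\<Delta> [x, m0, m1] = \<Delta> [m0, m1, x]" by (simp add: \<Delta>_3 algebra_simps)
      then show ?thesis using p that by (simp add: par_def)
    qed
    then have "br [x] a m0 m1 m2 = 0" if "x \<in> {l0, l1, l2}" "a \<in> {l0, l1, l2}" for x a
      using that L M by (intro br_1_zero) auto
    then show ?thesis using tri_eq_edges(1)[OF L M LM] by (simp add: edge_def)
  next
    assume "par l0 l1 \<or> par l0 l2 \<or> par l1 l2"
    then show ?thesis using tri_eq_edges(2)[OF L M LM] by blast
  qed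
next
  case False
  then obtain w where w: "w \<in> carrier_vec 3" "\<Delta> [m0, m1, w] \<noteq> 0" by (auto simp: par_def)
  have carr: "l0 \<in> carrier_vec 3" "l1 \<in> carrier_vec 3" "l2 \<in> carrier_vec 3" "m0 \<in> carrier_vec 3"
    "m1 \<in> carrier_vec 3" "m2 \<in> carrier_vec 3" using L M by auto
  have "\<Delta> [m2, m0, m1] = 0" using D by (simp add: \<Delta>_3 algebra_simps)
  then obtain r s where m2: "m2 = r \<cdot>\<^sub>v m0 + s \<cdot>\<^sub>v m1"
    using cramer_3[OF carr(6,4,5) _ w(2)] by blast
  have on: "\<exists>t u. x = t \<cdot>\<^sub>v m0 + u \<cdot>\<^sub>v m1" if "\<Delta> [x, m0, m1] = 0" "x \<in> carrier_vec 3" for x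
    using cramer_3[OF that(2) carr(4,5) that(1) w(2)] .
  note col = edge_collinear[OF _ m2]
  have same: "edge k a m0 m1 m2 = edge k' a m0 m1 m2"
    if "\<Delta> [k, m0, m1] \<noteq> 0" "\<Delta> [k', m0, m1] \<noteq> 0" "\<Delta> [a, m0, m1] = 0"
      "k \<in> {l0, l1, l2}" "k' \<in> {l0, l1, l2}" "a \<in> {l0, l1, l2}" for k k' a
    using on[OF that(3)] col(3)[of k a k'] that carr by auto
  have zero: "edge k a m0 m1 m2 = 0"
    if "\<Delta> [k, m0, m1] = 0 \<longleftrightarrow> \<Delta> [a, m0, m1] = 0" "k \<in> {l0, l1, l2}" "a \<in> {l0, l1, l2}" for k a
    using col(1,2)[of k a] that carr by auto
  have E': "\<not> (\<Delta> [l0, m0, m1] = 0 \<and> \<Delta> [l1, m0, m1] = 0)" "\<not> (\<Delta> [l0, m0, m1] = 0 \<and> \<Delta> [l2, m0, m1] = 0)"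
    "\<not> (\<Delta> [l1, m0, m1] = 0 \<and> \<Delta> [l2, m0, m1] = 0)"
    using E[of l0 l1] E[of l0 l2] E[of l1 l2] False by auto
  then consider "\<Delta> [l0, m0, m1] \<noteq> 0" "\<Delta> [l1, m0, m1] \<noteq> 0" "\<Delta> [l2, m0, m1] \<noteq> 0"
    | "\<Delta> [l0, m0, m1] = 0" "\<Delta> [l1, m0, m1] \<noteq> 0" "\<Delta> [l2, m0, m1] \<noteq> 0"
    | "\<Delta> [l0, m0, m1] \<noteq> 0" "\<Delta> [l1, m0, m1] = 0" "\<Delta> [l2, m0, m1] \<noteq> 0"
    | "\<Delta> [l0, m0, m1] \<noteq> 0" "\<Delta> [l1, m0, m1] \<noteq> 0" "\<Delta> [l2, m0, m1] = 0"
    by blast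
  then have "edge l0 l1 m0 m1 m2 + edge l1 l2 m0 m1 m2 - edge l0 l2 m0 m1 m2 = 0"
  proof cases
    case 1
    then show ?thesis
      using zero by simp
  next
    case 2
    then show ?thesis
      using zero[of l1 l2] same[of l1 l2 l0] by (simp add: edge_swap[of l0 l1] edge_swap[of l0 l2])
  next
    case 3
    then show ?thesis
      using zero[of l0 l2] same[of l0 l2 l1] by (simp add: edge_swap[of l1 l2])
  next
    case 4
    then show ?thesis
      using zero[of l0 l1] same[of l0 l1 l2] by simp
  qed
  then show ?thesis using tri_eq_edges(1)[OF L M LM] by simp
qed

text \<open>In every bracket the first two points are collinear with the center.\<close>

lemma tri_L_collinear:
  fixes l0 l1 l2 m0 m1 m2 :: "'a vec"
  assumes "set [l0, l1, l2, m0, m1, m2] \<subseteq> carrier_vec 3" "\<Delta> [l0, l1, l2] = 0"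
  shows "tri l0 l1 l2 m0 m1 m2 = 0"
proof -
  have "\<Delta> [l1, l0, l2] = 0" "\<Delta> [l2, l0, l1] = 0"
    using assms(2) by (simp_all add: \<Delta>_3 algebra_simps)
  then show ?thesis
    using assms by (simp add: tri_def br_1_zero)
qed

lemma dual_five_term_swap:
  fixes a b c d e :: "'a vec"
  assumes "set [a, b, c, d, e] \<subseteq> carrier_vec 3"
  shows "dual_five_term [] b a c d e = - dual_five_term [] a b c d e"
    "dual_five_term [] a c b d e = - dual_five_term [] a b c d e"
    "dual_five_term [] a b d c e = - dual_five_term [] a b c d e"
    "dual_five_term [] a b c e d = - dual_five_term [] a b c d e"
  using assms unfolding dual_five_term_def append_Nil
  by (simp_all add: br_1_swap(1)[of _ a b] br_1_swap(1)[of _ b c] br_1_swap(2)[of _ a b c]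
      br_1_swap(1)[of _ c d] br_1_swap(2)[of _ _ c d] br_1_swap(3)[of _ _ _ c d]
      br_1_swap(3)[of _ _ _ d e] br_1_swap(2)[of _ _ d e])

text \<open>Some three of the \<open>m\<close>'s form a basis, and antisymmetry moves them to the
  front. A triple (q, r, s) in \<open>nc\<close> says that s and a do not both lie on the line qr,
  which makes the corresponding Gale dual vector nonzero.\<close>

lemma dual_five_term_zero:
  fixes a m0 m1 m2 m3 :: "'a vec"
  assumes carr: "set [a, m0, m1, m2, m3] \<subseteq> carrier_vec 3"
    and ex: "\<Delta> [m0, m1, m2] \<noteq> 0 \<or> \<Delta> [m0, m1, m3] \<noteq> 0 \<or> \<Delta> [m0, m2, m3] \<noteq> 0 \<or> \<Delta> [m1, m2, m3] \<noteq> 0"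
    and nc: "\<And>q r s. {q, r, s} \<subseteq> {m0, m1, m2, m3} \<Longrightarrow> (q, r, s) \<in> set [(m1, m2, m3), (m1, m3, m2), (m2, m3, m1),
        (m0, m2, m3), (m0, m3, m2), (m2, m3, m0), (m0, m1, m3), (m0, m3, m1), (m1, m3, m0),
        (m0, m1, m2), (m0, m2, m1), (m1, m2, m0)] \<Longrightarrow>
      \<Delta> [q, r, s] \<noteq> 0 \<or> \<Delta> [q, r, a] \<noteq> 0"
  shows "dual_five_term [] a m0 m1 m2 m3 = 0"
proof -
  note sw = dual_five_term_swap
  have front: "dual_five_term [] a m0 m1 m2 m3 = dual_five_term [] m0 m1 m2 m3 a"
    using sw(1)[of a m0 m1 m2 m3] sw(2)[of m0 a m1 m2 m3] sw(3)[of m0 m1 a m2 m3]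
      sw(4)[of m0 m1 m2 a m3] carr by simp
  from ex show ?thesis
  proof (elim disjE)
    assume "\<Delta> [m0, m1, m2] \<noteq> 0"
    then show ?thesis unfolding front
      by (rule dual_five_term_3) (use nc[of m1 m2 m3] nc[of m0 m2 m3] nc[of m0 m1 m3] in auto)
  next
    assume "\<Delta> [m0, m1, m3] \<noteq> 0"
    then have "dual_five_term [] m0 m1 m3 m2 a = 0"
      by (rule dual_five_term_3) (use nc[of m1 m3 m2] nc[of m0 m3 m2] nc[of m0 m1 m2] in auto)
    then show ?thesis using sw(3)[of m0 m1 m3 m2 a] carr by (simp add: front)
  next
    assume "\<Delta> [m0, m2, m3] \<noteq> 0"
    then have "dual_five_term [] m0 m2 m3 m1 a = 0"
      by (rule dual_five_term_3) (use nc[of m2 m3 m1] nc[of m0 m3 m1] nc[of m0 m2 m1] in auto)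
    then show ?thesis using sw(3)[of m0 m2 m3 m1 a] sw(2)[of m0 m2 m1 m3 a] carr by (simp add: front)
  next
    assume "\<Delta> [m1, m2, m3] \<noteq> 0"
    then have "dual_five_term [] m1 m2 m3 m0 a = 0"
      by (rule dual_five_term_3) (use nc[of m2 m3 m0] nc[of m1 m3 m0] nc[of m1 m2 m0] in auto)
    then show ?thesis using sw(3)[of m1 m2 m3 m0 a] sw(2)[of m1 m2 m0 m3 a] sw(1)[of m1 m0 m2 m3 a] carr
      by (simp add: front)
  qed
qed

end

section \<open>Admissible pairs and projections\<close>

text \<open>The last clause, surjectivity, allows quantifiers over vectors of the projected space to
  be pulled back, as for \<open>par\<close>.\<close>

lemma project_point:
  fixes l :: "'a::field vec"
  assumes "l \<in> carrier_vec (Suc n)" "set us \<subseteq> carrier_vec (Suc n)" "length us = n" "\<Delta> (l # us) \<noteq> 0"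
  obtains P c where "c \<noteq> 0" "P \<in> carrier_mat n (Suc n)" "project [l] = map ((*\<^sub>v) P)"
    "\<And>bs. set bs \<subseteq> carrier_vec (Suc n) \<Longrightarrow> length bs = n \<Longrightarrow> \<Delta> (map ((*\<^sub>v) P) bs) = c * \<Delta> (l # bs)"
    "\<And>w. w \<in> carrier_vec n \<Longrightarrow> \<exists>u\<in>carrier_vec (Suc n). w = P *\<^sub>v u"
proof -
  let ?P = "projection_mat (Suc n) [l]"
  obtain c where c: "c \<noteq> 0" "?P \<in> carrier_mat (length us) (Suc n)"
    "\<And>bs. set bs \<subseteq> carrier_vec (Suc n) \<Longrightarrow> length bs = length us \<Longrightarrow>
      \<Delta> (map ((*\<^sub>v) ?P) bs) = c * \<Delta> ([l] @ bs)"
    by (rule project_scaling[of "[l]" "Suc n" us]) (use assms in auto)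
  have pr: "project [l] = map ((*\<^sub>v) ?P)"
    using assms(1) by (auto simp: project_def fun_eq_iff)
  have "\<Delta> (map ((*\<^sub>v) ?P) us) \<noteq> 0" using c(1) c(3)[of us] assms by simp
  then interpret p: projection "[]" "map ((*\<^sub>v) ?P) us" n n
    by unfold_locales (use assms c(2) in auto)
  have surj: "\<exists>u\<in>carrier_vec (Suc n). w = ?P *\<^sub>v u" if w: "w \<in> carrier_vec n" for w
  proof -
    obtain x y where xy: "x \<in> carrier_vec 0" "y \<in> carrier_vec n"
      "w = mat_of_cols n [] *\<^sub>v x + mat_of_cols n (map ((*\<^sub>v) ?P) us) *\<^sub>v y"
      using p.decompose[OF w] by auto
    have U: "mat_of_cols (Suc n) us \<in> carrier_mat (Suc n) n"
      using mat_of_cols_carrier(1)[of "Suc n" us] assms(3) by simp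
    have "mat_of_cols n (map ((*\<^sub>v) ?P) us) = ?P * mat_of_cols (Suc n) us"
    proof (rule mat_col_eqI)
      fix j assume "j < dim_col (?P * mat_of_cols (Suc n) us)"
      then have j: "j < length us" using U assms(3) by simp
      then have "us ! j \<in> carrier_vec (Suc n)" using assms(2) by auto
      then show "col (mat_of_cols n (map ((*\<^sub>v) ?P) us)) j = col (?P * mat_of_cols (Suc n) us) j"
        using j c(2) U assms(3) col_mult2[OF c(2) U, of j] by simp
    qed (use c(2) assms(3) in auto)
    moreover have "mat_of_cols n [] *\<^sub>v x = 0\<^sub>v n"
      using xy(1) by (intro eq_vecI) (auto simp: scalar_prod_def)
    ultimately have "w = ?P *\<^sub>v (mat_of_cols (Suc n) us *\<^sub>v y)"
      using xy(2,3) c(2) U assms(3) w by (simp add: assoc_mult_mat_vec[of _ n "Suc n" _ n])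
    then show ?thesis using U xy(2) by auto
  qed
  show thesis
    by (rule that[OF c(1) _ pr _ surj]) (use c(2,3) assms(3) in auto)
qed

lemma vec_span_1:
  assumes "u \<in> carrier_vec d"
  shows "vec_span d [u] = {r \<cdot>\<^sub>v (u :: 'a::field vec) | r. True}"
proof -
  have "mat_of_cols d [u] *\<^sub>v x = x $ 0 \<cdot>\<^sub>v u" if "x \<in> carrier_vec 1" for x
    by (rule eq_vecI) (use that assms in \<open>auto simp: scalar_prod_def mat_of_cols_index\<close>)
  then have "v \<in> vec_span d [u] \<longleftrightarrow> (\<exists>x\<in>carrier_vec 1. v = x $ 0 \<cdot>\<^sub>v u)" for v
    using vec_span_iff[of "[u]" d v] assms by auto
  moreover have "(\<exists>x\<in>carrier_vec 1. v = x $ 0 \<cdot>\<^sub>v u) \<longleftrightarrow> (\<exists>r. v = r \<cdot>\<^sub>v u)" for v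
    by (auto intro!: bexI[of _ "vec 1 (\<lambda>_. _)"])
  ultimately show ?thesis by auto
qed

lemma vec_span_2:
  assumes "u \<in> carrier_vec d" "v \<in> carrier_vec d"
  shows "vec_span d [u, v] = {r \<cdot>\<^sub>v u + s \<cdot>\<^sub>v (v :: 'a::field vec) | r s. True}"
proof -
  have *: "mat_of_cols d [u, v] *\<^sub>v x = x $ 0 \<cdot>\<^sub>v u + x $ 1 \<cdot>\<^sub>v v" if "x \<in> carrier_vec 2" for x
    by (rule eq_vecI) (use that assms in \<open>auto simp: scalar_prod_def mat_of_cols_index numeral_2_eq_2\<close>)
  have "w \<in> vec_span d [u, v] \<longleftrightarrow> (\<exists>x\<in>carrier_vec 2. w = mat_of_cols d [u, v] *\<^sub>v x)" for w
    using vec_span_iff[of "[u, v]" d w] assms by (simp add: numeral_2_eq_2)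
  then have "w \<in> vec_span d [u, v] \<longleftrightarrow> (\<exists>x\<in>carrier_vec 2. w = x $ 0 \<cdot>\<^sub>v u + x $ 1 \<cdot>\<^sub>v v)" for w
    using * by auto
  moreover have "(\<exists>x\<in>carrier_vec 2. w = x $ 0 \<cdot>\<^sub>v u + x $ 1 \<cdot>\<^sub>v v) \<longleftrightarrow> (\<exists>r s. w = r \<cdot>\<^sub>v u + s \<cdot>\<^sub>v v)" for w
  proof safe
    fix r s
    show "\<exists>x\<in>carrier_vec 2. r \<cdot>\<^sub>v u + s \<cdot>\<^sub>v v = x $ 0 \<cdot>\<^sub>v u + x $ 1 \<cdot>\<^sub>v v"
      by (intro bexI[of _ "vec 2 (\<lambda>i. if i = 0 then r else s)"]) auto
  qed auto
  ultimately show ?thesis by auto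
qed

lemma vec_span_scale:
  assumes "u \<in> carrier_vec d" "c \<noteq> 0"
  shows "vec_span d [c \<cdot>\<^sub>v (u :: 'a::field vec)] = vec_span d [u]"
proof -
  have cu: "c \<cdot>\<^sub>v u \<in> carrier_vec d" using assms(1) by simp
  have 1: "r \<cdot>\<^sub>v (c \<cdot>\<^sub>v u) = (r * c) \<cdot>\<^sub>v u" for r
    using assms by (simp add: smult_smult_assoc)
  have 2: "r \<cdot>\<^sub>v u = (r / c) \<cdot>\<^sub>v (c \<cdot>\<^sub>v u)" for r
    unfolding 1 using assms(2) by simp
  show ?thesis
    unfolding vec_span_1[OF cu] vec_span_1[OF assms(1)]
  proof (intro equalityI subsetI)
    fix x assume "x \<in> {r \<cdot>\<^sub>v (c \<cdot>\<^sub>v u) |r. True}"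
    then obtain r where "x = r \<cdot>\<^sub>v (c \<cdot>\<^sub>v u)" by blast
    then show "x \<in> {r \<cdot>\<^sub>v u |r. True}" unfolding 1 by blast
  next
    fix x assume "x \<in> {r \<cdot>\<^sub>v u |r. True}"
    then obtain r where "x = r \<cdot>\<^sub>v u" by blast
    then have "x = (r / c) \<cdot>\<^sub>v (c \<cdot>\<^sub>v u)" using 2[of r] by simp
    then show "x \<in> {r \<cdot>\<^sub>v (c \<cdot>\<^sub>v u) |r. True}" by blast
  qed
qed

lemma vec_span_line_subset:
  assumes "set [a, b, u, v] \<subseteq> carrier_vec 3" "\<not> par u v" "\<Delta> [a, u, v] = 0" "\<Delta> [b, u, v] = 0"
  shows "vec_span 3 [a, b] \<subseteq> vec_span 3 [u, v :: 'a::field vec]"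
proof -
  obtain w where w: "\<Delta> [u, v, w] \<noteq> 0" using assms(2) by (auto simp: par_def)
  have carr: "a \<in> carrier_vec 3" "b \<in> carrier_vec 3" "u \<in> carrier_vec 3" "v \<in> carrier_vec 3"
    using assms(1) by auto
  obtain p q where a: "a = p \<cdot>\<^sub>v u + q \<cdot>\<^sub>v v" using cramer_3[OF carr(1,3,4) assms(3) w] by blast
  obtain p' q' where b: "b = p' \<cdot>\<^sub>v u + q' \<cdot>\<^sub>v v" using cramer_3[OF carr(2,3,4) assms(4) w] by blast
  have "r \<cdot>\<^sub>v a + s \<cdot>\<^sub>v b = (r * p + s * p') \<cdot>\<^sub>v u + (r * q + s * q') \<cdot>\<^sub>v v" for r s
    using carr unfolding a b by (intro eq_vecI) (auto simp: algebra_simps)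
  then show ?thesis using carr by (auto simp: vec_span_2)
qed

lemma vec_span_line_eq:
  assumes "set [a, b, u, v] \<subseteq> carrier_vec 3" "\<not> par a b" "\<not> par u v" "\<Delta> [a, u, v] = 0" "\<Delta> [b, u, v] = 0"
  shows "vec_span 3 [a, b] = vec_span 3 [u, v :: 'a::field vec]"
proof
  show "vec_span 3 [a, b] \<subseteq> vec_span 3 [u, v]" by (rule vec_span_line_subset) (use assms in auto)
  obtain w where w: "\<Delta> [u, v, w] \<noteq> 0" using assms(3) by (auto simp: par_def)
  have carr: "a \<in> carrier_vec 3" "b \<in> carrier_vec 3" "u \<in> carrier_vec 3" "v \<in> carrier_vec 3"
    using assms(1) by auto
  obtain p q where a: "a = p \<cdot>\<^sub>v u + q \<cdot>\<^sub>v v" using cramer_3[OF carr(1,3,4) assms(4) w] by blast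
  obtain p' q' where b: "b = p' \<cdot>\<^sub>v u + q' \<cdot>\<^sub>v v" using cramer_3[OF carr(2,3,4) assms(5) w] by blast
  have "\<Delta> [u, a, b] = 0" "\<Delta> [v, a, b] = 0"
    using carr by (simp_all add: a b \<Delta>_3_lincomb \<Delta>_3_repeat)
  then show "vec_span 3 [u, v] \<subseteq> vec_span 3 [a, b]"
    by (intro vec_span_line_subset) (use assms in auto)
qed

lemma vec_span_cong: "set xs = set ys \<Longrightarrow> vec_span d xs = vec_span d ys"
  by (simp add: vec_span_def)

lemma set_nths_pair:
  assumes "i < length xs" "j < length xs"
  shows "set (nths xs {i, j}) = {xs ! i, xs ! j}"
  by (subst set_nths) (use assms in blast)

lemma admissible_vertices:
  fixes L M :: "'a::field points"
  assumes "admissible n (L, M)" "0 < n" "i \<le> n" "j \<le> n" "c \<noteq> 0"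
  shows "M ! j \<noteq> c \<cdot>\<^sub>v L ! i"
proof
  assume *: "M ! j = c \<cdot>\<^sub>v L ! i"
  have len: "length L = Suc n" "length M = Suc n" and "L ! i \<in> carrier_vec (Suc n)"
    using assms by (auto simp: admissible_def points_def)
  have "vec_span (Suc n) (nths L {i}) = vec_span (Suc n) [L ! i]"
    "vec_span (Suc n) (nths M {j}) = vec_span (Suc n) [M ! j]"
    using len assms(3,4) by (auto intro!: vec_span_cong simp: set_nths)
  then have "vec_span (Suc n) (nths L {i}) = vec_span (Suc n) (nths M {j})"
    using * vec_span_scale[OF \<open>L ! i \<in> carrier_vec (Suc n)\<close> assms(5)] by simp
  moreover have "{i} \<subset> {..n}" "{j} \<subset> {..n}" using assms(2-4) by (auto simp: psubset_eq dest: arg_cong[where f = card])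
  ultimately show False using assms(1) unfolding admissible_def by blast
qed

lemma admissible_edges:
  fixes L M :: "'a::field points"
  assumes "admissible 2 (L, M)" "i < j" "j < 3" "p < q" "q < 3"
  shows "vec_span 3 [L ! i, L ! j] \<noteq> vec_span 3 [M ! p, M ! q]"
proof
  assume *: "vec_span 3 [L ! i, L ! j] = vec_span 3 [M ! p, M ! q]"
  have len: "length L = 3" "length M = 3" using assms by (auto simp: admissible_def)
  have "vec_span 3 (nths L {i, j}) = vec_span 3 [L ! i, L ! j]"
    "vec_span 3 (nths M {p, q}) = vec_span 3 [M ! p, M ! q]"
    using len assms(2-5) by (auto intro!: vec_span_cong simp: set_nths_pair)
  then have "vec_span (Suc 2) (nths L {i, j}) = vec_span (Suc 2) (nths M {p, q})" using * by simp
  moreover have "{i, j} \<subset> {..2}" "{p, q} \<subset> {..2}"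
    using assms(2-5) by (auto simp: psubset_eq dest: arg_cong[where f = card])
  moreover have "I \<noteq> {} \<Longrightarrow> I \<subset> {..2} \<Longrightarrow> J \<noteq> {} \<Longrightarrow> J \<subset> {..2} \<Longrightarrow>
      vec_span (Suc 2) (nths L I) \<noteq> vec_span (Suc 2) (nths M J)" for I J
    using assms(1) by (simp add: admissible_def)
  ultimately show False by (metis insert_not_empty)
qed

section \<open>Tools for checking the relations of \<open>A_rels\<close>\<close>

lemma in_hyperplane_\<Delta>:
  fixes xs :: "'a::field points"
  assumes "in_hyperplane n xs" "length xs = Suc n" "set xs \<subseteq> carrier_vec (Suc n)"
  shows "\<Delta> xs = 0"
proof -
  obtain h where h: "h \<in> carrier_vec (Suc n)" "h \<noteq> 0\<^sub>v (Suc n)" "\<And>x. x \<in> set xs \<Longrightarrow> h \<bullet> x = 0"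
    using assms(1) by (auto simp: in_hyperplane_def)
  let ?A = "mat_of_cols (Suc n) xs"
  have A: "?A \<in> carrier_mat (Suc n) (Suc n)"
    using mat_of_cols_carrier(1)[of "Suc n" xs] assms(2) by simp
  have "?A\<^sup>T *\<^sub>v h = 0\<^sub>v (Suc n)"
  proof (rule eq_vecI)
    fix k assume "k < dim_vec (0\<^sub>v (Suc n) :: 'a vec)"
    then have k: "k < length xs" "xs ! k \<in> set xs" "xs ! k \<in> carrier_vec (Suc n)"
      using assms(2,3) by auto
    then have "(?A\<^sup>T *\<^sub>v h) $ k = xs ! k \<bullet> h" using assms(2) by simp
    also have "\<dots> = 0" using h(3)[OF k(2)] comm_scalar_prod[OF h(1) k(3)] by simp
    finally show "(?A\<^sup>T *\<^sub>v h) $ k = 0\<^sub>v (Suc n) $ k" using k(1) assms(2) by simp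
  qed (use assms(2) in simp)
  then have "det ?A\<^sup>T = 0"
    using det_0_iff_vec_prod_zero[of "?A\<^sup>T" "Suc n"] A h(1,2) by auto
  then show ?thesis using det_transpose[OF A] assms(2) by (simp add: \<Delta>_def)
qed

text \<open>Transpositions generate the symmetric group. The invariant \<open>Q\<close> keeps the
  permuted lists within the range where the sign change is known.\<close>

lemma alternating_sign:
  assumes "\<sigma> permutes {..<n}" "Q x" "\<And>x. Q x \<Longrightarrow> length x = n"
    and "\<And>x a b. Q x \<Longrightarrow> a < n \<Longrightarrow> b < n \<Longrightarrow> a \<noteq> b \<Longrightarrow> Q (permute_list (transpose a b) x) \<and>
      f (permute_list (transpose a b) x) = - (f x :: 'v::rat_vector)"
  shows "f (permute_list \<sigma> x) = of_int (sign \<sigma>) *\<^sub>Q f x"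
proof -
  have "\<forall>x. Q x \<longrightarrow> f (permute_list \<sigma> x) = of_int (sign \<sigma>) *\<^sub>Q f x"
    using assms(1) finite_lessThan[of n]
  proof (induction \<sigma> rule: permutes_induct)
    case id
    show ?case by (simp only: permute_list_id sign_id of_int_1 scaleQ_one) simp
  next
    case (swap a b p)
    show ?case
    proof (intro allI impI)
      fix x assume x: "Q x"
      have ab: "a < n" "b < n" using swap by auto
      have "permute_list (transpose a b \<circ> p) x = permute_list p (permute_list (transpose a b) x)"
        using swap.hyps assms(3)[OF x] by (intro permute_list_compose) auto
      then have "f (permute_list (transpose a b \<circ> p) x) = of_int (sign p) *\<^sub>Q - f x"
        using swap.IH assms(4)[OF x ab swap(3)] by simp
      moreover have "permutation p" using swap.hyps by (auto intro: permutation_permutes[THEN iffD2])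
      then have "sign (transpose a b \<circ> p) = - sign p"
        using swap(3) by (subst sign_compose) (auto simp: permutation_swap_id sign_swap_id)
      ultimately show "f (permute_list (transpose a b \<circ> p) x) =
          of_int (sign (transpose a b \<circ> p)) *\<^sub>Q f x"
        by (simp only: of_int_minus) simp
    qed
  qed
  then show ?thesis using assms(2) by blast
qed

lemma length_2_conv: "length xs = 2 \<longleftrightarrow> (\<exists>a b. xs = [a, b])"
  and length_3_conv: "length xs = 3 \<longleftrightarrow> (\<exists>a b c. xs = [a, b, c])"
  and length_4_conv: "length xs = 4 \<longleftrightarrow> (\<exists>a b c d. xs = [a, b, c, d])"
  by (auto simp: numeral_eq_Suc length_Suc_conv)

lemma sum_atMost_numeral:
  "sum f {..2} = f 0 + f 1 + f (2 :: nat)" "sum f {..Suc 1} = f 0 + f 1 + f (2 :: nat)"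
  "sum f {..Suc 2} = f 0 + f 1 + f 2 + f (3 :: nat)"
  by (simp_all add: numeral_eq_Suc)

lemma omit_list:
  "omit 0 (a # xs) = xs" "omit (Suc 0) (a # b # xs) = a # xs" "omit 2 (a # b # c # xs) = a # b # xs"
  "omit (Suc (Suc 0)) (a # b # c # xs) = a # b # xs" "omit 3 (a # b # c # d # xs) = a # b # c # xs"
  by (simp_all add: omit_def)

lemma invertible_mat_det_nonzero:
  assumes "g \<in> carrier_mat n n" "invertible_mat (g :: 'a::field mat)"
  shows "det g \<noteq> 0"
proof -
  obtain h where h: "g * h = 1\<^sub>m n" "h * g = 1\<^sub>m (dim_row h)"
    using assms unfolding invertible_mat_def inverts_mat_def by auto
  have "dim_col h = n" using arg_cong[OF h(1), of dim_col] by simp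
  moreover have "dim_row h = n" using arg_cong[OF h(2), of dim_col] assms(1) by simp
  ultimately have "h \<in> carrier_mat n n" by auto
  then have "det g * det h = 1" using det_mult[OF assms(1)] h(1) by (metis det_one)
  then show ?thesis by auto
qed

lemma \<Delta>_2_scale:
  assumes "u \<in> carrier_vec (Suc (Suc 0))"
  shows "\<Delta> [r \<cdot>\<^sub>v u, v] = r * \<Delta> [u, v :: 'a::field vec]" "\<Delta> [v, r \<cdot>\<^sub>v u] = r * \<Delta> [v, u]"
  using assms by (simp_all add: \<Delta>_2 algebra_simps)

text \<open>What projective equivalence means for determinants: a common factor, the determinant of
  the projective map, and one factor for each point. All of them cancel in a cross-ratio.\<close>

lemma same_configD:
  fixes xs ys :: "'a::field points"
  assumes "same_config n xs ys" "points n xs" "n = 1 \<or> n = 2"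
  obtains \<mu> t where "\<mu> \<noteq> 0" "\<And>k. k < length xs \<Longrightarrow> t k \<noteq> (0::'a)"
    "\<And>k. k < length xs \<Longrightarrow> ys ! k \<in> carrier_vec (Suc n) - {0\<^sub>v (Suc n)}"
    "\<And>ks. length ks = Suc n \<Longrightarrow> set ks \<subseteq> {..<length xs} \<Longrightarrow>
      \<Delta> (map ((!) ys) ks) = \<mu> * prod_list (map t ks) * \<Delta> (map ((!) xs) ks)"
proof -
  obtain g where g: "g \<in> carrier_mat (Suc n) (Suc n)" "invertible_mat g"
    "\<forall>k<length xs. \<exists>c. c \<noteq> 0 \<and> ys ! k = c \<cdot>\<^sub>v (g *\<^sub>v (xs ! k))"
    using assms(1) by (auto simp: same_config_def)
  then obtain t where t: "\<And>k. k < length xs \<Longrightarrow> t k \<noteq> 0 \<and> ys ! k = t k \<cdot>\<^sub>v (g *\<^sub>v (xs ! k))"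
    by metis
  have d: "det g \<noteq> 0" by (rule invertible_mat_det_nonzero[OF g(1,2)])
  have xs: "xs ! k \<in> carrier_vec (Suc n)" "xs ! k \<noteq> 0\<^sub>v (Suc n)" if "k < length xs" for k
    using assms(2) that by (auto simp: points_def)
  have gx: "g *\<^sub>v (xs ! k) \<in> carrier_vec (Suc n)" if "k < length xs" for k
    using g(1) xs[OF that] by simp
  have gx0: "g *\<^sub>v (xs ! k) \<noteq> 0\<^sub>v (Suc n)" if "k < length xs" for k
    using det_0_iff_vec_prod_zero[OF g(1)] d xs[OF that] by auto
  have ys: "ys ! k \<in> carrier_vec (Suc n) - {0\<^sub>v (Suc n)}" if "k < length xs" for k
  proof -
    have "ys ! k \<noteq> 0\<^sub>v (Suc n)"
    proof
      assume "ys ! k = 0\<^sub>v (Suc n)"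
      then have "(1 / t k) \<cdot>\<^sub>v (t k \<cdot>\<^sub>v (g *\<^sub>v (xs ! k))) = 0\<^sub>v (Suc n)" using t[OF that] by auto
      then show False
        using t[OF that] gx0[OF that] by (simp add: smult_smult_assoc)
    qed
    then show ?thesis using t[OF that] gx[OF that] by auto
  qed
  have "\<Delta> (map ((!) ys) ks) = det g * prod_list (map t ks) * \<Delta> (map ((!) xs) ks)"
    if ks: "length ks = Suc n" "set ks \<subseteq> {..<length xs}" for "ks"
  proof -
    have "\<Delta> (map ((!) ys) ks) = prod_list (map t ks) * \<Delta> (map (\<lambda>k. g *\<^sub>v (xs ! k)) ks)"
      using assms(3)
    proof
      assume n: "n = 1"
      then obtain i j where ij: "ks = [i, j]" using ks length_2_conv[of "ks"] by auto
      then show ?thesis using ks t gx[of i] gx[of j] n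
        by (simp add: \<Delta>_2_scale)
    next
      assume n: "n = 2"
      then obtain i j k where ij: "ks = [i, j, k]" using ks length_3_conv[of "ks"] by auto
      then show ?thesis using ks t gx[of i] gx[of j] gx[of k] n
        by (simp add: \<Delta>_3_scale)
    qed
    also have "\<Delta> (map (\<lambda>k. g *\<^sub>v (xs ! k)) ks) = det g * \<Delta> (map ((!) xs) ks)"
      using \<Delta>_map_mult[OF g(1), of "map ((!) xs) ks"] ks xs by (auto simp: o_def)
    finally show ?thesis by simp
  qed
  with d t ys show thesis by (intro that[of "det g" t]) auto
qed

section \<open>The map $a_1$\<close>

definition pair1 :: "'a::field points \<times> 'a points \<Rightarrow> 'a multQ"
  where "pair1 = (\<lambda>(L, M). mult_class (cross_ratio (L @ M)))"

lemma pair1_eq: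
  assumes "\<Delta> [a, c] \<noteq> 0" "\<Delta> [a, d] \<noteq> 0" "\<Delta> [b, c] \<noteq> 0" "\<Delta> [b, d] \<noteq> 0"
  shows "pair1 ([a, b], [c, d]) = mult_class (\<Delta> [a, c]) + mult_class (\<Delta> [b, d]) -
    mult_class (\<Delta> [a, d]) - mult_class (\<Delta> [b, c])"
  using assms by (simp add: pair1_def cross_ratio_def mult_class_divide mult_class_mult)

lemma admissible1_D:
  assumes "admissible 1 (L, M)"
  shows "\<exists>a b c d. L = [a, b] \<and> M = [c, d] \<and> set [a, b, c, d] \<subseteq> carrier_vec 2 - {0\<^sub>v 2} \<and>
    \<Delta> [a, c] \<noteq> 0 \<and> \<Delta> [a, d] \<noteq> 0 \<and> \<Delta> [b, c] \<noteq> 0 \<and> \<Delta> [b, d :: 'a::field vec] \<noteq> 0"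
proof -
  have "length L = 2" "length M = 2" and pts: "points 1 L" "points 1 M"
    using assms by (auto simp: admissible_def)
  then obtain a b c d where LM: "L = [a, b]" "M = [c, d]" by (auto simp: length_2_conv)
  have carr: "set [a, b, c, d] \<subseteq> carrier_vec 2 - {0\<^sub>v 2}"
    using pts by (auto simp: LM points_def numeral_2_eq_2)
  have "\<Delta> [L ! i, M ! j] \<noteq> 0" if ij: "i \<le> 1" "j \<le> 1" for i j
  proof
    assume "\<Delta> [L ! i, M ! j] = 0"
    moreover have "L ! i \<in> set [a, b, c, d]" "M ! j \<in> set [a, b, c, d]"
      using ij by (auto simp: LM le_Suc_eq)
    ultimately obtain r where "r \<noteq> 0" "M ! j = r \<cdot>\<^sub>v L ! i"
      using \<Delta>_2_eq_0[of "L ! i" "M ! j"] carr by blast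
    then show False using admissible_vertices[OF assms _ ij] by simp
  qed
  from this[of 0 0] this[of 0 1] this[of 1 0] this[of 1 1] show ?thesis
    using carr LM by simp
qed

abbreviation m3 :: "'a::field vec \<Rightarrow> 'a vec \<Rightarrow> 'a vec \<Rightarrow> 'a multQ"
  where "m3 x a b \<equiv> mult_class (\<Delta> [x, a, b])"

lemma m3_swap: "m3 b a c = m3 a b c" "m3 a c b = m3 a b c"
  by (simp_all only: \<Delta>_3_swap(1)[of b a] \<Delta>_3_swap(2)[of a c] mult_class_neg)

lemma project_3:
  fixes x :: "'a::field vec"
  assumes "x \<in> carrier_vec 3" "x \<noteq> 0\<^sub>v 3"
  obtains P c where "c \<noteq> 0" "P \<in> carrier_mat 2 3" "project [x] = map ((*\<^sub>v) P)"
    "\<And>a b. a \<in> carrier_vec 3 \<Longrightarrow> b \<in> carrier_vec 3 \<Longrightarrow> \<Delta> [P *\<^sub>v a, P *\<^sub>v b] = c * \<Delta> [x, a, b]"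
proof -
  obtain p q where pq: "p \<in> carrier_vec 3" "q \<in> carrier_vec 3" "\<Delta> [x, p, q] \<noteq> 0"
    using completion_3[OF assms] by blast
  obtain P c where P: "c \<noteq> 0" "P \<in> carrier_mat 2 (Suc 2)" "project [x] = map ((*\<^sub>v) P)"
    "\<And>bs. set bs \<subseteq> carrier_vec (Suc 2) \<Longrightarrow> length bs = 2 \<Longrightarrow> \<Delta> (map ((*\<^sub>v) P) bs) = c * \<Delta> (x # bs)"
    by (rule project_point[of x 2 "[p, q]"]) (use assms pq in auto)
  show thesis
  proof (rule that[OF P(1) _ P(3)])
    show "\<Delta> [P *\<^sub>v a, P *\<^sub>v b] = c * \<Delta> [x, a, b]" if "a \<in> carrier_vec 3" "b \<in> carrier_vec 3" for a b
      using P(4)[of "[a, b]"] that by simp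
  qed (use P(2) in simp)
qed

lemma pair1_project:
  fixes x :: "'a::field vec"
  assumes "set [x, a, b, c, d] \<subseteq> carrier_vec 3" "x \<noteq> 0\<^sub>v 3"
    and adm: "admissible 1 (project [x] [a, b], project [x] [c, d])"
  shows "pair1 (project [x] [a, b], project [x] [c, d]) = m3 x a c + m3 x b d - m3 x a d - m3 x b c"
proof -
  have carr: "a \<in> carrier_vec 3" "b \<in> carrier_vec 3" "c \<in> carrier_vec 3" "d \<in> carrier_vec 3"
    using assms(1) by auto
  obtain P r where P: "r \<noteq> 0" "project [x] = map ((*\<^sub>v) P)"
    "\<And>a b. a \<in> carrier_vec 3 \<Longrightarrow> b \<in> carrier_vec 3 \<Longrightarrow> \<Delta> [P *\<^sub>v a, P *\<^sub>v b] = r * \<Delta> [x, a, b]"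
    using project_3[of x] assms(1,2) by (metis insert_subset list.simps(15))
  have nz: "\<Delta> [P *\<^sub>v a, P *\<^sub>v c] \<noteq> 0" "\<Delta> [P *\<^sub>v a, P *\<^sub>v d] \<noteq> 0" "\<Delta> [P *\<^sub>v b, P *\<^sub>v c] \<noteq> 0"
    "\<Delta> [P *\<^sub>v b, P *\<^sub>v d] \<noteq> 0"
    using admissible1_D[OF adm] by (auto simp: P(2))
  then have "\<Delta> [x, a, c] \<noteq> 0" "\<Delta> [x, a, d] \<noteq> 0" "\<Delta> [x, b, c] \<noteq> 0" "\<Delta> [x, b, d] \<noteq> 0"
    using P(3) carr by auto
  then show ?thesis
    using pair1_eq[OF nz] P(1) carr by (simp add: P(2,3) mult_class_mult algebra_simps)
qed

text \<open>Split into four determinant classes, a cross-ratio satisfies the relations of additivity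
  and of projection by cancellation; the latter uses that signs are torsion, so the center and the
  projected points may be exchanged. For a degenerate pair the Pluecker relation gives the
  cross-ratio 1.\<close>

lemma pair1_relations:
  assumes "r \<in> A_rels 1"
  shows "lin_ext pair1 (r :: ('a::field points \<times> 'a points) free) = 0"
proof -
  have rel1: "pair1 (L, M) = 0" if adm: "admissible 1 (L, M)" and H: "in_hyperplane 1 L \<or> in_hyperplane 1 M"
    for L M :: "'a points"
  proof -
    obtain a b c d where LM: "L = [a, b]" "M = [c, d]" "set [a, b, c, d] \<subseteq> carrier_vec 2 - {0\<^sub>v 2}"
      "\<Delta> [a, c] \<noteq> 0" "\<Delta> [a, d] \<noteq> 0" "\<Delta> [b, c] \<noteq> 0" "\<Delta> [b, d] \<noteq> 0"
      using admissible1_D[OF adm] by blast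
    have "\<Delta> [a, b] = 0 \<or> \<Delta> [c, d] = 0"
      using H in_hyperplane_\<Delta>[of 1 L] in_hyperplane_\<Delta>[of 1 M] LM(3) by (auto simp: LM(1,2) numeral_2_eq_2)
    then have "\<Delta> [a, c] * \<Delta> [b, d] = \<Delta> [a, d] * \<Delta> [b, c]"
      using \<Delta>_2_pluecker[of a b c d] by (auto simp: algebra_simps)
    then show ?thesis using LM(4-) by (simp add: pair1_def LM(1,2) cross_ratio_def)
  qed
  have tr: "transpose i j = (transpose 0 (Suc 0) :: nat \<Rightarrow> nat)" if "i < 2" "j < 2" "i \<noteq> j" for i j
    using that by (auto simp: less_2_cases_iff transpose_commute)
  have pl: "permute_list (transpose 0 (Suc 0)) [u, v] = [v, u]" for u v :: "'a vec"
    by (simp add: permute_list_def transpose_def)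
  have rel2: "pair1 (permute_list \<sigma> L, M) = of_int (sign \<sigma>) *\<^sub>Q pair1 (L, M)"
    "pair1 (L, permute_list \<sigma> M) = of_int (sign \<sigma>) *\<^sub>Q pair1 (L, M)"
    if adm: "admissible 1 (L, M)" and \<sigma>: "\<sigma> permutes {..1}" for L M :: "'a points" and \<sigma>
  proof -
    obtain a b c d where LM: "L = [a, b]" "M = [c, d]"
      "\<Delta> [a, c] \<noteq> 0" "\<Delta> [a, d] \<noteq> 0" "\<Delta> [b, c] \<noteq> 0" "\<Delta> [b, d] \<noteq> 0"
      using admissible1_D[OF adm] by blast
    have \<sigma>2: "\<sigma> permutes {..<2}" using \<sigma> by (simp add: numeral_2_eq_2 lessThan_Suc_atMost)
    show "pair1 (permute_list \<sigma> L, M) = of_int (sign \<sigma>) *\<^sub>Q pair1 (L, M)"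
    proof (rule alternating_sign[OF \<sigma>2, where Q = "\<lambda>x. x = [a, b] \<or> x = [b, a]" and f = "\<lambda>x. pair1 (x, M)"])
      show "(permute_list (transpose i j) x = [a, b] \<or> permute_list (transpose i j) x = [b, a]) \<and>
        pair1 (permute_list (transpose i j) x, M) = - pair1 (x, M)"
        if "x = [a, b] \<or> x = [b, a]" "i < 2" "j < 2" "i \<noteq> j" for x i j
        using that(1) LM unfolding tr[OF that(2-4)] by (auto simp: pl pair1_eq)
    qed (use LM in auto)
    show "pair1 (L, permute_list \<sigma> M) = of_int (sign \<sigma>) *\<^sub>Q pair1 (L, M)"
    proof (rule alternating_sign[OF \<sigma>2, where Q = "\<lambda>x. x = [c, d] \<or> x = [d, c]" and f = "\<lambda>x. pair1 (L, x)"])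
      show "(permute_list (transpose i j) x = [c, d] \<or> permute_list (transpose i j) x = [d, c]) \<and>
        pair1 (L, permute_list (transpose i j) x) = - pair1 (L, x)"
        if "x = [c, d] \<or> x = [d, c]" "i < 2" "j < 2" "i \<noteq> j" for x i j
        using that(1) LM unfolding tr[OF that(2-4)] by (auto simp: pl pair1_eq)
    qed (use LM in auto)
  qed
  have rel3: "(\<Sum>i\<le>Suc 1. (-1) ^ i *\<^sub>Q pair1 (omit i L, M)) = 0"
    if L: "length L = 1 + 2" and adm: "\<forall>i\<le>Suc 1. admissible 1 (omit i L, M)" for L M :: "'a points"
  proof -
    obtain a b c where abc: "L = [a, b, c]" using L length_3_conv[of L] by auto
    have ad: "admissible 1 ([b, c], M)" "admissible 1 ([a, c], M)" "admissible 1 ([a, b], M)"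
      using adm[rule_format, of 0] adm[rule_format, of 1] adm[rule_format, of 2] by (simp_all add: abc omit_list)
    obtain u v where "M = [u, v]" "\<Delta> [b, u] \<noteq> 0" "\<Delta> [b, v] \<noteq> 0" "\<Delta> [c, u] \<noteq> 0" "\<Delta> [c, v] \<noteq> 0"
      using admissible1_D[OF ad(1)] by auto
    moreover from this have "\<Delta> [a, u] \<noteq> 0" "\<Delta> [a, v] \<noteq> 0" using admissible1_D[OF ad(2)] by auto
    ultimately show ?thesis by (simp add: sum_atMost_numeral abc omit_list pair1_eq)
  qed
  have rel3': "(\<Sum>i\<le>Suc 1. (-1) ^ i *\<^sub>Q pair1 (L, omit i M)) = 0"
    if L: "length M = 1 + 2" and adm: "\<forall>i\<le>Suc 1. admissible 1 (L, omit i M)" for L M :: "'a points"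
  proof -
    obtain a b c where abc: "M = [a, b, c]" using L length_3_conv[of M] by auto
    have ad: "admissible 1 (L, [b, c])" "admissible 1 (L, [a, c])" "admissible 1 (L, [a, b])"
      using adm[rule_format, of 0] adm[rule_format, of 1] adm[rule_format, of 2] by (simp_all add: abc omit_list)
    obtain u v where "L = [u, v]" "\<Delta> [u, b] \<noteq> 0" "\<Delta> [v, b] \<noteq> 0" "\<Delta> [u, c] \<noteq> 0" "\<Delta> [v, c] \<noteq> 0"
      using admissible1_D[OF ad(1)] by auto
    moreover from this have "\<Delta> [u, a] \<noteq> 0" "\<Delta> [v, a] \<noteq> 0" using admissible1_D[OF ad(2)] by auto
    ultimately show ?thesis by (simp add: sum_atMost_numeral abc omit_list pair1_eq)
  qed
  have rel4: "(\<Sum>i\<le>Suc 1. (-1) ^ i *\<^sub>Q pair1 (project [L!i] (omit i L), project [L!i] M)) = 0"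
    if L: "length L = 1 + 2" "length M = 1 + 1" and pts: "points (Suc 1) L" "points (Suc 1) M"
      and adm: "\<forall>i\<le>Suc 1. admissible 1 (project [L!i] (omit i L), project [L!i] M)" for L M :: "'a points"
  proof -
    obtain a b c where abc: "L = [a, b, c]" using L length_3_conv[of L] by auto
    obtain u v where uv: "M = [u, v]" using L length_2_conv[of M] by auto
    have carr: "set [a, b, c] \<subseteq> carrier_vec 3 - {0\<^sub>v 3}" "set [u, v] \<subseteq> carrier_vec 3"
      using pts by (auto simp: abc uv points_def numeral_3_eq_3)
    have ad: "admissible 1 (project [a] [b, c], project [a] [u, v])"
      "admissible 1 (project [b] [a, c], project [b] [u, v])"
      "admissible 1 (project [c] [a, b], project [c] [u, v])"
      using adm[rule_format, of 0] adm[rule_format, of 1] adm[rule_format, of 2]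
      by (simp_all add: abc uv omit_list)
    show ?thesis using carr ad
      by (simp add: sum_atMost_numeral abc uv omit_list pair1_project m3_swap)
  qed
  have rel4': "(\<Sum>i\<le>Suc 1. (-1) ^ i *\<^sub>Q pair1 (project [M!i] L, project [M!i] (omit i M))) = 0"
    if L: "length L = 1 + 1" "length M = 1 + 2" and pts: "points (Suc 1) L" "points (Suc 1) M"
      and adm: "\<forall>i\<le>Suc 1. admissible 1 (project [M!i] L, project [M!i] (omit i M))" for L M :: "'a points"
  proof -
    obtain a b c where abc: "M = [a, b, c]" using L length_3_conv[of M] by auto
    obtain u v where uv: "L = [u, v]" using L length_2_conv[of L] by auto
    have carr: "set [a, b, c] \<subseteq> carrier_vec 3 - {0\<^sub>v 3}" "set [u, v] \<subseteq> carrier_vec 3"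
      using pts by (auto simp: abc uv points_def numeral_3_eq_3)
    have ad: "admissible 1 (project [a] [u, v], project [a] [b, c])"
      "admissible 1 (project [b] [u, v], project [b] [a, c])"
      "admissible 1 (project [c] [u, v], project [c] [a, b])"
      using adm[rule_format, of 0] adm[rule_format, of 1] adm[rule_format, of 2]
      by (simp_all add: abc uv omit_list)
    show ?thesis using carr ad
      by (simp add: sum_atMost_numeral abc uv omit_list pair1_project m3_swap)
  qed
  have rel5: "pair1 (L, M) = pair1 (L', M')"
    if adm: "admissible 1 (L, M)" and len: "length L' = Suc 1" and sc: "same_config 1 (L @ M) (L' @ M')"
    for L M L' M' :: "'a points"
  proof -
    obtain a b c d where LM: "L = [a, b]" "M = [c, d]" using admissible1_D[OF adm] by blast
    have "length M' = 2" using sc len by (simp add: same_config_def LM)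
    then obtain a' b' c' d' where LM': "L' = [a', b']" "M' = [c', d']"
      using len length_2_conv[of L'] length_2_conv[of M'] by auto
    have pts: "points 1 (L @ M)" using adm by (auto simp: admissible_def points_def)
    obtain \<mu> t where l: "\<mu> \<noteq> 0" "\<And>k. k < length (L @ M) \<Longrightarrow> t k \<noteq> 0"
      "\<And>is. length is = Suc 1 \<Longrightarrow> set is \<subseteq> {..<length (L @ M)} \<Longrightarrow>
        \<Delta> (map ((!) (L' @ M')) is) = \<mu> * prod_list (map t is) * \<Delta> (map ((!) (L @ M)) is)"
      by (rule same_configD[OF sc pts]) auto
    have "cross_ratio (L' @ M') = cross_ratio (L @ M)"
      using l(3)[of "[0, 2]"] l(3)[of "[1, 3]"] l(3)[of "[0, 3]"] l(3)[of "[1, 2]"] l(1)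
        l(2)[of 0] l(2)[of 1] l(2)[of 2] l(2)[of 3]
      by (simp add: LM LM' cross_ratio_def)
    then show ?thesis by (simp add: pair1_def)
  qed
  show ?thesis
    using assms unfolding A_rels_def
    by (elim UnE CollectE exE conjE)
      (simp_all only: lin_ext_simps lin_ext_gen rel1 rel2 rel3 rel3' rel4 rel4' rel5 diff_self)
qed

lemma a1_props:
  shows a1_Qlinear: "Qlinear (a1 :: 'a::field A1 \<Rightarrow> _)"
    and a1_class: "admissible 1 (L, M) \<Longrightarrow> a1 (A1_class L M) = mult_class (cross_ratio (L @ M :: 'a points))"
proof -
  have eq: "(a1 :: 'a A1 \<Rightarrow> _) = (THE f. Qlinear f \<and> (\<forall>g\<in>Collect (admissible 1). f (abs_A1 (gen g)) = pair1 g))"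
    unfolding a1_def A1_class_def pair1_def by (rule arg_cong[where f = The]) auto
  note l = A1.the_lift[OF pair1_relations[where 'a = 'a], folded eq]
  show "Qlinear (a1 :: 'a A1 \<Rightarrow> _)" by (rule l(1))
  show "a1 (A1_class L M) = mult_class (cross_ratio (L @ M))" if "admissible 1 (L, M)"
    using l(2)[of "(L, M)"] that by (simp add: A1_class_def pair1_def)
qed

section \<open>The map $a_2$\<close>

lemma \<Delta>_4_lincomb:
  assumes "u \<in> carrier_vec 4" "v \<in> carrier_vec (4::nat)"
  shows "\<Delta> [x, r \<cdot>\<^sub>v u + s \<cdot>\<^sub>v v, y, z] = r * \<Delta> [x, u, y, z] + s * \<Delta> [x, v, y, z :: 'a::field vec]"
    and "\<Delta> [x, y, r \<cdot>\<^sub>v u + s \<cdot>\<^sub>v v, z] = r * \<Delta> [x, y, u, z] + s * \<Delta> [x, y, v, z]"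
  using assms by (simp_all add: \<Delta>_4 algebra_simps)

lemma \<Delta>_4_repeat: "\<Delta> [x, x, y, z] = 0" "\<Delta> [x, y, x, z] = 0" "\<Delta> [y, x, x, z] = 0"
  by (simp_all add: \<Delta>_4 algebra_simps)

lemma cramer_4_coordinate:
  assumes "i < 4"
  shows "\<Delta> [a, b, c, d] * x $ i = \<Delta> [x, b, c, d] * a $ i + \<Delta> [a, x, c, d] * b $ i +
    \<Delta> [a, b, x, d] * c $ i + \<Delta> [a, b, c, x] * (d :: 'a::field vec) $ i"
proof -
  have "i = 0 \<or> i = 1 \<or> i = 2 \<or> i = 3" using assms by arith
  then show ?thesis by (elim disjE) (simp_all add: \<Delta>_4 algebra_simps)
qed

lemma cramer_4:
  assumes "x \<in> carrier_vec 4" "u \<in> carrier_vec 4" "v \<in> carrier_vec 4"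
    and "\<Delta> [u, v, x, d] = 0" "\<Delta> [u, v, c, x] = 0" "\<Delta> [u, v, c, d] \<noteq> 0"
  shows "\<exists>r s. x = r \<cdot>\<^sub>v u + s \<cdot>\<^sub>v (v :: 'a::field vec)"
proof -
  have "x $ i = \<Delta> [x, v, c, d] / \<Delta> [u, v, c, d] * u $ i + \<Delta> [u, x, c, d] / \<Delta> [u, v, c, d] * v $ i"
    if "i < 4" for i
    using cramer_4_coordinate[OF that, of u v c d x] assms(4-6) by (simp add: field_simps)
  then have "x = (\<Delta> [x, v, c, d] / \<Delta> [u, v, c, d]) \<cdot>\<^sub>v u + (\<Delta> [u, x, c, d] / \<Delta> [u, v, c, d]) \<cdot>\<^sub>v v"
    using assms(1-3) by (intro eq_vecI) auto
  then show ?thesis by blast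
qed

lemma completion_4:
  assumes "l \<in> carrier_vec 4" "l \<noteq> 0\<^sub>v 4"
  shows "\<exists>p\<in>carrier_vec 4. \<exists>q\<in>carrier_vec 4. \<exists>r\<in>carrier_vec 4. \<Delta> [l, p, q, r :: 'a::field vec] \<noteq> 0"
proof -
  have "l $ 0 \<noteq> 0 \<or> l $ 1 \<noteq> 0 \<or> l $ 2 \<noteq> 0 \<or> l $ 3 \<noteq> 0"
  proof (rule ccontr)
    assume "\<not> ?thesis"
    then have "l $ i = 0" if "i < 4" for i
      using that by (cases "i = 0 \<or> i = 1 \<or> i = 2 \<or> i = 3") auto
    then have "l = 0\<^sub>v 4" using assms(1) by (intro eq_vecI) auto
    then show False using assms(2) by simp
  qed
  moreover have "\<Delta> [l, unit_vec 4 1, unit_vec 4 2, unit_vec 4 3] = l $ 0"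
    "\<Delta> [l, unit_vec 4 0, unit_vec 4 3, unit_vec 4 2] = l $ 1"
    "\<Delta> [l, unit_vec 4 0, unit_vec 4 1, unit_vec 4 3] = l $ 2"
    "\<Delta> [l, unit_vec 4 0, unit_vec 4 2, unit_vec 4 1] = l $ 3"
    by (simp_all add: \<Delta>_4)
  ultimately show ?thesis by (metis unit_vec_carrier)
qed

lemma project_4:
  fixes x :: "'a::field vec"
  assumes "x \<in> carrier_vec 4" "x \<noteq> 0\<^sub>v 4"
  obtains P r where "r \<noteq> 0" "P \<in> carrier_mat 3 4" "project [x] = map ((*\<^sub>v) P)"
    "\<And>a b c. a \<in> carrier_vec 4 \<Longrightarrow> b \<in> carrier_vec 4 \<Longrightarrow> c \<in> carrier_vec 4 \<Longrightarrow>
      \<Delta> [P *\<^sub>v a, P *\<^sub>v b, P *\<^sub>v c] = r * \<Delta> [x, a, b, c]"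
    "\<And>w. w \<in> carrier_vec 3 \<Longrightarrow> \<exists>u\<in>carrier_vec 4. w = P *\<^sub>v u"
proof -
  obtain p q s where pq: "p \<in> carrier_vec 4" "q \<in> carrier_vec 4" "s \<in> carrier_vec 4" "\<Delta> [x, p, q, s] \<noteq> 0"
    using completion_4[OF assms] by blast
  obtain P r where P: "r \<noteq> 0" "P \<in> carrier_mat 3 (Suc 3)" "project [x] = map ((*\<^sub>v) P)"
    "\<And>bs. set bs \<subseteq> carrier_vec (Suc 3) \<Longrightarrow> length bs = 3 \<Longrightarrow> \<Delta> (map ((*\<^sub>v) P) bs) = r * \<Delta> (x # bs)"
    "\<And>w. w \<in> carrier_vec 3 \<Longrightarrow> \<exists>u\<in>carrier_vec (Suc 3). w = P *\<^sub>v u"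
    by (rule project_point[of x 3 "[p, q, s]"]) (use assms pq in auto)
  show thesis
  proof (rule that[OF P(1) _ P(3)])
    show "\<Delta> [P *\<^sub>v a, P *\<^sub>v b, P *\<^sub>v c] = r * \<Delta> [x, a, b, c]"
      if "a \<in> carrier_vec 4" "b \<in> carrier_vec 4" "c \<in> carrier_vec 4" for a b c
      using P(4)[of "[a, b, c]"] that by simp
  qed (use P(2,5) in auto)
qed

text \<open>The two consequences of admissibility that are needed are the absence of a common vertex
  and of a common edge line. The latter presupposes nondegenerate edges, as only these span
  lines.\<close>

lemma admissible2_D:
  fixes L M :: "'a::field points"
  assumes adm: "admissible 2 (L, M)"
  shows "length L = 3" "length M = 3" "set L \<subseteq> carrier_vec 3 - {0\<^sub>v 3}" "set M \<subseteq> carrier_vec 3 - {0\<^sub>v 3}"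
    and "i < 3 \<Longrightarrow> j < 3 \<Longrightarrow> \<not> par (L ! i) (M ! j)"
    and "i < 3 \<Longrightarrow> j < 3 \<Longrightarrow> i \<noteq> j \<Longrightarrow> p < 3 \<Longrightarrow> q < 3 \<Longrightarrow> p \<noteq> q \<Longrightarrow> \<not> par (L ! i) (L ! j) \<Longrightarrow>
      \<not> par (M ! p) (M ! q) \<Longrightarrow> \<not> (\<Delta> [L ! i, M ! p, M ! q] = 0 \<and> \<Delta> [L ! j, M ! p, M ! q] = 0)"
proof -
  show len: "length L = 3" "length M = 3" and carr: "set L \<subseteq> carrier_vec 3 - {0\<^sub>v 3}" "set M \<subseteq> carrier_vec 3 - {0\<^sub>v 3}"
    using adm by (auto simp: admissible_def points_def)
  have nth: "L ! i \<in> carrier_vec 3 - {0\<^sub>v 3}" "M ! i \<in> carrier_vec 3 - {0\<^sub>v 3}" if "i < 3" for i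
    using carr len that by (metis nth_mem subset_iff)+
  show "\<not> par (L ! i) (M ! j)" if ij: "i < 3" "j < 3"
  proof
    assume "par (L ! i) (M ! j)"
    then obtain c where "c \<noteq> 0" "M ! j = c \<cdot>\<^sub>v L ! i"
      using par_scale[of "L ! i" "M ! j"] nth(1)[OF ij(1)] nth(2)[OF ij(2)] by auto
    then show False using admissible_vertices[OF adm, of i j c] ij by simp
  qed
  have lt: "\<not> (\<Delta> [L ! i, M ! p, M ! q] = 0 \<and> \<Delta> [L ! j, M ! p, M ! q] = 0)"
    if "i < j" "j < 3" "p < q" "q < 3" "\<not> par (L ! i) (L ! j)" "\<not> par (M ! p) (M ! q)" for i j p q
    using admissible_edges[OF adm that(1-4)] vec_span_line_eq[of "L ! i" "L ! j" "M ! p" "M ! q"]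
      nth[of i] nth[of j] nth[of p] nth[of q] that by auto
  show "\<not> (\<Delta> [L ! i, M ! p, M ! q] = 0 \<and> \<Delta> [L ! j, M ! p, M ! q] = 0)"
    if "i < 3" "j < 3" "i \<noteq> j" "p < 3" "q < 3" "p \<noteq> q" "\<not> par (L ! i) (L ! j)" "\<not> par (M ! p) (M ! q)"
  proof -
    have lt': "\<not> (\<Delta> [L ! i, M ! p, M ! q] = 0 \<and> \<Delta> [L ! j, M ! p, M ! q] = 0)"
      if "i < j" "j < 3" "\<not> par (L ! i) (L ! j)" for i j
      using lt[OF that(1,2) _ _ that(3)] \<open>p < 3\<close> \<open>q < 3\<close> \<open>p \<noteq> q\<close> \<open>\<not> par (M ! p) (M ! q)\<close> par_sym[of "M ! p" "M ! q"]
        \<Delta>_3_swap(2)[of "L ! i" "M ! q" "M ! p"] \<Delta>_3_swap(2)[of "L ! j" "M ! q" "M ! p"]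
      by (cases p q rule: linorder_cases) auto
    show ?thesis
      using lt'[of i j] lt'[of j i] that par_sym[of "L ! i" "L ! j"] by (cases i j rule: linorder_cases) auto
  qed
qed

definition pair2 :: "'a::field points \<times> 'a points \<Rightarrow> 'a B2"
  where "pair2 = (\<lambda>(L, M). \<Sum>i\<le>2. \<Sum>j\<le>2. (-1) ^ (i + j) *\<^sub>Q
    {cross_ratio (project [L!i] (omit i L @ omit j M))}\<^sub>2)"

lemma sym2_cross_ratio_project:
  fixes x :: "'a::field vec"
  assumes "set [x, a, b, c, d] \<subseteq> carrier_vec 3" "x \<noteq> 0\<^sub>v 3"
  shows "{cross_ratio (project [x] [a, b, c, d])}\<^sub>2 = br [x] a b c d"
proof -
  obtain P r where P: "r \<noteq> 0" "project [x] = map ((*\<^sub>v) P)"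
    "\<And>a b. a \<in> carrier_vec 3 \<Longrightarrow> b \<in> carrier_vec 3 \<Longrightarrow> \<Delta> [P *\<^sub>v a, P *\<^sub>v b] = r * \<Delta> [x, a, b]"
    using project_3[of x] assms by (metis insert_subset list.simps(15))
  show ?thesis using assms(1) P(1) by (simp add: cross_ratio_def br_def P(2,3))
qed

context infinite_field
begin

lemma pair2_eq_tri:
  fixes l0 l1 l2 m0 m1 m2 :: "'a vec"
  assumes "set [l0, l1, l2] \<subseteq> carrier_vec 3 - {0\<^sub>v 3}" "set [m0, m1, m2] \<subseteq> carrier_vec 3"
  shows "pair2 ([l0, l1, l2], [m0, m1, m2]) = tri l0 l1 l2 m0 m1 m2"
  using assms
  by (simp add: pair2_def sum_atMost_numeral omit_list sym2_cross_ratio_project tri_def)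

lemma tri_swap:
  fixes l0 l1 l2 m0 m1 m2 :: "'a vec"
  assumes "set [l0, l1, l2, m0, m1, m2] \<subseteq> carrier_vec 3"
  shows "tri l1 l0 l2 m0 m1 m2 = - tri l0 l1 l2 m0 m1 m2" "tri l0 l2 l1 m0 m1 m2 = - tri l0 l1 l2 m0 m1 m2"
    "tri l2 l1 l0 m0 m1 m2 = - tri l0 l1 l2 m0 m1 m2"
    "tri l0 l1 l2 m1 m0 m2 = - tri l0 l1 l2 m0 m1 m2" "tri l0 l1 l2 m0 m2 m1 = - tri l0 l1 l2 m0 m1 m2"
    "tri l0 l1 l2 m2 m1 m0 = - tri l0 l1 l2 m0 m1 m2"
  using assms unfolding tri_def
  by (simp_all add: br_1_swap(1)[of _ l0 l1] br_1_swap(1)[of _ l1 l2] br_1_swap(1)[of _ l0 l2]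
      br_1_swap(3)[of _ _ _ m0 m1] br_1_swap(3)[of _ _ _ m1 m2] br_1_swap(3)[of _ _ _ m0 m2])

lemma permute_list_transpose_3:
  fixes x :: "'a vec list"
  assumes "i < 3" "j < 3" "i \<noteq> j"
  shows "permute_list (transpose i j) [a, b, c] = [b, a, c] \<or>
    permute_list (transpose i j) [a, b, c] = [a, c, b] \<or> permute_list (transpose i j) [a, b, c] = [c, b, a]"
proof -
  have "i = 0 \<or> i = 1 \<or> i = 2" "j = 0 \<or> j = 1 \<or> j = 2" using assms by arith+
  then show ?thesis using assms(3)
    by (elim disjE) (simp_all add: permute_list_def upt_rec transpose_def)
qed

lemma pair2_permute:
  fixes L M :: "'a points"
  assumes "length L = 3" "length M = 3" "set L \<subseteq> carrier_vec 3 - {0\<^sub>v 3}" "set M \<subseteq> carrier_vec 3"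
    and \<sigma>: "\<sigma> permutes {..2}"
  shows "pair2 (permute_list \<sigma> L, M) = of_int (sign \<sigma>) *\<^sub>Q pair2 (L, M)"
    and "pair2 (L, permute_list \<sigma> M) = of_int (sign \<sigma>) *\<^sub>Q pair2 (L, M)"
proof -
  have \<sigma>3: "\<sigma> permutes {..<3}" using \<sigma> by (simp add: numeral_3_eq_3 numeral_2_eq_2 lessThan_Suc_atMost)
  obtain a b c where M: "M = [a, b, c]" using assms(2) length_3_conv[of M] by auto
  obtain u v w where L: "L = [u, v, w]" using assms(1) length_3_conv[of L] by auto
  show "pair2 (permute_list \<sigma> L, M) = of_int (sign \<sigma>) *\<^sub>Q pair2 (L, M)"
  proof (rule alternating_sign[OF \<sigma>3, where Q = "\<lambda>x. length x = 3 \<and> set x \<subseteq> carrier_vec 3 - {0\<^sub>v 3}"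
        and f = "\<lambda>x. pair2 (x, M)"])
    fix x :: "'a points" and i j :: nat
    assume x: "length x = 3 \<and> set x \<subseteq> carrier_vec 3 - {0\<^sub>v 3}" and ij: "i < 3" "j < 3" "i \<noteq> j"
    then obtain p q r where x3: "x = [p, q, r]" using length_3_conv[of x] by auto
    have carr: "set [p, q, r] \<subseteq> carrier_vec 3 - {0\<^sub>v 3}" "set [a, b, c] \<subseteq> carrier_vec 3"
      using x assms(4) by (auto simp: x3 M)
    show "(length (permute_list (transpose i j) x) = 3 \<and>
        set (permute_list (transpose i j) x) \<subseteq> carrier_vec 3 - {0\<^sub>v 3}) \<and>
        pair2 (permute_list (transpose i j) x, M) = - pair2 (x, M)"
      using permute_list_transpose_3[OF ij, of p q r] carr unfolding x3 M
      by (elim disjE) (simp_all add: pair2_eq_tri tri_swap[of p q r a b c])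
  qed (use assms in auto)
  show "pair2 (L, permute_list \<sigma> M) = of_int (sign \<sigma>) *\<^sub>Q pair2 (L, M)"
  proof (rule alternating_sign[OF \<sigma>3, where Q = "\<lambda>x. length x = 3 \<and> set x \<subseteq> carrier_vec 3"
        and f = "\<lambda>x. pair2 (L, x)"])
    fix x :: "'a points" and i j :: nat
    assume x: "length x = 3 \<and> set x \<subseteq> carrier_vec 3" and ij: "i < 3" "j < 3" "i \<noteq> j"
    then obtain p q r where x3: "x = [p, q, r]" using length_3_conv[of x] by auto
    have carr: "set [u, v, w] \<subseteq> carrier_vec 3 - {0\<^sub>v 3}" "set [p, q, r] \<subseteq> carrier_vec 3"
      using x assms(3) by (auto simp: x3 L)
    show "(length (permute_list (transpose i j) x) = 3 \<and>
        set (permute_list (transpose i j) x) \<subseteq> carrier_vec 3) \<and>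
        pair2 (L, permute_list (transpose i j) x) = - pair2 (L, x)"
      using permute_list_transpose_3[OF ij, of p q r] carr unfolding x3 L
      by (elim disjE) (simp_all add: pair2_eq_tri tri_swap[of u v w p q r])
  qed (use assms in auto)
qed

section \<open>The relations of \<open>A_rels 2\<close> under \<open>pair2\<close>\<close>

lemma br_project:
  assumes "r \<noteq> 0" "\<And>a b c. a \<in> carrier_vec 4 \<Longrightarrow> b \<in> carrier_vec 4 \<Longrightarrow> c \<in> carrier_vec 4 \<Longrightarrow>
      \<Delta> [P *\<^sub>v a, P *\<^sub>v b, P *\<^sub>v c] = r * \<Delta> [x, a, b, c :: 'a vec]"
    and "set [k, a, b, c, d] \<subseteq> carrier_vec 4"
  shows "br [P *\<^sub>v k] (P *\<^sub>v a) (P *\<^sub>v b) (P *\<^sub>v c) (P *\<^sub>v d) = br [x, k] a b c d"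
  using assms by (simp add: br_def)

text \<open>The dual relation for \<open>a\<close> and the four \<open>m i\<close>, seen from
  \<open>k\<close>. The hypotheses \<open>km\<close> and \<open>edge\<close> are what admissibility
  of the projections from the points \<open>m i\<close> provides when \<open>k\<close> and
  \<open>a\<close> are vertices of the other triangle; degenerate positions are still
  allowed.\<close>

lemma dual_five_term_4:
  fixes k a :: "'a vec" and m :: "nat \<Rightarrow> 'a vec"
  assumes carr: "k \<in> carrier_vec 4" "a \<in> carrier_vec 4" "\<And>i. i < 4 \<Longrightarrow> m i \<in> carrier_vec 4"
    and k: "k \<noteq> 0\<^sub>v 4"
    and M: "\<Delta> [m 0, m 1, m 2, m 3] \<noteq> 0"
    and ka: "u0 \<in> carrier_vec 4" "v0 \<in> carrier_vec 4" "\<Delta> [k, a, u0, v0] \<noteq> 0"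
    and km: "\<And>i j. i < 4 \<Longrightarrow> j < 4 \<Longrightarrow> i \<noteq> j \<Longrightarrow> \<exists>u\<in>carrier_vec 4. \<Delta> [m i, k, m j, u] \<noteq> 0"
    and edge: "\<And>i r s u. i < 4 \<Longrightarrow> r < 4 \<Longrightarrow> s < 4 \<Longrightarrow> distinct [i, r, s] \<Longrightarrow> u \<in> carrier_vec 4 \<Longrightarrow>
      \<Delta> [m i, k, a, u] \<noteq> 0 \<Longrightarrow> \<not> (\<Delta> [m i, k, m r, m s] = 0 \<and> \<Delta> [m i, a, m r, m s] = 0)"
  shows "dual_five_term [k] a (m 0) (m 1) (m 2) (m 3) = 0"
proof -
  \<comment> \<open>Otherwise k, a, m s all lie in a common plane with m q and m r. Seen from m q,
    both k and a then lie on the line through m r and m s, so by \<open>edge\<close> the points m q,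
    k, a are collinear; likewise m r, k, a. Thus k, m q, m r are collinear, against
    \<open>km\<close>.\<close>
  have nc: "\<Delta> [k, m q, m r, m s] \<noteq> 0 \<or> \<Delta> [k, m q, m r, a] \<noteq> 0"
    if qrs: "q < 4" "r < 4" "s < 4" "distinct [q, r, s]" for q r s
  proof (rule ccontr)
    assume "\<not> ?thesis"
    then have z: "\<Delta> [k, m q, m r, m s] = 0" "\<Delta> [k, m q, m r, a] = 0" by auto
    have mc: "m q \<in> carrier_vec 4" "m r \<in> carrier_vec 4" "m s \<in> carrier_vec 4" using qrs carr(3) by auto
    obtain u where u: "u \<in> carrier_vec 4" "\<Delta> [m q, k, m r, u] \<noteq> 0" using km[of q r] qrs by auto
    have "\<Delta> [m q, m r, k, a] = \<Delta> [k, m q, m r, a]" "\<Delta> [m q, m r, k, m s] = \<Delta> [k, m q, m r, m s]"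
      "\<Delta> [m q, m r, k, u] = - \<Delta> [m q, k, m r, u]"
      by (simp_all add: \<Delta>_4 algebra_simps)
    then have "\<Delta> [m q, m r, a, m s] = 0"
      using \<Delta>_pluecker[of "[m q, m r]" k a "m s" u] mc carr(1,2) u z by simp
    then have "\<Delta> [m q, a, m r, m s] = 0" "\<Delta> [m r, a, m q, m s] = 0"
      by (simp_all add: \<Delta>_4 algebra_simps)
    moreover have "\<Delta> [m q, k, m r, m s] = 0" "\<Delta> [m r, k, m q, m s] = 0"
      using z(1) by (simp_all add: \<Delta>_4 algebra_simps)
    ultimately have "\<Delta> [m q, k, a, w] = 0" "\<Delta> [m r, k, a, w] = 0" if "w \<in> carrier_vec 4" for w
      using edge[of q r s w] edge[of r q s w] qrs that by auto
    then have 0: "\<Delta> [m q, k, a, u0] = 0" "\<Delta> [m q, k, a, v0] = 0" "\<Delta> [m r, k, a, u0] = 0"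
      "\<Delta> [m r, k, a, v0] = 0" using ka by blast+
    have "\<Delta> [k, a, x, v0] = \<Delta> [x, k, a, v0]" "\<Delta> [k, a, u0, x] = - \<Delta> [x, k, a, u0]" for x
      by (simp_all add: \<Delta>_4 algebra_simps)
    with 0 have "\<Delta> [k, a, m q, v0] = 0" "\<Delta> [k, a, u0, m q] = 0" "\<Delta> [k, a, m r, v0] = 0"
      "\<Delta> [k, a, u0, m r] = 0" by simp_all
    then have on: "\<exists>s t. m q = s \<cdot>\<^sub>v k + t \<cdot>\<^sub>v a" "\<exists>s t. m r = s \<cdot>\<^sub>v k + t \<cdot>\<^sub>v a"
      using cramer_4[OF mc(1) carr(1,2) _ _ ka(3)] cramer_4[OF mc(2) carr(1,2) _ _ ka(3)] by blast+
    then obtain s t s' t' where "m q = s \<cdot>\<^sub>v k + t \<cdot>\<^sub>v a" "m r = s' \<cdot>\<^sub>v k + t' \<cdot>\<^sub>v a" by blast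
    then have "\<Delta> [k, m q, m r, u] = 0"
      using carr(1,2) by (simp add: \<Delta>_4_lincomb \<Delta>_4_repeat)
    moreover have "\<Delta> [m q, k, m r, u] = - \<Delta> [k, m q, m r, u]" by (simp add: \<Delta>_4 algebra_simps)
    ultimately show False using u(2) by simp
  qed
  \<comment> \<open>If all four determinants vanished, Cramer's rule in the basis formed by the
    \<open>m i\<close> would give k = 0.\<close>
  have ex: "\<Delta> [k, m 0, m 1, m 2] \<noteq> 0 \<or> \<Delta> [k, m 0, m 1, m 3] \<noteq> 0 \<or> \<Delta> [k, m 0, m 2, m 3] \<noteq> 0 \<or>
    \<Delta> [k, m 1, m 2, m 3] \<noteq> 0"
  proof (rule ccontr)
    assume *: "\<not> ?thesis"
    have "\<Delta> [m 0, k, m 2, m 3] = - \<Delta> [k, m 0, m 2, m 3]" "\<Delta> [m 0, m 1, k, m 3] = \<Delta> [k, m 0, m 1, m 3]"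
      "\<Delta> [m 0, m 1, m 2, k] = - \<Delta> [k, m 0, m 1, m 2]"
      by (simp_all add: \<Delta>_4 algebra_simps)
    then have "k $ i = 0" if "i < 4" for i
      using cramer_4_coordinate[OF that, of "m 0" "m 1" "m 2" "m 3" k] * M by simp
    then have "k = 0\<^sub>v 4" using carr(1) by (intro eq_vecI) auto
    then show False using k by simp
  qed
  obtain P r where P: "r \<noteq> 0" "P \<in> carrier_mat 3 4"
    "\<And>a b c. a \<in> carrier_vec 4 \<Longrightarrow> b \<in> carrier_vec 4 \<Longrightarrow> c \<in> carrier_vec 4 \<Longrightarrow>
      \<Delta> [P *\<^sub>v a, P *\<^sub>v b, P *\<^sub>v c] = r * \<Delta> [k, a, b, c]"
    by (rule project_4[OF carr(1) k]) blast
  have mc: "m 0 \<in> carrier_vec 4" "m 1 \<in> carrier_vec 4" "m 2 \<in> carrier_vec 4" "m 3 \<in> carrier_vec 4"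
    using carr(3) by auto
  have "dual_five_term [] (P *\<^sub>v a) (P *\<^sub>v m 0) (P *\<^sub>v m 1) (P *\<^sub>v m 2) (P *\<^sub>v m 3) = 0"
  proof (rule dual_five_term_zero)
    show "set [P *\<^sub>v a, P *\<^sub>v m 0, P *\<^sub>v m 1, P *\<^sub>v m 2, P *\<^sub>v m 3] \<subseteq> carrier_vec 3"
      using P(2) mc carr(2) by auto
    show "\<Delta> [P *\<^sub>v m 0, P *\<^sub>v m 1, P *\<^sub>v m 2] \<noteq> 0 \<or> \<Delta> [P *\<^sub>v m 0, P *\<^sub>v m 1, P *\<^sub>v m 3] \<noteq> 0 \<or>
      \<Delta> [P *\<^sub>v m 0, P *\<^sub>v m 2, P *\<^sub>v m 3] \<noteq> 0 \<or> \<Delta> [P *\<^sub>v m 1, P *\<^sub>v m 2, P *\<^sub>v m 3] \<noteq> 0"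
      using ex mc P(1) by (simp only: P(3) mult_eq_0_iff) blast
    fix x y z
    have nc': "\<Delta> [P *\<^sub>v m q, P *\<^sub>v m r, P *\<^sub>v m s] \<noteq> 0 \<or> \<Delta> [P *\<^sub>v m q, P *\<^sub>v m r, P *\<^sub>v a] \<noteq> 0"
      if "q < 4" "r < 4" "s < 4" "distinct [q, r, s]" for q r s
      using nc[OF that] P(1) that carr by (simp add: P(3))
    assume "(x, y, z) \<in> set [(P *\<^sub>v m 1, P *\<^sub>v m 2, P *\<^sub>v m 3), (P *\<^sub>v m 1, P *\<^sub>v m 3, P *\<^sub>v m 2),
      (P *\<^sub>v m 2, P *\<^sub>v m 3, P *\<^sub>v m 1), (P *\<^sub>v m 0, P *\<^sub>v m 2, P *\<^sub>v m 3), (P *\<^sub>v m 0, P *\<^sub>v m 3, P *\<^sub>v m 2),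
      (P *\<^sub>v m 2, P *\<^sub>v m 3, P *\<^sub>v m 0), (P *\<^sub>v m 0, P *\<^sub>v m 1, P *\<^sub>v m 3), (P *\<^sub>v m 0, P *\<^sub>v m 3, P *\<^sub>v m 1),
      (P *\<^sub>v m 1, P *\<^sub>v m 3, P *\<^sub>v m 0), (P *\<^sub>v m 0, P *\<^sub>v m 1, P *\<^sub>v m 2), (P *\<^sub>v m 0, P *\<^sub>v m 2, P *\<^sub>v m 1),
      (P *\<^sub>v m 1, P *\<^sub>v m 2, P *\<^sub>v m 0)]"
    then show "\<Delta> [x, y, z] \<noteq> 0 \<or> \<Delta> [x, y, P *\<^sub>v a] \<noteq> 0"
      using nc'[of 1 2 3] nc'[of 1 3 2] nc'[of 2 3 1] nc'[of 0 2 3] nc'[of 0 3 2] nc'[of 2 3 0]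
        nc'[of 0 1 3] nc'[of 0 3 1] nc'[of 1 3 0] nc'[of 0 1 2] nc'[of 0 2 1] nc'[of 1 2 0]
      by (simp only: list.set insert_iff prod.inject empty_iff) (elim disjE; simp)
  qed
  then show ?thesis
    using mc carr(2) by (simp add: dual_five_term_def br_project[OF P(1,3)])
qed

end

lemma \<Delta>_4_zero_swap:
  "\<Delta> [b, a, c, d] = 0 \<longleftrightarrow> \<Delta> [a, b, c, d] = 0" "\<Delta> [a, c, b, d] = 0 \<longleftrightarrow> \<Delta> [a, b, c, d] = 0"
  "\<Delta> [a, b, d, c] = 0 \<longleftrightarrow> \<Delta> [a, b, c, d] = 0"
  by (simp_all add: \<Delta>_4_swap(1)[of b a] \<Delta>_4_swap(2)[of a c b] \<Delta>_4_swap(3)[of a b d c])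

lemma nth_omit_skip:
  assumes "i < length M" "j < length M" "i \<noteq> j"
  defines "p \<equiv> if j < i then j else j - 1"
  shows "p < length M - 1" "omit i M ! p = M ! j"
proof -
  show "p < length M - 1" using assms by (auto simp: p_def)
  then show "omit i M ! p = M ! j" using assms nth_omit[of i M p] by (auto simp: p_def)
qed

context infinite_field
begin

text \<open>Restates the results on triangles in the plane for a projection from \<open>x\<close>,
  with determinants that contain \<open>x\<close>. The last two clauses keep the part of
  admissibility that \<open>dual_five_term_4\<close> will need.\<close>

lemma pair2_project:
  fixes x :: "'a vec"
  assumes x: "x \<in> carrier_vec 4" "x \<noteq> 0\<^sub>v 4"
    and carr: "set [l0, l1, l2, m0, m1, m2] \<subseteq> carrier_vec 4"
    and adm: "admissible 2 (project [x] [l0, l1, l2], project [x] [m0, m1, m2])"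
  defines "e \<equiv> \<lambda>k a. br [x, k] a m0 m1 m2 - br [x, a] k m0 m1 m2"
  shows "pair2 (project [x] [l0, l1, l2], project [x] [m0, m1, m2]) = e l0 l1 + e l1 l2 - e l0 l2"
    and "\<Delta> [x, m0, m1, m2] = 0 \<Longrightarrow> pair2 (project [x] [l0, l1, l2], project [x] [m0, m1, m2]) = 0"
    and "i < 3 \<Longrightarrow> j < 3 \<Longrightarrow> \<exists>u\<in>carrier_vec 4. \<Delta> [x, [l0, l1, l2] ! i, [m0, m1, m2] ! j, u] \<noteq> 0"
    and "i < 3 \<Longrightarrow> j < 3 \<Longrightarrow> i \<noteq> j \<Longrightarrow> p < 3 \<Longrightarrow> q < 3 \<Longrightarrow> p \<noteq> q \<Longrightarrow> u \<in> carrier_vec 4 \<Longrightarrow> w \<in> carrier_vec 4 \<Longrightarrow>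
      \<Delta> [x, [l0, l1, l2] ! i, [l0, l1, l2] ! j, u] \<noteq> 0 \<Longrightarrow> \<Delta> [x, [m0, m1, m2] ! p, [m0, m1, m2] ! q, w] \<noteq> 0 \<Longrightarrow>
      \<not> (\<Delta> [x, [l0, l1, l2] ! i, [m0, m1, m2] ! p, [m0, m1, m2] ! q] = 0 \<and>
        \<Delta> [x, [l0, l1, l2] ! j, [m0, m1, m2] ! p, [m0, m1, m2] ! q] = 0)"
proof -
  obtain P r where P: "r \<noteq> 0" "P \<in> carrier_mat 3 4" "project [x] = map ((*\<^sub>v) P)"
    "\<And>a b c. a \<in> carrier_vec 4 \<Longrightarrow> b \<in> carrier_vec 4 \<Longrightarrow> c \<in> carrier_vec 4 \<Longrightarrow>
      \<Delta> [P *\<^sub>v a, P *\<^sub>v b, P *\<^sub>v c] = r * \<Delta> [x, a, b, c]"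
    "\<And>w. w \<in> carrier_vec 3 \<Longrightarrow> \<exists>u\<in>carrier_vec 4. w = P *\<^sub>v u"
    by (rule project_4[OF x]) blast
  note a = admissible2_D[OF adm[unfolded P(3)]]
  have par: "par (P *\<^sub>v u) (P *\<^sub>v v) \<longleftrightarrow> (\<forall>w\<in>carrier_vec 4. \<Delta> [x, u, v, w] = 0)"
    if "u \<in> carrier_vec 4" "v \<in> carrier_vec 4" for u v
  proof -
    have "par (P *\<^sub>v u) (P *\<^sub>v v) \<longleftrightarrow> (\<forall>w\<in>carrier_vec 4. \<Delta> [P *\<^sub>v u, P *\<^sub>v v, P *\<^sub>v w] = 0)"
      unfolding par_def using P(2,5) by (metis mult_mat_vec_carrier)
    then show ?thesis using that P(1,4) by simp
  qed
  have Lc: "set [P *\<^sub>v l0, P *\<^sub>v l1, P *\<^sub>v l2] \<subseteq> carrier_vec 3 - {0\<^sub>v 3}"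
    and Mc: "set [P *\<^sub>v m0, P *\<^sub>v m1, P *\<^sub>v m2] \<subseteq> carrier_vec 3"
    using a(3,4) by auto
  have LM: "\<not> par l m" if "l \<in> {P *\<^sub>v l0, P *\<^sub>v l1, P *\<^sub>v l2}" "m \<in> {P *\<^sub>v m0, P *\<^sub>v m1, P *\<^sub>v m2}" for l m
    using that a(5)[of 0 0] a(5)[of 0 1] a(5)[of 0 2] a(5)[of 1 0] a(5)[of 1 1] a(5)[of 1 2]
      a(5)[of 2 0] a(5)[of 2 1] a(5)[of 2 2] by auto
  have tri: "pair2 (project [x] [l0, l1, l2], project [x] [m0, m1, m2]) =
      tri (P *\<^sub>v l0) (P *\<^sub>v l1) (P *\<^sub>v l2) (P *\<^sub>v m0) (P *\<^sub>v m1) (P *\<^sub>v m2)"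
    unfolding P(3) using pair2_eq_tri[OF Lc Mc] by simp
  have "edge (P *\<^sub>v k) (P *\<^sub>v a) (P *\<^sub>v m0) (P *\<^sub>v m1) (P *\<^sub>v m2) = e k a"
    if "k \<in> carrier_vec 4" "a \<in> carrier_vec 4" for k a
    using that carr by (simp add: edge_def e_def br_project[OF P(1,4)])
  then show "pair2 (project [x] [l0, l1, l2], project [x] [m0, m1, m2]) = e l0 l1 + e l1 l2 - e l0 l2"
    using tri_eq_edges(1)[OF Lc Mc LM] carr by (simp add: tri)
  have E: "\<not> (\<Delta> [[P *\<^sub>v l0, P *\<^sub>v l1, P *\<^sub>v l2] ! i, [P *\<^sub>v m0, P *\<^sub>v m1, P *\<^sub>v m2] ! p, [P *\<^sub>v m0, P *\<^sub>v m1, P *\<^sub>v m2] ! q] = 0 \<and>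
      \<Delta> [[P *\<^sub>v l0, P *\<^sub>v l1, P *\<^sub>v l2] ! j, [P *\<^sub>v m0, P *\<^sub>v m1, P *\<^sub>v m2] ! p, [P *\<^sub>v m0, P *\<^sub>v m1, P *\<^sub>v m2] ! q] = 0)"
    if "i < 3" "j < 3" "i \<noteq> j" "p < 3" "q < 3" "p \<noteq> q"
      "\<not> par ([P *\<^sub>v l0, P *\<^sub>v l1, P *\<^sub>v l2] ! i) ([P *\<^sub>v l0, P *\<^sub>v l1, P *\<^sub>v l2] ! j)"
      "\<not> par ([P *\<^sub>v m0, P *\<^sub>v m1, P *\<^sub>v m2] ! p) ([P *\<^sub>v m0, P *\<^sub>v m1, P *\<^sub>v m2] ! q)" for i j p q
    using a(6)[of i j p q] that by simp
  show "pair2 (project [x] [l0, l1, l2], project [x] [m0, m1, m2]) = 0" if D: "\<Delta> [x, m0, m1, m2] = 0"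
    unfolding tri
  proof (rule tri_M_collinear[OF Lc Mc LM])
    show "\<not> (\<Delta> [k, P *\<^sub>v m0, P *\<^sub>v m1] = 0 \<and> \<Delta> [a, P *\<^sub>v m0, P *\<^sub>v m1] = 0)"
      if "(k, a) \<in> {(P *\<^sub>v l0, P *\<^sub>v l1), (P *\<^sub>v l0, P *\<^sub>v l2), (P *\<^sub>v l1, P *\<^sub>v l2)}" "\<not> par k a"
        "\<not> par (P *\<^sub>v m0) (P *\<^sub>v m1)" for k a
      using that E[of 0 1 0 1] E[of 0 2 0 1] E[of 1 2 0 1] by auto
    show "\<Delta> [P *\<^sub>v m0, P *\<^sub>v m1, P *\<^sub>v m2] = 0" using D carr by (simp add: P(4))
  qed
  have nL: "[P *\<^sub>v l0, P *\<^sub>v l1, P *\<^sub>v l2] ! i = P *\<^sub>v ([l0, l1, l2] ! i)" "[l0, l1, l2] ! i \<in> carrier_vec 4"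
    and nM: "[P *\<^sub>v m0, P *\<^sub>v m1, P *\<^sub>v m2] ! i = P *\<^sub>v ([m0, m1, m2] ! i)" "[m0, m1, m2] ! i \<in> carrier_vec 4"
    if "i < 3" for i
  proof -
    have "i = 0 \<or> i = 1 \<or> i = 2" using that by arith
    then show "[P *\<^sub>v l0, P *\<^sub>v l1, P *\<^sub>v l2] ! i = P *\<^sub>v ([l0, l1, l2] ! i)" "[l0, l1, l2] ! i \<in> carrier_vec 4"
      "[P *\<^sub>v m0, P *\<^sub>v m1, P *\<^sub>v m2] ! i = P *\<^sub>v ([m0, m1, m2] ! i)" "[m0, m1, m2] ! i \<in> carrier_vec 4"
      using carr by (elim disjE; simp)+
  qed
  show "\<exists>u\<in>carrier_vec 4. \<Delta> [x, [l0, l1, l2] ! i, [m0, m1, m2] ! j, u] \<noteq> 0" if "i < 3" "j < 3"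
    using a(5)[OF that] par[OF nL(2)[OF that(1)] nM(2)[OF that(2)]] nL(1)[OF that(1)] nM(1)[OF that(2)]
    by auto
  show "\<not> (\<Delta> [x, [l0, l1, l2] ! i, [m0, m1, m2] ! p, [m0, m1, m2] ! q] = 0 \<and>
        \<Delta> [x, [l0, l1, l2] ! j, [m0, m1, m2] ! p, [m0, m1, m2] ! q] = 0)"
    if ij: "i < 3" "j < 3" "i \<noteq> j" "p < 3" "q < 3" "p \<noteq> q" and u: "u \<in> carrier_vec 4" "w \<in> carrier_vec 4"
      "\<Delta> [x, [l0, l1, l2] ! i, [l0, l1, l2] ! j, u] \<noteq> 0" "\<Delta> [x, [m0, m1, m2] ! p, [m0, m1, m2] ! q, w] \<noteq> 0"
  proof -
    have np: "\<not> par (P *\<^sub>v ([l0, l1, l2] ! i)) (P *\<^sub>v ([l0, l1, l2] ! j))"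
      "\<not> par (P *\<^sub>v ([m0, m1, m2] ! p)) (P *\<^sub>v ([m0, m1, m2] ! q))"
      using u par[OF nL(2)[OF ij(1)] nL(2)[OF ij(2)]] par[OF nM(2)[OF ij(4)] nM(2)[OF ij(5)]] by blast+
    show ?thesis
      using E[OF ij, unfolded nL(1)[OF ij(1)] nL(1)[OF ij(2)] nM(1)[OF ij(4)] nM(1)[OF ij(5)], OF np]
        P(4)[OF nL(2)[OF ij(1)] nM(2)[OF ij(4)] nM(2)[OF ij(5)]]
        P(4)[OF nL(2)[OF ij(2)] nM(2)[OF ij(4)] nM(2)[OF ij(5)]] by auto
  qed
qed

text \<open>If the \<open>m\<close>'s are coplanar, every term is 0. Otherwise let X(k, a) be the
  alternating sum over i of the bracket with center m_i k on a and the other three m's. By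
  \<open>pair2_project\<close> the relation is a sum of differences X(k, a) - X(a, k) over the edges
  of the first triangle. The dual relation seen from k identifies X(k, a) with the bracket of the
  four m's seen from the line ka, which is symmetric in k and a.\<close>

lemma pair2_project_M_relation:
  fixes l0 l1 l2 m0 m1 m2 m3 :: "'a vec"
  assumes L: "set [l0, l1, l2] \<subseteq> carrier_vec 4 - {0\<^sub>v 4}" and M: "set [m0, m1, m2, m3] \<subseteq> carrier_vec 4 - {0\<^sub>v 4}"
    and adm: "admissible 2 (project [m0] [l0, l1, l2], project [m0] [m1, m2, m3])"
      "admissible 2 (project [m1] [l0, l1, l2], project [m1] [m0, m2, m3])"
      "admissible 2 (project [m2] [l0, l1, l2], project [m2] [m0, m1, m3])"
      "admissible 2 (project [m3] [l0, l1, l2], project [m3] [m0, m1, m2])"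
  shows "pair2 (project [m0] [l0, l1, l2], project [m0] [m1, m2, m3]) -
    pair2 (project [m1] [l0, l1, l2], project [m1] [m0, m2, m3]) +
    pair2 (project [m2] [l0, l1, l2], project [m2] [m0, m1, m3]) -
    pair2 (project [m3] [l0, l1, l2], project [m3] [m0, m1, m2]) = 0"
proof -
  have Lc: "set [l0, l1, l2] \<subseteq> carrier_vec 4" and Mc: "set [m0, m1, m2, m3] \<subseteq> carrier_vec 4"
    using L M by auto
  have c: "m0 \<in> carrier_vec 4" "m1 \<in> carrier_vec 4" "m2 \<in> carrier_vec 4" "m3 \<in> carrier_vec 4"
    "m0 \<noteq> 0\<^sub>v 4" "m1 \<noteq> 0\<^sub>v 4" "m2 \<noteq> 0\<^sub>v 4" "m3 \<noteq> 0\<^sub>v 4"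
    "set [l0, l1, l2, m1, m2, m3] \<subseteq> carrier_vec 4" "set [l0, l1, l2, m0, m2, m3] \<subseteq> carrier_vec 4"
    "set [l0, l1, l2, m0, m1, m3] \<subseteq> carrier_vec 4" "set [l0, l1, l2, m0, m1, m2] \<subseteq> carrier_vec 4"
    using L M by auto
  note p0 = pair2_project[OF c(1,5,9) adm(1)] and p1 = pair2_project[OF c(2,6,10) adm(2)]
    and p2 = pair2_project[OF c(3,7,11) adm(3)] and p3 = pair2_project[OF c(4,8,12) adm(4)]
  show ?thesis
  proof (cases "\<Delta> [m0, m1, m2, m3] = 0")
    case True
    then have "\<Delta> [m1, m0, m2, m3] = 0" "\<Delta> [m2, m0, m1, m3] = 0" "\<Delta> [m3, m0, m1, m2] = 0"
      by (simp_all add: \<Delta>_4_zero_swap)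
    then show ?thesis using True p0(2) p1(2) p2(2) p3(2) by simp
  next
    case False
    define Ms where "Ms = [m0, m1, m2, m3]"
    define Ls where "Ls = [l0, l1, l2]"
    have lenM: "length Ms = 4" by (simp add: Ms_def)
    have km: "\<exists>u\<in>carrier_vec 4. \<Delta> [Ms ! i, Ls ! s, Ms ! j, u] \<noteq> 0"
      if "i < 4" "j < 4" "i \<noteq> j" "s < 3" for i j s
    proof -
      \<comment> \<open>Position of \<open>Ms ! j\<close> after removal of
        \<open>Ms ! i\<close>.\<close>
      define p where "p = (if j < i then j else j - 1)"
      have p: "p < 3" "omit i Ms ! p = Ms ! j"
        using nth_omit_skip[of i Ms j, folded p_def] that lenM by simp_all
      have "i = 0 \<or> i = 1 \<or> i = 2 \<or> i = 3" using that(1) by arith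
      then have "\<exists>u\<in>carrier_vec 4. \<Delta> [Ms ! i, Ls ! s, omit i Ms ! p, u] \<noteq> 0"
        unfolding Ms_def Ls_def
        using p0(3)[OF that(4) p(1)] p1(3)[OF that(4) p(1)] p2(3)[OF that(4) p(1)] p3(3)[OF that(4) p(1)]
        by (elim disjE; hypsubst; simp only: omit_list omit_list(5)[unfolded numeral_3_eq_3] nth_Cons_0 One_nat_def nth_Cons_Suc numeral_2_eq_2 numeral_3_eq_3)
      then show ?thesis by (simp only: p(2))
    qed
    have vol: "\<exists>w\<in>carrier_vec 4. \<Delta> [Ms ! i, Ms ! r, Ms ! s, w] \<noteq> 0"
      if "i < 4" "r < 4" "s < 4" "distinct [i, r, s]" for i r s
    proof -
      have "i = 0 \<or> i = 1 \<or> i = 2 \<or> i = 3" "r = 0 \<or> r = 1 \<or> r = 2 \<or> r = 3" "s = 0 \<or> s = 1 \<or> s = 2 \<or> s = 3"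
        using that by arith+
      then have "\<Delta> [Ms ! i, Ms ! r, Ms ! s, m0] \<noteq> 0 \<or> \<Delta> [Ms ! i, Ms ! r, Ms ! s, m1] \<noteq> 0 \<or>
        \<Delta> [Ms ! i, Ms ! r, Ms ! s, m2] \<noteq> 0 \<or> \<Delta> [Ms ! i, Ms ! r, Ms ! s, m3] \<noteq> 0"
        using that(4) False by (elim disjE) (simp_all add: Ms_def \<Delta>_4_zero_swap)
      then show ?thesis using c(1-4) by blast
    qed
    have edge: "\<not> (\<Delta> [Ms ! i, Ls ! s, Ms ! p, Ms ! q] = 0 \<and> \<Delta> [Ms ! i, Ls ! t, Ms ! p, Ms ! q] = 0)"
      if d: "i < 4" "p < 4" "q < 4" "distinct [i, p, q]" "u \<in> carrier_vec 4" "\<Delta> [Ms ! i, Ls ! s, Ls ! t, u] \<noteq> 0"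
        "s < 3" "t < 3" "s \<noteq> t" for i p q u s t
    proof -
      define p' where "p' = (if p < i then p else p - 1)"
      have p': "p' < 3" "omit i Ms ! p' = Ms ! p"
        using nth_omit_skip[of i Ms p, folded p'_def] d lenM by simp_all
      define q' where "q' = (if q < i then q else q - 1)"
      have q': "q' < 3" "omit i Ms ! q' = Ms ! q"
        using nth_omit_skip[of i Ms q, folded q'_def] d lenM by simp_all
      have pq: "p' \<noteq> q'" using d(4) unfolding p'_def q'_def by (auto split: if_splits)
      obtain w where w: "w \<in> carrier_vec 4" "\<Delta> [Ms ! i, omit i Ms ! p', omit i Ms ! q', w] \<noteq> 0"
        using vol[of i p q] d(1-4) p'(2) q'(2) by auto
      have "i = 0 \<or> i = 1 \<or> i = 2 \<or> i = 3" using d(1) by arith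
      then have "\<not> (\<Delta> [Ms ! i, Ls ! s, omit i Ms ! p', omit i Ms ! q'] = 0 \<and>
          \<Delta> [Ms ! i, Ls ! t, omit i Ms ! p', omit i Ms ! q'] = 0)"
        using d(6) w(2) unfolding Ms_def Ls_def
        using p0(4)[OF d(7-9) p'(1) q'(1) pq d(5) w(1)] p1(4)[OF d(7-9) p'(1) q'(1) pq d(5) w(1)]
          p2(4)[OF d(7-9) p'(1) q'(1) pq d(5) w(1)] p3(4)[OF d(7-9) p'(1) q'(1) pq d(5) w(1)]
        by (elim disjE; hypsubst; simp only: omit_list omit_list(5)[unfolded numeral_3_eq_3] nth_Cons_0 One_nat_def nth_Cons_Suc numeral_2_eq_2 numeral_3_eq_3)
      then show ?thesis unfolding p'(2) q'(2) .
    qed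
    define X where "X k a = br [m0, k] a m1 m2 m3 - br [m1, k] a m0 m2 m3 + br [m2, k] a m0 m1 m3 -
      br [m3, k] a m0 m1 m2" for k a
    have Lnth: "Ls ! s \<in> carrier_vec 4" "Ls ! s \<noteq> 0\<^sub>v 4" if "s < 3" for s
    proof -
      have "Ls ! s \<in> set [l0, l1, l2]" using that unfolding Ls_def by (intro nth_mem) simp
      then show "Ls ! s \<in> carrier_vec 4" "Ls ! s \<noteq> 0\<^sub>v 4" using L by blast+
    qed
    have X: "X (Ls ! s) (Ls ! t) = X (Ls ! t) (Ls ! s)" if st: "s < 3" "t < 3" "s \<noteq> t" for s t
    proof (cases "\<exists>u\<in>carrier_vec 4. \<exists>v\<in>carrier_vec 4. \<Delta> [Ls ! s, Ls ! t, u, v] \<noteq> 0")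
      case True
      then obtain u v where uv: "u \<in> carrier_vec 4" "v \<in> carrier_vec 4" "\<Delta> [Ls ! s, Ls ! t, u, v] \<noteq> 0"
        by blast
      have "dual_five_term [Ls ! s'] (Ls ! t') (Ms ! 0) (Ms ! 1) (Ms ! 2) (Ms ! 3) = 0"
        if st': "s' < 3" "t' < 3" "s' \<noteq> t'" "\<Delta> [Ls ! s', Ls ! t', u, v] \<noteq> 0" for s' t'
      proof (rule dual_five_term_4[OF Lnth(1)[OF st'(1)] Lnth(1)[OF st'(2)] _ Lnth(2)[OF st'(1)] _ uv(1,2) st'(4)])
        show "Ms ! i \<in> carrier_vec 4" if "i < 4" for i
          using nth_mem[of i Ms] that Mc lenM unfolding Ms_def by (simp only: subset_iff)
        show "\<Delta> [Ms ! 0, Ms ! 1, Ms ! 2, Ms ! 3] \<noteq> 0" using False by (simp add: Ms_def)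
        show "\<exists>u\<in>carrier_vec 4. \<Delta> [Ms ! i, Ls ! s', Ms ! j, u] \<noteq> 0" if "i < 4" "j < 4" "i \<noteq> j" for i j
          by (rule km[OF that st'(1)])
        show "\<not> (\<Delta> [Ms ! i, Ls ! s', Ms ! r, Ms ! q] = 0 \<and> \<Delta> [Ms ! i, Ls ! t', Ms ! r, Ms ! q] = 0)"
          if "i < 4" "r < 4" "q < 4" "distinct [i, r, q]" "u \<in> carrier_vec 4" "\<Delta> [Ms ! i, Ls ! s', Ls ! t', u] \<noteq> 0"
          for i r q u
          by (rule edge[OF that st'(1-3)])
      qed
      then have "dual_five_term [Ls ! s] (Ls ! t) m0 m1 m2 m3 = 0" "dual_five_term [Ls ! t] (Ls ! s) m0 m1 m2 m3 = 0"
        using st uv(3) by (auto simp: Ms_def \<Delta>_4_zero_swap(1)[of "Ls ! t" "Ls ! s"])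
      then have "br [Ls ! s, Ls ! t] m0 m1 m2 m3 = X (Ls ! s) (Ls ! t)"
        "br [Ls ! t, Ls ! s] m0 m1 m2 m3 = X (Ls ! t) (Ls ! s)"
        by (simp_all add: dual_five_term_def X_def br_center_swap algebra_simps)
      then show ?thesis using br_center_swap[of "Ls ! s" "Ls ! t"] by metis
    next
      \<comment> \<open>Now \<open>Ls ! s\<close> and \<open>Ls ! t\<close> are dependent, and every
        bracket in \<open>X\<close> has its first point in the span of its center.\<close>
      case False
      have "br [m, k] a p q r = 0" if m: "{m, p, q, r} \<subseteq> {m0, m1, m2, m3}" and ka: "(k, a) = (Ls ! s, Ls ! t) \<or> (k, a) = (Ls ! t, Ls ! s)"
        for m k a p q r
      proof -
        have carr: "m \<in> carrier_vec 4" "p \<in> carrier_vec 4" "q \<in> carrier_vec 4" "r \<in> carrier_vec 4"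
          "k \<in> carrier_vec 4" "a \<in> carrier_vec 4"
        proof -
          have "{m, p, q, r} \<subseteq> carrier_vec 4" by (rule order_trans[OF m]) (use c(1-4) in simp)
          then show "m \<in> carrier_vec 4" "p \<in> carrier_vec 4" "q \<in> carrier_vec 4" "r \<in> carrier_vec 4"
            by simp_all
          show "k \<in> carrier_vec 4" "a \<in> carrier_vec 4"
            using ka Lnth(1)[OF st(1)] Lnth(1)[OF st(2)] by auto
        qed
        have "\<Delta> [Ls ! s, Ls ! t, m, p] = 0" using False carr(1,2) by blast
        then have "\<Delta> [m, k, a, p] = 0"
          using ka by (elim disjE) (simp_all add: \<Delta>_4_zero_swap)
        then show ?thesis using carr by (intro br_eq_0) auto
      qed
      then show ?thesis by (simp add: X_def)
    qed
    have "X l0 l1 = X l1 l0" "X l0 l2 = X l2 l0" "X l1 l2 = X l2 l1"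
      using X[of 0 1] X[of 0 2] X[of 1 2] by (simp_all add: Ls_def)
    then have "(X l0 l1 - X l1 l0) - (X l0 l2 - X l2 l0) + (X l1 l2 - X l2 l1) = 0" by simp
    then show ?thesis
      unfolding p0(1) p1(1) p2(1) p3(1) X_def by (simp add: algebra_simps)
  qed
qed

text \<open>Additivity in the first triangle telescopes through \<open>edge\<close>; in the second
  it is formal from \<open>tri\<close>. The projection relation in the first triangle is also
  formal, since a bracket does not depend on the order of its two centers. The projection relation
  in the second is where the dual five-term relation enters.\<close>

lemma pair2_relations:
  assumes "r \<in> A_rels 2"
  shows "lin_ext pair2 (r :: ('a points \<times> 'a points) free) = 0"
proof -
  have lists: "\<exists>l0 l1 l2 m0 m1 m2. L = [l0, l1, l2] \<and> M = [m0, m1, m2]" if "admissible 2 (L, M)" for L M :: "'a points"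
    using admissible2_D(1,2)[OF that] length_3_conv[of L] length_3_conv[of M] by blast
  have LM: "\<not> par l m" if adm: "admissible 2 ([l0, l1, l2], [m0, m1, m2])"
    and "l \<in> {l0, l1, l2}" "m \<in> {m0, m1, m2}" for l0 l1 l2 m0 m1 m2 l m :: "'a vec"
    using that(2,3) admissible2_D(5)[OF adm, of 0 0] admissible2_D(5)[OF adm, of 0 1] admissible2_D(5)[OF adm, of 0 2]
      admissible2_D(5)[OF adm, of 1 0] admissible2_D(5)[OF adm, of 1 1] admissible2_D(5)[OF adm, of 1 2]
      admissible2_D(5)[OF adm, of 2 0] admissible2_D(5)[OF adm, of 2 1] admissible2_D(5)[OF adm, of 2 2] by auto
  have tri: "pair2 (L, M) = tri l0 l1 l2 m0 m1 m2"
    if "admissible 2 (L, M)" "L = [l0, l1, l2]" "M = [m0, m1, m2]" for L M l0 l1 l2 m0 m1 m2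
    using pair2_eq_tri[of l0 l1 l2 m0 m1 m2] admissible2_D(3,4)[OF that(1)] that(2,3) by auto
  have rel1: "pair2 (L, M) = 0" if adm: "admissible 2 (L, M)" and H: "in_hyperplane 2 L \<or> in_hyperplane 2 M"
    for L M :: "'a points"
  proof -
    obtain l0 l1 l2 m0 m1 m2 where L: "L = [l0, l1, l2]" and M: "M = [m0, m1, m2]" using lists[OF adm] by blast
    note ad = adm[unfolded L M]
    have carr: "set [l0, l1, l2] \<subseteq> carrier_vec 3 - {0\<^sub>v 3}" "set [m0, m1, m2] \<subseteq> carrier_vec 3"
      using admissible2_D(3,4)[OF ad] by auto
    have "\<Delta> L = 0 \<or> \<Delta> M = 0"
      using H in_hyperplane_\<Delta>[of 2 L] in_hyperplane_\<Delta>[of 2 M] carr by (auto simp: L M)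
    then have "tri l0 l1 l2 m0 m1 m2 = 0"
    proof
      assume "\<Delta> L = 0"
      then show ?thesis using carr by (intro tri_L_collinear) (auto simp: L)
    next
      assume "\<Delta> M = 0"
      show ?thesis
      proof (rule tri_M_collinear[OF carr LM[OF ad]])
        show "\<not> (\<Delta> [k, m0, m1] = 0 \<and> \<Delta> [a, m0, m1] = 0)"
          if "(k, a) \<in> {(l0, l1), (l0, l2), (l1, l2)}" "\<not> par k a" "\<not> par m0 m1" for k a
          using that admissible2_D(6)[OF ad, of 0 1 0 1] admissible2_D(6)[OF ad, of 0 2 0 1]
            admissible2_D(6)[OF ad, of 1 2 0 1] by auto
        show "\<Delta> [m0, m1, m2] = 0" using \<open>\<Delta> M = 0\<close> by (simp add: M)
      qed
    qed
    then show ?thesis using tri[OF adm L M] by simp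
  qed
  have rel2: "pair2 (permute_list \<sigma> L, M) = of_int (sign \<sigma>) *\<^sub>Q pair2 (L, M)"
    "pair2 (L, permute_list \<sigma> M) = of_int (sign \<sigma>) *\<^sub>Q pair2 (L, M)"
    if adm: "admissible 2 (L, M)" and \<sigma>: "\<sigma> permutes {..2}" for L M :: "'a points" and \<sigma>
    using pair2_permute[OF admissible2_D(1,2,3)[OF adm] _ \<sigma>] admissible2_D(4)[OF adm] by auto
  have rel3: "(\<Sum>i\<le>Suc 2. (-1) ^ i *\<^sub>Q pair2 (omit i L, M)) = 0"
    if L: "length L = 2 + 2" and adm: "\<forall>i\<le>Suc 2. admissible 2 (omit i L, M)" for L M :: "'a points"
  proof -
    obtain a b c d where abcd: "L = [a, b, c, d]" using L length_4_conv[of L] by auto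
    have ad: "admissible 2 ([b, c, d], M)" "admissible 2 ([a, c, d], M)" "admissible 2 ([a, b, d], M)"
      "admissible 2 ([a, b, c], M)"
      using adm[rule_format, of 0] adm[rule_format, of 1] adm[rule_format, of 2] adm[rule_format, of 3]
      by (simp_all add: abcd omit_list)
    obtain m0 m1 m2 where M: "M = [m0, m1, m2]" using lists[OF ad(1)] by blast
    have e: "tri u v w m0 m1 m2 = edge u v m0 m1 m2 + edge v w m0 m1 m2 - edge u w m0 m1 m2"
      if "admissible 2 ([u, v, w], M)" for u v w
      by (rule tri_eq_edges(1)) (use admissible2_D(3,4)[OF that] LM[OF that[unfolded M]] in \<open>auto simp: M\<close>)
    show ?thesis
      unfolding sum_atMost_numeral
      using tri[OF ad(1) refl M] tri[OF ad(2) refl M] tri[OF ad(3) refl M] tri[OF ad(4) refl M]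
        e[OF ad(1)] e[OF ad(2)] e[OF ad(3)] e[OF ad(4)]
      by (simp add: abcd omit_list)
  qed
  have rel3': "(\<Sum>i\<le>Suc 2. (-1) ^ i *\<^sub>Q pair2 (L, omit i M)) = 0"
    if L: "length M = 2 + 2" and adm: "\<forall>i\<le>Suc 2. admissible 2 (L, omit i M)" for L M :: "'a points"
  proof -
    obtain a b c d where abcd: "M = [a, b, c, d]" using L length_4_conv[of M] by auto
    have ad: "admissible 2 (L, [b, c, d])" "admissible 2 (L, [a, c, d])" "admissible 2 (L, [a, b, d])"
      "admissible 2 (L, [a, b, c])"
      using adm[rule_format, of 0] adm[rule_format, of 1] adm[rule_format, of 2] adm[rule_format, of 3]
      by (simp_all add: abcd omit_list)
    obtain l0 l1 l2 where L: "L = [l0, l1, l2]" using lists[OF ad(1)] by blast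
    show ?thesis
      unfolding sum_atMost_numeral
      using tri[OF ad(1) L refl] tri[OF ad(2) L refl] tri[OF ad(3) L refl] tri[OF ad(4) L refl]
      by (simp add: abcd omit_list tri_def)
  qed
  have rel4: "(\<Sum>i\<le>Suc 2. (-1) ^ i *\<^sub>Q pair2 (project [L!i] (omit i L), project [L!i] M)) = 0"
    if L: "length L = 2 + 2" "length M = 2 + 1" and pts: "points (Suc 2) L" "points (Suc 2) M"
      and adm: "\<forall>i\<le>Suc 2. admissible 2 (project [L!i] (omit i L), project [L!i] M)" for L M :: "'a points"
  proof -
    obtain a b c d where abcd: "L = [a, b, c, d]" using L length_4_conv[of L] by auto
    obtain u v w where uvw: "M = [u, v, w]" using L length_3_conv[of M] by auto
    have carr: "a \<in> carrier_vec 4" "b \<in> carrier_vec 4" "c \<in> carrier_vec 4" "d \<in> carrier_vec 4"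
      "a \<noteq> 0\<^sub>v 4" "b \<noteq> 0\<^sub>v 4" "c \<noteq> 0\<^sub>v 4" "d \<noteq> 0\<^sub>v 4"
      "u \<in> carrier_vec 4" "v \<in> carrier_vec 4" "w \<in> carrier_vec 4"
      using pts by (auto simp: abcd uvw points_def)
    have ad: "admissible 2 (project [a] [b, c, d], project [a] [u, v, w])"
      "admissible 2 (project [b] [a, c, d], project [b] [u, v, w])"
      "admissible 2 (project [c] [a, b, d], project [c] [u, v, w])"
      "admissible 2 (project [d] [a, b, c], project [d] [u, v, w])"
      using adm[rule_format, of 0] adm[rule_format, of 1] adm[rule_format, of 2] adm[rule_format, of 3]
      by (simp_all add: abcd uvw omit_list)
    show ?thesis
      unfolding sum_atMost_numeral
      using pair2_project(1)[OF _ _ _ ad(1)] pair2_project(1)[OF _ _ _ ad(2)]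
        pair2_project(1)[OF _ _ _ ad(3)] pair2_project(1)[OF _ _ _ ad(4)] carr
      by (simp add: abcd uvw omit_list br_center_swap)
  qed
  have rel4': "(\<Sum>i\<le>Suc 2. (-1) ^ i *\<^sub>Q pair2 (project [M!i] L, project [M!i] (omit i M))) = 0"
    if L: "length L = 2 + 1" "length M = 2 + 2" and pts: "points (Suc 2) L" "points (Suc 2) M"
      and adm: "\<forall>i\<le>Suc 2. admissible 2 (project [M!i] L, project [M!i] (omit i M))" for L M :: "'a points"
  proof -
    obtain a b c d where abcd: "M = [a, b, c, d]" using L length_4_conv[of M] by auto
    obtain u v w where uvw: "L = [u, v, w]" using L length_3_conv[of L] by auto
    have carr: "set [u, v, w] \<subseteq> carrier_vec 4 - {0\<^sub>v 4}" "set [a, b, c, d] \<subseteq> carrier_vec 4 - {0\<^sub>v 4}"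
      using pts by (auto simp: abcd uvw points_def)
    have ad: "admissible 2 (project [a] [u, v, w], project [a] [b, c, d])"
      "admissible 2 (project [b] [u, v, w], project [b] [a, c, d])"
      "admissible 2 (project [c] [u, v, w], project [c] [a, b, d])"
      "admissible 2 (project [d] [u, v, w], project [d] [a, b, c])"
      using adm[rule_format, of 0] adm[rule_format, of 1] adm[rule_format, of 2] adm[rule_format, of 3]
      by (simp_all add: abcd uvw omit_list)
    show ?thesis
      unfolding sum_atMost_numeral
      using pair2_project_M_relation[OF carr ad] by (simp add: abcd uvw omit_list)
  qed
  have rel5: "pair2 (L, M) = pair2 (L', M')"
    if adm: "admissible 2 (L, M)" and len: "length L' = Suc 2" and sc: "same_config 2 (L @ M) (L' @ M')"
    for L M L' M' :: "'a points"
  proof -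
    obtain l0 l1 l2 m0 m1 m2 where L: "L = [l0, l1, l2]" and M: "M = [m0, m1, m2]" using lists[OF adm] by blast
    have "length M' = 3" using sc len by (simp add: same_config_def L M)
    then obtain l0' l1' l2' m0' m1' m2' where L': "L' = [l0', l1', l2']" and M': "M' = [m0', m1', m2']"
      using len length_3_conv[of L'] length_3_conv[of M'] by auto
    have pts: "points 2 (L @ M)" using adm by (auto simp: admissible_def points_def)
    obtain \<mu> t where l: "\<mu> \<noteq> 0" "\<And>k. k < length (L @ M) \<Longrightarrow> t k \<noteq> 0"
      "\<And>k. k < length (L @ M) \<Longrightarrow> (L' @ M') ! k \<in> carrier_vec (Suc 2) - {0\<^sub>v (Suc 2)}"
      "\<And>ks. length ks = Suc 2 \<Longrightarrow> set ks \<subseteq> {..<length (L @ M)} \<Longrightarrow>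
        \<Delta> (map ((!) (L' @ M')) ks) = \<mu> * prod_list (map t ks) * \<Delta> (map ((!) (L @ M)) ks)"
      by (rule same_configD[OF sc pts]) auto
    have br: "br [(L' @ M') ! i] ((L' @ M') ! j) ((L' @ M') ! k) ((L' @ M') ! p) ((L' @ M') ! q) =
      br [(L @ M) ! i] ((L @ M) ! j) ((L @ M) ! k) ((L @ M) ! p) ((L @ M) ! q)"
      if "i < 6" "j < 6" "k < 6" "p < 6" "q < 6" for i j k p q
      using that l(4)[of "[i, j, p]"] l(4)[of "[i, k, q]"] l(4)[of "[i, j, q]"] l(4)[of "[i, k, p]"] l(1)
        l(2)[of i] l(2)[of j] l(2)[of k] l(2)[of p] l(2)[of q]
      by (simp add: br_def L M)
    have "set [l0', l1', l2'] \<subseteq> carrier_vec 3 - {0\<^sub>v 3}" "set [m0', m1', m2'] \<subseteq> carrier_vec 3"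
      using l(3)[of 0] l(3)[of 1] l(3)[of 2] l(3)[of 3] l(3)[of 4] l(3)[of 5] by (simp_all add: L' M' L M)
    then have "pair2 (L', M') = tri l0' l1' l2' m0' m1' m2'"
      by (simp add: L' M' pair2_eq_tri)
    moreover have "tri l0' l1' l2' m0' m1' m2' = tri l0 l1 l2 m0 m1 m2"
      using br[of 0 1 2 3 4] br[of 0 1 2 3 5] br[of 0 1 2 4 5] br[of 1 0 2 3 4] br[of 1 0 2 3 5] br[of 1 0 2 4 5]
        br[of 2 0 1 3 4] br[of 2 0 1 3 5] br[of 2 0 1 4 5]
      by (simp add: tri_def L M L' M')
    ultimately show ?thesis using tri[OF adm L M] by simp
  qed
  show ?thesis
    using assms unfolding A_rels_def
    by (elim UnE CollectE exE conjE)
      (simp_all only: lin_ext_simps lin_ext_gen rel1 rel2 rel3 rel3' rel4 rel4' rel5 diff_self)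
qed

lemma a2_props:
  shows a2_Qlinear: "Qlinear (a2 :: 'a A2 \<Rightarrow> _)"
    and a2_class: "admissible 2 (L, M) \<Longrightarrow> a2 (A2_class L M) = pair2 (L, M :: 'a points)"
proof -
  have eq: "(a2 :: 'a A2 \<Rightarrow> _) = (THE f. Qlinear f \<and> (\<forall>g\<in>Collect (admissible 2). f (abs_A2 (gen g)) = pair2 g))"
    unfolding a2_def A2_class_def pair2_def by (rule arg_cong[where f = The]) auto
  note l = A2.the_lift[OF pair2_relations, folded eq]
  show "Qlinear (a2 :: 'a A2 \<Rightarrow> _)" by (rule l(1))
  show "a2 (A2_class L M) = pair2 (L, M)" if "admissible 2 (L, M)"
    using l(2)[of "(L, M)"] that by (simp add: A2_class_def)
qed

end

section \<open>Alternating sums over the vertices of two tetrahedra\<close>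

lemma Alt_map: "length xs = n \<Longrightarrow> Alt n f (map g xs) = Alt n (\<lambda>x. f (map g x)) xs"
  unfolding Alt_def by (intro sum.cong refl arg_cong2[where f = scaleQ]) (auto simp: permute_list_map)

lemma Alt_map_3: "Alt 3 f (map g [a, b, c]) = Alt 3 (\<lambda>x. f (map g x)) [a, b, c]"
  by (rule Alt_map) simp

lemma permute_list_transpose_4:
  "permute_list (transpose 0 (Suc 0)) [a, b, c, d] = [b, a, c, d]"
  "permute_list (transpose (Suc 0) 2) [a, b, c, d] = [a, c, b, d]"
  "permute_list (transpose 2 3) [a, b, c, d] = [a, b, d, c]"
  "permute_list (transpose 0 2) [a, b, c, d] = [c, b, a, d]"
  "permute_list (transpose 0 3) [a, b, c, d] = [d, b, c, a]"
  by (simp_all add: permute_list_def upt_rec transpose_def)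

text \<open>Genericity in terms of vectors rather than positions, hence visibly invariant under
  permuting the vertices of either tetrahedron.\<close>

definition general_position :: "'a::field vec list \<Rightarrow> 'a vec list \<Rightarrow> bool"
  where "general_position l m \<longleftrightarrow> length l = 4 \<and> length m = 4 \<and> distinct (l @ m) \<and>
    set (l @ m) \<subseteq> carrier_vec 4 \<and>
    (\<forall>p q r s. distinct [p, q, r, s] \<longrightarrow> {p, q, r, s} \<subseteq> set (l @ m) \<longrightarrow> \<Delta> [p, q, r, s] \<noteq> 0)"

lemma general_position_permute:
  assumes "general_position l m" "\<sigma> permutes {..<4}" "\<tau> permutes {..<4}"
  shows "general_position (permute_list \<sigma> l) (permute_list \<tau> m)"
  using assms unfolding general_position_def by (simp add: distinct_permute_list)

lemma general_position_explicit:
  assumes "general_position l m"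
  obtains a b c d x y z w where "l = [a, b, c, d]" "m = [x, y, z, w]"
    "general_position [a, b, c, d] [x, y, z, w]"
  using assms length_4_conv[of l] length_4_conv[of m] unfolding general_position_def by auto

lemma general_positionD:
  assumes "general_position [a, b, c, d] [x, y, z, w]"
  shows "a \<in> carrier_vec 4" "b \<in> carrier_vec 4" "c \<in> carrier_vec 4" "d \<in> carrier_vec 4"
    "x \<in> carrier_vec 4" "y \<in> carrier_vec 4" "z \<in> carrier_vec 4" "w \<in> carrier_vec 4"
    and "distinct [a, b, c, d, x, y, z, w]"
    and "distinct [p, q, r, s] \<Longrightarrow> {p, q, r, s} \<subseteq> {a, b, c, d, x, y, z, w} \<Longrightarrow> \<Delta> [p, q, r, s] \<noteq> 0"
proof -
  show "distinct [a, b, c, d, x, y, z, w]"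
    using assms unfolding general_position_def by simp
  show "distinct [p, q, r, s] \<Longrightarrow> {p, q, r, s} \<subseteq> {a, b, c, d, x, y, z, w} \<Longrightarrow> \<Delta> [p, q, r, s] \<noteq> 0"
    using assms unfolding general_position_def by (simp del: insert_subset)
qed (use assms in \<open>simp_all add: general_position_def\<close>)

lemma nonzero_vec_4: "\<Delta> [p, q, r, s] \<noteq> 0 \<Longrightarrow> p \<noteq> 0\<^sub>v 4"
  by (auto simp: \<Delta>_4)

context infinite_field
begin

text \<open>The scale factor of the projection cancels in the triple ratio, which may therefore be
  computed with determinants through \<open>c\<close> before it is split into their classes.\<close>

lemma delta3_r3_project:
  assumes c: "c \<in> carrier_vec 4" "c \<noteq> 0\<^sub>v 4" and xs: "length xs = 6" "set xs \<subseteq> carrier_vec 4"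
    and nz: "\<And>i j k. i < 6 \<Longrightarrow> j < 6 \<Longrightarrow> k < 6 \<Longrightarrow> distinct [i, j, k] \<Longrightarrow>
      \<Delta> [c, xs ! i, xs ! j, xs ! k] \<noteq> (0::'a)"
  shows "\<delta>3 (r3 (project [c] xs)) = - (1/2) *\<^sub>Q Alt 6 (\<lambda>x. br [c, x!0] (x!1) (x!2) (x!3) (x!4)
    \<otimes>\<^sub>Q mult_class (\<Delta> [c, x!0, x!1, x!2])) xs"
proof -
  interpret triple_ratio F "[c]" using c by unfold_locales auto
  have g: "generic6 xs" using xs nz by (auto simp: generic6_def D_def)
  obtain P r where P: "r \<noteq> 0" "P \<in> carrier_mat 3 4" "project [c] = map ((*\<^sub>v) P)"
    "\<And>u v w. u \<in> carrier_vec 4 \<Longrightarrow> v \<in> carrier_vec 4 \<Longrightarrow> w \<in> carrier_vec 4 \<Longrightarrow>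
      \<Delta> [P *\<^sub>v u, P *\<^sub>v v, P *\<^sub>v w] = r * \<Delta> [c, u, v, w]"
    by (rule project_4[OF c]) blast
  let ?ys = "map ((*\<^sub>v) P) xs"
  let ?t = "\<lambda>y. \<Delta> [y!0, y!1, y!3] * \<Delta> [y!1, y!2, y!4] * \<Delta> [y!2, y!0, y!5] /
     (\<Delta> [y!0, y!1, y!4] * \<Delta> [y!1, y!2, y!5] * \<Delta> [y!2, y!0, y!3])"
  have mem: "xs ! i \<in> carrier_vec 4" if "i < 6" for i using xs that by auto
  have "Poly_Mapping.keys (r3_free ?ys) \<subseteq> - {0}"
    using xs nz mem P by (intro delta_r3_free(2)) auto
  then have "\<delta>3 (r3 (project [c] xs)) = lin_ext delta_gen (r3_free ?ys)"
    unfolding r3_def P(3) by (rule delta3_abs)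
  also have "\<dots> = (1/15) *\<^sub>Q Alt 6 (\<lambda>x. delta_gen (?t (map ((*\<^sub>v) P) x))) xs"
    using xs(1) by (simp add: r3_free_def lin_ext_simps Alt_Qlinear[OF lin_ext_Qlinear] Alt_map)
  also have "Alt 6 (\<lambda>x. delta_gen (?t (map ((*\<^sub>v) P) x))) xs =
      Alt 6 (\<lambda>x. {T (x!0) (x!1) (x!2) (x!3) (x!4) (x!5)}\<^sub>2 \<otimes>\<^sub>Q
        mult_class (T (x!0) (x!1) (x!2) (x!3) (x!4) (x!5))) xs"
  proof (rule Alt6_cong[OF g])
    fix p q s t u v assume "generic6 [p, q, s, t, u, v]"
    note G = generic6D[OF this]
    have "?t (map ((*\<^sub>v) P) [p, q, s, t, u, v]) = T p q s t u v"
      using G(1) P(1) by (simp add: P(4) T_def D_def mult.assoc)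
    then show "delta_gen (?t (map ((*\<^sub>v) P) [p, q, s, t, u, v])) =
      {T ([p, q, s, t, u, v]!0) ([p, q, s, t, u, v]!1) ([p, q, s, t, u, v]!2)
        ([p, q, s, t, u, v]!3) ([p, q, s, t, u, v]!4) ([p, q, s, t, u, v]!5)}\<^sub>2 \<otimes>\<^sub>Q
      mult_class (T ([p, q, s, t, u, v]!0) ([p, q, s, t, u, v]!1) ([p, q, s, t, u, v]!2)
        ([p, q, s, t, u, v]!3) ([p, q, s, t, u, v]!4) ([p, q, s, t, u, v]!5))"
      unfolding delta_gen_def by simp
  qed
  finally show ?thesis
    unfolding delta_triple_ratio[OF g] by (simp add: D_def scaleQ_scaleQ)
qed

text \<open>The two cross-ratios arise from the order u0, u1, v0, v1 by permutations of opposite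
  sign, so their classes are plus and minus the same bracket, and the difference in the definition
  of \<open>\<mu>3\<close> adds up the second factors.\<close>

lemma delta3_\<mu>3_project:
  assumes carr: "set [c, c', u0, u1, u2, v0, v1, v2] \<subseteq> carrier_vec 4"
    and nz: "\<And>p q. p \<noteq> q \<Longrightarrow> {p, q} \<subseteq> {u0, u1, u2, v0, v1, v2} \<Longrightarrow> \<Delta> [c, c', p, q] \<noteq> (0::'a)"
    and dist: "distinct [u0, u1, u2, v0, v1, v2]"
  shows "\<delta>3 (\<mu>3 (project [c, c'] [u0, u1, u2]) (project [c, c'] [v0, v1, v2])) =
    (1/4) *\<^sub>Q Alt 3 (\<lambda>u. Alt 3 (\<lambda>v. br [c, c'] (u!0) (u!1) (v!0) (v!1) \<otimes>\<^sub>Q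
      (2 *\<^sub>Q mult_class (\<Delta> [c, c', u!0, u!1]) + 2 *\<^sub>Q mult_class (\<Delta> [c, c', v!0, v!1])
       - mult_class (\<Delta> [c, c', u!0, v!0]) - mult_class (\<Delta> [c, c', u!0, v!1])
       - mult_class (\<Delta> [c, c', u!1, v!0]) - mult_class (\<Delta> [c, c', u!1, v!1]))) [v0, v1, v2]) [u0, u1, u2]"
proof -
  have "set [c, c'] \<subseteq> carrier_vec 4" "set [u0, u1] \<subseteq> carrier_vec 4" using carr by auto
  moreover have "\<Delta> ([c, c'] @ [u0, u1]) \<noteq> 0" using nz[of u0 u1] dist by simp
  ultimately obtain r where r: "r \<noteq> 0" "projection_mat 4 [c, c'] \<in> carrier_mat (length [u0, u1]) 4"
    "\<And>bs. set bs \<subseteq> carrier_vec 4 \<Longrightarrow> length bs = length [u0, u1] \<Longrightarrow>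
      \<Delta> (map ((*\<^sub>v) (projection_mat 4 [c, c'])) bs) = r * \<Delta> ([c, c'] @ bs)"
    using project_scaling[of "[c, c']" 4 "[u0, u1]"] by auto
  define P where "P = projection_mat 4 [c, c']"
  have P: "\<Delta> [P *\<^sub>v p, P *\<^sub>v q] = r * \<Delta> [c, c', p, q]" if "p \<in> carrier_vec 4" "q \<in> carrier_vec 4" for p q
    using r(3)[of "[p, q]"] that by (simp add: P_def)
  have proj: "project [c, c'] = map ((*\<^sub>v) P)"
    using carr by (auto simp: project_def P_def fun_eq_iff)
  have cs: "set [c, c'] \<subseteq> carrier_vec (length [c, c'] + 2)" using carr by simp
  show ?thesis
    unfolding \<mu>3_def proj Alt_map_3 Qlinear_scale[OF delta3_Qlinear] Alt_Qlinear[OF delta3_Qlinear]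
      Qlinear_diff[OF delta3_Qlinear]
  proof (rule arg_cong[where f = "scaleQ _"], rule Alt_cong, simp, rule Alt_cong, simp)
    fix u v :: "'a vec list"
    assume len: "length u = 3" "length v = 3"
      and ms: "mset u = mset [u0, u1, u2]" "mset v = mset [v0, v1, v2]"
    from len obtain p q s p' q' s' where u: "u = [p, q, s]" and v: "v = [p', q', s']"
      using length_3_conv[of u] length_3_conv[of v] by auto
    have su: "set u = {u0, u1, u2}" and sv: "set v = {v0, v1, v2}"
      using mset_eq_setD[OF ms(1)] mset_eq_setD[OF ms(2)] by auto
    have du: "distinct u" "distinct v"
      using mset_eq_imp_distinct_iff[OF ms(1)] mset_eq_imp_distinct_iff[OF ms(2)] dist by auto
    have "p \<in> set u" "q \<in> set u" "p' \<in> set v" "q' \<in> set v" by (simp_all add: u v)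
    then have sub: "{p, q, p', q'} \<subseteq> {u0, u1, u2, v0, v1, v2}" unfolding su sv by blast
    have "set u \<inter> set v = {}" using dist unfolding su sv by auto
    then have d: "distinct [p, q, p', q']" using du by (auto simp: u v)
    have c4: "p \<in> carrier_vec 4" "q \<in> carrier_vec 4" "p' \<in> carrier_vec 4" "q' \<in> carrier_vec 4"
      using sub carr by auto
    have n: "\<Delta> [c, c', p, q] \<noteq> 0" "\<Delta> [c, c', p, p'] \<noteq> 0" "\<Delta> [c, c', p, q'] \<noteq> 0"
      "\<Delta> [c, c', q, p'] \<noteq> 0" "\<Delta> [c, c', q, q'] \<noteq> 0" "\<Delta> [c, c', p', q'] \<noteq> 0"
      using nz sub d by simp_all
    note sw = \<Delta>_4_swap(3)[of c c' q' p'] \<Delta>_4_swap(3)[of c c' q' q] \<Delta>_4_swap(3)[of c c' p' q]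
    have 1: "\<delta>3 {cross_ratio [P *\<^sub>v p, P *\<^sub>v q', P *\<^sub>v q, P *\<^sub>v p']}\<^sub>3 = br [c, c'] p q p' q' \<otimes>\<^sub>Q
      (mult_class (\<Delta> [c, c', p, q]) + mult_class (\<Delta> [c, c', p', q']) -
       mult_class (\<Delta> [c, c', p, p']) - mult_class (\<Delta> [c, c', q, q']))"
    proof -
      have "br [c, c'] p q' q p' = br [c, c'] p q p' q'"
        using br_swap23[OF cs, of p q q' p'] br_swap34[OF cs, of p q p' q'] c4 by simp
      then show ?thesis
        using r(1) n c4 by (subst delta3_sym3)
          (simp_all add: cross_ratio_def P sw br_def mult_class_divide mult_class_mult algebra_simps)
    qed
    have 2: "\<delta>3 {cross_ratio [P *\<^sub>v p, P *\<^sub>v p', P *\<^sub>v q, P *\<^sub>v q']}\<^sub>3 = - (br [c, c'] p q p' q' \<otimes>\<^sub>Q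
      (mult_class (\<Delta> [c, c', p, q]) + mult_class (\<Delta> [c, c', p', q']) -
       mult_class (\<Delta> [c, c', p, q']) - mult_class (\<Delta> [c, c', q, p'])))"
    proof -
      have "br [c, c'] p p' q q' = - br [c, c'] p q p' q'"
        using br_swap23[OF cs, of p q p' q'] c4 by simp
      then show ?thesis
        unfolding tensor_simps(6)[symmetric]
        using r(1) n c4 by (subst delta3_sym3)
          (simp_all add: cross_ratio_def P sw br_def mult_class_divide mult_class_mult algebra_simps tensor_simps)
    qed
    show "\<delta>3 {cross_ratio [map ((*\<^sub>v) P) u ! 0, map ((*\<^sub>v) P) v ! 1, map ((*\<^sub>v) P) u ! 1, map ((*\<^sub>v) P) v ! 0]}\<^sub>3 -
      \<delta>3 {cross_ratio [map ((*\<^sub>v) P) u ! 0, map ((*\<^sub>v) P) v ! 0, map ((*\<^sub>v) P) u ! 1, map ((*\<^sub>v) P) v ! 1]}\<^sub>3 =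
      br [c, c'] (u!0) (u!1) (v!0) (v!1) \<otimes>\<^sub>Q
      (2 *\<^sub>Q mult_class (\<Delta> [c, c', u!0, u!1]) + 2 *\<^sub>Q mult_class (\<Delta> [c, c', v!0, v!1])
       - mult_class (\<Delta> [c, c', u!0, v!0]) - mult_class (\<Delta> [c, c', u!0, v!1])
       - mult_class (\<Delta> [c, c', u!1, v!0]) - mult_class (\<Delta> [c, c', u!1, v!1]))"
      by (simp add: u v 1 2 scaleQ_2 tensor_simps algebra_simps)
  qed
qed

end

lemma scale_4: "4 *\<^sub>Q v = v + v + v + v"
  using scaleQ_add_left[of 2 2 v] by (simp add: scaleQ_2 add.assoc)

lemma Alt_4:
  "length xs = 4 \<Longrightarrow> Alt 4 f xs = (\<Sum>i<Suc 3. (-1) ^ i *\<^sub>Q Alt 3 (\<lambda>ys. f (xs ! i # ys)) (omit i xs))"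
  using Alt_Suc[of xs 3 f] by simp

lemma mset_omit: "i < length xs \<Longrightarrow> mset (xs ! i # omit i xs) = mset xs"
  using arg_cong[OF id_take_nth_drop[of i xs], of mset] by (simp add: omit_def)

lemma general_position_omit:
  assumes "general_position l m" "i < 4" "j < 4"
  obtains a b c d x y z w where "l ! i = a" "omit i l = [b, c, d]" "m ! j = x" "omit j m = [y, z, w]"
    "general_position [a, b, c, d] [x, y, z, w]"
proof -
  have len: "length l = 4" "length m = 4" using assms by (simp_all add: general_position_def)
  note ms = mset_omit[of i l] mset_omit[of j m]
  have eq: "mset (l ! i # omit i l) = mset l" "mset (m ! j # omit j m) = mset m"
    using ms assms(2,3) len by simp_all
  then have "mset ((l ! i # omit i l) @ (m ! j # omit j m)) = mset (l @ m)"
    by (simp only: mset_append)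
  from mset_eq_imp_distinct_iff[OF this] mset_eq_setD[OF this] mset_eq_length[OF eq(1)]
    mset_eq_length[OF eq(2)]
  have "general_position (l ! i # omit i l) (m ! j # omit j m)"
    using assms(1) unfolding general_position_def by simp
  then show thesis
    by (rule general_position_explicit) (rule that, auto)
qed

locale tetrahedra = infinite_field F for F :: "'a::field itself" +
  fixes L M :: "'a vec list"
  assumes general: "general_position L M"
begin

definition A :: "('a vec list \<Rightarrow> 'a vec list \<Rightarrow> 'v::rat_vector) \<Rightarrow> 'v"
  where "A f = Alt 4 (\<lambda>l. Alt 4 (f l) M) L"

lemma A_simps: "A (\<lambda>l m. f l m + g l m) = A f + A g" "A (\<lambda>l m. f l m - g l m) = A f - A g"
  "A (\<lambda>l m. - f l m) = - A f" "A (\<lambda>l m. c *\<^sub>Q f l m) = c *\<^sub>Q A f"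
  by (simp_all add: A_def Alt_add Alt_diff Alt_minus Alt_scale)

lemma length_LM: "length L = 4" "length M = 4"
  using general by (simp_all add: general_position_def)

lemma A_cong:
  assumes "\<And>a b c d x y z w. set [a, b, c, d, x, y, z, w] \<subseteq> carrier_vec 4 \<Longrightarrow>
    general_position [a, b, c, d] [x, y, z, w] \<Longrightarrow> f [a, b, c, d] [x, y, z, w] = g [a, b, c, d] [x, y, z, w]"
  shows "A f = A g"
  unfolding A_def
proof (intro Alt_cong_perm)
  fix \<sigma> \<tau> :: "nat \<Rightarrow> nat" assume \<sigma>: "\<sigma> permutes {..<4}" and \<tau>: "\<tau> permutes {..<4}"
  note g = general_position_permute[OF general \<sigma> \<tau>]
  show "f (permute_list \<sigma> L) (permute_list \<tau> M) = g (permute_list \<sigma> L) (permute_list \<tau> M)"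
  proof (rule general_position_explicit[OF g])
    fix a b c d x y z w
    assume *: "permute_list \<sigma> L = [a, b, c, d]" "permute_list \<tau> M = [x, y, z, w]"
      "general_position [a, b, c, d] [x, y, z, w]"
    show ?thesis unfolding * by (rule assms) (use general_positionD(1-8)[OF *(3)] *(3) in auto)
  qed
qed

lemma A_swap_l:
  assumes "i < 4" "j < 4" "i \<noteq> j"
    and "\<And>a b c d x y z w. set [a, b, c, d, x, y, z, w] \<subseteq> carrier_vec 4 \<Longrightarrow>
      general_position [a, b, c, d] [x, y, z, w] \<Longrightarrow> f [a, b, c, d] [x, y, z, w] = g (permute_list (transpose i j) [a, b, c, d]) [x, y, z, w]"
  shows "A f = - A g"
proof -
  have "A f = A (\<lambda>l. g (permute_list (transpose i j) l))"
    by (rule A_cong) (rule assms(4))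
  also have "\<dots> = - A g"
    unfolding A_def using assms(1-3) length_LM by (intro Alt_swap) auto
  finally show ?thesis .
qed

lemma A_swap_m:
  assumes "i < 4" "j < 4" "i \<noteq> j"
    and "\<And>a b c d x y z w. set [a, b, c, d, x, y, z, w] \<subseteq> carrier_vec 4 \<Longrightarrow>
      general_position [a, b, c, d] [x, y, z, w] \<Longrightarrow> f [a, b, c, d] [x, y, z, w] = g [a, b, c, d] (permute_list (transpose i j) [x, y, z, w])"
  shows "A f = - A g"
proof -
  have "A f = A (\<lambda>l m. g l (permute_list (transpose i j) m))"
    by (rule A_cong) (rule assms(4))
  also have "\<dots> = Alt 4 (\<lambda>m. Alt 4 (\<lambda>l. g l (permute_list (transpose i j) m)) L) M"
    unfolding A_def by (rule Alt_commute)
  also have "\<dots> = - Alt 4 (\<lambda>m. Alt 4 (\<lambda>l. g l m) L) M"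
    using assms(1-3) length_LM by (intro Alt_swap) auto
  finally show ?thesis unfolding A_def Alt_commute[of 4 4 _ L] .
qed

lemma A_zero_l:
  assumes "i < 4" "j < 4" "i \<noteq> j"
    and "\<And>a b c d x y z w. set [a, b, c, d, x, y, z, w] \<subseteq> carrier_vec 4 \<Longrightarrow>
      general_position [a, b, c, d] [x, y, z, w] \<Longrightarrow> f [a, b, c, d] [x, y, z, w] = f (permute_list (transpose i j) [a, b, c, d]) [x, y, z, w]"
  shows "A f = 0"
  by (rule eq_neg_self_zero, rule A_swap_l[OF assms(1-3)]) (rule assms(4))

lemma A_zero_m:
  assumes "i < 4" "j < 4" "i \<noteq> j"
    and "\<And>a b c d x y z w. set [a, b, c, d, x, y, z, w] \<subseteq> carrier_vec 4 \<Longrightarrow>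
      general_position [a, b, c, d] [x, y, z, w] \<Longrightarrow> f [a, b, c, d] [x, y, z, w] = f [a, b, c, d] (permute_list (transpose i j) [x, y, z, w])"
  shows "A f = 0"
  by (rule eq_neg_self_zero, rule A_swap_m[OF assms(1-3)]) (rule assms(4))

text \<open>A cycle of length four is odd; it is written as three transpositions.\<close>

lemma A_rotate_m:
  assumes "\<And>a b c d x y z w. set [a, b, c, d, x, y, z, w] \<subseteq> carrier_vec 4 \<Longrightarrow>
      general_position [a, b, c, d] [x, y, z, w] \<Longrightarrow> f [a, b, c, d] [x, y, z, w] = g [a, b, c, d] [y, z, w, x]"
  shows "A f = - A g"
proof -
  have "A f = - A (\<lambda>l m. g l (permute_list (transpose 2 3) (permute_list (transpose (Suc 0) 2) m)))"
    by (rule A_swap_m[of 0 "Suc 0"]) (simp_all add: permute_list_transpose_4 assms)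
  also have "A (\<lambda>l m. g l (permute_list (transpose 2 3) (permute_list (transpose (Suc 0) 2) m))) = - A (\<lambda>l m. g l (permute_list (transpose 2 3) m))"
    by (rule A_swap_m[of "Suc 0" 2]) simp_all
  also have "A (\<lambda>l m. g l (permute_list (transpose 2 3) m)) = - A g"
    by (rule A_swap_m[of 2 3]) simp_all
  finally show ?thesis by simp
qed

lemma A_rotate_l:
  assumes "\<And>a b c d x y z w. set [a, b, c, d, x, y, z, w] \<subseteq> carrier_vec 4 \<Longrightarrow>
      general_position [a, b, c, d] [x, y, z, w] \<Longrightarrow> f [a, b, c, d] [x, y, z, w] = g [b, c, d, a] [x, y, z, w]"
  shows "A f = - A g"
proof -
  have "A f = - A (\<lambda>l m. g (permute_list (transpose 2 3) (permute_list (transpose (Suc 0) 2) l)) m)"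
    by (rule A_swap_l[of 0 "Suc 0"]) (simp_all add: permute_list_transpose_4 assms)
  also have "A (\<lambda>l m. g (permute_list (transpose 2 3) (permute_list (transpose (Suc 0) 2) l)) m) = - A (\<lambda>l m. g (permute_list (transpose 2 3) l) m)"
    by (rule A_swap_l[of "Suc 0" 2]) simp_all
  also have "A (\<lambda>l m. g (permute_list (transpose 2 3) l) m) = - A g"
    by (rule A_swap_l[of 2 3]) simp_all
  finally show ?thesis by simp
qed

text \<open>Expansion of both alternations along the first vertex. It turns the double sums that
  define \<open>a3'\<close>, \<open>a3''\<close> and the regrouped \<open>\<nu>\<close> into values
  of \<open>A\<close>.\<close>

lemma Alt_double:
  fixes H :: "'a vec \<Rightarrow> 'a vec \<Rightarrow> 'a vec list \<Rightarrow> 'a vec list \<Rightarrow> 'v::rat_vector"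
  shows "(\<Sum>i\<le>3. \<Sum>j\<le>3. (-1) ^ (i + j) *\<^sub>Q
      Alt 3 (\<lambda>u. Alt 3 (H (L!i) (M!j) u) (omit j M)) (omit i L)) =
    A (\<lambda>l m. H (hd l) (hd m) (tl l) (tl m))"
proof -
  have s: "{..3} = {..<Suc 3}" by auto
  have "A (\<lambda>l m. H (hd l) (hd m) (tl l) (tl m)) = (\<Sum>i<Suc 3. (-1) ^ i *\<^sub>Q
      Alt 3 (\<lambda>u. Alt 4 (\<lambda>m. H (L!i) (hd m) u (tl m)) M) (omit i L))"
    unfolding A_def Alt_4[OF length_LM(1)] list.sel ..
  also have "\<dots> = (\<Sum>i<Suc 3. (-1) ^ i *\<^sub>Q Alt 3 (\<lambda>u. \<Sum>j<Suc 3. (-1) ^ j *\<^sub>Q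
      Alt 3 (H (L!i) (M!j) u) (omit j M)) (omit i L))"
    unfolding Alt_4[OF length_LM(2)] list.sel ..
  also have "\<dots> = (\<Sum>i<Suc 3. \<Sum>j<Suc 3. (-1) ^ (i + j) *\<^sub>Q
      Alt 3 (\<lambda>u. Alt 3 (H (L!i) (M!j) u) (omit j M)) (omit i L))"
    by (simp only: Alt_sum Alt_scale Q.scale_sum_right scaleQ_scaleQ power_add)
  finally show ?thesis unfolding s ..
qed

section \<open>The value of \<delta>3 on \<open>a3\<close>\<close>

abbreviation m4 :: "'a vec \<Rightarrow> 'a vec \<Rightarrow> 'a vec \<Rightarrow> 'a vec \<Rightarrow> 'a multQ"
  where "m4 p q r s \<equiv> mult_class (\<Delta> [p, q, r, s])"

lemma m4_swap: "m4 q p r s = m4 p q r s" "m4 p r q s = m4 p q r s" "m4 p q s r = m4 p q r s"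
  by (simp_all only: \<Delta>_4_swap(1)[of q p] \<Delta>_4_swap(2)[of p r q] \<Delta>_4_swap(3)[of p q s r] mult_class_neg)

lemma br2_swap:
  fixes p q a b c d :: "'a vec"
  assumes "set [p, q, a, b, c, d] \<subseteq> carrier_vec 4"
  shows "br [p, q] b a c d = - br [p, q] a b c d" "br [p, q] a c b d = - br [p, q] a b c d"
    "br [p, q] a b d c = - br [p, q] a b c d"
  using br_swap[of "[p, q]" a b c d] assms by simp_all

definition "E1 = A (\<lambda>l m. br [l!0, m!0] (l!1) (l!2) (m!1) (m!2) \<otimes>\<^sub>Q m4 (l!0) (m!0) (l!1) (l!2))"
definition "E2 = A (\<lambda>l m. br [l!0, m!0] (l!1) (l!2) (m!1) (m!2) \<otimes>\<^sub>Q m4 (l!0) (m!0) (l!1) (m!1))"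
definition "E3 = A (\<lambda>l m. br [l!0, m!0] (l!1) (l!2) (m!1) (m!2) \<otimes>\<^sub>Q m4 (l!0) (m!0) (m!1) (m!2))"
definition "Z = A (\<lambda>l m. br [l!0, l!1] (l!2) (l!3) (m!0) (m!1) \<otimes>\<^sub>Q m4 (l!0) (m!0) (m!1) (m!2))"
definition "U = A (\<lambda>l m. br [l!0, l!1] (l!2) (m!0) (m!1) (m!2) \<otimes>\<^sub>Q m4 (l!0) (m!0) (m!1) (m!2))"

text \<open>Exchanging l_1, l_2 or m_1, m_2 changes the sign of the bracket and of the alternation,
  so each of the four mixed determinants contributes the same E2.\<close>

lemma delta3_a3'':
  "\<delta>3 (a3'' L M) = (1/2) *\<^sub>Q (E1 + E3) - E2"
proof -
  let ?H = "\<lambda>a x u v. br [a, x] (u!0) (u!1) (v!0) (v!1) \<otimes>\<^sub>Q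
      (2 *\<^sub>Q m4 a x (u!0) (u!1) + 2 *\<^sub>Q m4 a x (v!0) (v!1)
       - m4 a x (u!0) (v!0) - m4 a x (u!0) (v!1) - m4 a x (u!1) (v!0) - m4 a x (u!1) (v!1))"
  have ij: "\<delta>3 (\<mu>3 (project [L!i, M!j] (omit i L)) (project [L!i, M!j] (omit j M))) =
      (1/4) *\<^sub>Q Alt 3 (\<lambda>u. Alt 3 (?H (L!i) (M!j) u) (omit j M)) (omit i L)"
    if "i \<in> {..3}" "j \<in> {..3}" for i j :: nat
  proof -
    have "i < 4" "j < 4" using that by auto
    from general_position_omit[OF general this] obtain a b c d x y z w
      where LM: "L ! i = a" "omit i L = [b, c, d]" "M ! j = x" "omit j M = [y, z, w]"
        and gp: "general_position [a, b, c, d] [x, y, z, w]" by metis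
    note gpD = general_positionD[OF gp]
    have "\<Delta> [a, x, p, q] \<noteq> 0" if "p \<noteq> q" "{p, q} \<subseteq> {b, c, d, y, z, w}" for p q
      by (rule gpD(10)) (use that gpD(9) in auto)
    then show ?thesis
      unfolding LM by (intro delta3_\<mu>3_project) (use gpD(1-9) in auto)
  qed
  have e12: "A (\<lambda>l m. br [l!0, m!0] (l!1) (l!2) (m!1) (m!2) \<otimes>\<^sub>Q m4 (l!0) (m!0) (l!1) (m!2)) =
      - A (\<lambda>l m. - (br [l!0, m!0] (l!1) (l!2) (m!1) (m!2) \<otimes>\<^sub>Q m4 (l!0) (m!0) (l!1) (m!1)))"
  proof (rule A_swap_m[of "Suc 0" 2], goal_cases)
    case (4 a b c d x y z w)
    then show ?case
      using br2_swap(3)[of a x b c z y] by (simp add: permute_list_transpose_4 tensor_simps)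
  qed simp_all
  have e21: "A (\<lambda>l m. br [l!0, m!0] (l!1) (l!2) (m!1) (m!2) \<otimes>\<^sub>Q m4 (l!0) (m!0) (l!2) (m!1)) =
      - A (\<lambda>l m. - (br [l!0, m!0] (l!1) (l!2) (m!1) (m!2) \<otimes>\<^sub>Q m4 (l!0) (m!0) (l!1) (m!1)))"
  proof (rule A_swap_l[of "Suc 0" 2], goal_cases)
    case (4 a b c d x y z w)
    then show ?case
      using br2_swap(1)[of a x c b y z] by (simp add: permute_list_transpose_4 tensor_simps)
  qed simp_all
  have e22: "A (\<lambda>l m. br [l!0, m!0] (l!1) (l!2) (m!1) (m!2) \<otimes>\<^sub>Q m4 (l!0) (m!0) (l!2) (m!2)) =
      - A (\<lambda>l m. - (br [l!0, m!0] (l!1) (l!2) (m!1) (m!2) \<otimes>\<^sub>Q m4 (l!0) (m!0) (l!1) (m!2)))"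
  proof (rule A_swap_l[of "Suc 0" 2], goal_cases)
    case (4 a b c d x y z w)
    then show ?case
      using br2_swap(1)[of a x c b y z] by (simp add: permute_list_transpose_4 tensor_simps)
  qed simp_all
  have "\<delta>3 (a3'' L M) = (\<Sum>i\<le>3. \<Sum>j\<le>3. (-1) ^ (i + j) *\<^sub>Q (1/4) *\<^sub>Q
      Alt 3 (\<lambda>u. Alt 3 (?H (L!i) (M!j) u) (omit j M)) (omit i L))"
    unfolding a3''_def Qlinear_sum[OF delta3_Qlinear] Qlinear_scale[OF delta3_Qlinear]
    by (intro sum.cong refl) (simp only: ij)
  also have "\<dots> = (1/4) *\<^sub>Q (\<Sum>i\<le>3. \<Sum>j\<le>3. (-1) ^ (i + j) *\<^sub>Q
      Alt 3 (\<lambda>u. Alt 3 (?H (L!i) (M!j) u) (omit j M)) (omit i L))"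
    by (simp only: Q.scale_sum_right scaleQ_scaleQ mult.commute)
  also have "(\<Sum>i\<le>3. \<Sum>j\<le>3. (-1) ^ (i + j) *\<^sub>Q
      Alt 3 (\<lambda>u. Alt 3 (?H (L!i) (M!j) u) (omit j M)) (omit i L)) =
      A (\<lambda>l m. ?H (hd l) (hd m) (tl l) (tl m))"
    by (rule Alt_double)
  also have "\<dots> = A (\<lambda>l m. 2 *\<^sub>Q (br [l!0, m!0] (l!1) (l!2) (m!1) (m!2) \<otimes>\<^sub>Q m4 (l!0) (m!0) (l!1) (l!2)) +
      2 *\<^sub>Q (br [l!0, m!0] (l!1) (l!2) (m!1) (m!2) \<otimes>\<^sub>Q m4 (l!0) (m!0) (m!1) (m!2))
      - br [l!0, m!0] (l!1) (l!2) (m!1) (m!2) \<otimes>\<^sub>Q m4 (l!0) (m!0) (l!1) (m!1)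
      - br [l!0, m!0] (l!1) (l!2) (m!1) (m!2) \<otimes>\<^sub>Q m4 (l!0) (m!0) (l!1) (m!2)
      - br [l!0, m!0] (l!1) (l!2) (m!1) (m!2) \<otimes>\<^sub>Q m4 (l!0) (m!0) (l!2) (m!1)
      - br [l!0, m!0] (l!1) (l!2) (m!1) (m!2) \<otimes>\<^sub>Q m4 (l!0) (m!0) (l!2) (m!2))"
    by (rule A_cong) (simp add: tensor_simps algebra_simps)
  also have "\<dots> = 2 *\<^sub>Q E1 + 2 *\<^sub>Q E3 - E2
      - A (\<lambda>l m. br [l!0, m!0] (l!1) (l!2) (m!1) (m!2) \<otimes>\<^sub>Q m4 (l!0) (m!0) (l!1) (m!2))
      - A (\<lambda>l m. br [l!0, m!0] (l!1) (l!2) (m!1) (m!2) \<otimes>\<^sub>Q m4 (l!0) (m!0) (l!2) (m!1))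
      - A (\<lambda>l m. br [l!0, m!0] (l!1) (l!2) (m!1) (m!2) \<otimes>\<^sub>Q m4 (l!0) (m!0) (l!2) (m!2))"
    by (simp only: A_simps E1_def E2_def E3_def)
  finally have "\<delta>3 (a3'' L M) = (1/4) *\<^sub>Q (2 *\<^sub>Q E1 + 2 *\<^sub>Q E3 - E2 - E2 - E2 - E2)"
    by (simp only: e12 e21 e22 A_simps minus_minus E2_def[symmetric])
  also have "\<dots> = (1/4) *\<^sub>Q (2 *\<^sub>Q (E1 + E3) - 4 *\<^sub>Q E2)"
    using Q.scale_left_distrib[of 2 2 E2] by (simp add: scaleQ_2 algebra_simps)
  also have "\<dots> = (1/2) *\<^sub>Q (E1 + E3) - E2"
    by (simp add: Q.scale_right_diff_distrib scaleQ_scaleQ)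
  finally show ?thesis .
qed

text \<open>Of the 20 shuffles of the two triples, the ten that begin with an l are symmetric in l_0
  and this l, as both are centers, and cancel. After a leading m, the function sees only the next
  four points. Four shuffles show three l's and one m there; they involve only two of the m's and
  cancel as well. Six show two of each, with the same bracket up to sign; their determinants contain
  two l's once, two m's once and one of each four times, which gives the coefficients 1, 1 and
  4.\<close>

lemma delta3_a3':
  "\<delta>3 (a3' L M) = - (1/2) *\<^sub>Q (E1 + 4 *\<^sub>Q E2 + E3)"
proof -
  let ?G = "\<lambda>c x. br [c, x!0] (x!1) (x!2) (x!3) (x!4) \<otimes>\<^sub>Q m4 c (x!0) (x!1) (x!2)"
  let ?H = "\<lambda>c x u v. shuffle_sum (?G c) u (x # v)"
  have ij: "\<delta>3 (r3 (project [L!i] (omit i L @ omit j M))) =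
      - (1/2) *\<^sub>Q Alt 3 (\<lambda>u. Alt 3 (shuffle_sum (?G (L!i)) u) (omit j M)) (omit i L)"
    if "i \<in> {..3}" "j \<in> {..3}" for i j :: nat
  proof -
    have "i < 4" "j < 4" using that by auto
    from general_position_omit[OF general this] obtain a b c d x y z w
      where LM: "L ! i = a" "omit i L = [b, c, d]" "M ! j = x" "omit j M = [y, z, w]"
        and gp: "general_position [a, b, c, d] [x, y, z, w]" by metis
    note gpD = general_positionD[OF gp]
    have nz: "\<Delta> [a, p, q, r] \<noteq> 0" if "distinct [p, q, r]" "{p, q, r} \<subseteq> set [b, c, d, y, z, w]" for p q r
      by (rule gpD(10)) (use that gpD(9) in auto)
    have "\<delta>3 (r3 (project [a] [b, c, d, y, z, w])) = - (1/2) *\<^sub>Q Alt 6 (?G a) [b, c, d, y, z, w]"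
    proof (rule delta3_r3_project)
      show "a \<noteq> 0\<^sub>v 4" using nz[of b c d] gpD(9) by (intro nonzero_vec_4[of a b c d]) auto
      show "\<Delta> [a, [b, c, d, y, z, w] ! i, [b, c, d, y, z, w] ! j, [b, c, d, y, z, w] ! k] \<noteq> 0"
        if "i < 6" "j < 6" "k < 6" "distinct [i, j, k]" for i j k
      proof (rule nz)
        have "distinct [b, c, d, y, z, w]" using gpD(9) by auto
        then show "distinct [[b, c, d, y, z, w] ! i, [b, c, d, y, z, w] ! j, [b, c, d, y, z, w] ! k]"
          using that nth_eq_iff_index_eq[of "[b, c, d, y, z, w]"] by simp
        show "{[b, c, d, y, z, w] ! i, [b, c, d, y, z, w] ! j, [b, c, d, y, z, w] ! k} \<subseteq> set [b, c, d, y, z, w]"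
          using that by (intro insert_subsetI nth_mem empty_subsetI) simp_all
      qed
    qed (use gpD(1-8) in auto)
    also have "Alt 6 (?G a) [b, c, d, y, z, w] =
        Alt 3 (\<lambda>u. Alt 3 (shuffle_sum (?G a) u) [y, z, w]) [b, c, d]"
      using Alt_append[of "[b, c, d]" 3 "[y, z, w]" 3 "?G a"] by simp
    finally show ?thesis unfolding LM by simp
  qed
  have "\<delta>3 (a3' L M) = (\<Sum>i\<le>3. \<Sum>j\<le>3. (-1) ^ (i + j) *\<^sub>Q - (1/2) *\<^sub>Q
      Alt 3 (\<lambda>u. Alt 3 (shuffle_sum (?G (L!i)) u) (omit j M)) (omit i L))"
    unfolding a3'_def Qlinear_sum[OF delta3_Qlinear] Qlinear_scale[OF delta3_Qlinear]
    by (intro sum.cong refl) (simp only: ij)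
  also have "\<dots> = - (1/2) *\<^sub>Q (\<Sum>i\<le>3. \<Sum>j\<le>3. (-1) ^ (i + j) *\<^sub>Q
      Alt 3 (\<lambda>u. Alt 3 (shuffle_sum (?G (L!i)) u) (omit j M)) (omit i L))"
    by (simp only: Q.scale_sum_right scaleQ_scaleQ mult.commute)
  also have "(\<Sum>i\<le>3. \<Sum>j\<le>3. (-1) ^ (i + j) *\<^sub>Q
      Alt 3 (\<lambda>u. Alt 3 (shuffle_sum (?G (L!i)) u) (omit j M)) (omit i L)) =
      A (\<lambda>l m. shuffle_sum (?G (hd l)) (tl l) (tl m))"
    by (rule Alt_double)
  also have "\<dots> = A (\<lambda>l m.
      shuffle_sum (\<lambda>v. ?G (l!0) (l!1 # v)) [l!2, l!3] [m!1, m!2, m!3]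
      - shuffle_sum (\<lambda>v. ?G (l!0) (m!1 # v)) [l!1, l!2, l!3] [m!2, m!3])"
    by (rule A_cong) (simp add: scaleQ_one)
  also have "\<dots> = A (\<lambda>l m. shuffle_sum (\<lambda>v. ?G (l!0) (l!1 # v)) [l!2, l!3] [m!1, m!2, m!3])
      - A (\<lambda>l m. shuffle_sum (\<lambda>v. ?G (l!0) (m!1 # v)) [l!1, l!2, l!3] [m!2, m!3])"
    by (rule A_simps)
  \<comment> \<open>The summand is invariant under exchanging \<open>l!0\<close> and
    \<open>l!1\<close>: they are the two centers and both occur in the determinant.\<close>
  also have "A (\<lambda>l m. shuffle_sum (\<lambda>v. ?G (l!0) (l!1 # v)) [l!2, l!3] [m!1, m!2, m!3]) = 0"
  proof (rule A_zero_l[of 0 "Suc 0"], goal_cases)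
    case (4 a b c d x y z w)
    have "(\<lambda>v. ?G a (b # v)) = (\<lambda>v. ?G b (a # v))"
      by (rule ext) (simp add: br_center_swap[of a b] m4_swap(1)[of a b])
    then show ?case by (simp add: permute_list_transpose_4)
  qed simp_all
  also have "A (\<lambda>l m. shuffle_sum (\<lambda>v. ?G (l!0) (m!1 # v)) [l!1, l!2, l!3] [m!2, m!3]) =
    A (\<lambda>l m. br [l!0, m!1] (l!1) (l!2) (m!2) (m!3) \<otimes>\<^sub>Q
       (m4 (l!0) (m!1) (l!1) (l!2) + 4 *\<^sub>Q m4 (l!0) (m!1) (l!1) (m!2) + m4 (l!0) (m!1) (m!2) (m!3))
     + (br [l!0, m!1] (l!1) (l!2) (l!3) (m!2) \<otimes>\<^sub>Q m4 (l!0) (m!1) (l!1) (l!2)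
       - br [l!0, m!1] (l!1) (l!2) (m!2) (l!3) \<otimes>\<^sub>Q m4 (l!0) (m!1) (l!1) (l!2)
       + br [l!0, m!1] (l!1) (m!2) (l!2) (l!3) \<otimes>\<^sub>Q m4 (l!0) (m!1) (l!1) (m!2)
       - br [l!0, m!1] (m!2) (l!1) (l!2) (l!3) \<otimes>\<^sub>Q m4 (l!0) (m!1) (m!2) (l!1)))"
  proof (rule A_cong, goal_cases)
    case (1 a b c d x y z w)
    then have c: "set [a, y, b, c, z, w] \<subseteq> carrier_vec 4" by simp
    have "br [a, y] b z c w = - br [a, y] b c z w" "br [a, y] b z w c = br [a, y] b c z w"
      "br [a, y] z b c w = br [a, y] b c z w" "br [a, y] z b w c = - br [a, y] b c z w"
      "br [a, y] z w b c = br [a, y] b c z w"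
      using c br2_swap(2)[of a y b c z w] br2_swap(3)[of a y b z c w] br2_swap(1)[of a y b z c w]
        br2_swap(1)[of a y b z w c] br2_swap(2)[of a y z b w c] by simp_all
    then show ?case
      by (simp add: scale_4 tensor_simps scaleQ_one m4_swap algebra_simps)
  qed
  also have "\<dots> = A (\<lambda>l m. br [l!0, m!1] (l!1) (l!2) (m!2) (m!3) \<otimes>\<^sub>Q
       (m4 (l!0) (m!1) (l!1) (l!2) + 4 *\<^sub>Q m4 (l!0) (m!1) (l!1) (m!2) + m4 (l!0) (m!1) (m!2) (m!3)))"
    \<comment> \<open>The second group contains neither \<open>m!0\<close> nor
      \<open>m!3\<close>.\<close>
    unfolding A_simps(1) by (subst (2) A_zero_m[of 0 3]) (simp_all add: permute_list_transpose_4)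
  also have "\<dots> = - A (\<lambda>l m. br [l!0, m!0] (l!1) (l!2) (m!1) (m!2) \<otimes>\<^sub>Q
       (m4 (l!0) (m!0) (l!1) (l!2) + 4 *\<^sub>Q m4 (l!0) (m!0) (l!1) (m!1) + m4 (l!0) (m!0) (m!1) (m!2)))"
    by (rule A_rotate_m) simp
  finally show ?thesis
    by (simp add: tensor_simps A_simps E1_def E2_def E3_def)
qed

text \<open>The ratio of the weights 1/6 and - 1/3 is what makes E2 cancel: - (1/6) (4/2) + 1/3 =
  0.\<close>

lemma delta3_a3: "\<delta>3 (a3 L M) = - (1/4) *\<^sub>Q (E1 + E3)"
proof -
  have "\<delta>3 (a3 L M) = (1/6) *\<^sub>Q \<delta>3 (a3' L M) - (1/3) *\<^sub>Q \<delta>3 (a3'' L M)"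
    by (simp add: a3_def Qlinear_diff[OF delta3_Qlinear] Qlinear_scale[OF delta3_Qlinear])
  also have "\<dots> = (- (1/12) - 1/6) *\<^sub>Q E1 + (- (1/12) - 1/6) *\<^sub>Q E3 + (- (1/3) + 1/3) *\<^sub>Q E2"
    unfolding delta3_a3' delta3_a3'' scaleQ_add_left Q.scale_left_diff_distrib
    by (simp add: Q.scale_right_diff_distrib scaleQ_add_right scaleQ_scaleQ)
  also have "\<dots> = - (1/4) *\<^sub>Q (E1 + E3)"
    by (simp add: scaleQ_add_right)
  finally show ?thesis .
qed

lemma E3_eq: "E3 = - Z"
proof -
  have u2: "A (\<lambda>l m. br [l!0, l!2] (l!1) (m!0) (m!1) (m!2) \<otimes>\<^sub>Q m4 (l!0) (m!0) (m!1) (m!2)) =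
      - A (\<lambda>l m. br [l!0, l!1] (l!2) (m!0) (m!1) (m!2) \<otimes>\<^sub>Q m4 (l!0) (m!0) (m!1) (m!2))"
  proof (rule A_swap_l[of "Suc 0" 2], goal_cases)
    case (4 a b c d x y z w)
    then show ?case by (simp add: permute_list_transpose_4 tensor_simps m4_swap)
  qed simp_all
  have f2: "A (\<lambda>l m. br [l!0, m!1] (l!1) (l!2) (m!0) (m!2) \<otimes>\<^sub>Q m4 (l!0) (m!0) (m!1) (m!2)) =
      - A (\<lambda>l m. br [l!0, m!0] (l!1) (l!2) (m!1) (m!2) \<otimes>\<^sub>Q m4 (l!0) (m!0) (m!1) (m!2))"
  proof (rule A_swap_m[of 0 "Suc 0"], goal_cases)
    case (4 a b c d x y z w)
    then show ?case by (simp add: permute_list_transpose_4 tensor_simps m4_swap)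
  qed simp_all
  have f3: "A (\<lambda>l m. br [l!0, m!2] (l!1) (l!2) (m!0) (m!1) \<otimes>\<^sub>Q m4 (l!0) (m!0) (m!1) (m!2)) =
      - A (\<lambda>l m. - (br [l!0, m!0] (l!1) (l!2) (m!1) (m!2) \<otimes>\<^sub>Q m4 (l!0) (m!0) (m!1) (m!2)))"
  proof (rule A_swap_m[of 0 2], goal_cases)
    case (4 a b c d x y z w)
    then show ?case using br2_swap(3)[of a z b c y x] by (simp add: permute_list_transpose_4 tensor_simps m4_swap)
  qed simp_all
  \<comment> \<open>The second factor is symmetric in m_0, m_1, m_2 and free of l_1, l_2, so
    reindexing acts on the brackets only: the centers l_0 l_1 and l_0 l_2 give U each, the three
    centers l_0 m_i give E3 each.\<close>
  have "A (\<lambda>l m. dual_five_term [l!0] (l!1) (l!2) (m!0) (m!1) (m!2) \<otimes>\<^sub>Q m4 (l!0) (m!0) (m!1) (m!2)) = A (\<lambda>l m. 0)"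
  proof (rule A_cong, goal_cases)
    case (1 a b c d x y z w)
    note gpD = general_positionD[OF 1(2)]
    define v where "v i = [c, x, y, z] ! i" for i
    have v: "v i \<in> {c, x, y, z}" if "i < 4" for i
      using that nth_mem[of i "[c, x, y, z]"] by (simp add: v_def)
    have inj: "v i = v j \<longleftrightarrow> i = j" if "i < 4" "j < 4" for i j
      using that gpD(9) nth_eq_iff_index_eq[of "[c, x, y, z]" i j] by (simp add: v_def)
    have "dual_five_term [a] b (v 0) (v 1) (v 2) (v 3) = 0"
    proof (rule dual_five_term_4)
      show "v i \<in> carrier_vec 4" if "i < 4" for i using v[OF that] gpD(1-8) by auto
      have "\<Delta> [a, b, x, y] \<noteq> 0" by (rule gpD(10)) (use gpD(9) in auto)
      then show "a \<noteq> 0\<^sub>v 4" "\<Delta> [a, b, x, y] \<noteq> 0" by (auto dest: nonzero_vec_4)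
      show "\<Delta> [v 0, v 1, v 2, v 3] \<noteq> 0"
        unfolding v_def by (rule gpD(10)) (use gpD(9) in auto)
      show "\<exists>u\<in>carrier_vec 4. \<Delta> [v i, a, v j, u] \<noteq> 0" if "i < 4" "j < 4" "i \<noteq> j" for i j
      proof (rule bexI)
        have "v i \<noteq> v j" using that inj by simp
        then show "\<Delta> [v i, a, v j, w] \<noteq> 0"
          by (intro gpD(10)) (use v[OF that(1)] v[OF that(2)] gpD(9) in auto)
      qed (rule gpD(8))
      show "\<not> (\<Delta> [v i, a, v r, v s] = 0 \<and> \<Delta> [v i, b, v r, v s] = 0)"
        if "i < 4" "r < 4" "s < 4" "distinct [i, r, s]" for i r s
      proof -
        have "v i \<noteq> v r" "v i \<noteq> v s" "v r \<noteq> v s" using that inj by auto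
        then have "\<Delta> [v i, a, v r, v s] \<noteq> 0"
          by (intro gpD(10)) (use v[OF that(1)] v[OF that(2)] v[OF that(3)] gpD(9) in auto)
        then show ?thesis by simp
      qed
    qed (rule gpD)+
    then show ?case by (simp add: v_def tensor_simps)
  qed
  also have "A (\<lambda>l m. dual_five_term [l!0] (l!1) (l!2) (m!0) (m!1) (m!2) \<otimes>\<^sub>Q m4 (l!0) (m!0) (m!1) (m!2)) = U + U + (E3 + E3 + E3)"
    by (simp add: dual_five_term_def tensor_simps A_simps u2 f2 f3 U_def E3_def algebra_simps del: One_nat_def)
  also have "A (\<lambda>l m. 0 :: ('a B2, 'a multQ) tensor) = 0"
    by (simp add: A_def Alt_zero)
  finally have 1: "U + U + (E3 + E3 + E3) = 0" .
  have v1: "A (\<lambda>l m. br [l!0, l!1] (l!3) (m!0) (m!1) (m!2) \<otimes>\<^sub>Q m4 (l!0) (m!0) (m!1) (m!2)) =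
      - A (\<lambda>l m. br [l!0, l!1] (l!2) (m!0) (m!1) (m!2) \<otimes>\<^sub>Q m4 (l!0) (m!0) (m!1) (m!2))"
  proof (rule A_swap_l[of 2 3], goal_cases)
    case (4 a b c d x y z w)
    then show ?case by (simp add: permute_list_transpose_4 tensor_simps m4_swap)
  qed simp_all
  have z1: "A (\<lambda>l m. br [l!0, l!1] (l!2) (l!3) (m!1) (m!2) \<otimes>\<^sub>Q m4 (l!0) (m!0) (m!1) (m!2)) =
      - A (\<lambda>l m. - (br [l!0, l!1] (l!2) (l!3) (m!0) (m!1) \<otimes>\<^sub>Q m4 (l!0) (m!0) (m!1) (m!2)))"
  proof (rule A_swap_m[of 0 2], goal_cases)
    case (4 a b c d x y z w)
    then show ?case using br2_swap(3)[of a b c d z y] by (simp add: permute_list_transpose_4 tensor_simps m4_swap)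
  qed simp_all
  have z2: "A (\<lambda>l m. br [l!0, l!1] (l!2) (l!3) (m!0) (m!2) \<otimes>\<^sub>Q m4 (l!0) (m!0) (m!1) (m!2)) =
      - A (\<lambda>l m. br [l!0, l!1] (l!2) (l!3) (m!0) (m!1) \<otimes>\<^sub>Q m4 (l!0) (m!0) (m!1) (m!2))"
  proof (rule A_swap_m[of "Suc 0" 2], goal_cases)
    case (4 a b c d x y z w)
    then show ?case by (simp add: permute_list_transpose_4 tensor_simps m4_swap)
  qed simp_all
  \<comment> \<open>The two brackets with a single l among the four points give - U each, the three
    with both l_2 and l_3 give Z each.\<close>
  have "A (\<lambda>l m. five_term [l!0, l!1] (l!2) (l!3) (m!0) (m!1) (m!2) \<otimes>\<^sub>Q m4 (l!0) (m!0) (m!1) (m!2)) = A (\<lambda>l m. 0)"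
  proof (rule A_cong, goal_cases)
    case (1 a b c d x y z w)
    note gpD = general_positionD[OF 1(2)]
    have "\<Delta> [a, b, c, w] \<noteq> 0" "\<Delta> [a, b, d, w] \<noteq> 0" "\<Delta> [a, b, x, w] \<noteq> 0" "\<Delta> [a, b, y, w] \<noteq> 0"
      "\<Delta> [a, b, z, w] \<noteq> 0"
      by ((rule gpD(10)); use gpD(9) in auto)+
    then have "five_term [a, b] c d x y z = 0"
      using gpD(1-8) by (intro five_term_zero) (auto simp: off_center_def)
    then show ?case by (simp add: tensor_simps)
  qed
  also have "A (\<lambda>l m. five_term [l!0, l!1] (l!2) (l!3) (m!0) (m!1) (m!2) \<otimes>\<^sub>Q m4 (l!0) (m!0) (m!1) (m!2)) = Z + Z + Z - (U + U)"
    by (simp add: five_term_def tensor_simps A_simps v1 z1 z2 U_def Z_def algebra_simps del: One_nat_def)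
  also have "A (\<lambda>l m. 0 :: ('a B2, 'a multQ) tensor) = 0"
    by (simp add: A_def Alt_zero)
  finally have 2: "Z + Z + Z - (U + U) = 0" .
  have "3 *\<^sub>Q (E3 + Z) = (U + U + (E3 + E3 + E3)) + (Z + Z + Z - (U + U))"
    using scaleQ_add_left[of 1 2 "E3 + Z"] by (simp add: scaleQ_2 scaleQ_one algebra_simps)
  then have "E3 + Z = 0" unfolding 1 2 by simp
  then show ?thesis by (simp add: eq_neg_iff_add_eq_0)
qed

end

section \<open>The value of $\nu$\<close>

lemma nth_in_omit:
  assumes "i < length xs" "k < length xs" "i \<noteq> k"
  shows "xs ! k \<in> set (omit i xs)"
  using nth_omit_skip[OF assms] length_omit[OF assms(1)] by (metis nth_mem)

text \<open>A face of the first simplex contains a vertex, and a face of the second lies in a facet;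
  so it suffices that no vertex of the first lies in a facet of the second.\<close>

lemma admissibleI:
  fixes L M :: "'a::field points"
  assumes len: "length L = Suc n" "length M = Suc n" and pts: "points n L" "points n M"
    and L: "\<And>l j. l \<in> set L \<Longrightarrow> j \<le> n \<Longrightarrow> l \<notin> vec_span (Suc n) (omit j M)"
  shows "admissible n (L, M)"
proof -
  interpret V: vec_space "TYPE('a)" "Suc n" .
  have carr: "set L \<subseteq> carrier_vec (Suc n)" "set M \<subseteq> carrier_vec (Suc n)"
    using pts by (auto simp: points_def)
  have "vec_span (Suc n) (nths L I) \<noteq> vec_span (Suc n) (nths M J)"
    if I: "I \<noteq> {}" "I \<subset> {..n}" and J: "J \<noteq> {}" "J \<subset> {..n}" for I J
  proof -
    obtain i j where i: "i \<in> I" "i \<le> n" and j: "j \<notin> J" "j \<le> n" using I J by blast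
    have "L ! i \<in> set (nths L I)" using i len by (auto simp: set_nths)
    moreover have "set (nths L I) \<subseteq> carrier_vec (Suc n)" using carr set_nths_subset[of L I] by blast
    ultimately have "L ! i \<in> vec_span (Suc n) (nths L I)"
      unfolding vec_span_def by (rule V.span_mem[rotated])
    moreover have "set (nths M J) \<subseteq> set (omit j M)"
      using j len by (auto simp: set_nths intro!: nth_in_omit)
    then have "vec_span (Suc n) (nths M J) \<subseteq> vec_span (Suc n) (omit j M)"
      unfolding vec_span_def by (rule V.span_is_monotone)
    moreover have "L ! i \<in> set L" using i len by simp
    ultimately show ?thesis using L[of "L ! i" j] j by blast
  qed
  then show ?thesis using len pts by (simp add: admissible_def)
qed

lemma admissible_1I:
  fixes a b c d :: "'a::field vec"
  assumes "set [a, b, c, d] \<subseteq> carrier_vec 2"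
    and "\<Delta> [a, c] \<noteq> 0" "\<Delta> [a, d] \<noteq> 0" "\<Delta> [b, c] \<noteq> 0" "\<Delta> [b, d] \<noteq> 0"
  shows "admissible 1 ([a, b], [c, d])"
proof (rule admissibleI)
  have "u \<noteq> 0\<^sub>v 2" "v \<noteq> 0\<^sub>v 2" if "\<Delta> [u, v] \<noteq> 0" for u v :: "'a vec" using that by (auto simp: \<Delta>_2)
  then show "points 1 [a, b]" "points 1 [c, d]" using assms by (auto simp: points_def numeral_2_eq_2)
  have sp: "u \<notin> vec_span 2 [v]" if "\<Delta> [u, v] \<noteq> 0" "v \<in> carrier_vec 2" for u v :: "'a vec"
    using that by (auto simp: vec_span_1 \<Delta>_2)
  fix l j assume "l \<in> set [a, b]" "j \<le> (1::nat)"
  then have "l = a \<or> l = b" "j = 0 \<or> j = Suc 0" by auto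
  then show "l \<notin> vec_span (Suc 1) (omit j [c, d])"
    using sp assms by (elim disjE) (simp_all add: omit_list numeral_2_eq_2[symmetric])
qed simp_all

lemma admissible_2I:
  fixes l0 l1 l2 m0 m1 m2 :: "'a::field vec"
  assumes "set [l0, l1, l2, m0, m1, m2] \<subseteq> carrier_vec 3"
    and nz: "\<And>l m m'. l \<in> {l0, l1, l2} \<Longrightarrow> (m, m') \<in> {(m0, m1), (m0, m2), (m1, m2)} \<Longrightarrow> \<Delta> [l, m, m'] \<noteq> 0"
  shows "admissible 2 ([l0, l1, l2], [m0, m1, m2])"
proof (rule admissibleI)
  have "u \<noteq> 0\<^sub>v 3" "v \<noteq> 0\<^sub>v 3" "w \<noteq> 0\<^sub>v 3" if "\<Delta> [u, v, w] \<noteq> 0" for u v w :: "'a vec"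
    using that by (auto simp: \<Delta>_3)
  then have "l0 \<noteq> 0\<^sub>v 3" "l1 \<noteq> 0\<^sub>v 3" "l2 \<noteq> 0\<^sub>v 3" "m0 \<noteq> 0\<^sub>v 3" "m1 \<noteq> 0\<^sub>v 3" "m2 \<noteq> 0\<^sub>v 3"
    using nz[of l0 m0 m1] nz[of l1 m0 m1] nz[of l2 m1 m2] by auto
  then show "points 2 [l0, l1, l2]" "points 2 [m0, m1, m2]"
    using assms(1) by (auto simp: points_def numeral_3_eq_3 numeral_2_eq_2)
  have sp: "u \<notin> vec_span 3 [v, w]"
    if "\<Delta> [u, v, w] \<noteq> 0" "v \<in> carrier_vec 3" "w \<in> carrier_vec 3" for u v w :: "'a vec"
    using that by (auto simp: vec_span_2 \<Delta>_3_lincomb \<Delta>_3_repeat)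
  fix l j assume l: "l \<in> set [l0, l1, l2]" and "j \<le> (2::nat)"
  then have "j = 0 \<or> j = Suc 0 \<or> j = 2" by auto
  then show "l \<notin> vec_span (Suc 2) (omit j [m0, m1, m2])"
    using sp nz[of l] l assms(1) by (elim disjE) (simp_all add: omit_list)
qed simp_all

lemma a1_project_2:
  fixes p q u v s t :: "'a::field vec"
  assumes carr: "set [p, q, u, v, s, t] \<subseteq> carrier_vec 4"
    and nz: "\<Delta> [p, q, u, s] \<noteq> 0" "\<Delta> [p, q, u, t] \<noteq> 0" "\<Delta> [p, q, v, s] \<noteq> 0" "\<Delta> [p, q, v, t] \<noteq> 0"
  shows "a1 (A1_class (project [p, q] [u, v]) (project [p, q] [s, t])) =
    mult_class (\<Delta> [p, q, u, s]) + mult_class (\<Delta> [p, q, v, t]) -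
    mult_class (\<Delta> [p, q, u, t]) - mult_class (\<Delta> [p, q, v, s])"
proof -
  have "set [p, q] \<subseteq> carrier_vec 4" "set [u, s] \<subseteq> carrier_vec 4" "\<Delta> ([p, q] @ [u, s]) \<noteq> 0"
    using carr nz(1) by auto
  then obtain r where r: "r \<noteq> 0" "projection_mat 4 [p, q] \<in> carrier_mat (length [u, s]) 4"
    "\<And>bs. set bs \<subseteq> carrier_vec 4 \<Longrightarrow> length bs = length [u, s] \<Longrightarrow>
      \<Delta> (map ((*\<^sub>v) (projection_mat 4 [p, q])) bs) = r * \<Delta> ([p, q] @ bs)"
    using project_scaling[of "[p, q]" 4 "[u, s]"] by auto
  define P where "P = projection_mat 4 [p, q]"
  have P: "\<Delta> [P *\<^sub>v a, P *\<^sub>v b] = r * \<Delta> [p, q, a, b]" if "a \<in> carrier_vec 4" "b \<in> carrier_vec 4" for a b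
    using r(3)[of "[a, b]"] that by (simp add: P_def)
  have Pc: "P *\<^sub>v a \<in> carrier_vec 2" for a
  proof (rule carrier_vecI)
    have "length [u, s] = 2" by simp
    then show "dim_vec (P *\<^sub>v a) = 2"
      using carrier_matD(1)[OF r(2)] by (simp only: P_def dim_mult_mat_vec)
  qed
  have proj: "project [p, q] = map ((*\<^sub>v) P)"
    using carr by (auto simp: project_def P_def fun_eq_iff)
  have nz': "\<Delta> [P *\<^sub>v u, P *\<^sub>v s] \<noteq> 0" "\<Delta> [P *\<^sub>v u, P *\<^sub>v t] \<noteq> 0" "\<Delta> [P *\<^sub>v v, P *\<^sub>v s] \<noteq> 0" "\<Delta> [P *\<^sub>v v, P *\<^sub>v t] \<noteq> 0"
    using carr nz r(1) by (simp_all add: P)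
  have "a1 (A1_class (project [p, q] [u, v]) (project [p, q] [s, t])) = pair1 ([P *\<^sub>v u, P *\<^sub>v v], [P *\<^sub>v s, P *\<^sub>v t])"
    using a1_class[OF admissible_1I[OF _ nz']] by (simp add: proj pair1_def Pc)
  also have "\<dots> = mult_class (\<Delta> [p, q, u, s]) + mult_class (\<Delta> [p, q, v, t]) -
      mult_class (\<Delta> [p, q, u, t]) - mult_class (\<Delta> [p, q, v, s])"
    using pair1_eq[OF nz'] carr nz r(1) by (simp add: P mult_class_mult)
  finally show ?thesis .
qed

lemma Alt_3:
  fixes f :: "'a list \<Rightarrow> 'b::rat_vector"
  shows "Alt 3 f [a, b, c] =
  f [a, b, c] - f [a, c, b] - f [b, a, c] + f [b, c, a] + f [c, a, b] - f [c, b, a]"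
proof -
  have 1: "Alt (Suc 0) g [p] = g [p]" for g :: "'a list \<Rightarrow> 'b::rat_vector" and p
    by (subst Alt_Suc) (simp_all add: Alt_0 omit_list scaleQ_one)
  have 2: "Alt (Suc (Suc 0)) g [p, q] = g [p, q] - g [q, p]" for g :: "'a list \<Rightarrow> 'b" and p q
    by (subst Alt_Suc) (simp_all add: 1 omit_list scaleQ_one)
  show ?thesis
    unfolding numeral_3_eq_3 by (subst Alt_Suc) (simp_all add: 2 omit_list scaleQ_one)
qed

text \<open>Rows and columns of \<open>X\<close> have alternating sum 0. Hence the terms with
  \<open>N i 0\<close>, \<open>N 0 j\<close> and \<open>N 0 0\<close>, whose second factors do not
  depend on j, on i or on either, collapse to the boundary terms with j = 0, with i = 0 and with i =
  j = 0, which are just the ones missing from the sum over i, j \<ge> 1.\<close>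

lemma tensor_regroup:
  fixes X :: "nat \<Rightarrow> nat \<Rightarrow> 'u::rat_vector" and N :: "nat \<Rightarrow> nat \<Rightarrow> 'v::rat_vector"
  assumes X0: "\<And>j. j \<le> 3 \<Longrightarrow> (\<Sum>i\<le>3. (-1) ^ i *\<^sub>Q X i j) = 0"
    and X1: "\<And>i. i \<le> 3 \<Longrightarrow> (\<Sum>j\<le>3. (-1) ^ j *\<^sub>Q X i j) = 0"
  shows "(\<Sum>i=1..3. \<Sum>j=1..3. (-1) ^ (i + j) *\<^sub>Q (X i j \<otimes>\<^sub>Q (N i 0 + N 0 j - N 0 0 - N i j))) =
    - (\<Sum>i\<le>3. \<Sum>j\<le>3. (-1) ^ (i + j) *\<^sub>Q (X i j \<otimes>\<^sub>Q N i j))"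
proof -
  have split: "(\<Sum>i\<le>3. f i) = f 0 + (\<Sum>i=1..3. f i)" for f :: "nat \<Rightarrow> 'w::rat_vector"
    by (simp add: atMost_atLeast0 sum.atLeast_Suc_atMost)
  have col: "(\<Sum>i=1..3. (-1) ^ i *\<^sub>Q X i j) = - X 0 j" if "j \<le> 3" for j
    using X0[OF that] by (simp add: split scaleQ_one eq_neg_iff_add_eq_0 add.commute)
  have row: "(\<Sum>j=1..3. (-1) ^ j *\<^sub>Q X i j) = - X i 0" if "i \<le> 3" for i
    using X1[OF that] by (simp add: split scaleQ_one eq_neg_iff_add_eq_0 add.commute)
  have a: "(\<Sum>i=1..3. \<Sum>j=1..3. (-1) ^ (i + j) *\<^sub>Q (X i j \<otimes>\<^sub>Q N i 0)) = - (\<Sum>i=1..3. (-1) ^ i *\<^sub>Q (X i 0 \<otimes>\<^sub>Q N i 0))"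
    unfolding sum_negf[symmetric]
  proof (rule sum.cong[OF refl])
    fix i :: nat assume "i \<in> {1..3}"
    then have i: "i \<le> 3" by simp
    have "(\<Sum>j=1..3. (-1) ^ (i + j) *\<^sub>Q (X i j \<otimes>\<^sub>Q N i 0)) = (-1) ^ i *\<^sub>Q ((\<Sum>j=1..3. (-1) ^ j *\<^sub>Q X i j) \<otimes>\<^sub>Q N i 0)"
      by (simp only: tensor_simps Q.scale_sum_right scaleQ_scaleQ power_add)
    then show "(\<Sum>j=1..3. (-1) ^ (i + j) *\<^sub>Q (X i j \<otimes>\<^sub>Q N i 0)) = - ((-1) ^ i *\<^sub>Q (X i 0 \<otimes>\<^sub>Q N i 0))"
      unfolding row[OF i] by (simp only: tensor_simps Q.scale_minus_right)
  qed
  have b: "(\<Sum>i=1..3. \<Sum>j=1..3. (-1) ^ (i + j) *\<^sub>Q (X i j \<otimes>\<^sub>Q N 0 j)) = - (\<Sum>j=1..3. (-1) ^ j *\<^sub>Q (X 0 j \<otimes>\<^sub>Q N 0 j))"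
    unfolding sum_negf[symmetric]
  proof (subst sum.swap, rule sum.cong[OF refl])
    fix j :: nat assume "j \<in> {1..3}"
    then have j: "j \<le> 3" by simp
    have "(\<Sum>i=1..3. (-1) ^ (i + j) *\<^sub>Q (X i j \<otimes>\<^sub>Q N 0 j)) = (-1) ^ j *\<^sub>Q ((\<Sum>i=1..3. (-1) ^ i *\<^sub>Q X i j) \<otimes>\<^sub>Q N 0 j)"
      by (simp only: tensor_simps Q.scale_sum_right scaleQ_scaleQ power_add mult.commute)
    then show "(\<Sum>i=1..3. (-1) ^ (i + j) *\<^sub>Q (X i j \<otimes>\<^sub>Q N 0 j)) = - ((-1) ^ j *\<^sub>Q (X 0 j \<otimes>\<^sub>Q N 0 j))"
      unfolding col[OF j] by (simp only: tensor_simps Q.scale_minus_right)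
  qed
  have c: "(\<Sum>i=1..3. \<Sum>j=1..3. (-1) ^ (i + j) *\<^sub>Q (X i j \<otimes>\<^sub>Q N 0 0)) = X 0 0 \<otimes>\<^sub>Q N 0 0"
  proof -
    have "(\<Sum>i=1..3. \<Sum>j=1..3. (-1) ^ (i + j) *\<^sub>Q (X i j \<otimes>\<^sub>Q N 0 0)) =
        (\<Sum>i=1..3. (-1) ^ i *\<^sub>Q (\<Sum>j=1..3. (-1) ^ j *\<^sub>Q X i j)) \<otimes>\<^sub>Q N 0 0"
      by (simp only: tensor_simps Q.scale_sum_right scaleQ_scaleQ power_add)
    also have "(\<Sum>i=1..3. (-1) ^ i *\<^sub>Q (\<Sum>j=1..3. (-1) ^ j *\<^sub>Q X i j)) = (\<Sum>i=1..3. - ((-1) ^ i *\<^sub>Q X i 0))"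
      by (rule sum.cong[OF refl]) (simp only: row atLeastAtMost_iff Q.scale_minus_right)
    also have "\<dots> = X 0 0"
      unfolding sum_negf by (simp only: col minus_minus zero_le)
    finally show ?thesis .
  qed
  show ?thesis
    unfolding split tensor_simps Q.scale_right_diff_distrib scaleQ_add_right sum.distrib sum_subtractf
    unfolding a b c by (simp add: scaleQ_one)
qed

lemma omit_map: "omit i (map f xs) = map f (omit i xs)"
  by (simp add: omit_def take_map drop_map)

lemma admissible_project:
  fixes x :: "'a::field vec"
  assumes carr: "set [x, l0, l1, l2, m0, m1, m2] \<subseteq> carrier_vec 4"
    and nz: "\<And>l m m'. l \<in> {l0, l1, l2} \<Longrightarrow> (m, m') \<in> {(m0, m1), (m0, m2), (m1, m2)} \<Longrightarrow>
      \<Delta> [x, l, m, m'] \<noteq> 0"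
  shows "admissible 2 (project [x] [l0, l1, l2], project [x] [m0, m1, m2])"
proof -
  have x: "x \<in> carrier_vec 4" "x \<noteq> 0\<^sub>v 4" using carr nz[of l0 m0 m1] by (auto dest: nonzero_vec_4)
  obtain P r where P: "r \<noteq> 0" "P \<in> carrier_mat 3 4" "project [x] = map ((*\<^sub>v) P)"
    "\<And>a b c. a \<in> carrier_vec 4 \<Longrightarrow> b \<in> carrier_vec 4 \<Longrightarrow> c \<in> carrier_vec 4 \<Longrightarrow>
      \<Delta> [P *\<^sub>v a, P *\<^sub>v b, P *\<^sub>v c] = r * \<Delta> [x, a, b, c]"
    by (rule project_4[OF x]) blast
  have "admissible 2 ([P *\<^sub>v l0, P *\<^sub>v l1, P *\<^sub>v l2], [P *\<^sub>v m0, P *\<^sub>v m1, P *\<^sub>v m2])"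
  proof (rule admissible_2I)
    show "set [P *\<^sub>v l0, P *\<^sub>v l1, P *\<^sub>v l2, P *\<^sub>v m0, P *\<^sub>v m1, P *\<^sub>v m2] \<subseteq> carrier_vec 3"
      using P(2) carr by auto
    fix l m m' assume "l \<in> {P *\<^sub>v l0, P *\<^sub>v l1, P *\<^sub>v l2}"
      "(m, m') \<in> {(P *\<^sub>v m0, P *\<^sub>v m1), (P *\<^sub>v m0, P *\<^sub>v m2), (P *\<^sub>v m1, P *\<^sub>v m2)}"
    then obtain k n n' where "l = P *\<^sub>v k" "m = P *\<^sub>v n" "m' = P *\<^sub>v n'" "k \<in> {l0, l1, l2}"
      "(n, n') \<in> {(m0, m1), (m0, m2), (m1, m2)}" by blast
    then show "\<Delta> [l, m, m'] \<noteq> 0"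
      using P(1) nz[of k n n'] carr by (auto simp: P(4))
  qed
  then show ?thesis by (simp add: P(3))
qed

lemma a2_wedge_a1_split:
  assumes a2: "Qlinear (a2 :: 'a::field A2 \<Rightarrow> _)" and a1: "Qlinear (a1 :: 'a A1 \<Rightarrow> _)"
  shows "a2_wedge_a1 ((\<Sum>i\<in>I. \<Sum>j\<in>J. c i j *\<^sub>Q (A i j \<otimes>\<^sub>Q B i j)), (\<Sum>i\<in>I. \<Sum>j\<in>J. c i j *\<^sub>Q (B' i j \<otimes>\<^sub>Q A' i j))) =
    (\<Sum>i\<in>I. \<Sum>j\<in>J. c i j *\<^sub>Q (a2 (A i j) \<otimes>\<^sub>Q a1 (B i j))) -
    (\<Sum>i\<in>I. \<Sum>j\<in>J. c i j *\<^sub>Q (a2 (A' i j :: 'a A2) \<otimes>\<^sub>Q a1 (B' i j)))"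
proof -
  note W = a2_wedge_a1_props[OF a2 a1]
  let ?f = "\<lambda>t. a2_wedge_a1 (t, 0) :: ('a B2, 'a multQ) tensor"
  let ?g = "\<lambda>t. a2_wedge_a1 (0, t) :: ('a B2, 'a multQ) tensor"
  have f: "Qlinear ?f"
    by (rule QlinearI) (simp_all add: scaleQ_prod_def flip: Qlinear_add[OF W(1)] Qlinear_scale[OF W(1)])
  have g: "Qlinear ?g"
    by (rule QlinearI) (simp_all add: scaleQ_prod_def flip: Qlinear_add[OF W(1)] Qlinear_scale[OF W(1)])
  have split: "a2_wedge_a1 (s, t) = ?f s + ?g t" for s t
    by (simp flip: Qlinear_add[OF W(1)])
  have fv: "?f (u \<otimes>\<^sub>Q v) = a2 u \<otimes>\<^sub>Q a1 v" for u v
    using W(2)[of u v 0 0] by (simp add: tensor_simps Qlinear_zero[OF a2])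
  have gv: "?g (v \<otimes>\<^sub>Q u) = - (a2 u \<otimes>\<^sub>Q a1 v)" for u v
    using W(2)[of 0 0 v u] by (simp add: tensor_simps Qlinear_zero[OF a2])
  show ?thesis
    by (subst split, unfold Qlinear_sum[OF f] Qlinear_sum[OF g] Qlinear_scale[OF f] Qlinear_scale[OF g] fv gv)
      (simp add: sum_negf)
qed

context tetrahedra
begin

text \<open>Each of the nine brackets of \<open>tri\<close> occurs four times among the 36 terms,
  through the exchange of u!1, u!2 and of v!0, v!1, always with the same sign; hence the factor
  1/4.\<close>

lemma pair2_project_Alt:
  fixes x :: "'a vec"
  assumes carr: "set [x, u0, u1, u2, v0, v1, v2] \<subseteq> carrier_vec 4" and nz: "\<Delta> [x, u0, u1, u2] \<noteq> 0"
  shows "pair2 (project [x] [u0, u1, u2], project [x] [v0, v1, v2]) = (1/4) *\<^sub>Q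
    Alt 3 (\<lambda>u. Alt 3 (\<lambda>v. br [x, u!0] (u!1) (u!2) (v!0) (v!1)) [v0, v1, v2]) [u0, u1, u2]"
proof -
  have x: "x \<in> carrier_vec 4" "x \<noteq> 0\<^sub>v 4" using carr nz by (auto dest: nonzero_vec_4)
  obtain P r where P: "r \<noteq> 0" "P \<in> carrier_mat 3 4" "project [x] = map ((*\<^sub>v) P)"
    "\<And>a b c. a \<in> carrier_vec 4 \<Longrightarrow> b \<in> carrier_vec 4 \<Longrightarrow> c \<in> carrier_vec 4 \<Longrightarrow>
      \<Delta> [P *\<^sub>v a, P *\<^sub>v b, P *\<^sub>v c] = r * \<Delta> [x, a, b, c]"
    by (rule project_4[OF x]) blast
  have "\<Delta> [P *\<^sub>v u0, P *\<^sub>v u1, P *\<^sub>v u2] \<noteq> 0" using nz P(1) carr by (simp add: P(4))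
  then have "P *\<^sub>v u0 \<noteq> 0\<^sub>v 3" "P *\<^sub>v u1 \<noteq> 0\<^sub>v 3" "P *\<^sub>v u2 \<noteq> 0\<^sub>v 3" by (auto simp: \<Delta>_3)
  then have "set [P *\<^sub>v u0, P *\<^sub>v u1, P *\<^sub>v u2] \<subseteq> carrier_vec 3 - {0\<^sub>v 3}"
    "set [P *\<^sub>v v0, P *\<^sub>v v1, P *\<^sub>v v2] \<subseteq> carrier_vec 3"
    using P(2) carr by auto
  from pair2_eq_tri[OF this]
  have eq: "pair2 (project [x] [u0, u1, u2], project [x] [v0, v1, v2]) =
    br [x, u0] u1 u2 v1 v2 - br [x, u0] u1 u2 v0 v2 + br [x, u0] u1 u2 v0 v1
    - (br [x, u1] u0 u2 v1 v2 - br [x, u1] u0 u2 v0 v2 + br [x, u1] u0 u2 v0 v1)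
    + (br [x, u2] u0 u1 v1 v2 - br [x, u2] u0 u1 v0 v2 + br [x, u2] u0 u1 v0 v1)"
    using carr by (simp add: P(3) tri_def br_project[OF P(1,4)])
  have sw: "br [x, p] u1 u0 v w = - br [x, p] u0 u1 v w" "br [x, p] u2 u0 v w = - br [x, p] u0 u2 v w"
    "br [x, p] u2 u1 v w = - br [x, p] u1 u2 v w" "br [x, p] v w v1 v0 = - br [x, p] v w v0 v1"
    "br [x, p] v w v2 v0 = - br [x, p] v w v0 v2" "br [x, p] v w v2 v1 = - br [x, p] v w v1 v2"
    if "p \<in> carrier_vec 4" "v \<in> carrier_vec 4" "w \<in> carrier_vec 4" for p v w
    using br2_swap(1)[of x p u0 u1 v w] br2_swap(1)[of x p u0 u2 v w] br2_swap(1)[of x p u1 u2 v w]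
      br2_swap(3)[of x p v w v0 v1] br2_swap(3)[of x p v w v0 v2] br2_swap(3)[of x p v w v1 v2]
      that carr by simp_all
  have inner: "Alt 3 (\<lambda>v. br [x, p] a b (v!0) (v!Suc 0)) [v0, v1, v2] =
      2 *\<^sub>Q (br [x, p] a b v1 v2 - br [x, p] a b v0 v2 + br [x, p] a b v0 v1)"
    if "p \<in> carrier_vec 4" "a \<in> carrier_vec 4" "b \<in> carrier_vec 4" for p a b
    using that carr by (simp add: Alt_3 sw(4-6) scaleQ_2 algebra_simps)
  have "Alt 3 (\<lambda>u. Alt 3 (\<lambda>v. br [x, u!0] (u!1) (u!2) (v!0) (v!1)) [v0, v1, v2]) [u0, u1, u2] =
      2 *\<^sub>Q 2 *\<^sub>Q pair2 (project [x] [u0, u1, u2], project [x] [v0, v1, v2])"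
    unfolding eq using carr by (simp add: Alt_3[of _ u0 u1 u2] inner sw(1-3) scaleQ_2 algebra_simps)
  then show ?thesis by (simp add: scaleQ_scaleQ scaleQ_one)
qed

section \<open>Regrouping of \<nu> over all pairs of vertices\<close>

definition XL :: "nat \<Rightarrow> nat \<Rightarrow> 'a B2"
  where "XL i j = pair2 (project [L!i] (omit i L), project [L!i] (omit j M))"

definition XM :: "nat \<Rightarrow> nat \<Rightarrow> 'a B2"
  where "XM i j = pair2 (project [M!j] (omit i L), project [M!j] (omit j M))"

definition NL :: "nat \<Rightarrow> nat \<Rightarrow> 'a multQ"
  where "NL i j = mult_class (\<Delta> (L!i # omit j M))"

definition NM :: "nat \<Rightarrow> nat \<Rightarrow> 'a multQ"
  where "NM i j = mult_class (\<Delta> (M!j # omit i L))"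

lemma Alt_3_m4:
  fixes f :: "'a vec list \<Rightarrow> 'a B2"
  shows "Alt 3 (\<lambda>v. f v \<otimes>\<^sub>Q m4 a (v!0) (v!1) (v!2)) [y, z, w] = Alt 3 f [y, z, w] \<otimes>\<^sub>Q m4 a y z w"
  by (simp add: Alt_3 tensor_simps m4_swap)

text \<open>The second factor is symmetric in the last three m's, so the alternation over them
  passes through the tensor product. Moving the omitted vertex of M from the front to the end is a
  cycle of length four, whence the sign.\<close>

lemma sum_XL_NL: "(\<Sum>i\<le>3. \<Sum>j\<le>3. (-1) ^ (i + j) *\<^sub>Q (XL i j \<otimes>\<^sub>Q NL i j)) = - (1/4) *\<^sub>Q Z"
proof -
  let ?H = "\<lambda>a x u v. br [a, u!0] (u!1) (u!2) (v!0) (v!1) \<otimes>\<^sub>Q m4 a (v!0) (v!1) (v!2)"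
  have "XL i j \<otimes>\<^sub>Q NL i j = (1/4) *\<^sub>Q Alt 3 (\<lambda>u. Alt 3 (?H (L!i) (M!j) u) (omit j M)) (omit i L)"
    if "i \<in> {..3}" "j \<in> {..3}" for i j
  proof -
    have "i < 4" "j < 4" using that by auto
    from general_position_omit[OF general this] obtain a b c d x y z w
      where LM: "L ! i = a" "omit i L = [b, c, d]" "M ! j = x" "omit j M = [y, z, w]"
        and gp: "general_position [a, b, c, d] [x, y, z, w]" by metis
    note gpD = general_positionD[OF gp]
    have "\<Delta> [a, b, c, d] \<noteq> 0" by (rule gpD(10)) (use gpD(9) in auto)
    then show ?thesis
      unfolding XL_def NL_def LM Alt_3_m4 using gpD(1-8)
      by (subst pair2_project_Alt)
        (simp_all add: tensor_simps flip: Alt_Qlinear[OF Qlinear_tensor_left])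
  qed
  then have "(\<Sum>i\<le>3. \<Sum>j\<le>3. (-1) ^ (i + j) *\<^sub>Q (XL i j \<otimes>\<^sub>Q NL i j)) = (1/4) *\<^sub>Q
      (\<Sum>i\<le>3. \<Sum>j\<le>3. (-1) ^ (i + j) *\<^sub>Q Alt 3 (\<lambda>u. Alt 3 (?H (L!i) (M!j) u) (omit j M)) (omit i L))"
    unfolding Q.scale_sum_right by (intro sum.cong refl) (simp add: scaleQ_scaleQ mult.commute)
  also have "(\<Sum>i\<le>3. \<Sum>j\<le>3. (-1) ^ (i + j) *\<^sub>Q
      Alt 3 (\<lambda>u. Alt 3 (?H (L!i) (M!j) u) (omit j M)) (omit i L)) = A (\<lambda>l m. ?H (hd l) (hd m) (tl l) (tl m))"
    by (rule Alt_double)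
  also have "A (\<lambda>l m. ?H (hd l) (hd m) (tl l) (tl m)) = - Z"
    unfolding Z_def by (rule A_rotate_m) simp
  finally show ?thesis by simp
qed

lemma sum_XM_NM: "(\<Sum>i\<le>3. \<Sum>j\<le>3. (-1) ^ (i + j) *\<^sub>Q (XM i j \<otimes>\<^sub>Q NM i j)) = - (1/4) *\<^sub>Q E1"
proof -
  let ?H = "\<lambda>a x u v. br [x, u!0] (u!1) (u!2) (v!0) (v!1) \<otimes>\<^sub>Q m4 x (u!0) (u!1) (u!2)"
  have "XM i j \<otimes>\<^sub>Q NM i j = (1/4) *\<^sub>Q Alt 3 (\<lambda>u. Alt 3 (?H (L!i) (M!j) u) (omit j M)) (omit i L)"
    if "i \<in> {..3}" "j \<in> {..3}" for i j
  proof -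
    have "i < 4" "j < 4" using that by auto
    from general_position_omit[OF general this] obtain a b c d x y z w
      where LM: "L ! i = a" "omit i L = [b, c, d]" "M ! j = x" "omit j M = [y, z, w]"
        and gp: "general_position [a, b, c, d] [x, y, z, w]" by metis
    note gpD = general_positionD[OF gp]
    have "\<Delta> [x, b, c, d] \<noteq> 0" by (rule gpD(10)) (use gpD(9) in auto)
    then show ?thesis
      unfolding XM_def NM_def LM Alt_Qlinear[OF Qlinear_tensor_left, symmetric] Alt_3_m4 using gpD(1-8)
      by (subst pair2_project_Alt) (simp_all add: tensor_simps)
  qed
  then have "(\<Sum>i\<le>3. \<Sum>j\<le>3. (-1) ^ (i + j) *\<^sub>Q (XM i j \<otimes>\<^sub>Q NM i j)) = (1/4) *\<^sub>Q
      (\<Sum>i\<le>3. \<Sum>j\<le>3. (-1) ^ (i + j) *\<^sub>Q Alt 3 (\<lambda>u. Alt 3 (?H (L!i) (M!j) u) (omit j M)) (omit i L))"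
    unfolding Q.scale_sum_right by (intro sum.cong refl) (simp add: scaleQ_scaleQ mult.commute)
  also have "(\<Sum>i\<le>3. \<Sum>j\<le>3. (-1) ^ (i + j) *\<^sub>Q
      Alt 3 (\<lambda>u. Alt 3 (?H (L!i) (M!j) u) (omit j M)) (omit i L)) = A (\<lambda>l m. ?H (hd l) (hd m) (tl l) (tl m))"
    by (rule Alt_double)
  also have "A (\<lambda>l m. ?H (hd l) (hd m) (tl l) (tl m)) = - E1"
    unfolding E1_def by (rule A_rotate_l) (simp add: br_center_swap m4_swap)
  finally show ?thesis by simp
qed

lemma admissible_LM:
  assumes "i \<le> 3" "j \<le> 3"
  shows admissible_L: "admissible 2 (project [L!i] (omit i L), project [L!i] (omit j M))"
    and admissible_M: "admissible 2 (project [M!j] (omit i L), project [M!j] (omit j M))"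
proof -
  have "i < 4" "j < 4" using assms by auto
  from general_position_omit[OF general this] obtain a b c d x y z w
    where LM: "L ! i = a" "omit i L = [b, c, d]" "M ! j = x" "omit j M = [y, z, w]"
      and gp: "general_position [a, b, c, d] [x, y, z, w]" by metis
  note gpD = general_positionD[OF gp]
  show "admissible 2 (project [L!i] (omit i L), project [L!i] (omit j M))"
    "admissible 2 (project [M!j] (omit i L), project [M!j] (omit j M))"
    unfolding LM
    by (rule admissible_project; (rule gpD(10))?; use gpD(1-9) in auto)+
qed

lemma points_LM: "points 3 L" "points 3 M"
proof -
  have "x \<in> carrier_vec 4 \<and> x \<noteq> 0\<^sub>v 4" if "x \<in> set (L @ M)" for x
  proof (rule general_position_explicit[OF general])
    fix a b c d y z w v
    assume LM: "L = [a, b, c, d]" "M = [y, z, w, v]" and gp: "general_position [a, b, c, d] [y, z, w, v]"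
    note gpD = general_positionD[OF gp]
    have "\<Delta> [a, b, c, d] \<noteq> 0" "\<Delta> [b, c, d, a] \<noteq> 0" "\<Delta> [c, d, a, b] \<noteq> 0" "\<Delta> [d, a, b, c] \<noteq> 0"
      "\<Delta> [y, z, w, v] \<noteq> 0" "\<Delta> [z, w, v, y] \<noteq> 0" "\<Delta> [w, v, y, z] \<noteq> 0" "\<Delta> [v, y, z, w] \<noteq> 0"
      by ((rule gpD(10)); use gpD(9) in auto)+
    then show ?thesis using that gpD(1-8) by (auto simp: LM dest: nonzero_vec_4)
  qed
  then show "points 3 L" "points 3 M" by (auto simp: points_def)
qed

lemma points_omit: "points n xs \<Longrightarrow> points n (omit i xs)"
  unfolding points_def omit_def by (auto dest: in_set_takeD in_set_dropD)

text \<open>These are instances of the relations of \<open>A_rels 2\<close>: the projection relation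
  where the summation index is the center, the additivity relation in a fixed plane where it is
  not.\<close>

lemma X_relations:
  assumes k: "k \<le> 3"
  shows "(\<Sum>i\<le>3. (-1) ^ i *\<^sub>Q XL i k) = 0" "(\<Sum>j\<le>3. (-1) ^ j *\<^sub>Q XL k j) = 0"
    "(\<Sum>i\<le>3. (-1) ^ i *\<^sub>Q XM i k) = 0" "(\<Sum>j\<le>3. (-1) ^ j *\<^sub>Q XM k j) = 0"
proof -
  note p = points_LM
  have len: "length (omit k L) = 3" "length (omit k M) = 3" using k length_LM by (simp_all add: length_omit)
  have proj: "omit j (project [x] xs) = project [x] (omit j xs)" "length (project [x] xs) = length xs"
    for j x and xs :: "'a points"
    by (simp_all add: project_def omit_map)
  let ?r1 = "\<Sum>i\<le>Suc 2. (-1) ^ i *\<^sub>Q gen (project [L!i] (omit i L), project [L!i] (omit k M))"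
  let ?r2 = "\<Sum>j\<le>Suc 2. (-1) ^ j *\<^sub>Q gen (project [L!k] (omit k L), omit j (project [L!k] M))"
  let ?r3 = "\<Sum>i\<le>Suc 2. (-1) ^ i *\<^sub>Q gen (omit i (project [M!k] L), project [M!k] (omit k M))"
  let ?r4 = "\<Sum>j\<le>Suc 2. (-1) ^ j *\<^sub>Q gen (project [M!j] (omit k L), project [M!j] (omit j M))"
  have "?r1 \<in> A_rels 2" "?r2 \<in> A_rels 2" "?r3 \<in> A_rels 2" "?r4 \<in> A_rels 2"
  proof -
    show "?r1 \<in> A_rels 2"
      unfolding A_rels_def using p len length_LM admissible_L k points_omit[OF p(2), of k]
      by (intro UnI1[OF UnI1[OF UnI2]] CollectI exI[of _ L] exI[of _ "omit k M"]) simp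
    show "?r2 \<in> A_rels 2"
      unfolding A_rels_def using length_LM admissible_L[OF k]
      by (intro UnI1[OF UnI1[OF UnI1[OF UnI2]]] CollectI exI[of _ "project [L!k] (omit k L)"] exI[of _ "project [L!k] M"])
        (simp add: proj)
    show "?r3 \<in> A_rels 2"
      unfolding A_rels_def using length_LM admissible_M k
      by (intro UnI1[OF UnI1[OF UnI1[OF UnI1[OF UnI2]]]] CollectI exI[of _ "project [M!k] L"] exI[of _ "project [M!k] (omit k M)"])
        (simp add: proj)
    show "?r4 \<in> A_rels 2"
      unfolding A_rels_def using p len length_LM admissible_M k points_omit[OF p(1), of k]
      by (intro UnI1[OF UnI2] CollectI exI[of _ "omit k L"] exI[of _ M]) simp
  qed
  from this[THEN pair2_relations]
  show "(\<Sum>i\<le>3. (-1) ^ i *\<^sub>Q XL i k) = 0" "(\<Sum>j\<le>3. (-1) ^ j *\<^sub>Q XL k j) = 0"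
    "(\<Sum>i\<le>3. (-1) ^ i *\<^sub>Q XM i k) = 0" "(\<Sum>j\<le>3. (-1) ^ j *\<^sub>Q XM k j) = 0"
    by (simp_all add: lin_ext_simps XL_def XM_def proj)
qed

text \<open>The center consists of the two vertices of M other than m_0 and m_j. Together with m_0
  it is the face \<open>omit j M\<close>, together with m_j the face \<open>omit 0 M\<close>, so the
  four determinants of the cross-ratio are the ones in \<open>NL\<close>.\<close>

lemma a1_L:
  assumes "i \<in> {1..3}" "j \<in> {1..3}"
  shows "a1 (A1_class (project (others j M) [L!0, L!i]) (project (others j M) [M!0, M!j])) =
    NL i 0 + NL 0 j - NL 0 0 - NL i j"
proof (rule general_position_explicit[OF general])
  fix a b c d x y z w
  assume LM: "L = [a, b, c, d]" "M = [x, y, z, w]" and gp: "general_position [a, b, c, d] [x, y, z, w]"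
  note gpD = general_positionD[OF gp]
  define l where "l = L ! i"
  have l: "l \<in> {b, c, d}" using assms(1) by (auto simp: l_def LM numeral_eq_Suc atLeastAtMostSuc_conv)
  have nz: "\<Delta> [p, q, k, r] \<noteq> 0" if "k \<in> {a, l}" "distinct [p, q, r]" "{p, q, r} \<subseteq> {x, y, z, w}" for p q k r
    by (rule gpD(10)) (use that l gpD(9) in auto)
  have a1: "a1 (A1_class (project [p, q] [a, l]) (project [p, q] [s, t])) =
      m4 p q a s + m4 p q l t - m4 p q a t - m4 p q l s"
    if "{p, q, s, t} \<subseteq> {x, y, z, w}" "distinct [p, q, s, t]" for p q s t
  proof (rule a1_project_2)
    have "{x, y, z, w} \<subseteq> carrier_vec 4" "{a, l} \<subseteq> carrier_vec 4" using l gpD(1-8) by auto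
    then show "set [p, q, a, l, s, t] \<subseteq> carrier_vec 4"
      using that(1) unfolding list.set by blast
  qed (rule nz; use that in simp)+
  have "distinct [z, w, x, y]" "distinct [y, w, x, z]" "distinct [y, z, x, w]" using gpD(9) by auto
  moreover have "j = Suc 0 \<or> j = 2 \<or> j = 3" using assms(2) by auto
  ultimately show ?thesis
    unfolding NL_def l_def[symmetric] unfolding LM(2)
    by (elim disjE) (simp_all add: others_def omit_list LM(1) a1 m4_swap)
qed

lemma a1_M:
  assumes "i \<in> {1..3}" "j \<in> {1..3}"
  shows "a1 (A1_class (project (others i L) [L!0, L!i]) (project (others i L) [M!0, M!j])) =
    NM i 0 + NM 0 j - NM 0 0 - NM i j"
proof (rule general_position_explicit[OF general])
  fix a b c d x y z w
  assume LM: "L = [a, b, c, d]" "M = [x, y, z, w]" and gp: "general_position [a, b, c, d] [x, y, z, w]"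
  note gpD = general_positionD[OF gp]
  define m where "m = M ! j"
  have m: "m \<in> {y, z, w}" using assms(2) by (auto simp: m_def LM numeral_eq_Suc atLeastAtMostSuc_conv)
  have nz: "\<Delta> [p, q, r, k] \<noteq> 0" if "k \<in> {x, m}" "distinct [p, q, r]" "{p, q, r} \<subseteq> {a, b, c, d}" for p q k r
    by (rule gpD(10)) (use that m gpD(9) in auto)
  have a1: "a1 (A1_class (project [p, q] [s, t]) (project [p, q] [x, m])) =
      m4 p q s x + m4 p q t m - m4 p q s m - m4 p q t x"
    if "{p, q, s, t} \<subseteq> {a, b, c, d}" "distinct [p, q, s, t]" for p q s t
  proof (rule a1_project_2)
    have "{a, b, c, d} \<subseteq> carrier_vec 4" "{x, m} \<subseteq> carrier_vec 4" using m gpD(1-8) by auto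
    then show "set [p, q, s, t, x, m] \<subseteq> carrier_vec 4"
      using that(1) unfolding list.set by blast
  qed (rule nz; use that in simp)+
  have "distinct [c, d, a, b]" "distinct [b, d, a, c]" "distinct [b, c, a, d]" using gpD(9) by auto
  moreover have "i = Suc 0 \<or> i = 2 \<or> i = 3" using assms(1) by auto
  ultimately show ?thesis
    unfolding NM_def m_def[symmetric] unfolding LM(1)
    by (elim disjE) (simp_all add: others_def omit_list LM(2) a1 m4_swap)
qed

lemma a2_wedge_a1_\<nu>: "a2_wedge_a1 (\<nu> L M) = (1/4) *\<^sub>Q Z - (1/4) *\<^sub>Q E1"
proof -
  have "a2_wedge_a1 (\<nu> L M) =
      (\<Sum>i=1..3. \<Sum>j=1..3. (-1) ^ (i + j) *\<^sub>Q (XL i j \<otimes>\<^sub>Q (NL i 0 + NL 0 j - NL 0 0 - NL i j))) -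
      (\<Sum>i=1..3. \<Sum>j=1..3. (-1) ^ (i + j) *\<^sub>Q (XM i j \<otimes>\<^sub>Q (NM i 0 + NM 0 j - NM 0 0 - NM i j)))"
    unfolding \<nu>_def \<nu>21_def \<nu>12_def a2_wedge_a1_split[OF a2_Qlinear a1_Qlinear]
    by (intro arg_cong2[where f = minus] sum.cong refl)
      (simp_all only: a1_L a1_M a2_class admissible_L admissible_M XL_def XM_def atLeastAtMost_iff)
  then show ?thesis
    by (simp only: tensor_regroup[OF X_relations(1,2)] tensor_regroup[OF X_relations(3,4)]
        sum_XL_NL sum_XM_NM) simp
qed

end

lemma generic_pair_general_position:
  fixes L M :: "'a::field points"
  assumes "generic_pair 3 L M"
  shows "general_position L M"
proof -
  let ?xs = "L @ M"
  have len: "length L = 4" "length M = 4" and g: "generic 3 ?xs" using assms by (auto simp: generic_pair_def)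
  have nz: "\<Delta> [?xs ! i, ?xs ! j, ?xs ! k, ?xs ! l] \<noteq> 0"
    if "distinct [i, j, k, l]" "i < 8" "j < 8" "k < 8" "l < 8" for i j k l
    using generic_\<Delta>_nonzero[OF g, of "[i, j, k, l]"] that len by auto
  have "distinct ?xs"
    unfolding distinct_conv_nth
  proof (intro allI impI notI)
    fix i j assume ij: "i < length ?xs" "j < length ?xs" "i \<noteq> j" "?xs ! i = ?xs ! j"
    \<comment> \<open>Two further positions complete the repeated vector to four positions whose
      determinant has two equal columns.\<close>
    have "\<exists>r<3. r \<noteq> i \<and> r \<noteq> j" by presburger
    then obtain r where r: "r < 3" "r \<noteq> i" "r \<noteq> j" by blast
    have "\<exists>s<4. s \<noteq> i \<and> s \<noteq> j \<and> s \<noteq> r" by presburger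
    then obtain s where s: "s < 4" "s \<noteq> i" "s \<noteq> j" "s \<noteq> r" by blast
    have "\<Delta> [?xs ! i, ?xs ! j, ?xs ! r, ?xs ! s] \<noteq> 0"
      by (rule nz) (use ij r s len in auto)
    then show False using ij(4) \<Delta>_4_repeat(1) by metis
  qed
  moreover have "\<Delta> [p, q, r, s] \<noteq> 0" if pqrs: "distinct [p, q, r, s]" "{p, q, r, s} \<subseteq> set ?xs" for p q r s
  proof -
    have ex: "\<exists>i<8. v = ?xs ! i" if "v \<in> {p, q, r, s}" for v
    proof -
      have "v \<in> set ?xs" using pqrs(2) that by blast
      then show ?thesis using len by (metis in_set_conv_nth length_append numeral_Bit0)
    qed
    obtain i j k l where "i < 8" "p = ?xs ! i" "j < 8" "q = ?xs ! j" "k < 8" "r = ?xs ! k" "l < 8" "s = ?xs ! l"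
      using ex[of p] ex[of q] ex[of r] ex[of s] by blast
    then show ?thesis using nz[of i j k l] pqrs(1) by auto
  qed
  moreover have "set ?xs \<subseteq> carrier_vec 4"
    using g by (auto simp: generic_def points_def)
  ultimately show ?thesis using len unfolding general_position_def by blast
qed

theorem theorem3p2:
  fixes L M :: "'a::field points"
  assumes "generic_pair 3 L M"
  shows "\<delta>3 (a3 L M) = a2_wedge_a1 (\<nu> L M)"
proof (cases "finite (UNIV :: 'a set)")
  case True
  show ?thesis
    using tensor_eq_zero[OF multQ_trivial_of_finite[OF True]] by metis
next
  case False
  then interpret tetrahedra "TYPE('a)" L M
    using generic_pair_general_position[OF assms] by unfold_locales
  show ?thesis
    unfolding delta3_a3 a2_wedge_a1_\<nu> E3_eq by (simp add: Q.scale_right_diff_distrib)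
qed

end
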